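(* Fix a finite field $\mathbb{F}$ and $r>1$. Assuming $\mathrm{P}\neq\mathrm{NP}$, there is no $r$-approximation algorithm running in time $\mathrm{poly}(n)$ for rank-$k$ approximation in the entrywise $\ell_0$ metric of a matrix $A\in\mathbb{F}^{n\times d}$ with $n\ge d$ and $k=d-1$. Consequently, assuming the Exponential Time Hypothesis, there exists $\delta=\delta(r)>0$ such that there is no $r$-approximation algorithm for this problem (with $n\ge d$, $k=d-1$) running in time $2^{n^{\delta}}$.
   Context: Rank-$k$ approximation in the entrywise $\ell_0$ metric over $\mathbb{F}$: given $A\in\mathbb{F}^{n\times d}$ and $k$, find $U\in\mathbb{F}^{n\times k}$, $V\in\mathbb{F}^{k\times d}$ minimizing $\|UV-A\|_0$, the number of nonzero entries of $UV-A$; an $r$-approximation outputs $U,V$ whose objective is at most $r$ times the minimum. Exponential Time Hypothesis: 3-SAT on $n$ variables cannot be solved in time $2^{o(n)}$. *)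

theory Defs
  imports "HOL-Library.Landau_Symbols" "HOL-Library.Countable_Set" "Jordan_Normal_Form.Matrix"
begin

section \<open>Deterministic multi-tape Turing machines\<close>

text \<open>
  States and tape symbols are initial segments of the natural numbers. State 0 is initial, state 1
  is halting; symbol 0 is the blank, symbols 1 and 2 are the bits 0 and 1. Tapes are infinite in
  both directions. The input is on the first tape, the output on the last one.
\<close>

datatype move = Move_Left | Move_Stay | Move_Right

record tm =
  tm_tapes :: nat
  tm_states :: nat
  tm_symbols :: nat
  tm_delta :: "nat \<Rightarrow> nat list \<Rightarrow> nat \<times> (nat \<times> move) list"

definition turing_machine :: "tm \<Rightarrow> bool" where
  "turing_machine M \<longleftrightarrow>
     tm_tapes M \<ge> 1 \<and> tm_states M \<ge> 2 \<and> tm_symbols M \<ge> 3 \<and>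
     (\<forall>q ss. q < tm_states M \<and> length ss = tm_tapes M \<and> (\<forall>s\<in>set ss. s < tm_symbols M) \<longrightarrow>
        (case tm_delta M q ss of (q', acts) \<Rightarrow>
           q' < tm_states M \<and> length acts = tm_tapes M \<and>
           (\<forall>(s, mv)\<in>set acts. s < tm_symbols M)))"

type_synonym tape = "(int \<Rightarrow> nat) \<times> int"   \<comment> \<open>cell contents and head position\<close>
type_synonym config = "nat \<times> tape list"

fun move_head :: "move \<Rightarrow> int \<Rightarrow> int" where
  "move_head Move_Left p = p - 1"
| "move_head Move_Stay p = p"
| "move_head Move_Right p = p + 1"

fun act_tape :: "tape \<Rightarrow> nat \<times> move \<Rightarrow> tape" where
  "act_tape (c, p) (s, mv) = (c(p := s), move_head mv p)"

fun tm_step :: "tm \<Rightarrow> config \<Rightarrow> config" where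
  "tm_step M (q, ts) =
     (if q = 1 then (q, ts)
      else case tm_delta M q (map (\<lambda>(c, p). c p) ts) of
             (q', acts) \<Rightarrow> (q', map2 act_tape ts acts))"

definition tape_of :: "bool list \<Rightarrow> int \<Rightarrow> nat" where
  "tape_of w i = (if 0 \<le> i \<and> i < int (length w) then (if w ! nat i then 2 else 1) else 0)"

definition tm_init :: "tm \<Rightarrow> bool list \<Rightarrow> config" where
  "tm_init M w = (0, (tape_of w, 0) # replicate (tm_tapes M - 1) (tape_of [], 0))"

text \<open>On input \<open>w\<close>, \<open>M\<close> halts with output \<open>y\<close> after at most \<open>T\<close> steps.\<close>

definition tm_outputs :: "tm \<Rightarrow> bool list \<Rightarrow> bool list \<Rightarrow> real \<Rightarrow> bool" where
  "tm_outputs M w y T \<longleftrightarrow>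
     (\<exists>t::nat. real t \<le> T \<and>
        (case (tm_step M ^^ t) (tm_init M w) of
           (q, ts) \<Rightarrow> q = 1 \<and> fst (last ts) = tape_of y))"

section \<open>P and NP\<close>

definition poly_bounded :: "(nat \<Rightarrow> real) \<Rightarrow> bool" where
  "poly_bounded T \<longleftrightarrow> (\<exists>c::nat. T \<in> O(\<lambda>n. real n ^ c))"

definition class_P :: "bool list set set" where
  "class_P = {L. \<exists>M T. turing_machine M \<and> poly_bounded T \<and>
                   (\<forall>w. tm_outputs M w [w \<in> L] (T (length w)))}"

definition enc_nat :: "nat \<Rightarrow> bool list" where
  "enc_nat n = replicate n True @ [False]"

definition enc_pair :: "bool list \<Rightarrow> bool list \<Rightarrow> bool list" where
  "enc_pair x u = enc_nat (length x) @ x @ u"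

text \<open>
  The bound on the certificate length must be an actual polynomial: an arbitrary (possibly
  uncomputable) function of polynomial growth would itself carry information about membership.
\<close>

definition class_NP :: "bool list set set" where
  "class_NP = {L. \<exists>R\<in>class_P. \<exists>c::nat.
                    \<forall>x. x \<in> L \<longleftrightarrow>
                      (\<exists>u. length u \<le> c * length x ^ c + c \<and> enc_pair x u \<in> R)}"

section \<open>3-SAT and the Exponential Time Hypothesis\<close>

type_synonym literal = "bool \<times> nat"   \<comment> \<open>sign (\<open>True\<close> for a positive literal) and variable\<close>
type_synonym cnf = "literal list list"

text \<open>
  Clauses are not repeated, so that a formula on \<open>n\<close> variables has size polynomial in \<open>n\<close>
  and a running time can be measured in \<open>n\<close> alone.
\<close>

definition three_cnf :: "nat \<Rightarrow> cnf \<Rightarrow> bool" where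
  "three_cnf n \<phi> \<longleftrightarrow>
     distinct \<phi> \<and> (\<forall>C\<in>set \<phi>. length C \<le> 3 \<and> (\<forall>(b, v)\<in>set C. v < n))"

definition satisfiable :: "cnf \<Rightarrow> bool" where
  "satisfiable \<phi> \<longleftrightarrow> (\<exists>\<alpha> :: nat \<Rightarrow> bool. \<forall>C\<in>set \<phi>. \<exists>(b, v)\<in>set C. \<alpha> v = b)"

definition enc_list :: "('b \<Rightarrow> bool list) \<Rightarrow> 'b list \<Rightarrow> bool list" where
  "enc_list e xs = concat (map (\<lambda>x. True # e x) xs) @ [False]"

definition enc_literal :: "literal \<Rightarrow> bool list" where
  "enc_literal l = fst l # enc_nat (snd l)"

definition enc_cnf :: "nat \<Rightarrow> cnf \<Rightarrow> bool list" where
  "enc_cnf n \<phi> = enc_nat n @ enc_list (enc_list enc_literal) \<phi>"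

definition ETH :: bool where
  "ETH \<longleftrightarrow>
     \<not> (\<exists>M f. turing_machine M \<and> f \<in> o(\<lambda>n. real n) \<and>
          (\<forall>n \<phi>. three_cnf n \<phi> \<longrightarrow>
             tm_outputs M (enc_cnf n \<phi>) [satisfiable \<phi>] (2 powr f n)))"

section \<open>Low-rank approximation in the entrywise \<open>\<ell>\<^sub>0\<close> metric\<close>

definition l0 :: "'a::zero mat \<Rightarrow> nat" where
  "l0 A = card {(i, j). i < dim_row A \<and> j < dim_col A \<and> A $$ (i, j) \<noteq> 0}"

definition l0_opt :: "nat \<Rightarrow> 'a::field mat \<Rightarrow> nat" where
  "l0_opt k A = (LEAST m. \<exists>U\<in>carrier_mat (dim_row A) k. \<exists>V\<in>carrier_mat k (dim_col A).
                    m = l0 (U * V - A))"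

definition l0_approx :: "real \<Rightarrow> nat \<Rightarrow> 'a::field mat \<Rightarrow> 'a mat \<Rightarrow> 'a mat \<Rightarrow> bool" where
  "l0_approx r k A U V \<longleftrightarrow>
     U \<in> carrier_mat (dim_row A) k \<and> V \<in> carrier_mat k (dim_col A) \<and>
     real (l0 (U * V - A)) \<le> r * real (l0_opt k A)"

text \<open>
  On a finite type \<^term>\<open>to_nat_on UNIV\<close> is a fixed enumeration \<open>0, 1, \<dots>\<close> of the elements.
  As the field is fixed, each entry of a matrix has bounded code length.
\<close>

definition enc_mat :: "'a::finite mat \<Rightarrow> bool list" where
  "enc_mat A = enc_nat (dim_row A) @ enc_nat (dim_col A) @
     concat (map (\<lambda>i. concat (map (\<lambda>j. enc_nat (to_nat_on (UNIV :: 'a set) (A $$ (i, j))))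
                                  [0..<dim_col A]))
                 [0..<dim_row A])"

text \<open>
  \<open>M\<close> is an \<open>r\<close>-approximation algorithm over \<^typ>\<open>'a\<close>, with running time \<open>T n\<close>, for the instances
  with \<open>n \<ge> d\<close> and \<open>k = d - 1\<close>.
\<close>

definition approx_algorithm :: "'a::{finite,field} itself \<Rightarrow> real \<Rightarrow> tm \<Rightarrow> (nat \<Rightarrow> real) \<Rightarrow> bool" where
  "approx_algorithm F r M T \<longleftrightarrow>
     turing_machine M \<and>
     (\<forall>n d. \<forall>A \<in> (carrier_mat n d :: 'a mat set). n \<ge> d \<and> d \<ge> 1 \<longrightarrow>
        (\<exists>U V. l0_approx r (d - 1) A U V \<and>
               tm_outputs M (enc_mat A) (enc_mat U @ enc_mat V) (T n)))"

end

theory Submission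
  imports Defs "HOL-Library.Cardinality" "HOL-Real_Asymp.Real_Asymp"
begin

text \<open>
  The distance of a matrix \<open>A\<close> with \<open>d\<close> columns to the matrices of rank at most \<open>d - 1\<close> is the minimum
  number of nonzero entries of \<open>A z\<close> over \<open>z \<noteq> 0\<close>, i.e. a minimum distance of a linear code. A gap for it is
  obtained without the PCP theorem. A tableau of a nondeterministic computation is a system of equations that are
  linear in the entries of \<open>X = \<alpha> \<alpha>\<^sup>T\<close>. Let \<open>G\<close> generate a code whose nonzero words all have almost the same
  weight, and let the matrix map \<open>X\<close> to the entries of \<open>G X G\<^sup>T\<close> and to many copies of the left hand sides of
  the equations. A violated equation is expensive, a solution \<open>X\<close> of rank at least 2 has weight larger by a
  factor of almost \<open>1 + 1 / q\<close> than a rank one solution, and the rank one solutions are the accepting computations. Tensor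
  powers amplify the gap to any constant, so that the size of the instance, and with it \<open>\<delta>\<close>, depends on \<open>r\<close> only.
\<close>

section \<open>Fragments of Turing machines\<close>

text \<open>Minimum distance is a homogeneous linear problem. So coordinate 0 stands for the
  constant 1 and row 0 of \<open>X\<close> carries the linear terms. A rank one solution is fixed
  only up to a scalar and is neither symmetric nor boolean a priori; extra equations force this.
  Rank two gains only a factor \<open>1 + 1 / q\<close>, so the weights of the code must agree up to
  a smaller factor. A Hadamard code has constant weight but exponential length. Hence the vector is
  first compressed to logarithmically many symbols by hashing, and a Hadamard code on these has
  polynomial length. A hash function may lose the vector; \<open>t\<close> of them lose it together
  with probability at most \<open>(31 / 32) ^ t\<close>. All hash functions are enumerated as rows,
  so nothing is random. \<open>t\<close> and the tensor exponent do not depend on the input. An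
  approximation algorithm returns matrices and no value, so the decision procedure recomputes their
  error and compares it with a threshold. The reduction has to be an actual Turing machine.\<close>

definition fragment :: "nat \<Rightarrow> nat \<Rightarrow> tm \<Rightarrow> bool" where
  "fragment K G M \<longleftrightarrow> tm_tapes M = K \<and> tm_symbols M = G \<and> 2 \<le> tm_states M \<and>
     (\<forall>q ss. length ss = K \<longrightarrow>
        fst (tm_delta M q ss) < tm_states M \<and> length (snd (tm_delta M q ss)) = K \<and>
        ((\<forall>s\<in>set ss. s < G) \<longrightarrow> (\<forall>a\<in>set (snd (tm_delta M q ss)). fst a < G)))"

definition tapes :: "nat \<Rightarrow> (nat \<Rightarrow> tape) \<Rightarrow> tape list" where
  "tapes K \<sigma> = map \<sigma> [0..<K]"

text \<open>State 1 is absorbing, so the step count acts as an upper bound on the running time;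
  \<open>run_mono\<close> and \<open>run_eq\<close> rely on this.\<close>

definition run :: "tm \<Rightarrow> (nat \<Rightarrow> tape) \<Rightarrow> nat \<Rightarrow> (nat \<Rightarrow> tape) \<Rightarrow> bool" where
  "run M \<sigma> t \<sigma>' \<longleftrightarrow> (tm_step M ^^ t) (0, tapes (tm_tapes M) \<sigma>) = (1, tapes (tm_tapes M) \<sigma>')"

definition head :: "tape \<Rightarrow> nat" where "head \<tau> = fst \<tau> (snd \<tau>)"

lemma turing_machine_fragment:
  assumes "fragment K G M" "1 \<le> K" "3 \<le> G" shows "turing_machine M"
  using assms unfolding fragment_def turing_machine_def
  by (auto simp: case_prod_unfold)

lemma tm_step_halted [simp]: "(tm_step M ^^ t) (Suc 0, ts) = (Suc 0, ts)"
  by (induction t) auto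

lemma run_mono: assumes "run M \<sigma> t \<sigma>'" "t \<le> t'" shows "run M \<sigma> t' \<sigma>'"
proof -
  have "(tm_step M ^^ t') c = (tm_step M ^^ (t' - t)) ((tm_step M ^^ t) c)" for c
    using assms(2) by (metis add.commute comp_apply funpow_add le_add_diff_inverse)
  then show ?thesis using assms(1) unfolding run_def by simp
qed

lemma map_head_tapes: "map (\<lambda>(c, p). c p) (tapes K \<sigma>) = map (\<lambda>j. head (\<sigma> j)) [0..<K]"
  by (simp add: tapes_def head_def case_prod_unfold)

lemma act_stay: "act_tape \<tau> (head \<tau>, Move_Stay) = \<tau>"
  by (cases \<tau>) (simp add: head_def)

lemma map2_tapes: "map2 act_tape (tapes K \<sigma>) (map f [0..<K]) = tapes K (\<lambda>j. act_tape (\<sigma> j) (f j))"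
  by (simp add: tapes_def map2_map_map)

definition actm :: "nat \<Rightarrow> nat \<Rightarrow> (nat \<Rightarrow> nat \<Rightarrow> nat \<times> move) \<Rightarrow> tm" where
  "actm K G f = \<lparr>tm_tapes = K, tm_states = 2, tm_symbols = G,
     tm_delta = (\<lambda>q ss. (1, map (\<lambda>j. f j (ss ! j)) [0..<length ss]))\<rparr>"

lemma fragment_actm:
  assumes "\<And>j s. j < K \<Longrightarrow> s < G \<Longrightarrow> fst (f j s) < G" shows "fragment K G (actm K G f)"
  using assms by (auto simp: fragment_def actm_def)

lemma run_actm: "run (actm K G f) \<sigma> 1 (\<lambda>j. act_tape (\<sigma> j) (f j (head (\<sigma> j))))"
proof -
  have eq: "map (\<lambda>j. f j (map (\<lambda>j. head (\<sigma> j)) [0..<K] ! j)) [0..<K] = map (\<lambda>j. f j (head (\<sigma> j))) [0..<K]"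
    by simp
  show ?thesis
    unfolding run_def
    by (simp add: actm_def map_head_tapes) (simp add: eq map2_tapes[unfolded tapes_def] tapes_def)
qed

definition stay :: "nat list \<Rightarrow> (nat \<times> move) list" where "stay ss = map (\<lambda>s. (s, Move_Stay)) ss"

lemma map2_stay: "map2 act_tape ts (stay (map (\<lambda>(c, p). c p) ts)) = ts"
proof (rule nth_equalityI)
  fix i assume "i < length (map2 act_tape ts (stay (map (\<lambda>(c, p). c p) ts)))"
  then show "map2 act_tape ts (stay (map (\<lambda>(c, p). c p) ts)) ! i = ts ! i"
    using act_stay[of "ts ! i"] by (simp add: stay_def head_def case_prod_unfold)
qed (simp add: stay_def)

text \<open>
  State 0 branches by \<open>dec\<close> to 1 (halt), 2 (start of \<open>A\<close>) or 3 (start of \<open>B\<close>); when \<open>A\<close> halts the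
  machine continues in \<open>ex\<close>. This one combinator yields sequencing, branching and loops.
\<close>

definition comb :: "(nat list \<Rightarrow> nat) \<Rightarrow> nat \<Rightarrow> tm \<Rightarrow> tm \<Rightarrow> tm" where
  "comb dec ex A B = \<lparr>tm_tapes = tm_tapes A, tm_states = 2 * (tm_states A + tm_states B) + 4,
     tm_symbols = tm_symbols A,
     tm_delta = (\<lambda>q ss. if q = 0 then (dec ss, stay ss)
        else if even q then
          (case tm_delta A (q div 2 - 1) ss of (q', acts) \<Rightarrow> (if q' = 1 then ex else 2 * q' + 2, acts))
        else
          (case tm_delta B (q div 2 - 1) ss of (q', acts) \<Rightarrow> (if q' = 1 then 1 else 2 * q' + 3, acts)))\<rparr>"

text \<open>\<open>fragment\<close> bounds the next state and the number of actions for every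
  \<open>q\<close>, not only for legal states. Hence the decoded state \<open>q div 2 - 1\<close>
  needs no reachability argument.\<close>

lemma fragment_comb:
  assumes "fragment K G A" "fragment K G B" "\<And>ss. dec ss \<in> {1,2,3}" "ex \<in> {0,1,3}"
  shows "fragment K G (comb dec ex A B)"
proof -
  let ?M = "comb dec ex A B"
  have *: "fst (tm_delta ?M q ss) < tm_states ?M \<and> length (snd (tm_delta ?M q ss)) = K \<and>
        ((\<forall>s\<in>set ss. s < G) \<longrightarrow> (\<forall>a\<in>set (snd (tm_delta ?M q ss)). fst a < G))" if l: "length ss = K" for q ss
  proof -
    have a: "fst (tm_delta A p ss) < tm_states A" "length (snd (tm_delta A p ss)) = K"
        "(\<forall>s\<in>set ss. s < G) \<longrightarrow> (\<forall>a\<in>set (snd (tm_delta A p ss)). fst a < G)" for p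
      using assms(1) l unfolding fragment_def by blast+
    have b: "fst (tm_delta B p ss) < tm_states B" "length (snd (tm_delta B p ss)) = K"
        "(\<forall>s\<in>set ss. s < G) \<longrightarrow> (\<forall>a\<in>set (snd (tm_delta B p ss)). fst a < G)" for p
      using assms(2) l unfolding fragment_def by blast+
    have d: "dec ss < 4" using assms(3)[of ss] by auto
    have e: "ex < 4" using assms(4) by auto
    show ?thesis
      using a[of "q div 2 - 1"] b[of "q div 2 - 1"] d e l
      by (auto simp: comb_def case_prod_unfold stay_def)
  qed
  have "tm_tapes ?M = K" "tm_symbols ?M = G" "2 \<le> tm_states ?M"
    using assms(1) by (auto simp: comb_def fragment_def)
  with * show ?thesis unfolding fragment_def by blast
qed

lemma tm_step_comb:
  assumes "q \<noteq> 1"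
  shows "tm_step (comb dec ex A B) (2 * q + 2, ts) =
           (case tm_step A (q, ts) of (q', ts') \<Rightarrow> (if q' = 1 then ex else 2 * q' + 2, ts'))"
    and "tm_step (comb dec ex A B) (2 * q + 3, ts) =
           (case tm_step B (q, ts) of (q', ts') \<Rightarrow> (if q' = 1 then 1 else 2 * q' + 3, ts'))"
  using assms by (auto simp: comb_def case_prod_unfold)

declare tm_step.simps [simp del]

text \<open>A halted \<open>A\<close> idles in state 1, while the host \<open>C\<close> goes on in
  \<open>ex\<close>. The host therefore needs only the steps up to the halt, a number known to be at
  most \<open>t\<close>.\<close>

lemma embedded_run:
  assumes sim: "\<And>q ts. q \<noteq> 1 \<Longrightarrow> tm_step C (f q, ts) =
      (case tm_step A (q, ts) of (q', ts') \<Rightarrow> (if q' = 1 then ex else f q', ts'))"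
  shows "(tm_step A ^^ t) (q, ts) = (1, ts') \<Longrightarrow> q \<noteq> 1 \<Longrightarrow>
     \<exists>t'\<le>t. (tm_step C ^^ t') (f q, ts) = (ex, ts')"
proof (induction t arbitrary: q ts)
  case (Suc t)
  obtain q1 ts1 where s: "tm_step A (q, ts) = (q1, ts1)" by fastforce
  have r: "(tm_step A ^^ t) (q1, ts1) = (1, ts')"
    using Suc.prems(1) s by (simp add: funpow_swap1)
  show ?case
  proof (cases "q1 = 1")
    case True
    then have "ts' = ts1" using r by simp
    then have "(tm_step C ^^ 1) (f q, ts) = (ex, ts')"
      using sim[OF Suc.prems(2), of ts] s True by simp
    then show ?thesis by (metis Suc_le_mono One_nat_def le0)
  next
    case False
    from Suc.IH[OF r False] obtain t' where t': "t' \<le> t" "(tm_step C ^^ t') (f q1, ts1) = (ex, ts')"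
      by blast
    have "(tm_step C ^^ Suc t') (f q, ts) = (ex, ts')"
      using sim[OF Suc.prems(2), of ts] s False t'(2) by (simp add: funpow_swap1)
    then show ?thesis using t'(1) by (metis Suc_le_mono)
  qed
qed simp

definition seqm :: "tm \<Rightarrow> tm \<Rightarrow> tm" where "seqm A B = comb (\<lambda>_. 2) 3 A B"
definition item :: "(nat list \<Rightarrow> bool) \<Rightarrow> tm \<Rightarrow> tm \<Rightarrow> tm" where
  "item c A B = comb (\<lambda>ss. if c ss then 2 else 3) 1 A B"
definition whilem :: "(nat list \<Rightarrow> bool) \<Rightarrow> tm \<Rightarrow> tm" where
  "whilem c A = comb (\<lambda>ss. if c ss then 2 else 1) 0 A A"

lemma fragment_seqm: "fragment K G A \<Longrightarrow> fragment K G B \<Longrightarrow> fragment K G (seqm A B)"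
  and fragment_item: "fragment K G A \<Longrightarrow> fragment K G B \<Longrightarrow> fragment K G (item c A B)"
  and fragment_whilem: "fragment K G A \<Longrightarrow> fragment K G (whilem c A)"
  unfolding seqm_def item_def whilem_def by (intro fragment_comb; simp)+

lemma comb_start: "tm_step (comb dec ex A B) (0, ts) = (dec (map (\<lambda>(c, p). c p) ts), ts)"
  by (simp add: comb_def map2_stay tm_step.simps)

lemma comb_embedded:
  assumes "run A \<sigma> t \<sigma>'"
  shows "\<exists>t'\<le>t. (tm_step (comb dec ex A B) ^^ t') (2, tapes (tm_tapes A) \<sigma>) = (ex, tapes (tm_tapes A) \<sigma>')"
    and "\<exists>t'\<le>t. (tm_step (comb dec ex B A) ^^ t') (3, tapes (tm_tapes A) \<sigma>) = (1, tapes (tm_tapes A) \<sigma>')"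
  using embedded_run[of "comb dec ex A B" "\<lambda>q. 2 * q + 2" ex A, OF tm_step_comb(1), of t 0]
    embedded_run[of "comb dec ex B A" "\<lambda>q. 2 * q + 3" 1 A, OF tm_step_comb(2), of t 0] assms
  unfolding run_def by (auto simp: numeral_2_eq_2)

lemma tm_tapes_comb [simp]: "tm_tapes (comb dec ex A B) = tm_tapes A"
  by (simp add: comb_def)

lemma funpow_trans: "(f ^^ a) x = y \<Longrightarrow> (f ^^ b) y = z \<Longrightarrow> (f ^^ (a + b)) x = z"
  by (metis add.commute comp_apply funpow_add)

lemma run_seqm:
  assumes "tm_tapes A = tm_tapes B" "run A \<sigma> t1 \<sigma>1" "run B \<sigma>1 t2 \<sigma>2"
  shows "run (seqm A B) \<sigma> (t1 + t2 + 1) \<sigma>2"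
proof -
  let ?C = "comb (\<lambda>_. 2) 3 A B" let ?T = "tapes (tm_tapes A)"
  obtain a where a: "a \<le> t1" "(tm_step ?C ^^ a) (2, ?T \<sigma>) = (3, ?T \<sigma>1)"
    using comb_embedded(1)[OF assms(2)] by blast
  obtain b where b: "b \<le> t2" "(tm_step ?C ^^ b) (3, ?T \<sigma>1) = (1, ?T \<sigma>2)"
    using comb_embedded(2)[OF assms(3)] assms(1) by metis
  have "(tm_step ?C ^^ 1) (0, ?T \<sigma>) = (2, ?T \<sigma>)" by (simp add: comb_start)
  from funpow_trans[OF this funpow_trans[OF a(2) b(2)]]
  have "run ?C \<sigma> (1 + (a + b)) \<sigma>2" by (simp add: run_def)
  then show ?thesis unfolding seqm_def by (rule run_mono) (use a b in simp)
qed

definition heads :: "nat \<Rightarrow> (nat \<Rightarrow> tape) \<Rightarrow> nat list" where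
  "heads K \<sigma> = map (\<lambda>j. head (\<sigma> j)) [0..<K]"

lemma nth_heads [simp]: "j < K \<Longrightarrow> heads K \<sigma> ! j = head (\<sigma> j)"
  by (simp add: heads_def)

lemma run_itemI:
  assumes "tm_tapes A = tm_tapes B"
    and "c (heads (tm_tapes A) \<sigma>) \<Longrightarrow> run A \<sigma> t \<sigma>'" "\<not> c (heads (tm_tapes A) \<sigma>) \<Longrightarrow> run B \<sigma> t \<sigma>'"
  shows "run (item c A B) \<sigma> (t + 1) \<sigma>'"
proof -
  let ?C = "item c A B" let ?T = "tapes (tm_tapes A)"
  have "\<exists>q a. (tm_step ?C ^^ 1) (0, ?T \<sigma>) = (q, ?T \<sigma>) \<and> a \<le> t \<and> (tm_step ?C ^^ a) (q, ?T \<sigma>) = (1, ?T \<sigma>')"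
    using comb_embedded(1)[OF assms(2)] comb_embedded(2)[OF assms(3)] assms(1)
    by (cases "c (heads (tm_tapes A) \<sigma>)") (auto simp: item_def comb_start map_head_tapes heads_def)
  then obtain q a where "(tm_step ?C ^^ 1) (0, ?T \<sigma>) = (q, ?T \<sigma>)" "a \<le> t"
      "(tm_step ?C ^^ a) (q, ?T \<sigma>) = (1, ?T \<sigma>')" by blast
  from funpow_trans[OF this(1,3)] have "run ?C \<sigma> (1 + a) \<sigma>'" by (simp add: run_def item_def)
  then show ?thesis by (rule run_mono) (use \<open>a \<le> t\<close> in simp)
qed

lemma run_whilem:
  assumes "\<And>i. i < n \<Longrightarrow> c (heads (tm_tapes A) (S i)) \<and> run A (S i) t (S (Suc i))"
    and "\<not> c (heads (tm_tapes A) (S n))"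
  shows "run (whilem c A) (S 0) (n * (t + 1) + 1) (S n)"
proof -
  let ?C = "whilem c A" let ?T = "tapes (tm_tapes A)"
  have "\<exists>u \<le> i * (t + 1). (tm_step ?C ^^ u) (0, ?T (S 0)) = (0, ?T (S i))" if "i \<le> n" for i
    using that
  proof (induction i)
    case (Suc i)
    then obtain u where u: "u \<le> i * (t + 1)" "(tm_step ?C ^^ u) (0, ?T (S 0)) = (0, ?T (S i))"
      by auto
    have h: "c (heads (tm_tapes A) (S i))" "run A (S i) t (S (Suc i))" using assms(1) Suc.prems by auto
    obtain a where a: "a \<le> t" "(tm_step ?C ^^ a) (2, ?T (S i)) = (0, ?T (S (Suc i)))"
      using comb_embedded(1)[OF h(2)] unfolding whilem_def by blast
    have "(tm_step ?C ^^ 1) (0, ?T (S i)) = (2, ?T (S i))"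
      using h(1) by (simp add: whilem_def comb_start map_head_tapes heads_def)
    from funpow_trans[OF u(2) funpow_trans[OF this a(2)]] show ?case
      using u a by (intro exI[of _ "u + (1 + a)"]) auto
  qed (rule exI[of _ 0]; simp)
  then obtain u where u: "u \<le> n * (t + 1)" "(tm_step ?C ^^ u) (0, ?T (S 0)) = (0, ?T (S n))"
    by blast
  have "(tm_step ?C ^^ 1) (0, ?T (S n)) = (1, ?T (S n))"
    using assms(2) by (simp add: whilem_def comb_start map_head_tapes heads_def)
  from funpow_trans[OF u(2) this] have "run ?C (S 0) (u + 1) (S n)" by (simp add: run_def whilem_def)
  then show ?thesis by (rule run_mono) (use u in simp)
qed

section \<open>Polynomial time functions with unary values\<close>

text \<open>The value is the head position and the content never changes: counting is a move, and
  the mark on cell 0 makes zero testable. A counter can thus drive other heads in lockstep.\<close>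

definition ctr :: "nat \<Rightarrow> tape" where "ctr n = ((\<lambda>i. if i = 0 then 1 else 0), int n)"

lemma head_ctr [simp]: "head (ctr n) = (if n = 0 then 1 else 0)"
  by (simp add: ctr_def head_def)

fun dir :: "move \<Rightarrow> int" where
  "dir Move_Left = -1" | "dir Move_Stay = 0" | "dir Move_Right = 1"

definition mvm :: "nat \<Rightarrow> nat \<Rightarrow> (nat \<Rightarrow> move) \<Rightarrow> tm" where
  "mvm K G f = actm K G (\<lambda>j s. (s, f j))"

definition shift :: "(nat \<Rightarrow> move) \<Rightarrow> nat \<Rightarrow> (nat \<Rightarrow> tape) \<Rightarrow> nat \<Rightarrow> tape" where
  "shift f n \<sigma> = (\<lambda>j. (fst (\<sigma> j), snd (\<sigma> j) + int n * dir (f j)))"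

lemma run_eq: "run M \<sigma> t \<sigma>' \<Longrightarrow> t \<le> t'' \<Longrightarrow> \<sigma>' = \<sigma>'' \<Longrightarrow> run M \<sigma> t'' \<sigma>''"
  using run_mono by blast

lemma fragment_mvm: "fragment K G (mvm K G f)"
  unfolding mvm_def by (rule fragment_actm) simp

lemma run_mvm: "run (mvm K G f) \<sigma> 1 (shift f 1 \<sigma>)"
proof -
  have "act_tape \<tau> (head \<tau>, mv) = (fst \<tau>, snd \<tau> + dir mv)" for \<tau> mv
    by (cases \<tau>; cases mv) (auto simp: head_def)
  then show ?thesis
    using run_actm[of K G "\<lambda>j s. (s, f j)" \<sigma>] by (simp add: mvm_def shift_def)
qed

text \<open>Each unit taken from \<open>a\<close> moves all tapes along \<open>f\<close>. Depending
  on \<open>f\<close> this erases a counter, transfers it, duplicates it, or sends another head to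
  the position given by it.\<close>

definition drain :: "nat \<Rightarrow> nat \<Rightarrow> nat \<Rightarrow> (nat \<Rightarrow> move) \<Rightarrow> tm" where
  "drain K G a f = whilem (\<lambda>ss. ss ! a = 0) (mvm K G (f(a := Move_Left)))"

lemma fragment_drain: "fragment K G (drain K G a f)"
  unfolding drain_def by (intro fragment_whilem fragment_mvm)

lemma fragment_tapes: "fragment K G M \<Longrightarrow> tm_tapes M = K" by (simp add: fragment_def)

lemma shift_add: "shift f n (shift f m \<sigma>) = shift f (m + n) \<sigma>"
  by (simp add: shift_def algebra_simps)

lemma run_drain:
  assumes "a < K" "\<sigma> a = ctr n"
  shows "run (drain K G a f) \<sigma> (2 * n + 1) (shift (f(a := Move_Left)) n \<sigma>)"
proof -
  define g where "g = f(a := Move_Left)"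
  let ?f = g
  have ga: "g a = Move_Left" by (simp add: g_def)
  have t: "tm_tapes (mvm K G ?f) = K" using fragment_mvm fragment_tapes by blast
  have h: "shift ?f i \<sigma> a = ctr (n - i)" if "i \<le> n" for i
    using that assms(2) by (simp add: shift_def ctr_def ga)
  have r: "run (mvm K G ?f) (shift ?f i \<sigma>) 1 (shift ?f (Suc i) \<sigma>)" for i
    using run_mvm[of K G ?f "shift ?f i \<sigma>"] by (simp add: shift_add)
  have "run (drain K G a f) (shift ?f 0 \<sigma>) (n * (1 + 1) + 1) (shift ?f n \<sigma>)"
    unfolding drain_def g_def[symmetric]
    by (rule run_whilem) (use r h assms(1) in \<open>auto simp: t\<close>)
  moreover have "shift ?f 0 \<sigma> = \<sigma>" by (simp add: shift_def)
  ultimately show ?thesis by (simp add: mult_2 mult_2_right g_def)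
qed

section \<open>Polynomial bounds in the input lengths and the variables\<close>

type_synonym strs = "bool list \<times> bool list"
type_synonym env = "nat \<Rightarrow> nat"

definition sz :: "nat \<Rightarrow> strs \<Rightarrow> env \<Rightarrow> nat" where
  "sz k s e = length (fst s) + length (snd s) + (\<Sum>i<k. e i)"

text \<open>A bound may involve only finitely many variables. The base is at least 2, so constants,
  sums and products are absorbed by raising the exponent.\<close>

definition pbd :: "(strs \<Rightarrow> env \<Rightarrow> nat) \<Rightarrow> bool" where
  "pbd t \<longleftrightarrow> (\<exists>c k. \<forall>s e. t s e \<le> (sz k s e + 2) ^ c)"

lemma sz_mono: "k \<le> k' \<Longrightarrow> sz k s e \<le> sz k' s e"
  unfolding sz_def by (simp add: sum_mono2)

lemma pbd_mono: "pbd u \<Longrightarrow> (\<And>s e. t s e \<le> u s e) \<Longrightarrow> pbd t"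
  unfolding pbd_def by (meson le_trans)

lemma pbd2E:
  assumes "pbd t" "pbd u"
  obtains c k where "\<And>s e. t s e \<le> (sz k s e + 2) ^ c" "\<And>s e. u s e \<le> (sz k s e + 2) ^ c"
proof -
  obtain c1 k1 c2 k2 where *: "\<And>s e. t s e \<le> (sz k1 s e + 2) ^ c1" "\<And>s e. u s e \<le> (sz k2 s e + 2) ^ c2"
    using assms unfolding pbd_def by metis
  have "(sz k1 s e + 2) ^ c1 \<le> (sz (max k1 k2) s e + 2) ^ max c1 c2" for s e
    by (meson add_le_mono1 le_trans max.cobounded1 one_le_numeral power_increasing power_mono sz_mono trans_le_add2 zero_le)
  moreover have "(sz k2 s e + 2) ^ c2 \<le> (sz (max k1 k2) s e + 2) ^ max c1 c2" for s e
    by (meson add_le_mono1 le_trans max.cobounded2 one_le_numeral power_increasing power_mono sz_mono trans_le_add2 zero_le)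
  ultimately show thesis using * that by (meson le_trans)
qed

lemma pbd_const [intro]: "pbd (\<lambda>s e. n)"
proof -
  have "n \<le> (sz 0 s e + 2) ^ n" for s e
    by (rule order_trans[OF _ power_mono[of 2]]) (auto intro: less_imp_le)
  then show ?thesis unfolding pbd_def by blast
qed

lemma pbd_mult [intro]: assumes "pbd t" "pbd u" shows "pbd (\<lambda>s e. t s e * u s e)"
proof -
  obtain c k where "\<And>s e. t s e \<le> (sz k s e + 2) ^ c" "\<And>s e. u s e \<le> (sz k s e + 2) ^ c"
    by (rule pbd2E[OF assms]) (rule that)
  then have "t s e * u s e \<le> (sz k s e + 2) ^ (c + c)" for s e
    unfolding power_add by (rule mult_mono) auto
  then show ?thesis unfolding pbd_def by blast
qed

lemma pbd_add [intro]: assumes "pbd t" "pbd u" shows "pbd (\<lambda>s e. t s e + u s e)"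
proof -
  obtain c k where *: "\<And>s e. t s e \<le> (sz k s e + 2) ^ c" "\<And>s e. u s e \<le> (sz k s e + 2) ^ c"
    by (rule pbd2E[OF assms]) (rule that)
  have "t s e + u s e \<le> (sz k s e + 2) ^ Suc c" for s e
  proof -
    have "t s e + u s e \<le> 2 * (sz k s e + 2) ^ c" using *[of s e] by linarith
    also have "\<dots> \<le> (sz k s e + 2) * (sz k s e + 2) ^ c" by (rule mult_right_mono) auto
    finally show ?thesis by simp
  qed
  then show ?thesis unfolding pbd_def by blast
qed

lemma pbd_Suc [intro]: "pbd t \<Longrightarrow> pbd (\<lambda>s e. Suc (t s e))"
  using pbd_add[of t "\<lambda>s e. 1"] by (simp add: pbd_const)

lemma pbd_power [intro]: "pbd t \<Longrightarrow> pbd (\<lambda>s e. t s e ^ n)"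
  by (induction n) auto

lemma pbd_sz: "pbd (\<lambda>s e. sz k s e)"
  unfolding pbd_def by (rule exI[of _ 1], rule exI[of _ k]) simp

lemma pbd_var [intro]: "pbd (\<lambda>s e. e i)"
  by (rule pbd_mono[OF pbd_sz[of "Suc i"]]) (simp add: sz_def)

lemma pbd_len [intro]: "pbd (\<lambda>s e. length (fst s))" "pbd (\<lambda>s e. length (snd s))"
  by (rule pbd_mono[OF pbd_sz[of 0]]; simp add: sz_def)+

text \<open>A bound variable that is at most \<open>u\<close> enlarges \<open>sz\<close> by at most
  \<open>u\<close>; the bound for a loop body becomes one that is uniform over the
  iterations.\<close>

lemma pbd_push:
  assumes "pbd t" "pbd u"
  obtains t' where "pbd t'" "\<And>s e i. i \<le> u s e \<Longrightarrow> t s (case_nat i e) \<le> t' s e"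
proof -
  obtain c k where *: "\<And>s e. t s e \<le> (sz k s e + 2) ^ c" using assms(1) pbd_def by auto
  let ?t = "\<lambda>s e. (sz k s e + u s e + 2) ^ c"
  have "t s (case_nat i e) \<le> ?t s e" if "i \<le> u s e" for s e i
  proof -
    have "sz k s (case_nat i e) \<le> sz (Suc k) s (case_nat i e)" by (rule sz_mono) simp
    also have "\<dots> = sz k s e + i" unfolding sz_def by (subst sum.lessThan_Suc_shift) simp
    finally show ?thesis
      using that by (intro order_trans[OF *] power_mono) auto
  qed
  moreover have "pbd ?t" using assms pbd_sz by (intro pbd_power pbd_add pbd_const) auto
  ultimately show thesis using that by blast
qed

section \<open>Functions on unary counters: calling convention, substitution, bounded
  recursion\<close>

definition ready :: "nat \<Rightarrow> nat \<Rightarrow> nat \<Rightarrow> nat \<Rightarrow> (nat \<Rightarrow> nat) \<Rightarrow> nat \<Rightarrow> strs \<Rightarrow> env \<Rightarrow> (nat \<Rightarrow> tape) \<Rightarrow> bool" where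
  "ready b m p0 p1 loc k s e \<sigma> \<longleftrightarrow> \<sigma> p0 = (tape_of (fst s), 0) \<and> \<sigma> p1 = (tape_of (snd s), 0) \<and>
     (\<forall>i<k. \<sigma> (loc i) = ctr (e i)) \<and> (\<forall>j. b \<le> j \<and> j < b + m \<longrightarrow> \<sigma> j = ctr 0)"

text \<open>All scratch counters lie above the tapes in use. \<open>loc\<close> need not be
  injective, which later lets a single zero counter serve as every variable.\<close>

definition layout :: "nat \<Rightarrow> nat \<Rightarrow> nat \<Rightarrow> nat \<Rightarrow> nat \<Rightarrow> nat \<Rightarrow> (nat \<Rightarrow> nat) \<Rightarrow> nat \<Rightarrow> bool" where
  "layout K G b m p0 p1 loc k \<longleftrightarrow> b + m \<le> K \<and> 3 \<le> G \<and> p0 < b \<and> p1 < b \<and> (\<forall>i<k. loc i < b)"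

text \<open>
  Variable \<open>i\<close> sits in counter \<open>loc i\<close>, the value is left in counter \<open>b\<close>, and the counters
  \<open>b + 1, \<dots>\<close> are scratch space that is zero before and after.
\<close>

definition computes :: "(strs \<Rightarrow> env \<Rightarrow> nat) \<Rightarrow> nat \<Rightarrow> nat \<Rightarrow> (strs \<Rightarrow> env \<Rightarrow> nat) \<Rightarrow> bool" where
  "computes f k m T \<longleftrightarrow> (\<forall>K G b p0 p1 loc. layout K G b m p0 p1 loc k \<longrightarrow>
     (\<exists>M. fragment K G M \<and> (\<forall>s e \<sigma>. ready b m p0 p1 loc k s e \<sigma> \<longrightarrow>
             run M \<sigma> (T s e) (\<sigma>(b := ctr (f s e))))))"

text \<open>Values are unary and control loops, hence the value itself must be polynomially bounded,
  in addition to the time.\<close>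

definition pf :: "(strs \<Rightarrow> env \<Rightarrow> nat) \<Rightarrow> bool" where
  "pf f \<longleftrightarrow> pbd f \<and> (\<exists>k m T. 1 \<le> m \<and> pbd T \<and> computes f k m T)"

lemma computes_mono: "computes f k m T \<Longrightarrow> k \<le> k' \<Longrightarrow> m \<le> m' \<Longrightarrow> computes f k' m' T"
  unfolding computes_def
proof (intro allI impI)
  fix K G b p0 p1 loc
  assume f: "\<forall>K G b p0 p1 loc. layout K G b m p0 p1 loc k \<longrightarrow>
     (\<exists>M. fragment K G M \<and> (\<forall>s e \<sigma>. ready b m p0 p1 loc k s e \<sigma> \<longrightarrow>
             run M \<sigma> (T s e) (\<sigma>(b := ctr (f s e)))))"
    and k: "k \<le> k'" and m: "m \<le> m'" and L: "layout K G b m' p0 p1 loc k'"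
  have "layout K G b m p0 p1 loc k" using L k m unfolding layout_def by auto
  from f[rule_format, OF this] obtain M where M: "fragment K G M"
    "\<And>s e \<sigma>. ready b m p0 p1 loc k s e \<sigma> \<Longrightarrow> run M \<sigma> (T s e) (\<sigma>(b := ctr (f s e)))"
    by blast
  have "ready b m' p0 p1 loc k' s e \<sigma> \<Longrightarrow> ready b m p0 p1 loc k s e \<sigma>" for s e \<sigma>
    using k m unfolding ready_def by auto
  then show "\<exists>M. fragment K G M \<and> (\<forall>s e \<sigma>. ready b m' p0 p1 loc k' s e \<sigma> \<longrightarrow>
             run M \<sigma> (T s e) (\<sigma>(b := ctr (f s e))))"
    using M by (intro exI[of _ M]) simp
qed

lemma pf_pbd: "pf f \<Longrightarrow> pbd f" by (simp add: pf_def)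

lemma pfE:
  assumes "pf f"
  obtains k m T where "1 \<le> m" "pbd T" "\<And>k' m'. k \<le> k' \<Longrightarrow> m \<le> m' \<Longrightarrow> computes f k' m' T"
proof -
  obtain k m T where *: "1 \<le> m" "pbd T" "computes f k m T" using assms unfolding pf_def by blast
  show thesis by (rule that[OF *(1,2) computes_mono[OF *(3)]])
qed

lemma layout_Suc:
  "layout K G b (Suc m) p0 p1 loc k \<Longrightarrow> layout K G (Suc b) m p0 p1 loc k"
  unfolding layout_def by auto

lemma layout_push:
  "layout K G b (Suc m) p0 p1 loc k \<Longrightarrow> j < Suc b \<Longrightarrow> layout K G (Suc b) m p0 p1 (case_nat j loc) (Suc k)"
  unfolding layout_def by (auto split: nat.splits)

lemma ready_Suc:
  "ready b (Suc m) p0 p1 loc k s e \<sigma> \<Longrightarrow> layout K G b (Suc m) p0 p1 loc k \<Longrightarrow>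
   ready (Suc b) m p0 p1 loc k s e (\<sigma>(b := \<tau>))"
  unfolding ready_def layout_def by auto

lemma ready_push:
  "ready b m p0 p1 loc k s e \<sigma> \<Longrightarrow> \<sigma> j = ctr x \<Longrightarrow>
   ready b m p0 p1 (case_nat j loc) (Suc k) s (case_nat x e) \<sigma>"
  unfolding ready_def by (auto split: nat.splits)

text \<open>Draining destroys the source. So it fills two counters at once, and the second copy is
  poured back; this explains the two scratch counters.\<close>

lemma pf_var: "pf (\<lambda>s e. e i)"
proof -
  have "computes (\<lambda>s e. e i) (Suc i) 2 (\<lambda>s e. 4 * e i + 3)"
    unfolding computes_def
  proof (intro allI impI)
    fix K G b p0 p1 loc assume L: "layout K G b 2 p0 p1 loc (Suc i)"
    let ?a = "loc i"
    let ?M1 = "drain K G ?a (\<lambda>j. if j = b \<or> j = b + 1 then Move_Right else Move_Stay)"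
    let ?M2 = "drain K G (b + 1) (\<lambda>j. if j = ?a then Move_Right else Move_Stay)"
    have ab: "?a < b" "b + 2 \<le> K" using L unfolding layout_def by auto
    have "run (seqm ?M1 ?M2) \<sigma> (4 * e i + 3) (\<sigma>(b := ctr (e i)))"
      if R: "ready b 2 p0 p1 loc (Suc i) s e \<sigma>" for s e \<sigma>
    proof -
      have *: "\<sigma> ?a = ctr (e i)" "\<sigma> b = ctr 0" "\<sigma> (b + 1) = ctr 0" using R unfolding ready_def by auto
      have r1: "run ?M1 \<sigma> (2 * e i + 1) (\<sigma>(?a := ctr 0, b := ctr (e i), b + 1 := ctr (e i)))"
        by (rule run_eq[OF run_drain]) (use ab * in \<open>auto simp: shift_def fun_eq_iff ctr_def\<close>)
      have r2: "run ?M2 (\<sigma>(?a := ctr 0, b := ctr (e i), b + 1 := ctr (e i))) (2 * e i + 1) (\<sigma>(b := ctr (e i)))"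
        by (rule run_eq[OF run_drain]) (use ab * in \<open>auto simp: shift_def fun_eq_iff ctr_def\<close>)
      show ?thesis
        by (rule run_eq[OF run_seqm[OF _ r1 r2]]) (simp_all add: fragment_tapes[OF fragment_drain])
    qed
    then show "\<exists>M. fragment K G M \<and> (\<forall>s e \<sigma>. ready b 2 p0 p1 loc (Suc i) s e \<sigma> \<longrightarrow>
             run M \<sigma> (4 * e i + 3) (\<sigma>(b := ctr (e i))))"
      by (intro exI[of _ "seqm ?M1 ?M2"]) (auto intro: fragment_seqm fragment_drain)
  qed
  moreover have "pbd (\<lambda>s e. 4 * e i + 3)" by (intro pbd_add pbd_mult pbd_const pbd_var)
  ultimately show ?thesis unfolding pf_def using pbd_var by (meson one_le_numeral)
qed

lemma pf_zero: "pf (\<lambda>s e. 0)"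
proof -
  have "computes (\<lambda>s e. 0) 0 1 (\<lambda>s e. 1)"
    unfolding computes_def
  proof (intro allI impI)
    fix K G b p0 p1 loc assume L: "layout K G b 1 p0 p1 loc 0"
    have "run (mvm K G (\<lambda>_. Move_Stay)) \<sigma> 1 (\<sigma>(b := ctr 0))"
      if "ready b 1 p0 p1 loc 0 s e \<sigma>" for s e \<sigma>
      by (rule run_eq[OF run_mvm]) (use that in \<open>auto simp: shift_def ready_def fun_eq_iff\<close>)
    then show "\<exists>M. fragment K G M \<and> (\<forall>s e \<sigma>. ready b 1 p0 p1 loc 0 s e \<sigma> \<longrightarrow> run M \<sigma> 1 (\<sigma>(b := ctr 0)))"
      using fragment_mvm by blast
  qed
  then show ?thesis unfolding pf_def using pbd_const by blast
qed

lemma pf_Suc: assumes "pf f" shows "pf (\<lambda>s e. Suc (f s e))"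
proof -
  obtain k m T where f: "1 \<le> m" "pbd T" "computes f k m T" using assms unfolding pf_def by blast
  have "computes (\<lambda>s e. Suc (f s e)) k m (\<lambda>s e. T s e + 2)"
    unfolding computes_def
  proof (intro allI impI)
    fix K G b p0 p1 loc assume L: "layout K G b m p0 p1 loc k"
    then obtain M where M: "fragment K G M"
       "\<And>s e \<sigma>. ready b m p0 p1 loc k s e \<sigma> \<Longrightarrow> run M \<sigma> (T s e) (\<sigma>(b := ctr (f s e)))"
      using f(3) unfolding computes_def by blast
    let ?I = "mvm K G (\<lambda>j. if j = b then Move_Right else Move_Stay)"
    have "run (seqm M ?I) \<sigma> (T s e + 2) (\<sigma>(b := ctr (Suc (f s e))))"
      if R: "ready b m p0 p1 loc k s e \<sigma>" for s e \<sigma>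
      by (rule run_eq[OF run_seqm[OF _ M(2)[OF R] run_mvm]])
        (auto simp: fragment_tapes[OF fragment_mvm] fragment_tapes[OF M(1)] shift_def fun_eq_iff ctr_def)
    then show "\<exists>M. fragment K G M \<and> (\<forall>s e \<sigma>. ready b m p0 p1 loc k s e \<sigma> \<longrightarrow>
        run M \<sigma> (T s e + 2) (\<sigma>(b := ctr (Suc (f s e)))))"
      using fragment_seqm[OF M(1) fragment_mvm] by blast
  qed
  moreover have "pbd (\<lambda>s e. T s e + 2)" using f(2) by (intro pbd_add pbd_const)
  ultimately show ?thesis unfolding pf_def using f(1) pf_pbd[OF assms] by blast
qed

text \<open>The value of \<open>g\<close> in counter \<open>b\<close> becomes variable 0 of the
  body, which works one counter higher. Afterwards \<open>b\<close> is erased and the result moved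
  down to it.\<close>

lemma pf_let:
  assumes "pf (\<lambda>s e. F s (\<lambda>n. e (Suc n)) (e 0))" "pf g"
  shows "pf (\<lambda>s e. F s e (g s e))"
proof -
  let ?F = "\<lambda>s e. F s (\<lambda>n. e (Suc n)) (e 0)"
  obtain kF mF TF where F: "1 \<le> mF" "pbd TF" "\<And>k' m'. kF \<le> k' \<Longrightarrow> mF \<le> m' \<Longrightarrow> computes ?F k' m' TF"
    by (rule pfE[OF assms(1)]) (rule that)
  obtain kg mg Tg where g: "1 \<le> mg" "pbd Tg" "\<And>k' m'. kg \<le> k' \<Longrightarrow> mg \<le> m' \<Longrightarrow> computes g k' m' Tg"
    by (rule pfE[OF assms(2)]) (rule that)
  define k where "k = max kF kg"
  define m where "m = max mF mg"
  obtain TF' where TF': "pbd TF'" "\<And>s e i. i \<le> g s e \<Longrightarrow> TF s (case_nat i e) \<le> TF' s e"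
    by (rule pbd_push[OF F(2) pf_pbd[OF assms(2)]]) (rule that)
  obtain B where B: "pbd B" "\<And>s e i. i \<le> g s e \<Longrightarrow> ?F s (case_nat i e) \<le> B s e"
    by (rule pbd_push[OF pf_pbd[OF assms(1)] pf_pbd[OF assms(2)]]) (rule that)
  let ?T = "\<lambda>s e. Tg s e + TF' s e + 2 * g s e + 2 * B s e + 5"
  have cg: "computes g k (Suc m) Tg" by (rule g(3)) (auto simp: k_def m_def)
  have cF: "computes ?F (Suc k) m TF" by (rule F(3)) (auto simp: k_def m_def)
  have "computes (\<lambda>s e. F s e (g s e)) k (Suc m) ?T"
    unfolding computes_def
  proof (intro allI impI)
    fix K G b p0 p1 loc assume L: "layout K G b (Suc m) p0 p1 loc k"
    obtain Mg where Mg: "fragment K G Mg"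
       "\<And>s e \<sigma>. ready b (Suc m) p0 p1 loc k s e \<sigma> \<Longrightarrow> run Mg \<sigma> (Tg s e) (\<sigma>(b := ctr (g s e)))"
      using cg L unfolding computes_def by blast
    obtain MF where MF: "fragment K G MF"
       "\<And>s e \<sigma>. ready (Suc b) m p0 p1 (case_nat b loc) (Suc k) s e \<sigma> \<Longrightarrow>
          run MF \<sigma> (TF s e) (\<sigma>(Suc b := ctr (?F s e)))"
      using cF layout_push[OF L, of b] unfolding computes_def by blast
    let ?D1 = "drain K G b (\<lambda>_. Move_Stay)"
    let ?D2 = "drain K G (Suc b) (\<lambda>j. if j = b then Move_Right else Move_Stay)"
    let ?M = "seqm Mg (seqm MF (seqm ?D1 ?D2))"
    note tt = fragment_tapes[OF fragment_drain] fragment_tapes[OF Mg(1)] fragment_tapes[OF MF(1)]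
      fragment_tapes[OF fragment_seqm[OF fragment_drain fragment_drain]]
      fragment_tapes[OF fragment_seqm[OF MF(1) fragment_seqm[OF fragment_drain fragment_drain]]]
    have m1: "1 \<le> m" using F(1) by (simp add: m_def)
    have K: "b < K" "Suc b < K" using L m1 unfolding layout_def by auto
    have "run ?M \<sigma> (?T s e) (\<sigma>(b := ctr (F s e (g s e))))"
      if R: "ready b (Suc m) p0 p1 loc k s e \<sigma>" for s e \<sigma>
    proof -
      let ?x = "g s e" let ?y = "F s e (g s e)"
      have z: "\<sigma> b = ctr 0" "\<sigma> (Suc b) = ctr 0" using R m1 unfolding ready_def by auto
      have r2: "run MF (\<sigma>(b := ctr ?x)) (TF s (case_nat ?x e)) (\<sigma>(b := ctr ?x, Suc b := ctr ?y))"
      proof -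
        have "ready (Suc b) m p0 p1 (case_nat b loc) (Suc k) s (case_nat ?x e) (\<sigma>(b := ctr ?x))"
          by (rule ready_push[OF ready_Suc[OF R L]]) simp
        from MF(2)[OF this] show ?thesis by simp
      qed
      have r3: "run ?D1 (\<sigma>(b := ctr ?x, Suc b := ctr ?y)) (2 * ?x + 1) (\<sigma>(Suc b := ctr ?y))"
        by (rule run_eq[OF run_drain]) (use K z in \<open>auto simp: shift_def fun_eq_iff ctr_def\<close>)
      have r4: "run ?D2 (\<sigma>(Suc b := ctr ?y)) (2 * ?y + 1) (\<sigma>(b := ctr ?y))"
        by (rule run_eq[OF run_drain]) (use K z in \<open>auto simp: shift_def fun_eq_iff ctr_def\<close>)
      show ?thesis
        by (rule run_eq[OF run_seqm[OF _ Mg(2)[OF R] run_seqm[OF _ r2 run_seqm[OF _ r3 r4]]]])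
          (use TF'(2)[of ?x s e] B(2)[of ?x s e] in \<open>auto simp: tt\<close>)
    qed
    moreover have "fragment K G ?M" by (intro fragment_seqm fragment_drain Mg MF)
    ultimately show "\<exists>M. fragment K G M \<and> (\<forall>s e \<sigma>. ready b (Suc m) p0 p1 loc k s e \<sigma> \<longrightarrow>
        run M \<sigma> (?T s e) (\<sigma>(b := ctr (F s e (g s e)))))" by blast
  qed
  moreover have "pbd ?T" by (intro pbd_add pbd_mult pbd_const g TF' B pf_pbd[OF assms(2)])
  moreover have "pbd (\<lambda>s e. F s e (g s e))"
    by (rule pbd_mono[OF B(1)]) (use B(2) in force)
  moreover have "1 \<le> Suc m" by simp
  ultimately show ?thesis unfolding pf_def by blast
qed

text \<open>Counter \<open>b\<close> counts down, \<open>b1\<close> holds the accumulator,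
  \<open>b2\<close> the index, and \<open>b3\<close> receives the next value. The bound
  \<open>B\<close> on all intermediate values keeps primitive recursion inside polynomial
  time.\<close>

lemma pf_rec:
  assumes "pf (\<lambda>s e. H s (\<lambda>n. e (Suc (Suc n))) (e 0) (e 1))" "pf A" "pf N" "pbd B"
    and bound: "\<And>s e i. i \<le> N s e \<Longrightarrow> rec_nat (A s e) (H s e) i \<le> B s e"
  shows "pf (\<lambda>s e. rec_nat (A s e) (H s e) (N s e))"
proof -
  let ?H = "\<lambda>s e. H s (\<lambda>n. e (Suc (Suc n))) (e 0) (e 1)"
  obtain kH mH TH where H: "1 \<le> mH" "pbd TH" "\<And>k' m'. kH \<le> k' \<Longrightarrow> mH \<le> m' \<Longrightarrow> computes ?H k' m' TH"
    by (rule pfE[OF assms(1)]) (rule that)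
  obtain kA mA TA where A: "1 \<le> mA" "pbd TA" "\<And>k' m'. kA \<le> k' \<Longrightarrow> mA \<le> m' \<Longrightarrow> computes A k' m' TA"
    by (rule pfE[OF assms(2)]) (rule that)
  obtain kN mN TN where N: "1 \<le> mN" "pbd TN" "\<And>k' m'. kN \<le> k' \<Longrightarrow> mN \<le> m' \<Longrightarrow> computes N k' m' TN"
    by (rule pfE[OF assms(3)]) (rule that)
  define k where "k = max kH (max kA kN)"
  define m where "m = max mH (max mA mN)"
  have pbdU: "pbd (\<lambda>s e. N s e + B s e)" using pf_pbd[OF assms(3)] assms(4) by blast
  \<comment> \<open>The body runs with two pushed variables. The bound for the inner push lives in
    an environment that already contains the accumulator, hence the shifted arguments of
    \<open>N\<close> and \<open>B\<close>.\<close>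
  obtain T1 where T1: "pbd T1" "\<And>s e i. i \<le> N s (\<lambda>n. e (Suc n)) + B s (\<lambda>n. e (Suc n)) \<Longrightarrow> TH s (case_nat i e) \<le> T1 s e"
  proof -
    have "pbd (\<lambda>s e. N s (\<lambda>n. e (Suc n)) + B s (\<lambda>n. e (Suc n)))"
    proof -
      obtain c k where c: "\<And>s e. N s e + B s e \<le> (sz k s e + 2) ^ c" using pbdU unfolding pbd_def by auto
      have "sz k s (\<lambda>n. e (Suc n)) \<le> sz (Suc k) s e" for s e
        using sum.lessThan_Suc_shift[of e k] by (simp add: sz_def)
      then have "N s (\<lambda>n. e (Suc n)) + B s (\<lambda>n. e (Suc n)) \<le> (sz (Suc k) s e + 2) ^ c" for s e
        by (meson add_le_mono1 c le_trans power_mono zero_le)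
      then show ?thesis unfolding pbd_def by blast
    qed
    from pbd_push[OF H(2) this] that show thesis by blast
  qed
  obtain T2 where T2: "pbd T2" "\<And>s e i. i \<le> N s e + B s e \<Longrightarrow> T1 s (case_nat i e) \<le> T2 s e"
    by (rule pbd_push[OF T1(1) pbdU]) (rule that)
  have TH: "TH s (case_nat i (case_nat a e)) \<le> T2 s e" if "i \<le> N s e + B s e" "a \<le> N s e + B s e" for s e i a
    using T1(2)[of i s "case_nat a e"] T2(2)[of a s e] that by simp
  let ?I = "\<lambda>s e. T2 s e + 4 * B s e + 6"
  let ?T = "\<lambda>s e. TN s e + TA s e + N s e * (?I s e + 1) + 2 * N s e + 2 * B s e + 7"
  have cN: "computes N k (Suc (Suc (Suc m))) TN" by (rule N(3)) (auto simp: k_def m_def)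
  have cA: "computes A k (Suc (Suc m)) TA" by (rule A(3)) (auto simp: k_def m_def)
  have cH: "computes ?H (Suc (Suc k)) m TH" by (rule H(3)) (auto simp: k_def m_def)
  have m1: "1 \<le> m" using H(1) by (simp add: m_def)
  have "computes (\<lambda>s e. rec_nat (A s e) (H s e) (N s e)) k (Suc (Suc (Suc m))) ?T"
    unfolding computes_def
  proof (intro allI impI)
    fix K G b p0 p1 loc assume L: "layout K G b (Suc (Suc (Suc m))) p0 p1 loc k"
    define b1 where "b1 = Suc b"
    define b2 where "b2 = Suc b1"
    define b3 where "b3 = Suc b2"
    have L1: "layout K G b1 (Suc (Suc m)) p0 p1 loc k" unfolding b1_def by (rule layout_Suc[OF L])
    have L3: "layout K G b3 m p0 p1 (case_nat b2 (case_nat b1 loc)) (Suc (Suc k))"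
      using L unfolding layout_def b1_def b2_def b3_def by (auto split: nat.splits)
    obtain MN where MN: "fragment K G MN"
       "\<And>s e \<sigma>. ready b (Suc (Suc (Suc m))) p0 p1 loc k s e \<sigma> \<Longrightarrow> run MN \<sigma> (TN s e) (\<sigma>(b := ctr (N s e)))"
      using cN L unfolding computes_def by blast
    obtain MA where MA: "fragment K G MA"
       "\<And>s e \<sigma>. ready b1 (Suc (Suc m)) p0 p1 loc k s e \<sigma> \<Longrightarrow> run MA \<sigma> (TA s e) (\<sigma>(b1 := ctr (A s e)))"
      using cA L1 unfolding computes_def by blast
    obtain MH where MH: "fragment K G MH"
       "\<And>s e \<sigma>. ready b3 m p0 p1 (case_nat b2 (case_nat b1 loc)) (Suc (Suc k)) s e \<sigma> \<Longrightarrow>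
          run MH \<sigma> (TH s e) (\<sigma>(b3 := ctr (?H s e)))"
      using cH L3 unfolding computes_def by blast
    let ?D1 = "drain K G b1 (\<lambda>_. Move_Stay)"
    let ?D2 = "drain K G b3 (\<lambda>j. if j = b1 then Move_Right else Move_Stay)"
    let ?D3 = "mvm K G (\<lambda>j. if j = b then Move_Left else if j = b2 then Move_Right else Move_Stay)"
    let ?body = "seqm MH (seqm ?D1 (seqm ?D2 ?D3))"
    let ?D4 = "drain K G b2 (\<lambda>_. Move_Stay)"
    let ?D5 = "drain K G b1 (\<lambda>j. if j = b then Move_Right else Move_Stay)"
    let ?loop = "whilem (\<lambda>ss. ss ! b = 0) ?body"
    let ?M = "seqm MN (seqm MA (seqm ?loop (seqm ?D4 ?D5)))"
    have fb: "fragment K G ?body" by (intro fragment_seqm fragment_drain fragment_mvm MH)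
    have fl: "fragment K G ?loop" by (intro fragment_whilem fb)
    have fM: "fragment K G ?M" by (intro fragment_seqm fl fragment_drain MN MA)
    have tt: "tm_tapes (drain K G a f) = K" "tm_tapes (mvm K G f) = K" "tm_tapes MN = K" "tm_tapes MA = K" "tm_tapes MH = K"
      "tm_tapes ?loop = K" "tm_tapes ?body = K" "tm_tapes (seqm X Y) = tm_tapes X" for a f X Y
      using fragment_tapes[OF fragment_drain] fragment_tapes[OF fragment_mvm] fragment_tapes[OF MN(1)]
        fragment_tapes[OF MA(1)] fragment_tapes[OF MH(1)] fragment_tapes[OF fl] fragment_tapes[OF fb]
      by (auto simp: seqm_def)
    have K: "b < K" "b1 < K" "b2 < K" "b3 < K" using L m1 unfolding layout_def b1_def b2_def b3_def by auto
    have nb: "b \<noteq> b1" "b \<noteq> b2" "b \<noteq> b3" "b1 \<noteq> b2" "b1 \<noteq> b3" "b2 \<noteq> b3"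
      unfolding b1_def b2_def b3_def by auto
    have "run ?M \<sigma> (?T s e) (\<sigma>(b := ctr (rec_nat (A s e) (H s e) (N s e))))"
      if R: "ready b (Suc (Suc (Suc m))) p0 p1 loc k s e \<sigma>" for s e \<sigma>
    proof -
      let ?n = "N s e"
      define r where "r = rec_nat (A s e) (H s e)"
      have r0: "r 0 = A s e" and rS: "r (Suc i) = H s e i (r i)" for i by (auto simp: r_def)
      have rB: "r i \<le> B s e" if "i \<le> ?n" for i using bound[OF that] by (simp add: r_def)
      have z: "\<sigma> b = ctr 0" "\<sigma> b1 = ctr 0" "\<sigma> b2 = ctr 0" "\<sigma> b3 = ctr 0"
        using R m1 unfolding ready_def b1_def b2_def b3_def by auto
      define S where "S i = \<sigma>(b := ctr (?n - i), b1 := ctr (r i), b2 := ctr i)" for i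
      have r1: "run MN \<sigma> (TN s e) (\<sigma>(b := ctr ?n))" by (rule MN(2)[OF R])
      have r2: "run MA (\<sigma>(b := ctr ?n)) (TA s e) (S 0)"
        by (rule run_eq[OF MA(2)]) (use ready_Suc[OF R L, of "ctr ?n"] z nb in \<open>auto simp: b1_def[symmetric] S_def r0 fun_eq_iff\<close>)
      have step: "run ?body (S i) (?I s e) (S (Suc i))" if i: "i < ?n" for i
      proof -
        let ?E = "case_nat i (case_nat (r i) e)"
        have "ready b3 m p0 p1 (case_nat b2 (case_nat b1 loc)) (Suc (Suc k)) s ?E (S i)"
          using R L unfolding ready_def layout_def S_def b1_def b2_def b3_def
          by (auto split: nat.splits)
        from MH(2)[OF this] have q1: "run MH (S i) (TH s ?E) ((S i)(b3 := ctr (r (Suc i))))"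
          by (simp add: rS)
        have q2: "run ?D1 ((S i)(b3 := ctr (r (Suc i)))) (2 * r i + 1) ((S i)(b3 := ctr (r (Suc i)), b1 := ctr 0))"
          by (rule run_eq[OF run_drain]) (use K nb in \<open>auto simp: shift_def fun_eq_iff ctr_def S_def\<close>)
        have q3: "run ?D2 ((S i)(b3 := ctr (r (Suc i)), b1 := ctr 0)) (2 * r (Suc i) + 1) ((S i)(b1 := ctr (r (Suc i))))"
          by (rule run_eq[OF run_drain]) (use K nb z in \<open>auto simp: shift_def fun_eq_iff ctr_def S_def\<close>)
        have q4: "run ?D3 ((S i)(b1 := ctr (r (Suc i)))) 1 (S (Suc i))"
          by (rule run_eq[OF run_mvm]) (use K nb z i in \<open>auto simp: shift_def fun_eq_iff ctr_def S_def\<close>)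
        show ?thesis
          by (rule run_eq[OF run_seqm[OF _ q1 run_seqm[OF _ q2 run_seqm[OF _ q3 q4]]]])
            (use TH[of i s e "r i"] rB[of i] rB[of "Suc i"] i in \<open>auto simp: tt\<close>)
      qed
      have r3: "run ?loop (S 0) (?n * (?I s e + 1) + 1) (S ?n)"
      proof (rule run_whilem)
        have "heads (tm_tapes ?body) (S i) ! b = (if i < ?n then 0 else 1)" if "i \<le> ?n" for i
          using that K nb by (auto simp: tt S_def)
        then show "i < ?n \<Longrightarrow> heads (tm_tapes ?body) (S i) ! b = 0 \<and> run ?body (S i) (?I s e) (S (Suc i))"
          "heads (tm_tapes ?body) (S ?n) ! b \<noteq> 0" for i using step by auto
      qed
      have r4: "run ?D4 (S ?n) (2 * ?n + 1) ((S ?n)(b2 := ctr 0))"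
        by (rule run_eq[OF run_drain]) (use K nb in \<open>auto simp: shift_def fun_eq_iff ctr_def S_def\<close>)
      have r5: "run ?D5 ((S ?n)(b2 := ctr 0)) (2 * r ?n + 1) (\<sigma>(b := ctr (r ?n)))"
        by (rule run_eq[OF run_drain]) (use K nb z in \<open>auto simp: shift_def fun_eq_iff ctr_def S_def\<close>)
      have "run ?M \<sigma> (?T s e) (\<sigma>(b := ctr (r ?n)))"
        by (rule run_eq[OF run_seqm[OF _ r1 run_seqm[OF _ r2 run_seqm[OF _ r3 run_seqm[OF _ r4 r5]]]]])
          (use rB[of ?n] in \<open>auto simp: tt\<close>)
      then show ?thesis by (simp add: r_def)
    qed
    then show "\<exists>M. fragment K G M \<and> (\<forall>s e \<sigma>. ready b (Suc (Suc (Suc m))) p0 p1 loc k s e \<sigma> \<longrightarrow>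
        run M \<sigma> (?T s e) (\<sigma>(b := ctr (rec_nat (A s e) (H s e) (N s e)))))" using fM by blast
  qed
  moreover have "pbd ?T"
    by (intro pbd_add pbd_mult pbd_const N A T2 assms(4) pf_pbd[OF assms(3)])
  moreover have "pbd (\<lambda>s e. rec_nat (A s e) (H s e) (N s e))"
    by (rule pbd_mono[OF assms(4)]) (use bound in auto)
  moreover have "1 \<le> Suc (Suc (Suc m))" by simp
  ultimately show ?thesis unfolding pf_def by blast
qed

definition str :: "bool \<Rightarrow> strs \<Rightarrow> bool list" where "str i s = (if i then snd s else fst s)"

lemma tape_of_int: "tape_of w (int n) = (if n < length w then if w ! n then 2 else 1 else 0)"
  by (simp add: tape_of_def)

lemma pbd_rename: assumes "pbd t" shows "pbd (\<lambda>s e. t s (\<lambda>n. e (\<rho> n)))"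
proof -
  obtain c k where *: "\<And>s e. t s e \<le> (sz k s e + 2) ^ c" using assms unfolding pbd_def by auto
  have "pbd (\<lambda>s e. \<Sum>i<k. e (\<rho> i))" for k by (induction k) auto
  then have "pbd (\<lambda>s e. (sz k s (\<lambda>n. e (\<rho> n)) + 2) ^ c)"
    unfolding sz_def by (intro pbd_power pbd_add pbd_const pbd_len)
  then show ?thesis by (rule pbd_mono) (rule *)
qed

text \<open>The machine is reused as it is: renaming variables is a change of
  \<open>loc\<close>.\<close>

lemma pf_rename: assumes "pf f" shows "pf (\<lambda>s e. f s (\<lambda>n. e (\<rho> n)))"
proof -
  obtain k m T where f: "1 \<le> m" "pbd T" "computes f k m T" using assms unfolding pf_def by blast
  define k' where "k' = Suc (\<Sum>i<k. \<rho> i)"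
  have k': "\<rho> i < k'" if "i < k" for i
    unfolding k'_def using member_le_sum[of i "{..<k}" \<rho>] that by simp
  have "computes (\<lambda>s e. f s (\<lambda>n. e (\<rho> n))) k' m (\<lambda>s e. T s (\<lambda>n. e (\<rho> n)))"
    unfolding computes_def
  proof (intro allI impI)
    fix K G b p0 p1 loc assume "layout K G b m p0 p1 loc k'"
    then have "layout K G b m p0 p1 (\<lambda>n. loc (\<rho> n)) k" unfolding layout_def using k' by blast
    then obtain M where M: "fragment K G M"
       "\<And>s e \<sigma>. ready b m p0 p1 (\<lambda>n. loc (\<rho> n)) k s e \<sigma> \<Longrightarrow> run M \<sigma> (T s e) (\<sigma>(b := ctr (f s e)))"
      using f(3) unfolding computes_def by blast
    have "ready b m p0 p1 loc k' s e \<sigma> \<Longrightarrow> ready b m p0 p1 (\<lambda>n. loc (\<rho> n)) k s (\<lambda>n. e (\<rho> n)) \<sigma>" for s e \<sigma>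
      unfolding ready_def using k' by blast
    then show "\<exists>M. fragment K G M \<and> (\<forall>s e \<sigma>. ready b m p0 p1 loc k' s e \<sigma> \<longrightarrow>
        run M \<sigma> (T s (\<lambda>n. e (\<rho> n))) (\<sigma>(b := ctr (f s (\<lambda>n. e (\<rho> n))))))"
      using M by (intro exI[of _ M]) simp
  qed
  then show ?thesis using f pbd_rename pf_pbd[OF assms] unfolding pf_def by blast
qed

text \<open>One copy of the position drives the input head out, and a second copy made on the way
  drives it back, so that the convention \<open>ready\<close> is restored.\<close>

lemma pf_symeq:
  assumes "pf f" shows "pf (\<lambda>s e. of_bool (tape_of (str i s) (int (f s e)) = c))"
proof -
  obtain k m0 T where f: "1 \<le> m0" "pbd T" "\<And>k' m'. k \<le> k' \<Longrightarrow> m0 \<le> m' \<Longrightarrow> computes f k' m' T"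
    by (rule pfE[OF assms]) (rule that)
  define m where "m = Suc m0"
  let ?T = "\<lambda>s e. T s e + 4 * f s e + 10"
  let ?g = "\<lambda>s e. of_bool (tape_of (str i s) (int (f s e)) = c) :: nat"
  have cf: "computes f k m T" by (rule f(3)) (auto simp: m_def)
  have "computes ?g k (Suc m) ?T"
    unfolding computes_def
  proof (intro allI impI)
    fix K G b p0 p1 loc assume L: "layout K G b (Suc m) p0 p1 loc k"
    define b1 where "b1 = Suc b"
    define b2 where "b2 = Suc b1"
    define p where "p = (if i then p1 else p0)"
    obtain M where M: "fragment K G M"
       "\<And>s e \<sigma>. ready b1 m p0 p1 loc k s e \<sigma> \<Longrightarrow> run M \<sigma> (T s e) (\<sigma>(b1 := ctr (f s e)))"
      using cf layout_Suc[OF L] unfolding computes_def b1_def by blast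
    let ?D1 = "drain K G b1 (\<lambda>j. if j = b2 \<or> j = p then Move_Right else Move_Stay)"
    let ?I = "item (\<lambda>ss. ss ! p = c) (mvm K G (\<lambda>j. if j = b then Move_Right else Move_Stay)) (mvm K G (\<lambda>j. Move_Stay))"
    let ?D2 = "drain K G b2 (\<lambda>j. if j = p then Move_Left else Move_Stay)"
    let ?M = "seqm M (seqm ?D1 (seqm ?I ?D2))"
    have fI: "fragment K G ?I" by (intro fragment_item fragment_mvm)
    have fM: "fragment K G ?M" by (intro fragment_seqm fragment_drain fI M)
    have tt: "tm_tapes (drain K G a f) = K" "tm_tapes (mvm K G f) = K" "tm_tapes M = K" "tm_tapes ?I = K"
        "tm_tapes (seqm X Y) = tm_tapes X" for a f X Y
      using fragment_tapes[OF fragment_drain] fragment_tapes[OF fragment_mvm] fragment_tapes[OF M(1)] fragment_tapes[OF fI]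
      by (auto simp: seqm_def)
    have K: "b < K" "b1 < K" "b2 < K" "p < b" "p < K" using L f(1)
      unfolding layout_def m_def b1_def b2_def p_def by auto
    have nb: "b \<noteq> b1" "b \<noteq> b2" "b1 \<noteq> b2" "p \<noteq> b" "p \<noteq> b1" "p \<noteq> b2" using K(4)
      unfolding b1_def b2_def by auto
    have "run ?M \<sigma> (?T s e) (\<sigma>(b := ctr (?g s e)))" if R: "ready b (Suc m) p0 p1 loc k s e \<sigma>" for s e \<sigma>
    proof -
      let ?n = "f s e" let ?w = "str i s"
      have z: "\<sigma> b = ctr 0" "\<sigma> b1 = ctr 0" "\<sigma> b2 = ctr 0" "\<sigma> p = (tape_of ?w, 0)"
        using R f(1) unfolding ready_def m_def b1_def b2_def p_def str_def by auto
      have "ready b1 m p0 p1 loc k s e \<sigma>" using R L unfolding ready_def layout_def b1_def by auto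
      from M(2)[OF this] have r1: "run M \<sigma> (T s e) (\<sigma>(b1 := ctr ?n))" .
      have r2: "run ?D1 (\<sigma>(b1 := ctr ?n)) (2 * ?n + 1) (\<sigma>(b2 := ctr ?n, p := (tape_of ?w, int ?n)))"
        by (rule run_eq[OF run_drain]) (use K nb z in \<open>auto simp: shift_def fun_eq_iff ctr_def\<close>)
      have r3: "run ?I (\<sigma>(b2 := ctr ?n, p := (tape_of ?w, int ?n))) (1 + 1)
          (\<sigma>(b2 := ctr ?n, p := (tape_of ?w, int ?n), b := ctr (?g s e)))"
        by (rule run_itemI; (rule run_eq[OF run_mvm])?)
          (use K nb z in \<open>auto simp: tt shift_def fun_eq_iff ctr_def head_def\<close>)
      have r4: "run ?D2 (\<sigma>(b2 := ctr ?n, p := (tape_of ?w, int ?n), b := ctr (?g s e))) (2 * ?n + 1) (\<sigma>(b := ctr (?g s e)))"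
        by (rule run_eq[OF run_drain]) (use K nb z in \<open>auto simp: shift_def fun_eq_iff ctr_def\<close>)
      show ?thesis
        by (rule run_eq[OF run_seqm[OF _ r1 run_seqm[OF _ r2 run_seqm[OF _ r3 r4]]]]) (auto simp: tt)
    qed
    then show "\<exists>M. fragment K G M \<and> (\<forall>s e \<sigma>. ready b (Suc m) p0 p1 loc k s e \<sigma> \<longrightarrow>
        run M \<sigma> (?T s e) (\<sigma>(b := ctr (?g s e))))" using fM by blast
  qed
  moreover have "pbd ?T" by (intro pbd_add pbd_mult pbd_const f pf_pbd[OF assms])
  moreover have "pbd ?g" by (rule pbd_mono[OF pbd_const[of 1]]) simp
  moreover have "1 \<le> Suc m" by simp
  ultimately show ?thesis unfolding pf_def by blast
qed

lemma pbd_str: "pbd (\<lambda>s e. length (str i s))"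
  by (cases i) (auto simp: str_def)

lemma pf_len: "pf (\<lambda>s e. length (str i s))"
proof -
  let ?T = "\<lambda>s e. 4 * length (str i s) + 10"
  let ?g = "\<lambda>s e. length (str i s)"
  have "computes ?g 0 2 ?T"
    unfolding computes_def
  proof (intro allI impI)
    fix K G b p0 p1 loc assume L: "layout K G b 2 p0 p1 loc 0"
    define b1 where "b1 = Suc b"
    define p where "p = (if i then p1 else p0)"
    define fb where "fb = (\<lambda>j. if j = b \<or> j = b1 \<or> j = p then Move_Right else Move_Stay)"
    let ?B = "mvm K G fb"
    let ?W = "whilem (\<lambda>ss. ss ! p \<noteq> 0) ?B"
    let ?D = "drain K G b1 (\<lambda>j. if j = p then Move_Left else Move_Stay)"
    let ?M = "seqm ?W ?D"
    have fW: "fragment K G ?W" by (intro fragment_whilem fragment_mvm)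
    have fM: "fragment K G ?M" by (intro fragment_seqm fragment_drain fW)
    have tt: "tm_tapes ?D = K" "tm_tapes (mvm K G f) = K" "tm_tapes ?W = K" for f
      using fragment_tapes[OF fragment_drain] fragment_tapes[OF fragment_mvm] fragment_tapes[OF fW] by blast+
    have K: "b < K" "b1 < K" "p < b" "p < K" using L unfolding layout_def b1_def p_def by auto
    have nb: "b \<noteq> b1" "p \<noteq> b" "p \<noteq> b1" using K(3) unfolding b1_def by auto
    have "run ?M \<sigma> (?T s e) (\<sigma>(b := ctr (?g s e)))" if R: "ready b 2 p0 p1 loc 0 s e \<sigma>" for s e \<sigma>
    proof -
      let ?w = "str i s" let ?n = "length ?w"
      have z: "\<sigma> b = ctr 0" "\<sigma> b1 = ctr 0" "\<sigma> p = (tape_of ?w, 0)"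
        using R unfolding ready_def b1_def p_def str_def by auto
      have r1: "run ?W (shift fb 0 \<sigma>) (?n * (1 + 1) + 1) (shift fb ?n \<sigma>)"
      proof (rule run_whilem)
        have h: "head (shift fb j \<sigma> p) = tape_of ?w (int j)" for j
          using z by (simp add: shift_def fb_def head_def)
        show "heads (tm_tapes ?B) (shift fb j \<sigma>) ! p \<noteq> 0 \<and> run ?B (shift fb j \<sigma>) 1 (shift fb (Suc j) \<sigma>)"
          if "j < ?n" for j
          using that K h[of j] run_mvm[of K G fb "shift fb j \<sigma>"] by (simp add: tt tape_of_int shift_add)
        show "\<not> heads (tm_tapes ?B) (shift fb ?n \<sigma>) ! p \<noteq> 0" using K h[of ?n] by (simp add: tt tape_of_int)
      qed
      have s0: "shift fb 0 \<sigma> = \<sigma>" by (simp add: shift_def)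
      have sn: "shift fb ?n \<sigma> = \<sigma>(b := ctr ?n, b1 := ctr ?n, p := (tape_of ?w, int ?n))"
        using z nb by (auto simp: shift_def fb_def fun_eq_iff ctr_def)
      have r2: "run ?D (\<sigma>(b := ctr ?n, b1 := ctr ?n, p := (tape_of ?w, int ?n))) (2 * ?n + 1) (\<sigma>(b := ctr ?n))"
        by (rule run_eq[OF run_drain]) (use K nb z in \<open>auto simp: shift_def fun_eq_iff ctr_def\<close>)
      show ?thesis
        by (rule run_eq[OF run_seqm[OF trans[OF tt(3) tt(1)[symmetric]] r1[unfolded s0 sn] r2]]) auto
    qed
    then show "\<exists>M. fragment K G M \<and> (\<forall>s e \<sigma>. ready b 2 p0 p1 loc 0 s e \<sigma> \<longrightarrow>
        run M \<sigma> (?T s e) (\<sigma>(b := ctr (?g s e))))" using fM by blast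
  qed
  moreover have "pbd ?T" by (intro pbd_add pbd_mult pbd_const pbd_str)
  moreover have "1 \<le> (2::nat)" by simp
  ultimately show ?thesis unfolding pf_def using pbd_str by blast
qed

section \<open>Arithmetic, case distinctions and bounded sums in polynomial time\<close>

named_theorems pfi

lemma pf_const [pfi]: "pf (\<lambda>s e. n)"
  by (induction n) (auto intro: pf_zero pf_Suc)

declare pf_var [pfi] pf_Suc [pfi] pf_len [pfi] pf_symeq [pfi]

abbreviation pfp :: "(strs \<Rightarrow> env \<Rightarrow> bool) \<Rightarrow> bool" where
  "pfp P \<equiv> pf (\<lambda>s e. of_bool (P s e))"

lemma pf_cong: "pf f \<Longrightarrow> (\<And>s e. f s e = g s e) \<Longrightarrow> pf g"
  by (metis ext)

lemma pf_iter:
  assumes "pf (\<lambda>s e. H s (\<lambda>n. e (Suc (Suc n))) (e 0) (e 1))" "pf A" "pf N" "pbd B"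
    and "\<And>s e i. i \<le> N s e \<Longrightarrow> R s e i \<le> B s e"
    and "\<And>s e. R s e 0 = A s e" "\<And>s e i. R s e (Suc i) = H s e i (R s e i)"
  shows "pf (\<lambda>s e. R s e (N s e))"
proof -
  have *: "rec_nat (A s e) (H s e) i = R s e i" for s e i
    by (induction i) (simp_all add: assms(6,7))
  have "pf (\<lambda>s e. rec_nat (A s e) (H s e) (N s e))"
    by (rule pf_rec[OF assms(1-4)]) (simp add: * assms(5))
  then show ?thesis by (simp add: *)
qed

lemma pf_weaken2: "pf f \<Longrightarrow> pf (\<lambda>s e. f s (\<lambda>n. e (Suc (Suc n))))"
  by (rule pf_rename)

lemma pf_weaken: "pf f \<Longrightarrow> pf (\<lambda>s e. f s (\<lambda>n. e (Suc n)))"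
  by (rule pf_rename)

lemma pf_add [pfi]: assumes "pf f" "pf g" shows "pf (\<lambda>s e. f s e + g s e)"
  by (rule pf_iter[where H = "\<lambda>s e i a. Suc a" and A = f and B = "\<lambda>s e. f s e + g s e"])
    (use assms in \<open>intro pfi pbd_add pf_pbd[OF assms(1)] pf_pbd[OF assms(2)] | simp\<close>)+

text \<open>A recursion whose step returns its own index ends with the predecessor.\<close>

lemma pf_pred: assumes "pf f" shows "pf (\<lambda>s e. f s e - 1)"
  by (rule pf_iter[where H = "\<lambda>s e i a. i" and A = "\<lambda>s e. 0" and B = f and R = "\<lambda>s e i. i - 1"])
    (use assms in \<open>intro pfi pf_pbd[OF assms] | simp\<close>)+

lemma pf_diff [pfi]: assumes "pf f" "pf g" shows "pf (\<lambda>s e. f s e - g s e)"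
  by (rule pf_iter[where H = "\<lambda>s e i a. a - 1" and A = f and B = f])
    (use assms in \<open>intro pf_var pf_pred pf_pbd[OF assms(1)] pf_pbd[OF assms(2)] | simp\<close>)+

lemma pf_mult [pfi]: assumes "pf f" "pf g" shows "pf (\<lambda>s e. f s e * g s e)"
  by (rule pf_iter[where H = "\<lambda>s e i a. a + f s e" and A = "\<lambda>s e. 0" and B = "\<lambda>s e. f s e * g s e"])
    (use assms in \<open>intro pfi pbd_mult pf_weaken2[OF assms(1)] pf_pbd[OF assms(1)] pf_pbd[OF assms(2)] | simp\<close>)+

lemma pfp_le [pfi]: assumes "pf f" "pf g" shows "pfp (\<lambda>s e. f s e \<le> g s e)"
proof -
  have "pf (\<lambda>s e. 1 - (f s e - g s e))" using assms by (intro pfi)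
  then show ?thesis by (rule pf_cong) simp
qed

lemma pfp_less [pfi]: assumes "pf f" "pf g" shows "pfp (\<lambda>s e. f s e < g s e)"
  by (rule pf_cong[OF pfp_le[OF pf_Suc[OF assms(1)] assms(2)]]) (simp add: Suc_le_eq)

lemma pfp_not [pfi]: assumes "pfp P" shows "pfp (\<lambda>s e. \<not> P s e)"
proof -
  have "pf (\<lambda>s e. 1 - of_bool (P s e))" using assms by (intro pfi)
  then show ?thesis by (rule pf_cong) simp
qed

lemma pfp_conj [pfi]: assumes "pfp P" "pfp Q" shows "pfp (\<lambda>s e. P s e \<and> Q s e)"
  by (rule pf_cong[OF pf_mult[OF assms]]) simp

lemma pfp_eq [pfi]: assumes "pf f" "pf g" shows "pfp (\<lambda>s e. f s e = g s e)"
  by (rule pf_cong[OF pfp_conj[OF pfp_le[OF assms] pfp_le[OF assms(2,1)]]]) auto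

lemma pfp_const [pfi]: "pfp (\<lambda>s e. P)"
  by (rule pf_const)

text \<open>A recursion of length 0 or 1 chooses between its start value and its step.\<close>

lemma pf_If [pfi]: assumes "pfp P" "pf f" "pf g" shows "pf (\<lambda>s e. if P s e then f s e else g s e)"
proof -
  have "pf (\<lambda>s e. if of_bool (P s e) = (0::nat) then g s e else f s e)"
    by (rule pf_iter[where H = "\<lambda>s e i a. f s e" and A = g and N = "\<lambda>s e. of_bool (P s e)"
          and B = "\<lambda>s e. f s e + g s e" and R = "\<lambda>s e i. if i = 0 then g s e else f s e"])
      (use assms in \<open>intro pbd_add pf_weaken2[OF assms(2)] pf_pbd[OF assms(3)] pf_pbd[OF assms(2)] | simp\<close>)+
  then show ?thesis by (rule pf_cong) simp
qed

text \<open>Under a binder the bound variable is variable 0 and the other ones are shifted.\<close>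

lemma pf_sum [pfi]:
  assumes "pf (\<lambda>s e. F s (\<lambda>n. e (Suc n)) (e 0))" "pf N"
  shows "pf (\<lambda>s e. \<Sum>i<N s e. F s e i)"
proof -
  obtain B where B: "pbd B" "\<And>s e i. i \<le> N s e \<Longrightarrow> F s (\<lambda>n. case_nat i e (Suc n)) (case_nat i e 0) \<le> B s e"
    by (rule pbd_push[OF pf_pbd[OF assms(1)] pf_pbd[OF assms(2)]]) (rule that)
  have bd: "(\<Sum>j<i. F s e j) \<le> N s e * B s e" if "i \<le> N s e" for s e i
  proof -
    have "(\<Sum>j<i. F s e j) \<le> (\<Sum>j<i. B s e)"
    proof (rule sum_mono)
      fix j assume "j \<in> {..<i}"
      then show "F s e j \<le> B s e" using B(2)[of j s e] that by simp
    qed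
    also have "\<dots> \<le> N s e * B s e" using that by simp
    finally show ?thesis .
  qed
  have w: "pf (\<lambda>s e. F s (\<lambda>n. e (Suc (Suc n))) (e 0))"
    using pf_rename[OF assms(1), of "case_nat 0 (\<lambda>n. Suc (Suc n))"] by simp
  show ?thesis
    by (rule pf_iter[where H = "\<lambda>s e i a. a + F s e i" and A = "\<lambda>s e. 0" and B = "\<lambda>s e. N s e * B s e"])
      (intro pfi pbd_mult pf_pbd[OF assms(2)] w assms(2) B(1) bd | assumption | simp)+
qed

text \<open>Division counts the positive multiples of the divisor up to the dividend; the conjunct
  \<open>0 < g s e\<close> reproduces the value 0 for division by zero.\<close>

lemma pf_div [pfi]: assumes "pf f" "pf g" shows "pf (\<lambda>s e. f s e div g s e)"
proof -
  have *: "pf (\<lambda>s e. \<Sum>i<f s e. of_bool (0 < g s e \<and> Suc i * g s e \<le> f s e))"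
    by (intro pfi pf_weaken[OF assms(1)] pf_weaken[OF assms(2)] assms)
  have "(\<Sum>i<a. of_bool (0 < b \<and> Suc i * b \<le> a)) = a div b" for a b :: nat
  proof (cases "b = 0")
    case False
    have "{..<a} \<inter> {i. Suc i * b \<le> a} = {..<a div b}"
      using False less_le_trans[OF _ div_le_dividend[of a b]]
      by (auto simp: less_eq_div_iff_mult_less_eq[symmetric] Suc_le_eq simp del: mult_Suc)
    then have "(\<Sum>i<a. of_bool (Suc i * b \<le> a)) = a div b"
      by (simp add: sum_of_bool_eq del: mult_Suc)
    then show ?thesis using False by simp
  qed simp
  then show ?thesis by (intro pf_cong[OF *]) simp
qed

lemma pf_mod [pfi]: assumes "pf f" "pf g" shows "pf (\<lambda>s e. f s e mod g s e)"
  by (rule pf_cong[OF pf_diff[OF assms(1) pf_mult[OF assms(2) pf_div[OF assms]]]]) (simp add: minus_mult_div_eq_mod)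

lemma pf_power [pfi]:
  assumes "pf f" "pf g" "pbd (\<lambda>s e. f s e ^ g s e)" shows "pf (\<lambda>s e. f s e ^ g s e)"
proof -
  \<comment> \<open>The summand 1 is for \<open>x = 0\<close>, where \<open>x ^ 0 = 1\<close> may
    exceed \<open>x ^ n\<close>.\<close>
  have bd: "x ^ i \<le> x ^ n + 1" if "i \<le> n" for x i n :: nat
    using power_increasing[OF that, of x] by (cases "x = 0") (auto simp: power_0_left)
  show ?thesis
    by (rule pf_iter[where H = "\<lambda>s e i a. a * f s e" and A = "\<lambda>s e. 1" and B = "\<lambda>s e. f s e ^ g s e + 1"])
      (intro pfi pf_weaken2[OF assms(1)] pbd_add pbd_const assms bd | assumption | simp)+
qed

lemma pf_power_const [pfi]: "pf f \<Longrightarrow> pf (\<lambda>s e. f s e ^ n)"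
  by (rule pf_power[OF _ pf_const pbd_power[OF pf_pbd]])

text \<open>A function on finitely many arguments is a fixed cascade of tests, whatever its
  definition. This is how field arithmetic and the transition table of a machine enter the
  programs.\<close>

lemma pf_table:
  assumes "pf f" "\<And>s e. f s e < q" shows "pf (\<lambda>s e. g (f s e) :: nat)"
proof -
  have "pf (\<lambda>s e. if f s e < q then g (f s e) else 0)" for q
  proof (induction q)
    case (Suc q)
    have "pf (\<lambda>s e. if f s e = q then g q else if f s e < q then g (f s e) else 0)"
      by (rule pf_If[OF pfp_eq[OF assms(1) pf_const] pf_const Suc])
    then show ?case by (rule pf_cong) auto
  qed (simp add: pf_const)
  from this[of q] show ?thesis by (rule pf_cong) (simp add: assms(2))
qed

text \<open>The power itself need not be polynomially bounded. Capping by \<open>g\<close> after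
  every doubling keeps the counter small and does not change the comparison.\<close>

lemma pfp_cappow [pfi]: assumes "pf f" "pf g" shows "pfp (\<lambda>s e. 2 ^ f s e < g s e)"
proof -
  have *: "min (2 ^ Suc n) x = min (2 * min (2 ^ n) x) x" for x n :: nat by (auto simp: min_def)
  have m: "pf (\<lambda>s e. min (h1 s e) (h2 s e))" if "pf h1" "pf h2" for h1 h2
    unfolding min_def using that by (intro pfi)
  have "pf (\<lambda>s e. min (2 ^ f s e) (g s e))"
    by (rule pf_iter[where H = "\<lambda>s e i a. min (2 * a) (g s e)" and A = "\<lambda>s e. min 1 (g s e)" and B = g])
      (intro m pf_mult pf_var pf_const pf_weaken2[OF assms(2)] pf_pbd[OF assms(2)] assms * | simp)+
  from pfp_less[OF this assms(2)] show ?thesis by (rule pf_cong) auto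
qed

section \<open>Polynomial time string output\<close>

text \<open>The head waits on the first blank behind the word, so appending needs no search.\<close>

definition wtape :: "bool list \<Rightarrow> tape" where "wtape w = (tape_of w, int (length w))"

lemma tape_of_snoc: "(tape_of w)(int (length w) := if x then 2 else 1) = tape_of (w @ [x])"
  by (auto simp: tape_of_def fun_eq_iff nth_append nat_less_iff)

definition emits :: "(strs \<Rightarrow> env \<Rightarrow> bool list) \<Rightarrow> nat \<Rightarrow> nat \<Rightarrow> (strs \<Rightarrow> env \<Rightarrow> nat) \<Rightarrow> bool" where
  "emits F k m T \<longleftrightarrow> (\<forall>K G b p0 p1 loc o'. layout K G b m p0 p1 loc k \<and> o' < b \<and> o' \<noteq> p0 \<and> o' \<noteq> p1 \<and>
       (\<forall>i<k. loc i \<noteq> o') \<longrightarrow>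
     (\<exists>M. fragment K G M \<and> (\<forall>s e \<sigma> w. ready b m p0 p1 loc k s e \<sigma> \<and> \<sigma> o' = wtape w \<longrightarrow>
             run M \<sigma> (T s e) (\<sigma>(o' := wtape (w @ F s e))))))"

definition ps :: "(strs \<Rightarrow> env \<Rightarrow> bool list) \<Rightarrow> bool" where
  "ps F \<longleftrightarrow> pbd (\<lambda>s e. length (F s e)) \<and> (\<exists>k m T. 1 \<le> m \<and> pbd T \<and> emits F k m T)"

lemma emitsD:
  assumes "emits F k m T" "layout K G b m p0 p1 loc k" "o' < b" "o' \<noteq> p0" "o' \<noteq> p1" "\<forall>i<k. loc i \<noteq> o'"
  obtains M where "fragment K G M" "\<And>s e \<sigma> w. ready b m p0 p1 loc k s e \<sigma> \<Longrightarrow> \<sigma> o' = wtape w \<Longrightarrow>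
             run M \<sigma> (T s e) (\<sigma>(o' := wtape (w @ F s e)))"
proof -
  have "\<exists>M. fragment K G M \<and> (\<forall>s e \<sigma> w. ready b m p0 p1 loc k s e \<sigma> \<and> \<sigma> o' = wtape w \<longrightarrow>
             run M \<sigma> (T s e) (\<sigma>(o' := wtape (w @ F s e))))"
    using assms(1)[unfolded emits_def, rule_format, of K G b p0 p1 loc o'] assms(2-) by simp
  then show thesis using that by blast
qed

lemma emitsI:
  assumes "\<And>K G b p0 p1 loc o'. layout K G b m p0 p1 loc k \<Longrightarrow> o' < b \<Longrightarrow> o' \<noteq> p0 \<Longrightarrow> o' \<noteq> p1 \<Longrightarrow>
       \<forall>i<k. loc i \<noteq> o' \<Longrightarrow>
     \<exists>M. fragment K G M \<and> (\<forall>s e \<sigma> w. ready b m p0 p1 loc k s e \<sigma> \<longrightarrow> \<sigma> o' = wtape w \<longrightarrow>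
             run M \<sigma> (T s e) (\<sigma>(o' := wtape (w @ F s e))))"
  shows "emits F k m T"
  unfolding emits_def
proof (intro allI impI)
  fix K G b p0 p1 loc o'
  assume a: "layout K G b m p0 p1 loc k \<and> o' < b \<and> o' \<noteq> p0 \<and> o' \<noteq> p1 \<and> (\<forall>i<k. loc i \<noteq> o')"
  show "\<exists>M. fragment K G M \<and> (\<forall>s e \<sigma> w. ready b m p0 p1 loc k s e \<sigma> \<and> \<sigma> o' = wtape w \<longrightarrow>
             run M \<sigma> (T s e) (\<sigma>(o' := wtape (w @ F s e))))"
    unfolding imp_conjL by (rule assms) (use a in simp_all)
qed

lemma emits_mono: assumes "emits F k m T" "k \<le> k'" "m \<le> m'" shows "emits F k' m' T"
proof (rule emitsI)
  fix K G b p0 p1 loc o'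
  assume L: "layout K G b m' p0 p1 loc k'" and o: "o' < b" "o' \<noteq> p0" "o' \<noteq> p1" "\<forall>i<k'. loc i \<noteq> o'"
  have "layout K G b m p0 p1 loc k" using L assms(2,3) unfolding layout_def by auto
  moreover have "\<forall>i<k. loc i \<noteq> o'" using o(4) assms(2) by simp
  ultimately obtain M where M: "fragment K G M" "\<And>s e \<sigma> w. ready b m p0 p1 loc k s e \<sigma> \<Longrightarrow> \<sigma> o' = wtape w \<Longrightarrow>
             run M \<sigma> (T s e) (\<sigma>(o' := wtape (w @ F s e)))"
    using emitsD[OF assms(1) _ o(1-3)] by metis
  have "ready b m' p0 p1 loc k' s e \<sigma> \<Longrightarrow> ready b m p0 p1 loc k s e \<sigma>" for s e \<sigma>
    using assms(2,3) unfolding ready_def by auto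
  then show "\<exists>M. fragment K G M \<and> (\<forall>s e \<sigma> w. ready b m' p0 p1 loc k' s e \<sigma> \<longrightarrow> \<sigma> o' = wtape w \<longrightarrow>
             run M \<sigma> (T s e) (\<sigma>(o' := wtape (w @ F s e))))"
    using M by (intro exI[of _ M]) simp
qed

lemma psE:
  assumes "ps F"
  obtains k m T where "1 \<le> m" "pbd T" "\<And>k' m'. k \<le> k' \<Longrightarrow> m \<le> m' \<Longrightarrow> emits F k' m' T"
proof -
  obtain k m T where *: "1 \<le> m" "pbd T" "emits F k m T" using assms unfolding ps_def by blast
  show thesis by (rule that[OF *(1,2) emits_mono[OF *(3)]])
qed

lemma ps_bit [pfi]: assumes "pfp P" shows "ps (\<lambda>s e. [P s e])"
proof -
  obtain k m T where f: "1 \<le> m" "pbd T" "\<And>k' m'. k \<le> k' \<Longrightarrow> m \<le> m' \<Longrightarrow> computes (\<lambda>s e. of_bool (P s e)) k' m' T"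
    by (rule pfE[OF assms]) (rule that)
  let ?T = "\<lambda>s e. T s e + 10"
  have "emits (\<lambda>s e. [P s e]) k m ?T"
  proof (rule emitsI)
    fix K G b p0 p1 loc o'
    assume L: "layout K G b m p0 p1 loc k" and o: "o' < b" "o' \<noteq> p0" "o' \<noteq> p1" "\<forall>i<k. loc i \<noteq> o'"
    obtain M where M: "fragment K G M"
       "\<And>s e \<sigma>. ready b m p0 p1 loc k s e \<sigma> \<Longrightarrow> run M \<sigma> (T s e) (\<sigma>(b := ctr (of_bool (P s e))))"
      using f(3)[of k m] L unfolding computes_def by blast
    let ?W = "\<lambda>x. actm K G (\<lambda>j s. if j = o' then (x, Move_Right) else (s, Move_Stay))"
    let ?I = "item (\<lambda>ss. ss ! b = 0) (?W 2) (?W 1)"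
    let ?D = "drain K G b (\<lambda>j. Move_Stay)"
    let ?M = "seqm M (seqm ?I ?D)"
    have K: "b < K" "o' < K" "3 \<le> G" using L o(1) f(1) unfolding layout_def by auto
    have fW: "fragment K G (?W x)" if "x < 3" for x by (rule fragment_actm) (use K that in auto)
    have fI: "fragment K G ?I" by (intro fragment_item fW) auto
    have fM: "fragment K G ?M" by (intro fragment_seqm fragment_drain fI M)
    have tt: "tm_tapes ?D = K" "tm_tapes (?W x) = K" "tm_tapes M = K" "tm_tapes ?I = K"
        "tm_tapes (seqm X Y) = tm_tapes X" for x X Y
      using fragment_tapes[OF fragment_drain] fragment_tapes[OF M(1)] fragment_tapes[OF fI]
      by (auto simp: seqm_def actm_def)
    have "run ?M \<sigma> (?T s e) (\<sigma>(o' := wtape (w @ [P s e])))"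
      if R: "ready b m p0 p1 loc k s e \<sigma>" and w: "\<sigma> o' = wtape w" for s e \<sigma> w
    proof -
      let ?v = "of_bool (P s e) :: nat"
      have z: "\<sigma> b = ctr 0" using R f(1) unfolding ready_def by auto
      have u: "act_tape (wtape w) (x, Move_Right) = wtape (w @ [P s e])" if "x = (if P s e then 2 else 1)" for x
        using tape_of_snoc[of w "P s e"] that by (simp add: wtape_def)
      have r1: "run M \<sigma> (T s e) (\<sigma>(b := ctr ?v))" by (rule M(2)[OF R])
      have r2: "run ?I (\<sigma>(b := ctr ?v)) (1 + 1) (\<sigma>(b := ctr ?v, o' := wtape (w @ [P s e])))"
        by (rule run_itemI; (rule run_eq[OF run_actm])?)
          (use K o(1) w u in \<open>auto simp: tt fun_eq_iff act_stay split: if_splits\<close>)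
      have r3: "run ?D (\<sigma>(b := ctr ?v, o' := wtape (w @ [P s e]))) (2 * ?v + 1) (\<sigma>(o' := wtape (w @ [P s e])))"
        by (rule run_eq[OF run_drain[where n = ?v]]) (use K o(1) z in \<open>auto simp: shift_def fun_eq_iff ctr_def\<close>)
      show ?thesis
        by (rule run_eq[OF run_seqm[OF _ r1 run_seqm[OF _ r2 r3]]]) (auto simp: tt)
    qed
    then show "\<exists>M. fragment K G M \<and> (\<forall>s e \<sigma> w. ready b m p0 p1 loc k s e \<sigma> \<longrightarrow> \<sigma> o' = wtape w \<longrightarrow>
             run M \<sigma> (?T s e) (\<sigma>(o' := wtape (w @ [P s e]))))" using fM by blast
  qed
  moreover have "pbd ?T" by (intro pbd_add pbd_const f)
  moreover have "pbd (\<lambda>s e. length [P s e])" using pbd_const[of 1] by simp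
  ultimately show ?thesis unfolding ps_def using f(1) by blast
qed

lemma ps_append [pfi]: assumes "ps F1" "ps F2" shows "ps (\<lambda>s e. F1 s e @ F2 s e)"
proof -
  obtain k1 m1 T1 where 1: "1 \<le> m1" "pbd T1" "\<And>k' m'. k1 \<le> k' \<Longrightarrow> m1 \<le> m' \<Longrightarrow> emits F1 k' m' T1"
    by (rule psE[OF assms(1)]) (rule that)
  obtain k2 m2 T2 where 2: "1 \<le> m2" "pbd T2" "\<And>k' m'. k2 \<le> k' \<Longrightarrow> m2 \<le> m' \<Longrightarrow> emits F2 k' m' T2"
    by (rule psE[OF assms(2)]) (rule that)
  define k where "k = max k1 k2"
  define m where "m = max m1 m2"
  have e: "emits F1 k m T1" "emits F2 k m T2" using 1(3)[of k m] 2(3)[of k m] by (auto simp: k_def m_def)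
  let ?T = "\<lambda>s e. T1 s e + T2 s e + 1"
  have "emits (\<lambda>s e. F1 s e @ F2 s e) k m ?T"
  proof (rule emitsI)
    fix K G b p0 p1 loc o'
    assume L: "layout K G b m p0 p1 loc k" and o: "o' < b" "o' \<noteq> p0" "o' \<noteq> p1" "\<forall>i<k. loc i \<noteq> o'"
    obtain A where A: "fragment K G A" "\<And>s e \<sigma> w. ready b m p0 p1 loc k s e \<sigma> \<Longrightarrow> \<sigma> o' = wtape w \<Longrightarrow>
             run A \<sigma> (T1 s e) (\<sigma>(o' := wtape (w @ F1 s e)))"
      by (rule emitsD[OF e(1) L o]) (rule that)
    obtain B where B: "fragment K G B" "\<And>s e \<sigma> w. ready b m p0 p1 loc k s e \<sigma> \<Longrightarrow> \<sigma> o' = wtape w \<Longrightarrow>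
             run B \<sigma> (T2 s e) (\<sigma>(o' := wtape (w @ F2 s e)))"
      by (rule emitsD[OF e(2) L o]) (rule that)
    have "run (seqm A B) \<sigma> (?T s e) (\<sigma>(o' := wtape (w @ F1 s e @ F2 s e)))"
      if R: "ready b m p0 p1 loc k s e \<sigma>" and w: "\<sigma> o' = wtape w" for s e \<sigma> w
    proof -
      have "ready b m p0 p1 loc k s e (\<sigma>(o' := wtape (w @ F1 s e)))"
        using R o unfolding ready_def by auto
      from B(2)[OF this, of "w @ F1 s e"] have "run B (\<sigma>(o' := wtape (w @ F1 s e))) (T2 s e) (\<sigma>(o' := wtape (w @ F1 s e @ F2 s e)))"
        by simp
      from run_seqm[OF _ A(2)[OF R w] this] show ?thesis
        using fragment_tapes[OF A(1)] fragment_tapes[OF B(1)] by simp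
    qed
    then show "\<exists>M. fragment K G M \<and> (\<forall>s e \<sigma> w. ready b m p0 p1 loc k s e \<sigma> \<longrightarrow> \<sigma> o' = wtape w \<longrightarrow>
             run M \<sigma> (?T s e) (\<sigma>(o' := wtape (w @ F1 s e @ F2 s e))))"
      using fragment_seqm[OF A(1) B(1)] by blast
  qed
  moreover have "pbd ?T" by (intro pbd_add pbd_const 1 2)
  moreover have "pbd (\<lambda>s e. length (F1 s e @ F2 s e))" using assms unfolding ps_def by auto
  moreover have "1 \<le> m" using 1(1) by (simp add: m_def)
  ultimately show ?thesis unfolding ps_def by blast
qed

lemma ps_concat [pfi]:
  assumes "ps (\<lambda>s e. F s (\<lambda>n. e (Suc n)) (e 0))" "pf N"
  shows "ps (\<lambda>s e. concat (map (F s e) [0..<N s e]))"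
proof -
  let ?F = "\<lambda>s e. F s (\<lambda>n. e (Suc n)) (e 0)"
  obtain kF mF TF where F: "1 \<le> mF" "pbd TF" "\<And>k' m'. kF \<le> k' \<Longrightarrow> mF \<le> m' \<Longrightarrow> emits ?F k' m' TF"
    by (rule psE[OF assms(1)]) (rule that)
  obtain kN mN TN where N: "1 \<le> mN" "pbd TN" "\<And>k' m'. kN \<le> k' \<Longrightarrow> mN \<le> m' \<Longrightarrow> computes N k' m' TN"
    by (rule pfE[OF assms(2)]) (rule that)
  define k where "k = max kF kN"
  define m where "m = max mF mN"
  have pbl: "pbd (\<lambda>s e. length (?F s e))" using assms(1) unfolding ps_def by blast
  obtain TF' where TF': "pbd TF'" "\<And>s e i. i \<le> N s e \<Longrightarrow> TF s (case_nat i e) \<le> TF' s e"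
    by (rule pbd_push[OF F(2) pf_pbd[OF assms(2)]]) (rule that)
  obtain B where B: "pbd B" "\<And>s e i. i \<le> N s e \<Longrightarrow> length (?F s (case_nat i e)) \<le> B s e"
    by (rule pbd_push[OF pbl pf_pbd[OF assms(2)]]) (rule that)
  let ?I = "\<lambda>s e. TF' s e + 2"
  let ?T = "\<lambda>s e. TN s e + N s e * (?I s e + 1) + 2 * N s e + 5"
  have cN: "computes N k (Suc (Suc m)) TN" by (rule N(3)) (auto simp: k_def m_def)
  have cF: "emits ?F (Suc k) m TF" by (rule F(3)) (auto simp: k_def m_def)
  have m1: "1 \<le> m" using F(1) by (simp add: m_def)
  have "emits (\<lambda>s e. concat (map (F s e) [0..<N s e])) k (Suc (Suc m)) ?T"
  proof (rule emitsI)
    fix K G b p0 p1 loc o'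
    assume L: "layout K G b (Suc (Suc m)) p0 p1 loc k" and o: "o' < b" "o' \<noteq> p0" "o' \<noteq> p1" "\<forall>i<k. loc i \<noteq> o'"
    define b1 where "b1 = Suc b"
    define b2 where "b2 = Suc b1"
    have L2: "layout K G b2 m p0 p1 (case_nat b1 loc) (Suc k)"
      using L unfolding layout_def b1_def b2_def by (auto split: nat.splits)
    have K: "b < K" "b1 < K" "o' < K" using L o(1) m1 unfolding layout_def b1_def by auto
    have nb: "b \<noteq> b1" "b \<noteq> o'" "b1 \<noteq> o'" "o' < b2" using o(1) unfolding b1_def b2_def by auto
    obtain MN where MN: "fragment K G MN"
       "\<And>s e \<sigma>. ready b (Suc (Suc m)) p0 p1 loc k s e \<sigma> \<Longrightarrow> run MN \<sigma> (TN s e) (\<sigma>(b := ctr (N s e)))"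
      using cN L unfolding computes_def by blast
    have lo: "\<forall>i<Suc k. case_nat b1 loc i \<noteq> o'" using o(4) nb by (auto split: nat.splits)
    obtain MF where MF: "fragment K G MF"
      "\<And>s e \<sigma> w. ready b2 m p0 p1 (case_nat b1 loc) (Suc k) s e \<sigma> \<Longrightarrow> \<sigma> o' = wtape w \<Longrightarrow>
             run MF \<sigma> (TF s e) (\<sigma>(o' := wtape (w @ ?F s e)))"
      by (rule emitsD[OF cF L2 nb(4) o(2,3) lo]) (rule that)
    let ?A = "mvm K G (\<lambda>j. if j = b then Move_Left else if j = b1 then Move_Right else Move_Stay)"
    let ?body = "seqm MF ?A"
    let ?loop = "whilem (\<lambda>ss. ss ! b = 0) ?body"
    let ?D = "drain K G b1 (\<lambda>j. Move_Stay)"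
    let ?M = "seqm MN (seqm ?loop ?D)"
    have fb: "fragment K G ?body" by (intro fragment_seqm fragment_mvm MF)
    have fl: "fragment K G ?loop" by (intro fragment_whilem fb)
    have fM: "fragment K G ?M" by (intro fragment_seqm fl fragment_drain MN)
    have tt: "tm_tapes ?D = K" "tm_tapes ?A = K" "tm_tapes MN = K" "tm_tapes MF = K" "tm_tapes ?loop = K" "tm_tapes ?body = K"
        "tm_tapes (seqm X Y) = tm_tapes X" for X Y
      using fragment_tapes[OF fragment_drain] fragment_tapes[OF fragment_mvm] fragment_tapes[OF MN(1)]
        fragment_tapes[OF MF(1)] fragment_tapes[OF fl] fragment_tapes[OF fb]
      by (auto simp: seqm_def)
    have "run ?M \<sigma> (?T s e) (\<sigma>(o' := wtape (w @ concat (map (F s e) [0..<N s e]))))"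
      if R: "ready b (Suc (Suc m)) p0 p1 loc k s e \<sigma>" and w: "\<sigma> o' = wtape w" for s e \<sigma> w
    proof -
      let ?n = "N s e"
      have z: "\<sigma> b = ctr 0" "\<sigma> b1 = ctr 0" using R unfolding ready_def b1_def by auto
      define r where "r i = w @ concat (map (F s e) [0..<i])" for i
      define S where "S i = \<sigma>(b := ctr (?n - i), b1 := ctr i, o' := wtape (r i))" for i
      have r1: "run MN \<sigma> (TN s e) (S 0)"
        by (rule run_eq[OF MN(2)[OF R]]) (use z w nb in \<open>auto simp: S_def r_def fun_eq_iff\<close>)
      have step: "run ?body (S i) (?I s e) (S (Suc i))" if i: "i < ?n" for i
      proof -
        let ?E = "case_nat i e"
        have "ready b2 m p0 p1 (case_nat b1 loc) (Suc k) s ?E (S i)"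
          using R L o unfolding ready_def layout_def S_def b1_def b2_def
          by (auto split: nat.splits)
        from MF(2)[OF this, of "r i"] have q1: "run MF (S i) (TF s ?E) ((S i)(o' := wtape (r (Suc i))))"
          by (simp add: r_def S_def)
        have q2: "run ?A ((S i)(o' := wtape (r (Suc i)))) 1 (S (Suc i))"
          by (rule run_eq[OF run_mvm]) (use K nb z i in \<open>auto simp: shift_def fun_eq_iff ctr_def S_def\<close>)
        show ?thesis
          by (rule run_eq[OF run_seqm[OF _ q1 q2]])
            (use TF'(2)[of i s e] i in \<open>auto simp: tt\<close>)
      qed
      have r3: "run ?loop (S 0) (?n * (?I s e + 1) + 1) (S ?n)"
      proof (rule run_whilem)
        have "heads (tm_tapes ?body) (S i) ! b = (if i < ?n then 0 else 1)" if "i \<le> ?n" for i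
          using that K nb by (auto simp: tt S_def)
        then show "i < ?n \<Longrightarrow> heads (tm_tapes ?body) (S i) ! b = 0 \<and> run ?body (S i) (?I s e) (S (Suc i))"
          "heads (tm_tapes ?body) (S ?n) ! b \<noteq> 0" for i using step by auto
      qed
      have r4: "run ?D (S ?n) (2 * ?n + 1) (\<sigma>(o' := wtape (r ?n)))"
        by (rule run_eq[OF run_drain]) (use K nb z in \<open>auto simp: shift_def fun_eq_iff ctr_def S_def\<close>)
      have "run ?M \<sigma> (?T s e) (\<sigma>(o' := wtape (r ?n)))"
        by (rule run_eq[OF run_seqm[OF _ r1 run_seqm[OF _ r3 r4]]]) (auto simp: tt)
      then show ?thesis by (simp add: r_def)
    qed
    then show "\<exists>M. fragment K G M \<and> (\<forall>s e \<sigma> w. ready b (Suc (Suc m)) p0 p1 loc k s e \<sigma> \<longrightarrow> \<sigma> o' = wtape w \<longrightarrow>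
             run M \<sigma> (?T s e) (\<sigma>(o' := wtape (w @ concat (map (F s e) [0..<N s e])))))" using fM by blast
  qed
  moreover have "pbd ?T" by (intro pbd_add pbd_mult pbd_const N TF' pf_pbd[OF assms(2)])
  moreover have "pbd (\<lambda>s e. length (concat (map (F s e) [0..<N s e])))"
  proof (rule pbd_mono)
    show "pbd (\<lambda>s e. N s e * B s e)" by (intro pbd_mult B pf_pbd[OF assms(2)])
    fix s e
    have "length (concat (map (F s e) [0..<n])) \<le> n * B s e" if "n \<le> N s e" for n
      using that
    proof (induction n)
      case (Suc n)
      then show ?case using B(2)[of n s e] by simp
    qed simp
    then show "length (concat (map (F s e) [0..<N s e])) \<le> N s e * B s e" by blast
  qed
  moreover have "1 \<le> Suc (Suc m)" by simp
  ultimately show ?thesis unfolding ps_def by blast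
qed

lemma ps_nil [pfi]: "ps (\<lambda>s e. [])"
  using ps_concat[OF ps_bit[OF pfp_const[of True]] pf_const[of 0]] by simp

lemma ps_enc_nat [pfi]: assumes "pf f" shows "ps (\<lambda>s e. enc_nat (f s e))"
proof -
  have "replicate n True = concat (map (\<lambda>i. [True]) [0..<n])" for n
    by (simp add: map_replicate_const)
  then show ?thesis
    unfolding enc_nat_def using assms by (simp only:) (intro pfi)
qed

section \<open>Calling a machine\<close>

text \<open>\<open>turing_machine\<close> restricts \<open>tm_delta\<close> only on legal states and
  symbols, whereas \<open>fragment\<close> speaks about all states; the fallback that halts closes
  the difference. Tape \<open>\<kappa> + 1\<close> copies the moves of the output tape without
  writing.\<close>

definition embed :: "nat \<Rightarrow> tm \<Rightarrow> tm" where
  "embed K M = \<lparr>tm_tapes = K, tm_states = tm_states M, tm_symbols = tm_symbols M,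
     tm_delta = (\<lambda>q ss. let \<kappa> = tm_tapes M; us = take \<kappa> (drop 1 ss) in
       if q < tm_states M \<and> (\<forall>s\<in>set us. s < tm_symbols M) then
         (case tm_delta M q us of (q', acts) \<Rightarrow>
           (q', map (\<lambda>j. if 1 \<le> j \<and> j \<le> \<kappa> then acts ! (j - 1)
                        else if j = \<kappa> + 1 then (ss ! j, snd (acts ! (\<kappa> - 1)))
                        else if j = \<kappa> + 2 then (ss ! j, Move_Right)
                        else (ss ! j, Move_Stay)) [0..<length ss]))
       else (1, stay ss))\<rparr>"

lemma turing_machineD:
  assumes "turing_machine M" "q < tm_states M" "length ss = tm_tapes M" "\<forall>s\<in>set ss. s < tm_symbols M"
    and "tm_delta M q ss = (q', acts)"
  shows "q' < tm_states M" "length acts = tm_tapes M" "\<forall>a\<in>set acts. fst a < tm_symbols M"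
proof -
  have "case tm_delta M q ss of (q', acts) \<Rightarrow> q' < tm_states M \<and> length acts = tm_tapes M \<and>
      (\<forall>(s, mv)\<in>set acts. s < tm_symbols M)"
    using conjunct2[OF conjunct2[OF conjunct2[OF assms(1)[unfolded turing_machine_def]]], rule_format, of q ss]
      assms(2-4) by simp
  then show "q' < tm_states M" "length acts = tm_tapes M" "\<forall>a\<in>set acts. fst a < tm_symbols M"
    unfolding assms(5) by (simp_all add: case_prod_unfold)
qed

lemma fragment_embed:
  assumes M: "turing_machine M" and K: "tm_tapes M + 3 \<le> K"
  shows "fragment K (tm_symbols M) (embed K M)"
proof -
  let ?E = "embed K M"
  have "fst (tm_delta ?E q ss) < tm_states ?E \<and> length (snd (tm_delta ?E q ss)) = K \<and>
        ((\<forall>s\<in>set ss. s < tm_symbols M) \<longrightarrow> (\<forall>a\<in>set (snd (tm_delta ?E q ss)). fst a < tm_symbols M))"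
    if l: "length ss = K" for q ss
  proof -
    let ?us = "take (tm_tapes M) (drop 1 ss)"
    have lu: "length ?us = tm_tapes M" using l K by simp
    have s2: "2 \<le> tm_states M" "1 \<le> tm_tapes M" using M unfolding turing_machine_def by auto
    obtain q' acts where d: "tm_delta M q ?us = (q', acts)" by fastforce
    show ?thesis
    proof (cases "q < tm_states M \<and> (\<forall>s\<in>set ?us. s < tm_symbols M)")
      case True
      note D = turing_machineD[OF M _ lu _ d]
      have a: "fst (acts ! (j - 1)) < tm_symbols M" if "1 \<le> j" "j \<le> tm_tapes M" for j
        using D(2,3) True that by (metis One_nat_def diff_less le_trans less_le_trans nth_mem zero_less_one diff_Suc_less Suc_le_eq)
      show ?thesis using True l d D(1) a s2 by (auto simp: embed_def Let_def)
    next
      case False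
      then show ?thesis using l s2 by (auto simp: embed_def Let_def stay_def)
    qed
  qed
  moreover have "2 \<le> tm_states M" using M unfolding turing_machine_def by auto
  ultimately show ?thesis unfolding fragment_def by (simp add: embed_def)
qed

definition valid_config :: "tm \<Rightarrow> config \<Rightarrow> bool" where
  "valid_config M c \<longleftrightarrow> fst c < tm_states M \<and> length (snd c) = tm_tapes M \<and>
     (\<forall>\<tau>\<in>set (snd c). \<forall>i. fst \<tau> i < tm_symbols M)"

lemma fst_act_tape: "fst (act_tape \<tau> a) = (fst \<tau>)(snd \<tau> := fst a)"
  by (cases \<tau>; cases a) simp

lemma snd_act_tape: "snd (act_tape \<tau> a) = snd \<tau> + dir (snd a)"
  by (cases \<tau>; cases a; cases "snd a") auto

lemma valid_heads:
  assumes "valid_config M (q, ts)"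
  shows "length (map head ts) = tm_tapes M" "\<forall>s\<in>set (map head ts). s < tm_symbols M"
  using assms unfolding valid_config_def head_def by auto

lemma map_head: "map (\<lambda>(c, p). c p) ts = map head ts"
  by (simp add: head_def case_prod_unfold)

lemma valid_step:
  assumes M: "turing_machine M" and v: "valid_config M (q, ts)"
  shows "valid_config M (tm_step M (q, ts))"
proof (cases "q = 1")
  case False
  obtain q' acts where d: "tm_delta M q (map head ts) = (q', acts)" by fastforce
  have "q < tm_states M" using v unfolding valid_config_def by simp
  note D = turing_machineD[OF M this valid_heads[OF v] d]
  have "\<forall>\<tau>\<in>set (map2 act_tape ts acts). \<forall>i. fst \<tau> i < tm_symbols M"
    using v D unfolding valid_config_def
    by (auto simp: fst_act_tape dest: set_zip_leftD set_zip_rightD) (fastforce dest: set_zip_leftD set_zip_rightD)+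
  then show ?thesis using False v D d unfolding valid_config_def by (simp add: tm_step.simps map_head)
qed (use v in \<open>simp add: tm_step.simps\<close>)

definition spread :: "nat \<Rightarrow> (nat \<Rightarrow> tape) \<Rightarrow> tape list \<Rightarrow> nat \<Rightarrow> nat \<Rightarrow> tape" where
  "spread \<kappa> \<sigma> ts n = (\<lambda>j. if 1 \<le> j \<and> j \<le> \<kappa> then ts ! (j - 1)
      else if j = \<kappa> + 1 then (fst (ctr 0), snd (last ts)) else if j = \<kappa> + 2 then ctr n else \<sigma> j)"

lemma embed_step:
  assumes M: "turing_machine M" and K: "tm_tapes M + 3 \<le> K" and v: "valid_config M (q, ts)" and q: "q \<noteq> 1"
    and s: "tm_step M (q, ts) = (q', ts')"
  shows "tm_step (embed K M) (q, tapes K (spread (tm_tapes M) \<sigma> ts n)) =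
            (q', tapes K (spread (tm_tapes M) \<sigma> ts' (Suc n)))"
    and "\<bar>snd (last ts')\<bar> \<le> \<bar>snd (last ts)\<bar> + 1"
proof -
  let ?\<kappa> = "tm_tapes M" let ?S = "spread (tm_tapes M) \<sigma> ts n"
  obtain acts where d: "tm_delta M q (map head ts) = (q', acts)" and ts': "ts' = map2 act_tape ts acts"
    using s q by (auto simp: tm_step.simps map_head split: prod.splits)
  have qs: "q < tm_states M" and lt: "length ts = ?\<kappa>" using v unfolding valid_config_def by auto
  note D = turing_machineD[OF M qs valid_heads[OF v] d]
  have k1: "1 \<le> ?\<kappa>" using M unfolding turing_machine_def by auto
  have us: "take ?\<kappa> (drop 1 (map (\<lambda>j. head (?S j)) [0..<K])) = map head ts"
    by (rule nth_equalityI) (use lt K in \<open>auto simp: spread_def\<close>)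
  have la: "last ts = ts ! (?\<kappa> - 1)" "last ts' = act_tape (ts ! (?\<kappa> - 1)) (acts ! (?\<kappa> - 1))"
  proof -
    have "ts \<noteq> []" "ts' \<noteq> []" "length ts' = ?\<kappa>" using lt k1 D(2) ts' by auto
    then show "last ts = ts ! (?\<kappa> - 1)" "last ts' = act_tape (ts ! (?\<kappa> - 1)) (acts ! (?\<kappa> - 1))"
      using lt k1 D(2) ts' by (auto simp: last_conv_nth)
  qed
  let ?f = "\<lambda>j. if 1 \<le> j \<and> j \<le> ?\<kappa> then acts ! (j - 1)
                        else if j = ?\<kappa> + 1 then (head (?S j), snd (acts ! (?\<kappa> - 1)))
                        else if j = ?\<kappa> + 2 then (head (?S j), Move_Right)
                        else (head (?S j), Move_Stay)"
  have "tm_delta (embed K M) q (map (\<lambda>j. head (?S j)) [0..<K]) = (q', map ?f [0..<K])"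
    using us d qs valid_heads(2)[OF v]
    by (auto simp: embed_def Let_def)
  then have st: "tm_step (embed K M) (q, tapes K ?S) = (q', tapes K (\<lambda>j. act_tape (?S j) (?f j)))"
    using q by (simp add: tm_step.simps map_head_tapes map2_tapes)
  have "act_tape (?S j) (?f j) = spread ?\<kappa> \<sigma> ts' (Suc n) j" for j
  proof -
    consider "1 \<le> j" "j \<le> ?\<kappa>" | "j = ?\<kappa> + 1" | "j = ?\<kappa> + 2" | "j = 0 \<or> j > ?\<kappa> + 2" by linarith
    then show ?thesis
    proof cases
      case 1
      then have "j - 1 < length ts" "j - 1 < length acts" using lt D(2) by auto
      then show ?thesis using 1 ts' by (simp add: spread_def)
    next
      case 2
      have "act_tape \<tau> (head \<tau>, mv) = (fst \<tau>, snd \<tau> + dir mv)" for \<tau> mv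
        by (cases \<tau>; cases mv) (auto simp: head_def)
      with 2 show ?thesis using la k1 by (simp add: spread_def snd_act_tape)
    next
      case 3
      have "act_tape \<tau> (head \<tau>, mv) = (fst \<tau>, snd \<tau> + dir mv)" for \<tau> mv
        by (cases \<tau>; cases mv) (auto simp: head_def)
      then show ?thesis using 3 by (simp add: spread_def ctr_def)
    next
      case 4
      then show ?thesis by (auto simp: spread_def act_stay)
    qed
  qed
  then show "tm_step (embed K M) (q, tapes K ?S) = (q', tapes K (spread ?\<kappa> \<sigma> ts' (Suc n)))"
    using st by simp
  have "\<bar>dir mv\<bar> \<le> 1" for mv by (cases mv) auto
  then show "\<bar>snd (last ts')\<bar> \<le> \<bar>snd (last ts)\<bar> + 1"
    using la abs_triangle_ineq[of "snd (ts ! (?\<kappa> - 1))" "dir (snd (acts ! (?\<kappa> - 1)))"]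
    by (simp add: snd_act_tape) (meson add_left_mono order_trans)
qed

lemma embed_run:
  assumes M: "turing_machine M" and K: "tm_tapes M + 3 \<le> K"
  shows "(tm_step M ^^ t) (q, ts) = (1, ts') \<Longrightarrow> valid_config M (q, ts) \<Longrightarrow> q \<noteq> 1 \<Longrightarrow>
     \<exists>t'\<le>t. (tm_step (embed K M) ^^ t') (q, tapes K (spread (tm_tapes M) \<sigma> ts n)) =
          (1, tapes K (spread (tm_tapes M) \<sigma> ts' (n + t'))) \<and> \<bar>snd (last ts')\<bar> \<le> \<bar>snd (last ts)\<bar> + int t'"
proof (induction t arbitrary: q ts n)
  case (Suc t)
  obtain q1 ts1 where s: "tm_step M (q, ts) = (q1, ts1)" by fastforce
  have r: "(tm_step M ^^ t) (q1, ts1) = (1, ts')" using Suc.prems(1) s by (simp add: funpow_swap1)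
  note st = embed_step[OF M K Suc.prems(2,3) s]
  show ?case
  proof (cases "q1 = 1")
    case True
    then have "ts' = ts1" using r by simp
    then show ?thesis using st(1)[of \<sigma> n] st(2) True by (intro exI[of _ 1]) auto
  next
    case False
    have "valid_config M (q1, ts1)" using valid_step[OF M Suc.prems(2)] s by simp
    from Suc.IH[OF r this False, of "Suc n"] obtain t' where t': "t' \<le> t"
      "(tm_step (embed K M) ^^ t') (q1, tapes K (spread (tm_tapes M) \<sigma> ts1 (Suc n))) =
          (1, tapes K (spread (tm_tapes M) \<sigma> ts' (Suc n + t')))"
      "\<bar>snd (last ts')\<bar> \<le> \<bar>snd (last ts1)\<bar> + int t'" by blast
    have "(tm_step (embed K M) ^^ Suc t') (q, tapes K (spread (tm_tapes M) \<sigma> ts n)) =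
          (1, tapes K (spread (tm_tapes M) \<sigma> ts' (n + Suc t')))"
      using st(1)[of \<sigma> n] t'(2) by (simp add: funpow_swap1)
    then show ?thesis using t' st(2) by (intro exI[of _ "Suc t'"]) auto
  qed
qed simp

lemma nth_init: "j < tm_tapes M \<Longrightarrow> snd (tm_init M w) ! j = (if j = 0 then (tape_of w, 0) else (tape_of [], 0))"
  by (cases j) (auto simp: tm_init_def)

lemma valid_init: assumes "turing_machine M" shows "valid_config M (tm_init M w)"
  using assms unfolding turing_machine_def valid_config_def tm_init_def
  by (auto simp: tape_of_def)

text \<open>Tape 0 holds the input, \<open>1, \<dots>, \<kappa>\<close> are the tapes of \<open>M\<close>. Tape \<open>\<kappa> + 1\<close> mirrors the head of the
  output tape of \<open>M\<close> next to a marked origin and tape \<open>\<kappa> + 2\<close> counts steps; together they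
  allow to rewind the output tape, whose head can be arbitrarily far on either side. Tape \<open>\<kappa> + 3\<close> stays blank.\<close>

lemma oracle_machine:
  assumes M: "turing_machine M" and F: "ps F" and D: "pf D"
  obtains M' c where "turing_machine M'"
    "\<And>x y t. tm_outputs M (F (x, []) (\<lambda>_. 0)) y t \<Longrightarrow>
       tm_outputs M' x [D (x, y) (\<lambda>_. 0) \<noteq> 0] (real ((length x + length y + 2) ^ c) + 10 * t)"
proof -
  define e0 :: env where "e0 = (\<lambda>_. 0)"
  obtain kF mF TF where F': "1 \<le> mF" "pbd TF" "\<And>k' m'. kF \<le> k' \<Longrightarrow> mF \<le> m' \<Longrightarrow> emits F k' m' TF"
    by (rule psE[OF F]) (rule that)
  obtain kD mD TD where D': "1 \<le> mD" "pbd TD" "\<And>k' m'. kD \<le> k' \<Longrightarrow> mD \<le> m' \<Longrightarrow> computes D k' m' TD"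
    by (rule pfE[OF D]) (rule that)
  define k where "k = max kF kD"
  define m where "m = max mF mD"
  define \<kappa> where "\<kappa> = tm_tapes M"
  define G where "G = tm_symbols M"
  define b where "b = \<kappa> + 4"
  define K where "K = b + m + 1"
  define z where "z = K - 1"
  have \<kappa>1: "1 \<le> \<kappa>" and G3: "3 \<le> G" using M unfolding turing_machine_def \<kappa>_def G_def by auto
  have m1: "1 \<le> m" using F'(1) by (simp add: m_def)
  \<comment> \<open>Every variable is read from counter \<open>\<kappa> + 1\<close>, which is zero
    whenever a program runs, in accordance with \<open>e0\<close>. The second string is the blank
    tape \<open>\<kappa> + 3\<close> for the query and the output tape \<open>\<kappa>\<close> of
    \<open>M\<close> for the final test.\<close>
  let ?loc = "\<lambda>_::nat. \<kappa> + 1"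
  have LF: "layout K G b m 0 (\<kappa> + 3) ?loc k" and LD: "layout K G b m 0 \<kappa> ?loc k"
    unfolding layout_def K_def b_def using G3 by auto
  obtain MF where MF: "fragment K G MF" "\<And>s e \<sigma> w. ready b m 0 (\<kappa> + 3) ?loc k s e \<sigma> \<Longrightarrow> \<sigma> 1 = wtape w \<Longrightarrow>
             run MF \<sigma> (TF s e) (\<sigma>(1 := wtape (w @ F s e)))"
  proof (rule emitsD[OF _ LF, of F TF 1])
    show "emits F k m TF" by (rule F'(3)) (auto simp: k_def m_def)
  qed (use \<kappa>1 in \<open>auto simp: b_def\<close>)
  have "computes D k m TD" by (rule D'(3)) (auto simp: k_def m_def)
  then obtain MD where MD: "fragment K G MD" "\<And>s e \<sigma>. ready b m 0 \<kappa> ?loc k s e \<sigma> \<Longrightarrow>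
             run MD \<sigma> (TD s e) (\<sigma>(b := ctr (D s e)))"
    using LD unfolding computes_def by blast
  define A0 where "A0 = actm K G (\<lambda>j s. if j = \<kappa> + 1 \<or> j = \<kappa> + 2 \<or> b \<le> j then (1, Move_Stay) else (s, Move_Stay))"
  define mv where "mv d J = mvm K G (\<lambda>j. if j \<in> J then d else Move_Stay)" for d J
  define W1 where "W1 = whilem (\<lambda>ss. ss ! 1 \<noteq> 0) (mv Move_Left {1})"
  define W2 where "W2 = whilem (\<lambda>ss. ss ! (\<kappa> + 1) \<noteq> 1) (mv Move_Right {\<kappa>, \<kappa> + 1})"
  \<comment> \<open>After \<open>t'\<close> steps the output head is at most \<open>t'\<close> cells
    away from the origin. Moving it left by \<open>t'\<close> brings it to the origin or left of it,
    and \<open>W2\<close> then walks right to the mark.\<close>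
  define R2 where "R2 = drain K G (\<kappa> + 2) (\<lambda>j. if j \<in> {\<kappa>, \<kappa> + 1} then Move_Left else Move_Stay)"
  \<comment> \<open>The answer tape \<open>z\<close> was initialised as a counter, and the content
    of a counter is \<open>tape_of [False]\<close>; only a positive answer has to be
    written.\<close>
  define Out where "Out = item (\<lambda>ss. ss ! b = 0) (actm K G (\<lambda>j s. if j = z then (2, Move_Stay) else (s, Move_Stay))) (mv Move_Stay {})"
  define E where "E = embed K M"
  define P where "P = seqm A0 (seqm MF (seqm (mv Move_Left {1}) (seqm W1 (seqm (mv Move_Right {1})
     (seqm E (seqm R2 (seqm W2 (seqm MD Out))))))))"
  have K3: "tm_tapes M + 3 \<le> K" unfolding K_def b_def \<kappa>_def by simp
  have fr: "fragment K G A0" "fragment K G (mv d J)" "fragment K G W1" "fragment K G W2" "fragment K G R2"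
    "fragment K G Out" "fragment K G E" for d J
  proof -
    show m: "fragment K G (mv d J)" for d J unfolding mv_def by (rule fragment_mvm)
    show "fragment K G A0" unfolding A0_def by (rule fragment_actm) (use G3 in auto)
    show "fragment K G W1" "fragment K G W2" unfolding W1_def W2_def by (rule fragment_whilem, rule m)+
    show "fragment K G R2" unfolding R2_def by (rule fragment_drain)
    show "fragment K G Out" unfolding Out_def by (intro fragment_item fragment_actm m) (use G3 in auto)
    show "fragment K G E" unfolding E_def G_def by (rule fragment_embed[OF M K3])
  qed
  have fP: "fragment K G P" unfolding P_def by (intro fragment_seqm fr MF MD)
  note tt' = fr[THEN fragment_tapes] MF(1)[THEN fragment_tapes] MD(1)[THEN fragment_tapes]
  have tt: "tm_tapes A0 = K" "tm_tapes (mv d J) = K" "tm_tapes W1 = K" "tm_tapes W2 = K" "tm_tapes R2 = K"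
    "tm_tapes Out = K" "tm_tapes E = K" "tm_tapes MF = K" "tm_tapes MD = K" "tm_tapes (seqm X Y) = tm_tapes X" for d J X Y
    using tt' by (auto simp: seqm_def)
  have KK: "1 < K" "\<kappa> < K" "\<kappa> + 1 < K" "\<kappa> + 2 < K" "b < K" "z < K" "b < z"
    using m1 unfolding K_def b_def z_def by auto
  have tP: "turing_machine P" by (rule turing_machine_fragment[OF fP _ G3]) (use KK in simp)
  let ?T = "\<lambda>s e. TF s e + TD s e + 4 * length (F s e) + 40"
  have "pbd (\<lambda>s e. TF (fst s, []) e)" "pbd (\<lambda>s e. length (F (fst s, []) e))"
  proof -
    have *: "pbd (\<lambda>s e. t (fst s, []) e)" if t: "pbd t" for t
    proof -
      obtain c k where c: "\<And>s e. t s e \<le> (sz k s e + 2) ^ c" using t unfolding pbd_def by auto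
      have "(sz k (fst s, []) e + 2) ^ c \<le> (sz k s e + 2) ^ c" for s e
        by (intro power_mono) (auto simp: sz_def)
      then show ?thesis unfolding pbd_def using c by (meson le_trans)
    qed
    show "pbd (\<lambda>s e. TF (fst s, []) e)" by (rule *[OF F'(2)])
    have "pbd (\<lambda>s e. length (F s e))" using F unfolding ps_def by blast
    from *[OF this] show "pbd (\<lambda>s e. length (F (fst s, []) e))" .
  qed
  then have "pbd (\<lambda>s e. TF (fst s, []) e + TD s e + 4 * length (F (fst s, []) e) + 40)"
    by (intro pbd_add pbd_mult pbd_const D')
  then obtain c kk where c: "\<And>s e. TF (fst s, []) e + TD s e + 4 * length (F (fst s, []) e) + 40 \<le> (sz kk s e + 2) ^ c"
    unfolding pbd_def by blast
  show thesis
  proof (rule that[OF tP])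
    fix x y and tr :: real
    assume out: "tm_outputs M (F (x, []) (\<lambda>_. 0)) y tr"
    define w where "w = F (x, []) e0"
    obtain t where o: "real t \<le> tr \<and> (case (tm_step M ^^ t) (tm_init M w) of (q, ts) \<Rightarrow> q = 1 \<and> fst (last ts) = tape_of y)"
      using out unfolding tm_outputs_def w_def e0_def by (rule exE)
    obtain q ts' where qt: "(tm_step M ^^ t) (tm_init M w) = (q, ts')" by (rule prod.exhaust)
    have t: "real t \<le> tr" "(tm_step M ^^ t) (tm_init M w) = (1, ts')" "fst (last ts') = tape_of y"
      using o by (simp_all add: qt)
    define \<sigma>i where "\<sigma>i j = (if j = 0 then (tape_of x, 0 :: int) else (tape_of [], 0))" for j :: nat
    define \<sigma>0 where "\<sigma>0 j = (if j = 0 then (tape_of x, 0) else if j \<le> \<kappa> \<or> j = \<kappa> + 3 then (tape_of [], 0) else ctr 0)" for j :: nat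
    have init: "tm_init P x = (0, tapes K \<sigma>i)"
    proof -
      have "tm_tapes P = K" using fP fragment_tapes by blast
      moreover have "(tape_of x, 0 :: int) # replicate (K - 1) (tape_of [], 0) = tapes K \<sigma>i"
        by (rule nth_equalityI) (use KK in \<open>auto simp: tapes_def \<sigma>i_def nth_Cons split: nat.splits\<close>)
      ultimately show ?thesis by (simp add: tm_init_def)
    qed
    have r0: "run A0 \<sigma>i 1 \<sigma>0"
      unfolding A0_def
      by (rule run_eq[OF run_actm])
        (auto simp: fun_eq_iff \<sigma>i_def \<sigma>0_def b_def ctr_def head_def tape_of_def)
    have "ready b m 0 (\<kappa> + 3) ?loc k (x, []) e0 \<sigma>0"
      unfolding ready_def \<sigma>0_def b_def e0_def by auto
    moreover have "\<sigma>0 1 = wtape []" using \<kappa>1 by (simp add: \<sigma>0_def wtape_def)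
    ultimately have r1: "run MF \<sigma>0 (TF (x, []) e0) (\<sigma>0(1 := wtape w))"
      using MF(2)[of "(x, [])" e0 \<sigma>0 "[]"] by (simp add: w_def)
    define S1 where "S1 i = \<sigma>0(1 := (tape_of w, int (length w) - 1 - int i))" for i
    have r2: "run (mv Move_Left {1}) (\<sigma>0(1 := wtape w)) 1 (S1 0)"
      unfolding mv_def by (rule run_eq[OF run_mvm]) (auto simp: shift_def fun_eq_iff wtape_def S1_def)
    have r3: "run W1 (S1 0) (length w * (1 + 1) + 1) (S1 (length w))"
      unfolding W1_def
    proof (rule run_whilem)
      have h: "head (S1 i 1) = (if i < length w then tape_of w (int (length w - 1 - i)) else 0)" if "i \<le> length w" for i
        using that by (auto simp: S1_def head_def tape_of_def nat_diff_distrib' of_nat_diff algebra_simps)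
      show "heads (tm_tapes (mv Move_Left {1})) (S1 i) ! 1 \<noteq> 0 \<and> run (mv Move_Left {1}) (S1 i) 1 (S1 (Suc i))"
        if "i < length w" for i
      proof
        show "heads (tm_tapes (mv Move_Left {1})) (S1 i) ! 1 \<noteq> 0"
          using that h[of i] tape_of_int[of w "length w - 1 - i"] KK by (simp add: tt)
        show "run (mv Move_Left {1}) (S1 i) 1 (S1 (Suc i))"
          unfolding mv_def by (rule run_eq[OF run_mvm]) (auto simp: shift_def fun_eq_iff S1_def)
      qed
      show "\<not> heads (tm_tapes (mv Move_Left {1})) (S1 (length w)) ! 1 \<noteq> 0"
        using h[of "length w"] KK by (simp add: tt)
    qed
    define \<sigma>2 where "\<sigma>2 = \<sigma>0(1 := (tape_of w, 0))"
    have r4: "run (mv Move_Right {1}) (S1 (length w)) 1 \<sigma>2"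
      unfolding mv_def by (rule run_eq[OF run_mvm]) (auto simp: shift_def fun_eq_iff S1_def \<sigma>2_def)
    let ?ts0 = "snd (tm_init M w)"
    have ls: "last ?ts0 = ?ts0 ! (\<kappa> - 1)" "snd (last ?ts0) = 0"
    proof -
      have "length ?ts0 = \<kappa>" using \<kappa>1 by (simp add: tm_init_def \<kappa>_def)
      then show l: "last ?ts0 = ?ts0 ! (\<kappa> - 1)" using \<kappa>1 by (subst last_conv_nth) auto
      show "snd (last ?ts0) = 0" unfolding l using \<kappa>1 by (subst nth_init) (auto simp: \<kappa>_def)
    qed
    have "spread \<kappa> \<sigma>2 ?ts0 0 j = \<sigma>2 j" for j
      using nth_init[of "j - 1" M w] \<kappa>1 ls
      by (auto simp: spread_def \<sigma>2_def \<sigma>0_def \<kappa>_def ctr_def)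
    then have sp: "tapes K (spread \<kappa> \<sigma>2 ?ts0 0) = tapes K \<sigma>2" by (simp add: tapes_def)
    have "(tm_step M ^^ t) (0, ?ts0) = (1, ts')" "valid_config M (0, ?ts0)"
      using t(2) valid_init[OF M, of w] by (simp_all add: tm_init_def)
    from embed_run[OF M K3 this, of \<sigma>2 0] obtain t' where t': "t' \<le> t"
      "(tm_step E ^^ t') (0, tapes K \<sigma>2) = (1, tapes K (spread \<kappa> \<sigma>2 ts' t'))"
      "\<bar>snd (last ts')\<bar> \<le> int t'"
      using sp ls by (auto simp: E_def \<kappa>_def)
    define h where "h = snd (last ts')"
    have r5: "run E \<sigma>2 t (spread \<kappa> \<sigma>2 ts' t')"
      by (rule run_mono[OF _ t'(1)]) (use t'(2) in \<open>simp add: run_def tt\<close>)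
    define S2 where "S2 i = (\<lambda>j. if 1 \<le> j \<and> j < \<kappa> then ts' ! (j - 1) else if j = \<kappa> then (tape_of y, h - int t' + int i)
       else if j = \<kappa> + 1 then (fst (ctr 0), h - int t' + int i) else \<sigma>2 j)" for i
    have lt: "ts' ! (\<kappa> - 1) = (tape_of y, h)"
    proof -
      have "valid_config M ((tm_step M ^^ n) (tm_init M w))" for n
        by (induction n) (use valid_init[OF M] valid_step[OF M, of "fst c" "snd c" for c] in simp_all)
      from this[of t] have "length ts' = \<kappa>" using t(2) by (simp add: valid_config_def \<kappa>_def)
      then have "last ts' = ts' ! (\<kappa> - 1)" using \<kappa>1 by (subst last_conv_nth) auto
      then show ?thesis using t(3) by (metis h_def prod.collapse)
    qed
    have r6: "run R2 (spread \<kappa> \<sigma>2 ts' t') (2 * t' + 1) (S2 0)"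
      unfolding R2_def
      by (rule run_eq[OF run_drain[where n = t']])
        (use KK \<kappa>1 lt in \<open>auto simp: shift_def fun_eq_iff spread_def S2_def h_def[symmetric] ctr_def \<sigma>2_def \<sigma>0_def\<close>)
    define N where "N = nat (int t' - h)"
    have N: "int N = int t' - h" "N \<le> 2 * t'" using t'(3) unfolding N_def h_def by auto
    have r7: "run W2 (S2 0) (N * (1 + 1) + 1) (S2 N)"
      unfolding W2_def
    proof (rule run_whilem)
      have hh: "head (S2 i (\<kappa> + 1)) = (if i = N then 1 else 0)" for i
        using N by (auto simp: S2_def head_def ctr_def)
      show "heads (tm_tapes (mv Move_Right {\<kappa>, \<kappa> + 1})) (S2 i) ! (\<kappa> + 1) \<noteq> 1 \<and>
          run (mv Move_Right {\<kappa>, \<kappa> + 1}) (S2 i) 1 (S2 (Suc i))" if "i < N" for i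
      proof
        show "heads (tm_tapes (mv Move_Right {\<kappa>, \<kappa> + 1})) (S2 i) ! (\<kappa> + 1) \<noteq> 1"
          unfolding tt nth_heads[OF KK(3)] hh using that by simp
        show "run (mv Move_Right {\<kappa>, \<kappa> + 1}) (S2 i) 1 (S2 (Suc i))"
          unfolding mv_def by (rule run_eq[OF run_mvm]) (auto simp: shift_def fun_eq_iff S2_def)
      qed
      show "\<not> heads (tm_tapes (mv Move_Right {\<kappa>, \<kappa> + 1})) (S2 N) ! (\<kappa> + 1) \<noteq> 1"
        unfolding tt nth_heads[OF KK(3)] hh by simp
    qed
    have "ready b m 0 \<kappa> ?loc k (x, y) e0 (S2 N)"
      using N \<kappa>1 unfolding ready_def S2_def b_def e0_def \<sigma>2_def \<sigma>0_def by (auto simp: ctr_def)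
    from MD(2)[OF this] have r8: "run MD (S2 N) (TD (x, y) e0) ((S2 N)(b := ctr (D (x, y) e0)))" .
    let ?d = "D (x, y) e0 \<noteq> 0"
    define \<sigma>f where "\<sigma>f = (S2 N)(b := ctr (D (x, y) e0), z := (tape_of [?d], 0))"
    have zz: "S2 N z = (tape_of [False], 0)"
      using KK(7) unfolding S2_def b_def \<sigma>2_def \<sigma>0_def by (auto simp: ctr_def tape_of_def fun_eq_iff)
    have r9: "run Out ((S2 N)(b := ctr (D (x, y) e0))) (1 + 1) \<sigma>f"
      unfolding Out_def
    proof (rule run_itemI)
      let ?A = "actm K G (\<lambda>j s. if j = z then (2, Move_Stay) else (s, Move_Stay))"
      have tA: "tm_tapes ?A = K" by (simp add: actm_def)
      show "tm_tapes ?A = tm_tapes (mv Move_Stay {})" using tA tt(2) by simp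
      { assume "heads (tm_tapes ?A) ((S2 N)(b := ctr (D (x, y) e0))) ! b = 0"
        then have "?d" using KK(5) by (simp add: tA split: if_splits)
        moreover have "(tape_of [False])(0 := 2) = tape_of [True]" by (auto simp: tape_of_def fun_eq_iff)
        ultimately show "run ?A ((S2 N)(b := ctr (D (x, y) e0))) 1 \<sigma>f"
          by (intro run_eq[OF run_actm]) (use zz KK(7) in \<open>auto simp: fun_eq_iff \<sigma>f_def act_stay\<close>) }
      { assume "\<not> heads (tm_tapes ?A) ((S2 N)(b := ctr (D (x, y) e0))) ! b = 0"
        then have "\<not> ?d" using KK(5) by (simp add: tA split: if_splits)
        then show "run (mv Move_Stay {}) ((S2 N)(b := ctr (D (x, y) e0))) 1 \<sigma>f"
          unfolding mv_def by (intro run_eq[OF run_mvm]) (use zz KK(7) in \<open>auto simp: fun_eq_iff \<sigma>f_def shift_def\<close>) }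
    qed
    have "run P \<sigma>i ((length x + length y + 2) ^ c + 10 * t) \<sigma>f"
      unfolding P_def
    proof (rule run_eq[OF run_seqm[OF _ r0 run_seqm[OF _ r1 run_seqm[OF _ r2 run_seqm[OF _ r3 run_seqm[OF _ r4
          run_seqm[OF _ r5 run_seqm[OF _ r6 run_seqm[OF _ r7 run_seqm[OF _ r8 r9]]]]]]]]]])
      have "sz kk (x, y) e0 = length x + length y" by (simp add: sz_def e0_def)
      then have "TF (x, []) e0 + TD (x, y) e0 + 4 * length w + 40 \<le> (length x + length y + 2) ^ c"
        using c[of "(x, y)" e0] by (simp add: w_def)
      then show "1 + (TF (x, []) e0 + (1 + (length w * (1 + 1) + 1 + (1 + (t + (2 * t' + 1 + (N * (1 + 1) + 1 + (TD (x, y) e0 +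
         (1 + 1) + 1) + 1) + 1) + 1) + 1) + 1) + 1) + 1) + 1 \<le> (length x + length y + 2) ^ c + 10 * t"
        using N(2) t'(1) unfolding one_add_one by linarith
    qed (simp_all add: tt)
    then have "(tm_step P ^^ ((length x + length y + 2) ^ c + 10 * t)) (tm_init P x) = (1, tapes K \<sigma>f)"
      using fragment_tapes[OF fP] init by (simp add: run_def)
    moreover have "fst (last (tapes K \<sigma>f)) = tape_of [?d]"
      using KK by (simp add: tapes_def last_map z_def \<sigma>f_def)
    ultimately show "tm_outputs P x [D (x, y) (\<lambda>_. 0) \<noteq> 0] (real ((length x + length y + 2) ^ c) + 10 * tr)"
      unfolding tm_outputs_def e0_def[symmetric]
      using t(1) by (intro exI[of _ "(length x + length y + 2) ^ c + 10 * t"]) (auto simp del: of_nat_power)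
  qed
qed

section \<open>Digits\<close>

definition dig :: "nat \<Rightarrow> nat \<Rightarrow> nat \<Rightarrow> nat" where "dig b n i = n div b ^ i mod b"

lemma divmod_bij:
  fixes A B :: nat
  assumes "0 < A"
  shows "bij_betw (\<lambda>n. (n mod A, n div A)) {n. n < A * B \<and> R (n mod A) (n div A)} {(m, d). m < A \<and> d < B \<and> R m d}"
proof (rule bij_betwI[where g = "\<lambda>(m, d). m + A * d"])
  show "(\<lambda>(m, d). m + A * d) \<in> {(m, d). m < A \<and> d < B \<and> R m d} \<rightarrow> {n. n < A * B \<and> R (n mod A) (n div A)}"
  proof (rule Pi_I)
    fix x assume "x \<in> {(m, d). m < A \<and> d < B \<and> R m d}"
    then obtain m d where x: "x = (m, d)" "m < A" "d < B" "R m d" by blast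
    then have "m + A * d < A * Suc d" by simp
    also have "\<dots> \<le> A * B" using x(3) by (intro mult_le_mono2) simp
    finally show "(case x of (m, d) \<Rightarrow> m + A * d) \<in> {n. n < A * B \<and> R (n mod A) (n div A)}"
      using x by simp
  qed
qed (use assms in \<open>auto simp: less_mult_imp_div_less mult.commute\<close>)

lemma card_divmod:
  fixes A B :: nat
  assumes "0 < A"
  shows "card {n. n < A * B \<and> R (n mod A) (n div A)} = (\<Sum>m<A. card {d. d < B \<and> R m d})"
    and "card {n. n < A * B \<and> R (n mod A) (n div A)} = (\<Sum>d<B. card {m. m < A \<and> R m d})"
proof -
  have c: "card {n. n < A * B \<and> R (n mod A) (n div A)} = card {(m, d). m < A \<and> d < B \<and> R m d}"
    by (rule bij_betw_same_card[OF divmod_bij[OF assms]])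
  have "{(m, d). m < A \<and> d < B \<and> R m d} = (SIGMA m:{..<A}. {d. d < B \<and> R m d})" by auto
  then show "card {n. n < A * B \<and> R (n mod A) (n div A)} = (\<Sum>m<A. card {d. d < B \<and> R m d})"
    using c by (simp only:) (rule card_SigmaI; simp)
  have "card {(m, d). m < A \<and> d < B \<and> R m d} = card {(d, m). m < A \<and> d < B \<and> R m d}"
    by (rule bij_betw_same_card[of prod.swap]) (auto simp: bij_betw_def inj_on_def image_iff)
  moreover have "{(d, m). m < A \<and> d < B \<and> R m d} = (SIGMA d:{..<B}. {m. m < A \<and> R m d})" by auto
  ultimately show "card {n. n < A * B \<and> R (n mod A) (n div A)} = (\<Sum>d<B. card {m. m < A \<and> R m d})"
    using c by (simp only:) (rule card_SigmaI; simp)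
qed

lemma dig_mod: assumes "i < k" shows "dig b (n mod b ^ k) i = dig b n i"
proof (cases "b = 0")
  case False
  have k: "b ^ k = b ^ i * b ^ (k - i)" using assms by (simp flip: power_add)
  have "n mod b ^ k div b ^ i = n div b ^ i mod b ^ (k - i)"
    unfolding k mod_mult2_eq using False by simp
  moreover have "b dvd b ^ (k - i)" using assms by (simp add: dvd_power)
  ultimately show ?thesis by (simp add: dig_def mod_mod_cancel)
qed (use assms in \<open>cases k; simp add: dig_def\<close>)

lemma dig_top: "n < b ^ Suc k \<Longrightarrow> dig b n k = n div b ^ k"
  by (simp add: dig_def less_mult_imp_div_less)

lemma dig_less: "0 < b \<Longrightarrow> dig b n i < b"
  by (simp add: dig_def)

text \<open>Digits are independent coordinates. This counts tuples of hash functions and, with all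
  factors equal to 1, gives the existence statement \<open>dig_ex\<close>.\<close>

lemma card_digits:
  assumes "0 < b"
  shows "card {n. n < b ^ k \<and> (\<forall>i<k. P i (dig b n i))} = (\<Prod>i<k. card {d. d < b \<and> P i d})"
proof (induction k)
  case 0
  have "{n::nat. n = 0} = {0}" by auto
  then show ?case by simp
next
  case (Suc k)
  let ?Q = "\<lambda>m. \<forall>i<k. P i (dig b m i)"
  have *: "{n. n < b ^ Suc k \<and> (\<forall>i<Suc k. P i (dig b n i))} = {n. n < b ^ k * b \<and> ?Q (n mod b ^ k) \<and> P k (n div b ^ k)}"
    using dig_top[of _ b k] by (auto simp: dig_mod less_Suc_eq mult.commute)
  have "card {n. n < b ^ Suc k \<and> (\<forall>i<Suc k. P i (dig b n i))} = (\<Sum>m<b ^ k. card {d. d < b \<and> ?Q m \<and> P k d})"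
    unfolding * using card_divmod(1)[of "b ^ k" b "\<lambda>m d. ?Q m \<and> P k d"] assms by simp
  also have "\<dots> = (\<Sum>m<b ^ k. of_bool (?Q m) * card {d. d < b \<and> P k d})"
  proof (rule sum.cong[OF refl])
    fix m show "card {d. d < b \<and> ?Q m \<and> P k d} = of_bool (?Q m) * card {d. d < b \<and> P k d}"
      by (cases "?Q m") simp_all
  qed
  also have "\<dots> = (\<Sum>m<b ^ k. of_bool (?Q m)) * card {d. d < b \<and> P k d}"
    by (rule sum_distrib_right[symmetric])
  also have "(\<Sum>m<b ^ k. of_bool (?Q m)) = card {n. n < b ^ k \<and> ?Q n}"
    by (subst sum_of_bool_eq) (simp_all add: Int_def)
  finally show ?case using Suc by simp
qed

lemma dig_ex: assumes "\<And>i. i < k \<Longrightarrow> f i < b" "0 < b" shows "\<exists>n<b ^ k. \<forall>i<k. dig b n i = f i"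
proof -
  have "card {n. n < b ^ k \<and> (\<forall>i<k. dig b n i = f i)} = (\<Prod>i<k. card {d. d < b \<and> d = f i})"
    by (rule card_digits[OF assms(2)])
  also have "\<dots> = (\<Prod>i<k. 1)"
  proof (rule prod.cong)
    fix i assume "i \<in> {..<k}"
    then have "{d. d < b \<and> d = f i} = {f i}" using assms(1) by auto
    then show "card {d. d < b \<and> d = f i} = 1" by simp
  qed simp
  finally have "{n. n < b ^ k \<and> (\<forall>i<k. dig b n i = f i)} \<noteq> {}" by force
  then show ?thesis by blast
qed

lemma dig_unique:
  assumes "n < b ^ k" "n' < b ^ k" "\<And>i. i < k \<Longrightarrow> dig b n i = dig b n' i" shows "n = n'"
  using assms
proof (induction k arbitrary: n n')
  case (Suc k)
  have b: "0 < b" using Suc.prems(1) by (cases b) auto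
  have "n mod b ^ k = n' mod b ^ k"
    by (rule Suc.IH) (use b Suc.prems(3) in \<open>auto simp: dig_mod\<close>)
  moreover have "n div b ^ k = n' div b ^ k"
    using Suc.prems(3)[of k] Suc.prems(1,2) by (simp add: dig_top)
  ultimately show ?case by (metis div_mult_mod_eq)
qed simp

section \<open>Codes\<close>

text \<open>Matrices and vectors are functions on numbers with their sizes kept apart, so that
  entries are given by index arithmetic that the programs above can evaluate.\<close>

definition ap :: "nat \<Rightarrow> (nat \<Rightarrow> nat \<Rightarrow> 'a::field) \<Rightarrow> (nat \<Rightarrow> 'a) \<Rightarrow> nat \<Rightarrow> 'a" where
  "ap m A z i = (\<Sum>j<m. A i j * z j)"

definition wt :: "nat \<Rightarrow> (nat \<Rightarrow> 'a::zero) \<Rightarrow> nat" where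
  "wt n f = card {i. i < n \<and> f i \<noteq> 0}"

definition nz :: "nat \<Rightarrow> (nat \<Rightarrow> 'a::zero) \<Rightarrow> bool" where "nz m z \<longleftrightarrow> (\<exists>j<m. z j \<noteq> 0)"

definition felt :: "nat \<Rightarrow> 'a::finite" where "felt = from_nat_into UNIV"

lemma felt_bij: "bij_betw (felt :: nat \<Rightarrow> 'a::finite) {..<CARD('a)} UNIV"
  unfolding felt_def by (rule bij_betw_from_nat_into_finite) simp

lemma card_felt: "card {d. d < CARD('a) \<and> felt d \<in> (X :: 'a::finite set)} = card X"
proof -
  have "X \<subseteq> felt ` {d. d < CARD('a) \<and> felt d \<in> X}"
  proof
    fix x assume x: "x \<in> X"
    have "x \<in> felt ` {..<CARD('a)}" using felt_bij[where 'a = 'a] unfolding bij_betw_def by simp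
    then show "x \<in> felt ` {d. d < CARD('a) \<and> felt d \<in> X}" using x by auto
  qed
  then have "felt ` {d. d < CARD('a) \<and> felt d \<in> X} = X" by auto
  moreover have "inj_on (felt :: nat \<Rightarrow> 'a) {d. d < CARD('a) \<and> felt d \<in> X}"
    using felt_bij[where 'a = 'a] unfolding bij_betw_def by (elim conjE inj_on_subset) auto
  ultimately show ?thesis using card_image by fastforce
qed

text \<open>Induction on the number of coefficients: a nonzero last entry lets the last digit be
  solved for uniquely, a zero one leaves it free. Hence a nonzero word of the Hadamard code has
  relative weight exactly \<open>1 - 1 / q\<close>.\<close>

lemma card_linear_form:
  fixes v :: "nat \<Rightarrow> 'a::{finite,field}"
  assumes "nz k v"
  shows "card {c. c < CARD('a) ^ k \<and> (\<Sum>i<k. felt (dig CARD('a) c i) * v i) = a} * CARD('a) = CARD('a) ^ k"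
  using assms
proof (induction k arbitrary: a)
  case (Suc k)
  define q where "q = CARD('a)"
  have q0: "0 < q" by (simp add: q_def)
  let ?S = "\<lambda>c. \<Sum>i<k. felt (dig q c i) * v i"
  have S: "(\<Sum>i<Suc k. felt (dig q c i) * v i) = ?S (c mod q ^ k) + felt (c div q ^ k) * v k" if "c < q ^ k * q" for c
    using that by (simp add: dig_mod dig_top mult.commute)
  have "{c. c < q ^ Suc k \<and> (\<Sum>i<Suc k. felt (dig q c i) * v i) = a} =
      {c. c < q ^ k * q \<and> ?S (c mod q ^ k) + felt (c div q ^ k) * v k = a}"
    using S by (auto simp: mult.commute[of q])
  then have c: "card {c. c < q ^ Suc k \<and> (\<Sum>i<Suc k. felt (dig q c i) * v i) = a} =
      (\<Sum>m<q ^ k. card {d. d < q \<and> ?S m + felt d * v k = a})"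
     "card {c. c < q ^ Suc k \<and> (\<Sum>i<Suc k. felt (dig q c i) * v i) = a} =
      (\<Sum>d<q. card {m. m < q ^ k \<and> ?S m + felt d * v k = a})"
    using card_divmod[of "q ^ k" q "\<lambda>m d. ?S m + felt d * v k = a"] q0 by auto
  show ?case
  proof (cases "v k = 0")
    case False
    have "card {d. d < q \<and> ?S m + felt d * v k = a} = 1" for m
    proof -
      have "{d. d < q \<and> ?S m + felt d * v k = a} = {d. d < q \<and> felt d \<in> {(a - ?S m) / v k}}"
        using False by (auto simp: field_simps)
      then show ?thesis using card_felt[of "{(a - ?S m) / v k}"] by (simp add: q_def)
    qed
    then have "card {c. c < q ^ Suc k \<and> (\<Sum>i<Suc k. felt (dig q c i) * v i) = a} = q ^ k" using c(1) by simp
    then show ?thesis unfolding q_def[symmetric] by (simp only: power_Suc mult.commute)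
  next
    case True
    then have "nz k v" using Suc.prems by (auto simp: nz_def less_Suc_eq)
    from Suc.IH[OF this, of a] c(2) show ?thesis
      unfolding q_def[symmetric] using True by (simp add: mult.commute mult.left_commute)
  qed
qed (simp add: nz_def)

subsection \<open>Isolation by hashing\<close>

text \<open>\<open>h\<close> encodes slope and offset of an affine map modulo \<open>N\<close>. As
  \<open>N\<close> will be a power of two and not a prime, pairwise independence is available only
  up to a constant factor, which is enough.\<close>

definition hash :: "nat \<Rightarrow> nat \<Rightarrow> nat \<Rightarrow> nat" where
  "hash N h i = (h div N * i + h mod N) mod N"

lemma card_shift:
  assumes "0 < N" shows "card {b. b < N \<and> P ((c + b) mod N)} = card {v. v < (N::nat) \<and> P v}"
proof -
  let ?f = "\<lambda>b. (c + b) mod N"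
  have inj: "inj_on ?f {..<N}"
  proof (rule inj_onI)
    have *: "x = y" if "x \<le> y" "y < N" "?f x = ?f y" for x y
    proof -
      have "N dvd (c + y) - (c + x)" using that by (subst mod_eq_dvd_iff_nat[symmetric]) auto
      then have "N dvd y - x" by simp
      then show ?thesis using that by (metis diff_is_0_eq le_antisym less_imp_diff_less nat_dvd_not_less not_gr_zero)
    qed
    fix x y assume "x \<in> {..<N}" "y \<in> {..<N}" "?f x = ?f y"
    then show "x = y" using *[of x y] *[of y x] by (cases "x \<le> y") auto
  qed
  have "?f ` {..<N} \<subseteq> {..<N}" using assms by auto
  then have im: "?f ` {..<N} = {..<N}" using inj by (simp add: endo_inj_surj)
  have "{v. v < N \<and> P v} = ?f ` {b. b < N \<and> P (?f b)}"
  proof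
    show "{v. v < N \<and> P v} \<subseteq> ?f ` {b. b < N \<and> P (?f b)}"
    proof
      fix v assume v: "v \<in> {v. v < N \<and> P v}"
      then have "v \<in> ?f ` {..<N}" using im by simp
      then show "v \<in> ?f ` {b. b < N \<and> P (?f b)}" using v by auto
    qed
    show "?f ` {b. b < N \<and> P (?f b)} \<subseteq> {v. v < N \<and> P v}" using assms by auto
  qed
  moreover have "inj_on ?f {b. b < N \<and> P (?f b)}" by (rule inj_on_subset[OF inj]) auto
  ultimately show ?thesis by (simp add: card_image)
qed

lemma card_hash_less:
  assumes "0 < N" "W \<le> N"
  shows "card {h. h < N * N \<and> hash N h i < W} = N * W"
proof -
  have "{v. v < N \<and> v < W} = {..<W}" using assms(2) by auto
  then have "card {b. b < N \<and> (a * i + b) mod N < W} = W" for a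
    using card_shift[OF assms(1), of "\<lambda>v. v < W" "a * i"] by simp
  then show ?thesis
    using card_divmod(2)[OF assms(1), of N "\<lambda>b a. (a * i + b) mod N < W"] by (simp add: hash_def)
qed

lemma card_progression:
  assumes "0 < \<delta>" shows "card {a::nat. lo \<le> v + a * \<delta> \<and> v + a * \<delta> < lo + W} \<le> W div \<delta> + 1"
    and "finite {a::nat. lo \<le> v + a * \<delta> \<and> v + a * \<delta> < lo + W}"
proof -
  let ?A = "{a::nat. lo \<le> v + a * \<delta> \<and> v + a * \<delta> < lo + W}"
  have "\<exists>a0. ?A \<subseteq> {a0..a0 + W div \<delta>}"
  proof (cases "?A = {}")
    case False
    define a0 where "a0 = (LEAST a. a \<in> ?A)"
    obtain a1 where "a1 \<in> ?A" using False by blast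
    then have a0: "a0 \<in> ?A" unfolding a0_def by (rule LeastI)
    have "a0 \<le> a \<and> a \<le> a0 + W div \<delta>" if "a \<in> ?A" for a
    proof
      show le: "a0 \<le> a" unfolding a0_def using that by (rule Least_le)
      have "a * \<delta> < a0 * \<delta> + W" using a0 that by simp
      then have "(a - a0) * \<delta> \<le> W" by (simp add: diff_mult_distrib)
      then have "a - a0 \<le> W div \<delta>" using assms by (simp add: less_eq_div_iff_mult_less_eq)
      then show "a \<le> a0 + W div \<delta>" by simp
    qed
    then have "?A \<subseteq> {a0..a0 + W div \<delta>}" by (intro subsetI) (simp only: atLeastAtMost_iff)
    then show ?thesis by blast
  qed auto
  then obtain a0 where "?A \<subseteq> {a0..a0 + W div \<delta>}" by blast
  from card_mono[OF _ this] finite_subset[OF this]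
  show "card ?A \<le> W div \<delta> + 1" "finite ?A" by auto
qed

text \<open>The values \<open>v + a * \<delta>\<close> fall into at most \<open>\<delta> + 1\<close>
  periods of length \<open>N\<close>, and each period meets the window in at most
  \<open>W div \<delta> + 1\<close> of them. The product is at most \<open>4 * W\<close> because
  \<open>\<delta> \<le> W\<close>.\<close>

lemma card_hash_pair_aux:
  assumes "0 < \<delta>" "\<delta> \<le> W" "W \<le> N" "v < W"
  shows "card {a. a < N \<and> (v + a * \<delta>) mod N < W} \<le> 4 * W"
proof -
  let ?C = "\<lambda>c. {a. c * N \<le> v + a * \<delta> \<and> v + a * \<delta> < c * N + W}"
  have "{a. a < N \<and> (v + a * \<delta>) mod N < W} \<subseteq> (\<Union>c\<le>\<delta>. ?C c)"
  proof
    fix a assume "a \<in> {a. a < N \<and> (v + a * \<delta>) mod N < W}"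
    then have a: "a < N" "(v + a * \<delta>) mod N < W" by auto
    let ?c = "(v + a * \<delta>) div N"
    have "v + a * \<delta> < N + N * \<delta>" using a(1) assms by (intro add_less_le_mono) auto
    then have "?c < Suc \<delta>" by (intro less_mult_imp_div_less) (simp add: mult.commute)
    moreover have "?c * N + (v + a * \<delta>) mod N = v + a * \<delta>" by simp
    then have "v + a * \<delta> < ?c * N + W" "?c * N \<le> v + a * \<delta>" using a(2) by linarith+
    then have "a \<in> ?C ?c" by simp
    ultimately show "a \<in> (\<Union>c\<le>\<delta>. ?C c)" by (intro UN_I[of ?c]) auto
  qed
  then have "card {a. a < N \<and> (v + a * \<delta>) mod N < W} \<le> card (\<Union>c\<le>\<delta>. ?C c)"
    by (intro card_mono) (auto intro: card_progression(2)[OF assms(1)])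
  also have "\<dots> \<le> (\<Sum>c\<le>\<delta>. card (?C c))" by (rule card_UN_le) simp
  also have "\<dots> \<le> (\<Sum>c\<le>\<delta>. W div \<delta> + 1)" by (intro sum_mono card_progression(1)[OF assms(1)])
  also have "\<dots> = (\<delta> + 1) * (W div \<delta> + 1)" by simp
  also have "\<dots> = \<delta> * (W div \<delta>) + W div \<delta> + \<delta> + 1" by (simp add: algebra_simps)
  also have "\<dots> \<le> W + W + W + W"
    using assms by (intro add_mono) (auto simp: Suc_le_eq)
  finally show ?thesis by simp
qed

text \<open>For a fixed slope \<open>a\<close> the residue \<open>v\<close> of
  \<open>a * i + b\<close> runs through all values as \<open>b\<close> does, and the residue at
  \<open>j\<close> is that of \<open>v + a * (j - i)\<close>. Exchanging the sums over
  \<open>a\<close> and \<open>v\<close> leaves the count of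
  \<open>card_hash_pair_aux\<close>.\<close>

lemma card_hash_pair:
  assumes "i \<noteq> j" "i < m" "j < m" "m \<le> W" "W \<le> N"
  shows "card {h. h < N * N \<and> hash N h i < W \<and> hash N h j < W} \<le> 4 * W * W"
  using assms
proof (induction i j rule: linorder_wlog)
  case (le i j)
  have N: "0 < N" using le by auto
  let ?\<delta> = "j - i"
  have d: "0 < ?\<delta>" "?\<delta> \<le> W" using le by auto
  let ?f = "\<lambda>a b. (a * i + b) mod N"
  have j: "(a * j + b) mod N = (?f a b + a * ?\<delta>) mod N" for a b
  proof -
    have "j = i + ?\<delta>" using le by simp
    then have "a * j + b = (a * i + b) + a * ?\<delta>" by (metis add.assoc add.commute distrib_left)
    then have "a * j + b = (a * i + b) + a * ?\<delta>" by (simp add: ac_simps)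
    then show ?thesis by (simp only: mod_add_left_eq)
  qed
  have "card {h. h < N * N \<and> hash N h i < W \<and> hash N h j < W} =
     (\<Sum>a<N. card {b. b < N \<and> ?f a b < W \<and> (?f a b + a * ?\<delta>) mod N < W})"
    using card_divmod(2)[OF N, of N "\<lambda>b a. ?f a b < W \<and> (a * j + b) mod N < W"] unfolding j by (simp add: hash_def j)
  also have "\<dots> = (\<Sum>a<N. card {v. v < W \<and> (v + a * ?\<delta>) mod N < W})"
  proof (rule sum.cong)
    fix a
    have "{v. v < N \<and> v < W \<and> (v + a * ?\<delta>) mod N < W} = {v. v < W \<and> (v + a * ?\<delta>) mod N < W}" using le by auto
    then show "card {b. b < N \<and> ?f a b < W \<and> (?f a b + a * ?\<delta>) mod N < W} = card {v. v < W \<and> (v + a * ?\<delta>) mod N < W}"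
      using card_shift[OF N, of "\<lambda>v. v < W \<and> (v + a * ?\<delta>) mod N < W" "a * i"] by simp
  qed simp
  also have "\<dots> = (\<Sum>v<W. card {a. a < N \<and> (v + a * ?\<delta>) mod N < W})"
  proof -
    have W: "0 < W" using le by auto
    show ?thesis
      using card_divmod[OF W, of N "\<lambda>v a. (v + a * ?\<delta>) mod N < W"] by simp
  qed
  also have "\<dots> \<le> (\<Sum>v<W. 4 * W)" by (intro sum_mono card_hash_pair_aux) (use d le in auto)
  finally show ?case by (simp add: mult.commute)
next
  case (sym i j)
  then show ?case by (simp add: conj_commute conj_left_commute)
qed

definition block :: "nat \<Rightarrow> nat \<Rightarrow> nat \<Rightarrow> nat \<Rightarrow> 'a::field" where
  "block N h l i = of_bool (hash N h i < N div 2 ^ l)"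

text \<open>If the support of \<open>z\<close> has about \<open>2 ^ l / 8\<close> elements, then a constant fraction of the hash
  functions puts exactly one of them below \<open>N / 2 ^ l\<close>.\<close>

lemma block_isolates:
  fixes z :: "nat \<Rightarrow> 'a::field"
  assumes z: "nz m z" and m: "m \<le> 2 ^ L" and N: "N = 2 ^ (2 * L + 3)"
  shows "32 * card {h. h < N * N \<and> (\<exists>l<L + 4. ap m (block N h) z l \<noteq> 0)} \<ge> N * N"
proof -
  define U where "U = {i. i < m \<and> z i \<noteq> 0}"
  define s where "s = card U"
  have finU: "finite U" by (simp add: U_def)
  have s1: "1 \<le> s" using z finU unfolding s_def nz_def U_def by (auto simp: Suc_le_eq card_gt_0_iff)
  have "s \<le> m" unfolding s_def U_def using card_mono[of "{..<m}" U] by (auto simp: U_def)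
  then have sL: "s \<le> 2 ^ L" using m by simp
  define e where "e = (LEAST e. s \<le> 2 ^ e)"
  have e1: "s \<le> 2 ^ e" unfolding e_def by (rule LeastI[of _ L]) (rule sL)
  have e2: "e \<le> L" unfolding e_def by (rule Least_le) (rule sL)
  have e3: "2 ^ e < 2 * s"
  proof (cases e)
    case (Suc e')
    then have "\<not> s \<le> 2 ^ e'" using not_less_Least[of e' "\<lambda>e. s \<le> 2 ^ e"] unfolding e_def by simp
    then show ?thesis using Suc by simp
  qed (use s1 in simp)
  \<comment> \<open>Now \<open>2 ^ l\<close> lies between \<open>8 * s\<close> and
    \<open>16 * s\<close>. A support element falls below \<open>W\<close> with probability above
    \<open>1 / (16 * s)\<close>, and given this some other one does so with probability at most
    \<open>1 / 2\<close>. Summing the \<open>s\<close> disjoint events yields the constant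
    \<open>1 / 32\<close>.\<close>
  define l where "l = e + 3"
  define W where "W = N div 2 ^ l"
  have Np: "N = W * 2 ^ l" and W2: "W = 2 ^ (2 * L - e)"
  proof -
    have "(2::nat) ^ (2 * L + 3) = 2 ^ (2 * L - e) * 2 ^ l" using e2 by (simp add: l_def flip: power_add)
    then show "W = 2 ^ (2 * L - e)" unfolding W_def N by simp
    then show "N = W * 2 ^ l" using \<open>2 ^ (2 * L + 3) = 2 ^ (2 * L - e) * 2 ^ l\<close> N by simp
  qed
  have WN: "W \<le> N" "0 < W" "0 < N" unfolding Np W2 by auto
  have mW: "m \<le> W"
  proof -
    have "(2::nat) ^ L \<le> 2 ^ (2 * L - e)" using e2 by (intro power_increasing) auto
    from le_trans[OF m this] show ?thesis by (simp only: W2)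
  qed
  define A where "A i = {h. h < N * N \<and> hash N h i < W}" for i
  define B where "B i = A i - (\<Union>j\<in>U - {i}. A j)" for i
  have finA: "finite (A i)" for i unfolding A_def by simp
  \<comment> \<open>Union bound: of the \<open>N * W\<close> functions that put \<open>i\<close>
    below \<open>W\<close>, at most \<open>4 * W * W\<close> put a given other support element there
    as well.\<close>
  have cB: "real (card (B i)) \<ge> real N * W - (real s - 1) * (4 * W * W)" if "i \<in> U" for i
  proof -
    have "card (A i \<inter> (\<Union>j\<in>U - {i}. A j)) \<le> (\<Sum>j\<in>U - {i}. card (A i \<inter> A j))"
      unfolding Int_UN_distrib by (rule card_UN_le) (rule finite_Diff[OF finU])
    also have "\<dots> \<le> (\<Sum>j\<in>U - {i}. 4 * W * W)"
    proof (rule sum_mono)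
      fix j assume "j \<in> U - {i}"
      moreover have "A i \<inter> A j = {h. h < N * N \<and> hash N h i < W \<and> hash N h j < W}" by (auto simp: A_def)
      ultimately show "card (A i \<inter> A j) \<le> 4 * W * W"
        using card_hash_pair[of i j m W N] that mW WN by (auto simp: U_def)
    qed
    also have "\<dots> = (s - 1) * (4 * W * W)" using that finU by (simp add: s_def)
    finally have 1: "card (A i \<inter> (\<Union>j\<in>U - {i}. A j)) \<le> (s - 1) * (4 * W * W)" .
    have "card (A i) = N * W" unfolding A_def by (rule card_hash_less) (use WN in auto)
    moreover have "card (B i) = card (A i) - card (A i \<inter> (\<Union>j\<in>U - {i}. A j))"
      unfolding B_def using finA by (simp add: card_Diff_subset_Int)
    ultimately have "N * W \<le> card (B i) + (s - 1) * (4 * W * W)" using 1 by linarith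
    then have "real (N * W) \<le> real (card (B i)) + real ((s - 1) * (4 * W * W))" 
      by (simp only: of_nat_add[symmetric] of_nat_le_iff)
    then show ?thesis using s1 by (simp add: of_nat_diff)
  qed
  have disj: "B i \<inter> B j = {}" if "i \<in> U" "j \<in> U" "i \<noteq> j" for i j
    using that unfolding B_def by auto
  have sub: "(\<Union>i\<in>U. B i) \<subseteq> {h. h < N * N \<and> (\<exists>l<L + 4. ap m (block N h) z l \<noteq> 0)}"
  proof
    fix h assume "h \<in> (\<Union>i\<in>U. B i)"
    then obtain i where i: "i \<in> U" "h \<in> A i" "\<And>j. j \<in> U \<Longrightarrow> j \<noteq> i \<Longrightarrow> h \<notin> A j" unfolding B_def by blast
    have hN: "h < N * N" using i(2) by (simp add: A_def)
    have "ap m (block N h) z l = (\<Sum>j<m. if j = i then z i else 0)"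
      unfolding ap_def
    proof (rule sum.cong)
      fix j assume "j \<in> {..<m}"
      then show "block N h l j * z j = (if j = i then z i else 0)"
        using i hN by (cases "j \<in> U") (auto simp: block_def A_def U_def W_def)
    qed simp
    also have "\<dots> = z i" using i(1) by (simp add: U_def)
    finally have "ap m (block N h) z l \<noteq> 0" using i(1) by (simp add: U_def)
    moreover have "l < L + 4" using e2 by (simp add: l_def)
    ultimately show "h \<in> {h. h < N * N \<and> (\<exists>l<L + 4. ap m (block N h) z l \<noteq> 0)}" using hN by blast
  qed
  have "real N * N \<le> 32 * (\<Sum>i\<in>U. real (card (B i)))"
  proof -
    let ?w = "real W" let ?p = "2 ^ l :: real"
    have p: "?p = 8 * 2 ^ e" by (simp add: l_def power_add)
    have ss: "real s \<le> 2 ^ e" "2 ^ e < 2 * real s"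
      using of_nat_mono[OF e1, where 'a = real] of_nat_less_iff[where 'a = real, THEN iffD2, OF e3] by simp_all
    have "real N * N = ?w * ?w * (?p * ?p)" unfolding Np by simp
    also have "\<dots> \<le> ?w * ?w * (32 * (real s * (?p - 4 * real s)))"
    proof (rule mult_left_mono)
      have "?p * ?p \<le> 16 * real s * ?p" using ss(2) p by (intro mult_right_mono) auto
      moreover have "real s * (?p - 4 * real s) \<ge> real s * (?p / 2)" using ss(1) p by (intro mult_left_mono) auto
      moreover have "32 * (real s * (?p / 2)) = 16 * real s * ?p" by simp
      ultimately show "?p * ?p \<le> 32 * (real s * (?p - 4 * real s))" by linarith
    qed simp
    also have "\<dots> \<le> ?w * ?w * (32 * (real s * (?p - 4 * real s))) + 128 * real s * (?w * ?w)" by simp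
    also have "\<dots> = 32 * (real s * (real N * W - (real s - 1) * (4 * W * W)))"
    proof -
      have key: "w * w * (32 * (x * (p - 4 * x))) + 128 * x * (w * w) = 32 * (x * (w * p * w - (x - 1) * (4 * w * w)))"
        for w x p :: real by (simp add: algebra_simps)
      have "real N = ?w * ?p" unfolding Np by simp
      then show ?thesis by (simp only: of_nat_mult of_nat_numeral key)
    qed
    also have "\<dots> = 32 * (\<Sum>i\<in>U. real N * W - (real s - 1) * (4 * W * W))" by (simp add: s_def)
    also have "\<dots> \<le> 32 * (\<Sum>i\<in>U. real (card (B i)))" using cB by (intro mult_left_mono sum_mono) auto
    finally show ?thesis .
  qed
  then have "N * N \<le> 32 * (\<Sum>i\<in>U. card (B i))"
  proof -
    assume "real N * N \<le> 32 * (\<Sum>i\<in>U. real (card (B i)))"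
    then have "real (N * N) \<le> real (32 * (\<Sum>i\<in>U. card (B i)))" by simp
    then show ?thesis by (simp only: of_nat_le_iff)
  qed
  also have "(\<Sum>i\<in>U. card (B i)) = card (\<Union>i\<in>U. B i)"
    by (rule card_UN_disjoint[symmetric]) (use finU disj finA in \<open>auto simp: B_def\<close>)
  also have "\<dots> \<le> card {h. h < N * N \<and> (\<exists>l<L + 4. ap m (block N h) z l \<noteq> 0)}"
    by (rule card_mono[OF _ sub]) simp
  finally show ?thesis by simp
qed

subsection \<open>A code with nearly constant weight\<close>

lemma wt_sum: "wt n f = (\<Sum>i<n. of_bool (f i \<noteq> 0))"
  unfolding wt_def by (simp add: sum_of_bool_eq Int_def)

text \<open>The lower digits of a row number are the coefficients of a Hadamard code for the symbols of \<open>t\<close> block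
  codes, the upper digits are their hash functions.\<close>

definition gen :: "nat \<Rightarrow> nat \<Rightarrow> nat \<Rightarrow> nat \<Rightarrow> nat \<Rightarrow> 'a::{finite,field}" where
  "gen N l t \<rho> i = (\<Sum>j<t * l. felt (dig CARD('a) (\<rho> mod CARD('a) ^ (t * l)) j) *
      block N (dig (N * N) (\<rho> div CARD('a) ^ (t * l)) (j div l)) (j mod l) i)"

lemma ap_gen:
  fixes z :: "nat \<Rightarrow> 'a::{finite,field}"
  shows "ap m (gen N l t) z \<rho> = (\<Sum>j<t * l. felt (dig CARD('a) (\<rho> mod CARD('a) ^ (t * l)) j) *
      ap m (block N (dig (N * N) (\<rho> div CARD('a) ^ (t * l)) (j div l))) z (j mod l))"
  unfolding ap_def gen_def sum_distrib_right sum_distrib_left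
  by (subst sum.swap) (simp add: mult.assoc)

text \<open>Fix the tuple of hash functions. If it gives \<open>z\<close> some nonzero block symbol,
  then \<open>card_linear_form\<close> shows that exactly the fraction \<open>1 - 1 / q\<close> of
  the coefficient vectors yields a nonzero entry; otherwise none does. The weight is thus
  proportional to \<open>NZ\<close>.\<close>

lemma wt_gen:
  fixes z :: "nat \<Rightarrow> 'a::{finite,field}" and l t m N :: nat
  defines "q \<equiv> CARD('a)"
  defines "NZ \<equiv> card {h. h < (N * N) ^ t \<and> (\<exists>\<tau><t. \<exists>j<l. ap m (block N (dig (N * N) h \<tau>)) z j \<noteq> 0)}"
  assumes l: "0 < l"
  shows "q * wt (q ^ (t * l) * (N * N) ^ t) (ap m (gen N l t) z) = NZ * (q ^ (t * l) * (q - 1))"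
proof -
  define v where "v h j = ap m (block N (dig (N * N) h (j div l))) z (j mod l)" for h j
  let ?A = "q ^ (t * l)" let ?B = "(N * N) ^ t"
  let ?F = "\<lambda>c h. \<Sum>j<t * l. felt (dig q c j) * v h j"
  have q1: "1 \<le> q" unfolding q_def by (simp add: Suc_le_eq)
  have A0: "0 < ?A" using q1 by simp
  have nzv: "nz (t * l) (v h) \<longleftrightarrow> (\<exists>\<tau><t. \<exists>j<l. ap m (block N (dig (N * N) h \<tau>)) z j \<noteq> 0)" for h
  proof
    assume "nz (t * l) (v h)"
    then obtain j where j: "j < t * l" "v h j \<noteq> 0" unfolding nz_def by blast
    then have "j div l < t" "j mod l < l" using l by (auto simp: less_mult_imp_div_less)
    then show "\<exists>\<tau><t. \<exists>j<l. ap m (block N (dig (N * N) h \<tau>)) z j \<noteq> 0" using j(2) unfolding v_def by blast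
  next
    assume "\<exists>\<tau><t. \<exists>j<l. ap m (block N (dig (N * N) h \<tau>)) z j \<noteq> 0"
    then obtain \<tau> j where *: "\<tau> < t" "j < l" "ap m (block N (dig (N * N) h \<tau>)) z j \<noteq> 0" by blast
    have "\<tau> * l + j < Suc \<tau> * l" using *(2) by simp
    also have "\<dots> \<le> t * l" using *(1) by (intro mult_le_mono1) simp
    finally have "\<tau> * l + j < t * l" .
    moreover have "v h (\<tau> * l + j) \<noteq> 0" using * unfolding v_def by simp
    ultimately show "nz (t * l) (v h)" unfolding nz_def by blast
  qed
  have "wt (?A * ?B) (ap m (gen N l t) z) = card {\<rho>. \<rho> < ?A * ?B \<and> ?F (\<rho> mod ?A) (\<rho> div ?A) \<noteq> 0}"
    unfolding wt_def ap_gen q_def v_def by simp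
  also have "\<dots> = (\<Sum>h<?B. card {c. c < ?A \<and> ?F c h \<noteq> 0})"
    using card_divmod(2)[OF A0, of ?B "\<lambda>c h. ?F c h \<noteq> 0"] .
  finally have "q * wt (?A * ?B) (ap m (gen N l t) z) = (\<Sum>h<?B. q * card {c. c < ?A \<and> ?F c h \<noteq> 0})"
    by (simp add: sum_distrib_left)
  also have "\<dots> = (\<Sum>h<?B. of_bool (nz (t * l) (v h)) * (?A * (q - 1)))"
  proof (rule sum.cong)
    fix h
    show "q * card {c. c < ?A \<and> ?F c h \<noteq> 0} = of_bool (nz (t * l) (v h)) * (?A * (q - 1))"
    proof (cases "nz (t * l) (v h)")
      case True
      have z: "card {c. c < ?A \<and> ?F c h = 0} * q = ?A"
        using card_linear_form[OF True, of 0] unfolding q_def .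
      have "{..<?A} = {c. c < ?A \<and> ?F c h \<noteq> 0} \<union> {c. c < ?A \<and> ?F c h = 0}" by auto
      then have "card {..<?A} = card ({c. c < ?A \<and> ?F c h \<noteq> 0} \<union> {c. c < ?A \<and> ?F c h = 0})" by simp
      also have "\<dots> = card {c. c < ?A \<and> ?F c h \<noteq> 0} + card {c. c < ?A \<and> ?F c h = 0}"
        by (rule card_Un_disjoint) auto
      finally have "?A = card {c. c < ?A \<and> ?F c h \<noteq> 0} + card {c. c < ?A \<and> ?F c h = 0}" by simp
      then have "q * ?A = q * (card {c. c < ?A \<and> ?F c h \<noteq> 0} + card {c. c < ?A \<and> ?F c h = 0})" by simp
      also have "\<dots> = q * card {c. c < ?A \<and> ?F c h \<noteq> 0} + ?A"
        using z by (simp only: distrib_left mult.commute[of _ q])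
      finally have "q * card {c. c < ?A \<and> ?F c h \<noteq> 0} = ?A * q - ?A * 1" by (simp only: mult.commute[of _ q])
      then show ?thesis using True by (simp only: diff_mult_distrib2 of_bool_eq mult_1)
    next
      case False
      then have "?F c h = 0" for c unfolding nz_def by (intro sum.neutral) auto
      then show ?thesis using False by simp
    qed
  qed simp
  also have "\<dots> = NZ * (?A * (q - 1))"
    unfolding NZ_def by (simp add: sum_distrib_right[symmetric] sum_of_bool_eq Int_def nzv)
  finally show ?thesis .
qed

text \<open>The upper bound is that \<open>NZ\<close> cannot exceed the number of tuples. For the
  lower bound the digits of a tuple are independent and each misses \<open>z\<close> for at most
  \<open>31 / 32\<close> of its values, so all of them miss for at most \<open>(31 / 32) ^ t\<close>
  of the tuples.\<close>

lemma wt_gen_bounds: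
  fixes z :: "nat \<Rightarrow> 'a::{finite,field}" and t L m N :: nat
  assumes z: "nz m z" and m: "m \<le> 2 ^ L" and N: "N = 2 ^ (2 * L + 3)"
  defines "q \<equiv> CARD('a)"
  defines "S \<equiv> q ^ (t * (L + 4)) * (N * N) ^ t"
  shows "q * wt S (ap m (gen N (L + 4) t) z) \<le> S * (q - 1)"
    and "(1 - (31 / 32) ^ t) * (real S * real (q - 1)) \<le> real q * real (wt S (ap m (gen N (L + 4) t) z))"
proof -
  let ?l = "L + 4" let ?H = "N * N" let ?A = "q ^ (t * ?l)"
  let ?P = "\<lambda>d. \<forall>j<?l. ap m (block N d) z j = 0"
  define NZ where "NZ = card {h. h < ?H ^ t \<and> (\<exists>\<tau><t. \<exists>j<?l. ap m (block N (dig ?H h \<tau>)) z j \<noteq> 0)}"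
  have eq: "q * wt S (ap m (gen N ?l t) z) = NZ * (?A * (q - 1))"
    unfolding q_def S_def NZ_def using wt_gen[where l = "L + 4" and t = t and N = N and m = m and z = z] by simp
  have N0: "0 < ?H" using N by simp
  have "NZ \<le> card {..<?H ^ t}" unfolding NZ_def by (rule card_mono) auto
  then have "NZ * (?A * (q - 1)) \<le> ?H ^ t * (?A * (q - 1))" by (intro mult_le_mono1) simp
  then show "q * wt S (ap m (gen N ?l t) z) \<le> S * (q - 1)"
  proof -
    assume "NZ * (?A * (q - 1)) \<le> ?H ^ t * (?A * (q - 1))"
    moreover have "S * (q - 1) = ?H ^ t * (?A * (q - 1))" unfolding S_def by (simp only: mult_ac)
    ultimately show ?thesis by (simp only: eq)
  qed
  define Z where "Z = card {d. d < ?H \<and> ?P d}"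
  have "card {h. h < ?H ^ t \<and> (\<forall>\<tau><t. ?P (dig ?H h \<tau>))} = Z ^ t"
    using card_digits[OF N0, of t "\<lambda>_. ?P"] by (simp add: Z_def)
  moreover have "card {..<?H ^ t} = NZ + card {h. h < ?H ^ t \<and> (\<forall>\<tau><t. ?P (dig ?H h \<tau>))}"
  proof -
    have *: "{..<?H ^ t} = {h. h < ?H ^ t \<and> (\<exists>\<tau><t. \<exists>j<?l. ap m (block N (dig ?H h \<tau>)) z j \<noteq> 0)} \<union>
       {h. h < ?H ^ t \<and> (\<forall>\<tau><t. ?P (dig ?H h \<tau>))}" by blast
    show "card {..<?H ^ t} = NZ + card {h. h < ?H ^ t \<and> (\<forall>\<tau><t. ?P (dig ?H h \<tau>))}"
      unfolding NZ_def * by (rule card_Un_disjoint) auto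
  qed
  ultimately have NZ: "?H ^ t = NZ + Z ^ t" by simp
  have "32 * Z \<le> 31 * ?H"
  proof -
    have "card {..<?H} = card ({h. h < ?H \<and> (\<exists>j<?l. ap m (block N h) z j \<noteq> 0)} \<union> {d. d < ?H \<and> ?P d})"
      by (rule arg_cong[where f = card]) auto
    also have "\<dots> = card {h. h < ?H \<and> (\<exists>j<?l. ap m (block N h) z j \<noteq> 0)} + Z"
      unfolding Z_def by (rule card_Un_disjoint) auto
    finally show ?thesis using block_isolates[OF z m N] by simp
  qed
  then have "real Z \<le> 31 / 32 * real ?H" by linarith
  then have "real Z ^ t \<le> (31 / 32 * real ?H) ^ t" by (intro power_mono) auto
  then have zt: "real Z ^ t \<le> (31 / 32) ^ t * real ?H ^ t" by (simp only: power_mult_distrib)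
  have "real ?H ^ t = real NZ + real Z ^ t" using arg_cong[OF NZ, of real] by (simp only: of_nat_add of_nat_power)
  then have "(1 - (31 / 32) ^ t) * real ?H ^ t \<le> real NZ" using zt by (simp add: left_diff_distrib)
  then have "(1 - (31 / 32) ^ t) * real ?H ^ t * (real ?A * real (q - 1)) \<le> real NZ * (real ?A * real (q - 1))"
    by (rule mult_right_mono) simp
  moreover have "real q * real (wt S (ap m (gen N ?l t) z)) = real NZ * (real ?A * real (q - 1))"
    using arg_cong[OF eq, of real] by (simp only: of_nat_mult)
  moreover have "real S = real ?A * real ?H ^ t" unfolding S_def by (simp only: of_nat_mult of_nat_power)
  ultimately show "(1 - (31 / 32) ^ t) * (real S * real (q - 1)) \<le> real q * real (wt S (ap m (gen N ?l t) z))"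
    by (simp add: mult_ac)
qed

section \<open>Tensor products\<close>

definition tens :: "nat \<Rightarrow> nat \<Rightarrow> (nat \<Rightarrow> nat \<Rightarrow> 'a::field) \<Rightarrow> (nat \<Rightarrow> nat \<Rightarrow> 'a) \<Rightarrow> nat \<Rightarrow> nat \<Rightarrow> 'a" where
  "tens n d A B \<rho> \<gamma> = A (\<rho> div n) (\<gamma> div d) * B (\<rho> mod n) (\<gamma> mod d)"

lemma sum_divmod:
  fixes f :: "nat \<Rightarrow> nat \<Rightarrow> 'a::comm_monoid_add"
  assumes "0 < d" shows "(\<Sum>\<gamma><c * d. f (\<gamma> div d) (\<gamma> mod d)) = (\<Sum>a<c. \<Sum>b<d. f a b)"
proof -
  have "bij_betw (\<lambda>n. (n mod d, n div d)) {..<c * d} ({..<d} \<times> {..<c})"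
  proof -
    have "{..<c * d} = {n. n < d * c \<and> True}" "{..<d} \<times> {..<c} = {(m, e). m < d \<and> e < c \<and> True}"
      by (auto simp: mult.commute)
    then show ?thesis using divmod_bij[OF assms, of c "\<lambda>_ _. True"] by (simp only:)
  qed
  then have "(\<Sum>\<gamma><c * d. f (\<gamma> div d) (\<gamma> mod d)) = (\<Sum>(b, a)\<in>{..<d} \<times> {..<c}. f a b)"
    using sum.reindex_bij_betw[of "\<lambda>n. (n mod d, n div d)" "{..<c * d}" "{..<d} \<times> {..<c}" "\<lambda>(b, a). f a b"] by simp
  also have "\<dots> = (\<Sum>b<d. \<Sum>a<c. f a b)" by (simp add: sum.cartesian_product)
  also have "\<dots> = (\<Sum>a<c. \<Sum>b<d. f a b)" by (rule sum.swap)
  finally show ?thesis .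
qed

text \<open>With \<open>Z\<close> read as a \<open>d1\<close> by \<open>d2\<close> matrix, the
  tensor product acts as \<open>Z\<close> to \<open>A Z B\<^sup>T\<close>: first \<open>A\<close> on
  every column, then \<open>B\<close> on every row.\<close>

lemma ap_tens:
  assumes "0 < d2"
  shows "ap (d1 * d2) (tens n2 d2 A B) Z \<rho> =
     ap d2 B (\<lambda>b. ap d1 A (\<lambda>a. Z (a * d2 + b)) (\<rho> div n2)) (\<rho> mod n2)"
proof -
  have "ap (d1 * d2) (tens n2 d2 A B) Z \<rho> =
     (\<Sum>\<gamma><d1 * d2. A (\<rho> div n2) (\<gamma> div d2) * B (\<rho> mod n2) (\<gamma> mod d2) * Z ((\<gamma> div d2) * d2 + \<gamma> mod d2))"
    unfolding ap_def tens_def by simp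
  also have "\<dots> = (\<Sum>a<d1. \<Sum>b<d2. A (\<rho> div n2) a * B (\<rho> mod n2) b * Z (a * d2 + b))"
    using sum_divmod[OF assms, of "\<lambda>a b. A (\<rho> div n2) a * B (\<rho> mod n2) b * Z (a * d2 + b)"] .
  also have "\<dots> = (\<Sum>b<d2. \<Sum>a<d1. A (\<rho> div n2) a * B (\<rho> mod n2) b * Z (a * d2 + b))" by (rule sum.swap)
  also have "\<dots> = ap d2 B (\<lambda>b. ap d1 A (\<lambda>a. Z (a * d2 + b)) (\<rho> div n2)) (\<rho> mod n2)"
    unfolding ap_def by (simp add: sum_distrib_left mult_ac)
  finally show ?thesis .
qed

lemma wt_tens:
  assumes "0 < d2" "0 < n2"
  shows "wt (n1 * n2) (ap (d1 * d2) (tens n2 d2 A B) Z) =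
     (\<Sum>i<n1. wt n2 (ap d2 B (\<lambda>b. ap d1 A (\<lambda>a. Z (a * d2 + b)) i)))"
  unfolding wt_sum ap_tens[OF assms(1)]
  by (rule sum_divmod[OF assms(2), of "\<lambda>i j. of_bool (ap d2 B (\<lambda>b. ap d1 A (\<lambda>a. Z (a * d2 + b)) i) j \<noteq> 0)"])

text \<open>After \<open>A\<close> has acted on the columns, every nonzero row is a nonzero message
  for \<open>B\<close>.\<close>

lemma wt_tens_rows:
  assumes "0 < d2" "0 < n2" and B: "\<And>z. nz d2 z \<Longrightarrow> c \<le> real (wt n2 (ap d2 B z))"
  shows "real (card {i. i < n1 \<and> nz d2 (\<lambda>b. ap d1 A (\<lambda>a. Z (a * d2 + b)) i)}) * c \<le>
     real (wt (n1 * n2) (ap (d1 * d2) (tens n2 d2 A B) Z))"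
proof -
  let ?R = "\<lambda>i b. ap d1 A (\<lambda>a. Z (a * d2 + b)) i"
  have "real (card {i. i < n1 \<and> nz d2 (?R i)}) * c = (\<Sum>i<n1. of_bool (nz d2 (?R i)) * c)"
    by (simp add: sum_distrib_right[symmetric] sum_of_bool_eq Int_def)
  also have "\<dots> \<le> (\<Sum>i<n1. real (wt n2 (ap d2 B (?R i))))"
  proof (rule sum_mono)
    fix i show "of_bool (nz d2 (?R i)) * c \<le> real (wt n2 (ap d2 B (?R i)))"
      using B[of "?R i"] by (cases "nz d2 (?R i)") auto
  qed
  finally show ?thesis by (simp add: wt_tens[OF assms(1,2)])
qed

lemma nz_column:
  assumes "nz (d1 * d2) Z" obtains b where "b < d2" "nz d1 (\<lambda>a. Z (a * d2 + b))"
proof -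
  obtain \<gamma> where g: "\<gamma> < d1 * d2" "Z \<gamma> \<noteq> 0" using assms unfolding nz_def by blast
  then have "0 < d2" by (cases d2) auto
  then have "\<gamma> mod d2 < d2" "\<gamma> div d2 < d1" using g(1) by (auto simp: less_mult_imp_div_less)
  moreover have "Z (\<gamma> div d2 * d2 + \<gamma> mod d2) \<noteq> 0" using g(2) by simp
  ultimately show thesis using that[of "\<gamma> mod d2"] unfolding nz_def by blast
qed

text \<open>The classical product bound: \<open>A\<close> spreads a nonzero column of
  \<open>Z\<close> over at least \<open>c\<close> rows, and \<open>B\<close> gives weight at least
  \<open>c'\<close> to each of them.\<close>

lemma wt_tens_lower:
  assumes d: "0 < n2" and A: "\<And>z. nz d1 z \<Longrightarrow> c \<le> real (wt n1 (ap d1 A z))"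
    and B: "\<And>z. nz d2 z \<Longrightarrow> c' \<le> real (wt n2 (ap d2 B z))" and c': "0 \<le> c'" and Z: "nz (d1 * d2) Z"
  shows "c * c' \<le> real (wt (n1 * n2) (ap (d1 * d2) (tens n2 d2 A B) Z))"
proof -
  obtain b where b: "b < d2" "nz d1 (\<lambda>a. Z (a * d2 + b))" by (rule nz_column[OF Z])
  have d2: "0 < d2" using b(1) by simp
  have "c \<le> real (wt n1 (ap d1 A (\<lambda>a. Z (a * d2 + b))))" by (rule A[OF b(2)])
  also have "\<dots> \<le> real (card {i. i < n1 \<and> nz d2 (\<lambda>b. ap d1 A (\<lambda>a. Z (a * d2 + b)) i)})"
    unfolding wt_def using b(1) by (intro of_nat_mono card_mono) (auto simp: nz_def)
  finally show ?thesis
    using wt_tens_rows[OF d2 d B, of n1 d1 A Z] c' by (meson mult_right_mono order_trans)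
qed

lemma wt_tens_pure:
  assumes "0 < d2" "0 < n2"
  shows "wt (n1 * n2) (ap (d1 * d2) (tens n2 d2 A B) (\<lambda>\<gamma>. u (\<gamma> div d2) * v (\<gamma> mod d2))) =
    wt n1 (ap d1 A u) * wt n2 (ap d2 B v)"
proof -
  have "wt n2 (ap d2 B (\<lambda>b. ap d1 A (\<lambda>a. u ((a * d2 + b) div d2) * v ((a * d2 + b) mod d2)) i)) =
      of_bool (ap d1 A u i \<noteq> 0) * wt n2 (ap d2 B v)" for i
  proof -
    have "ap d2 B (\<lambda>b. ap d1 A (\<lambda>a. u ((a * d2 + b) div d2) * v ((a * d2 + b) mod d2)) i) j = ap d1 A u i * ap d2 B v j" for j
    proof -
      have "ap d2 B (\<lambda>b. ap d1 A (\<lambda>a. u ((a * d2 + b) div d2) * v ((a * d2 + b) mod d2)) i) j =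
         (\<Sum>b<d2. B j b * (\<Sum>a<d1. A i a * (u a * v b)))"
        unfolding ap_def by (intro sum.cong) auto
      then show ?thesis unfolding ap_def by (simp add: sum_distrib_left sum_distrib_right mult_ac)
    qed
    then show ?thesis unfolding wt_def by simp
  qed
  then show ?thesis
    unfolding wt_tens[OF assms] by (simp add: wt_sum[of n1] sum_distrib_right)
qed

lemma nz_pure: assumes "nz d1 u" "nz d2 v" shows "nz (d1 * d2) (\<lambda>\<gamma>. u (\<gamma> div d2) * v (\<gamma> mod d2) :: 'a::field)"
proof -
  obtain a b where "a < d1" "u a \<noteq> 0" "b < d2" "v b \<noteq> 0" using assms unfolding nz_def by blast
  moreover have "a * d2 + b < d1 * d2"
  proof -
    have "a * d2 + b < Suc a * d2" using \<open>b < d2\<close> by simp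
    also have "\<dots> \<le> d1 * d2" using \<open>a < d1\<close> by (intro mult_le_mono1) simp
    finally show ?thesis .
  qed
  ultimately show ?thesis unfolding nz_def by (intro exI[of _ "a * d2 + b"]) simp
qed

text \<open>Each coordinate on which \<open>x\<close> and \<open>y\<close> do not both vanish is nonzero on exactly \<open>q\<close> of the
  \<open>q + 1\<close> points of the projective line spanned by \<open>x\<close> and \<open>y\<close>.\<close>

lemma rank_two_support:
  fixes G :: "nat \<Rightarrow> nat \<Rightarrow> 'a::{finite,field}"
  assumes D: "\<And>z. nz m z \<Longrightarrow> D \<le> real (wt S (ap m G z))"
    and x: "nz m x" and xy: "\<And>\<beta>. nz m (\<lambda>i. y i + \<beta> * x i)"
  shows "(real CARD('a) + 1) * D \<le> real CARD('a) * real (card {i. i < S \<and> (ap m G x i \<noteq> 0 \<or> ap m G y i \<noteq> 0)})"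
proof -
  let ?q = "CARD('a)"
  let ?s = "ap m G x" let ?u = "ap m G y"
  have lin: "ap m G (\<lambda>i. y i + \<beta> * x i) i = ?u i + \<beta> * ?s i" for \<beta> i
    unfolding ap_def by (simp add: algebra_simps sum.distrib sum_distrib_left)
  have pt: "of_bool (?s i \<noteq> 0) + (\<Sum>\<beta>\<in>UNIV. of_bool (?u i + \<beta> * ?s i \<noteq> 0)) = (?q * of_bool (?s i \<noteq> 0 \<or> ?u i \<noteq> 0) :: nat)" for i
  proof (cases "?s i = 0")
    case False
    have "{\<beta>. ?u i + \<beta> * ?s i \<noteq> 0} = UNIV - {- ?u i / ?s i}"
    proof -
      have "?u i + \<beta> * ?s i = 0 \<longleftrightarrow> \<beta> = - ?u i / ?s i" for \<beta>
        using False by (simp add: field_simps eq_neg_iff_add_eq_0 add.commute)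
      then show ?thesis by auto
    qed
    then have "card {\<beta>. ?u i + \<beta> * ?s i \<noteq> 0} = ?q - 1" by (simp add: card_Diff_singleton)
    moreover have "(\<Sum>\<beta>\<in>UNIV. of_bool (?u i + \<beta> * ?s i \<noteq> 0)) = card {\<beta>. ?u i + \<beta> * ?s i \<noteq> 0}"
      by (simp add: sum_of_bool_eq)
    moreover have "0 < ?q" by simp
    ultimately show ?thesis using False by simp
  qed simp
  have "(real ?q + 1) * D = D + (\<Sum>\<beta>\<in>(UNIV :: 'a set). D)" by (simp add: algebra_simps)
  also have "\<dots> \<le> real (wt S ?s) + (\<Sum>\<beta>\<in>UNIV. real (wt S (ap m G (\<lambda>i. y i + \<beta> * x i))))"
    by (intro add_mono sum_mono D x xy)
  also have "\<dots> = real (wt S ?s + (\<Sum>\<beta>\<in>UNIV. wt S (ap m G (\<lambda>i. y i + \<beta> * x i))))" by simp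
  finally have 1: "(real ?q + 1) * D \<le> real (wt S ?s + (\<Sum>\<beta>\<in>UNIV. wt S (ap m G (\<lambda>i. y i + \<beta> * x i))))" .
  have "wt S ?s + (\<Sum>\<beta>\<in>UNIV. wt S (ap m G (\<lambda>i. y i + \<beta> * x i))) =
      (\<Sum>i<S. of_bool (?s i \<noteq> 0) + (\<Sum>\<beta>\<in>UNIV. of_bool (?u i + \<beta> * ?s i \<noteq> 0)))"
    unfolding wt_sum lin sum.distrib by (subst (2) sum.swap) simp
  also have "\<dots> = ?q * card {i. i < S \<and> (?s i \<noteq> 0 \<or> ?u i \<noteq> 0)}"
    unfolding pt by (simp add: sum_distrib_left[symmetric] sum_of_bool_eq Int_def)
  finally show ?thesis using 1 by simp
qed

text \<open>Compare every column with the pivot column \<open>b\<close>. Either all are multiples of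
  it, or one is not, and then the two are independent in the form that
  \<open>rank_two_support\<close> requires.\<close>

lemma rank_one_or_pair:
  fixes X :: "nat \<Rightarrow> nat \<Rightarrow> 'a::field"
  assumes "b < d2" "nz d1 (\<lambda>a. X a b)"
  shows "(\<exists>v. \<forall>a<d1. \<forall>b'<d2. X a b' = X a b * v b') \<or>
    (\<exists>b'<d2. \<forall>\<beta>. nz d1 (\<lambda>a. X a b' + \<beta> * X a b))"
proof (rule disjCI)
  assume "\<not> (\<exists>b'<d2. \<forall>\<beta>. nz d1 (\<lambda>a. X a b' + \<beta> * X a b))"
  then have "\<forall>b'. \<exists>\<beta>. b' < d2 \<longrightarrow> (\<forall>a<d1. X a b' + \<beta> * X a b = 0)" unfolding nz_def by blast
  then obtain \<beta> where "\<And>b' a. b' < d2 \<Longrightarrow> a < d1 \<Longrightarrow> X a b' + \<beta> b' * X a b = 0" by metis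
  then have "\<And>b' a. b' < d2 \<Longrightarrow> a < d1 \<Longrightarrow> X a b' = X a b * (- \<beta> b')"
    by (simp add: eq_neg_iff_add_eq_0 mult.commute)
  then show "\<exists>v. \<forall>a<d1. \<forall>b'<d2. X a b' = X a b * v b'" by (intro exI[of _ "\<lambda>b'. - \<beta> b'"]) blast
qed

text \<open>Two independent columns reach at least \<open>(q + 1) / q * D\<close> rows after the
  first application of \<open>G\<close>; each of these rows has weight at least \<open>D\<close>
  after the second.\<close>

lemma wt_tens_rank_two:
  fixes G :: "nat \<Rightarrow> nat \<Rightarrow> 'a::{finite,field}"
  assumes S: "0 < S" and D: "\<And>z. nz m z \<Longrightarrow> D \<le> real (wt S (ap m G z))" and D0: "0 \<le> D"
    and Z: "nz (m * m) Z" and r: "\<not> (\<exists>u v. \<forall>a<m. \<forall>b<m. Z (a * m + b) = u a * v b)"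
  shows "(real CARD('a) + 1) * (D * D) \<le> real CARD('a) * real (wt (S * S) (ap (m * m) (tens S m G G) Z))"
proof -
  obtain b where b: "b < m" "nz m (\<lambda>a. Z (a * m + b))" by (rule nz_column[OF Z])
  have n: "\<not> (\<exists>v. \<forall>a<m. \<forall>b'<m. Z (a * m + b') = Z (a * m + b) * v b')"
  proof
    assume "\<exists>v. \<forall>a<m. \<forall>b'<m. Z (a * m + b') = Z (a * m + b) * v b'"
    then obtain v where "\<forall>a<m. \<forall>b'<m. Z (a * m + b') = Z (a * m + b) * v b'" by (rule exE)
    then have "\<exists>u v. \<forall>a<m. \<forall>b<m. Z (a * m + b) = u a * v b"
      by (intro exI[of _ "\<lambda>a. Z (a * m + b)"] exI[of _ v])
    with r show False by (rule notE)
  qed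
  have "\<exists>b'<m. \<forall>\<beta>. nz m (\<lambda>a. Z (a * m + b') + \<beta> * Z (a * m + b))"
    using rank_one_or_pair[of b m m "\<lambda>a b. Z (a * m + b)", OF b]
  proof (rule disjE)
    assume a: "\<exists>v. \<forall>a<m. \<forall>b'<m. Z (a * m + b') = Z (a * m + b) * v b'"
    show ?thesis by (rule notE[OF n a])
  qed
  then obtain b' where b': "b' < m" "\<And>\<beta>. nz m (\<lambda>a. Z (a * m + b') + \<beta> * Z (a * m + b))"
    by (elim exE conjE) (rule that, assumption, rule spec)
  let ?R = "\<lambda>i b. ap m G (\<lambda>a. Z (a * m + b)) i"
  have "(real CARD('a) + 1) * D \<le> real CARD('a) * real (card {i. i < S \<and> (?R i b \<noteq> 0 \<or> ?R i b' \<noteq> 0)})"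
    by (rule rank_two_support[OF D b(2) b'(2)])
  also have "\<dots> \<le> real CARD('a) * real (card {i. i < S \<and> nz m (?R i)})"
    using b(1) b'(1) by (intro mult_left_mono of_nat_mono card_mono) (auto simp: nz_def)
  finally have "(real CARD('a) + 1) * D * D \<le> real CARD('a) * real (card {i. i < S \<and> nz m (?R i)}) * D"
    using D0 by (rule mult_right_mono)
  also have "\<dots> \<le> real CARD('a) * real (wt (S * S) (ap (m * m) (tens S m G G) Z))"
    using wt_tens_rows[of m S D G S m G Z, OF _ S D] b(1) by (simp add: mult.assoc mult_left_mono)
  finally show ?thesis by (simp add: mult.assoc)
qed

section \<open>The gap\<close>

text \<open>The columns of the base matrix are the entries of an \<open>m \<times> m\<close> matrix \<open>X\<close>. Its rows evaluate \<open>G X G\<^sup>T\<close>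
  and \<open>S\<^sup>2\<close> copies of every linear equation, so that violating an equation is too expensive.\<close>

definition base :: "nat \<Rightarrow> nat \<Rightarrow> (nat \<Rightarrow> nat \<Rightarrow> 'a::field) \<Rightarrow> (nat \<Rightarrow> nat \<Rightarrow> nat \<Rightarrow> 'a) \<Rightarrow> nat \<Rightarrow> nat \<Rightarrow> 'a" where
  "base S m G cf \<rho> \<gamma> = (if \<rho> < S * S then tens S m G G \<rho> \<gamma> else cf (\<rho> div (S * S) - 1) (\<gamma> div m) (\<gamma> mod m))"

definition holds :: "nat \<Rightarrow> nat \<Rightarrow> (nat \<Rightarrow> nat \<Rightarrow> nat \<Rightarrow> 'a::field) \<Rightarrow> (nat \<Rightarrow> nat \<Rightarrow> 'a) \<Rightarrow> bool" where
  "holds m E cf X \<longleftrightarrow> (\<forall>e<E. (\<Sum>a<m. \<Sum>b<m. cf e a b * X a b) = 0)"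

lemma ap_base:
  assumes "0 < m"
  shows "ap (m * m) (base S m G cf) Z \<rho> = (if \<rho> < S * S then ap (m * m) (tens S m G G) Z \<rho>
     else (\<Sum>a<m. \<Sum>b<m. cf (\<rho> div (S * S) - 1) a b * Z (a * m + b)))"
proof (cases "\<rho> < S * S")
  case False
  have "ap (m * m) (base S m G cf) Z \<rho> =
     (\<Sum>\<gamma><m * m. cf (\<rho> div (S * S) - 1) (\<gamma> div m) (\<gamma> mod m) * Z ((\<gamma> div m) * m + \<gamma> mod m))"
    using False unfolding ap_def base_def by simp
  also have "\<dots> = (\<Sum>a<m. \<Sum>b<m. cf (\<rho> div (S * S) - 1) a b * Z (a * m + b))"
    by (rule sum_divmod[OF assms, of "\<lambda>a b. cf (\<rho> div (S * S) - 1) a b * Z (a * m + b)"])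
  finally show ?thesis using False by simp
qed (simp add: ap_def base_def)

text \<open>If all equations hold, \<open>unsat\<close> excludes rank one, and the tensor part alone
  is heavy enough. Otherwise a violated equation contributes \<open>S * S\<close> nonzero rows,
  which suffices by \<open>SD\<close>. \<open>unsat\<close> has two vectors because a rank one
  matrix need not be symmetric.\<close>

lemma base_lower:
  fixes G :: "nat \<Rightarrow> nat \<Rightarrow> 'a::{finite,field}"
  assumes S: "0 < S" and D: "\<And>z. nz m z \<Longrightarrow> D \<le> real (wt S (ap m G z))" and D0: "0 \<le> D"
    and SD: "(real CARD('a) + 1) * (D * D) \<le> real CARD('a) * (real S * real S)"
    and unsat: "\<And>u v. holds m E cf (\<lambda>a b. u a * v b) \<Longrightarrow> \<forall>a<m. \<forall>b<m. u a * v b = 0"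
    and Z: "nz (m * m) Z"
  shows "(real CARD('a) + 1) * (D * D) \<le> real CARD('a) * real (wt (S * S * (1 + E)) (ap (m * m) (base S m G cf) Z))"
proof -
  let ?q = "real CARD('a)" let ?n = "S * S * (1 + E)" let ?A = "ap (m * m) (base S m G cf) Z"
  let ?X = "\<lambda>a b. Z (a * m + b)"
  have m: "0 < m" using Z unfolding nz_def by (cases m) auto
  have q0: "0 \<le> ?q" by simp
  show ?thesis
  proof (cases "holds m E cf ?X")
    case True
    have "\<not> (\<exists>u v. \<forall>a<m. \<forall>b<m. ?X a b = u a * v b)"
    proof
      assume "\<exists>u v. \<forall>a<m. \<forall>b<m. ?X a b = u a * v b"
      then obtain u v where uv0: "\<forall>a<m. \<forall>b<m. ?X a b = u a * v b" by (elim exE)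
      have uv: "?X a b = u a * v b" if "a < m" "b < m" for a b using uv0[rule_format, OF that] .
      have "(\<Sum>a<m. \<Sum>b<m. cf e a b * (u a * v b)) = (\<Sum>a<m. \<Sum>b<m. cf e a b * ?X a b)" for e
      proof (rule sum.cong[OF refl], rule sum.cong[OF refl])
        fix a b assume "a \<in> {..<m}" "b \<in> {..<m}"
        then show "cf e a b * (u a * v b) = cf e a b * ?X a b" using uv[of a b] by (simp only: lessThan_iff)
      qed
      then have "holds m E cf (\<lambda>a b. u a * v b)" using True unfolding holds_def by simp
      from unsat[OF this] uv have z: "?X a b = 0" if "a < m" "b < m" for a b using that by simp
      obtain \<gamma> where g: "\<gamma> < m * m" "Z \<gamma> \<noteq> 0" using Z unfolding nz_def by blast
      have "Z (\<gamma> div m * m + \<gamma> mod m) = 0"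
        by (rule z) (use g(1) m in \<open>simp_all add: less_mult_imp_div_less\<close>)
      then show False using g(2) by simp
    qed
    from wt_tens_rank_two[OF S D D0 Z this]
    have "(?q + 1) * (D * D) \<le> ?q * real (wt (S * S) (ap (m * m) (tens S m G G) Z))" .
    also have "\<dots> \<le> ?q * real (wt ?n ?A)"
    proof (intro mult_left_mono of_nat_mono q0)
      have "{i. i < S * S \<and> ap (m * m) (tens S m G G) Z i \<noteq> 0} \<subseteq> {i. i < ?n \<and> ?A i \<noteq> 0}"
      proof
        fix i assume i: "i \<in> {i. i < S * S \<and> ap (m * m) (tens S m G G) Z i \<noteq> 0}"
        have "S * S * 1 \<le> ?n" by (rule mult_le_mono2) simp
        then have "i < ?n" using i by simp
        then show "i \<in> {i. i < ?n \<and> ?A i \<noteq> 0}" using i by (simp add: ap_base[OF m])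
      qed
      then show "wt (S * S) (ap (m * m) (tens S m G G) Z) \<le> wt ?n ?A"
        unfolding wt_def by (intro card_mono) auto
    qed
    finally show ?thesis .
  next
    case False
    then obtain e where e: "e < E" "(\<Sum>a<m. \<Sum>b<m. cf e a b * ?X a b) \<noteq> 0" unfolding holds_def by blast
    \<comment> \<open>Block 0 of \<open>S * S\<close> rows is the tensor part, so equation
      \<open>e\<close> occupies block \<open>e + 1\<close>.\<close>
    have "(\<lambda>c. S * S * (e + 1) + c) ` {..<S * S} \<subseteq> {i. i < ?n \<and> ?A i \<noteq> 0}"
    proof
      fix i assume "i \<in> (\<lambda>c. S * S * (e + 1) + c) ` {..<S * S}"
      then obtain c where c: "c < S * S" "i = S * S * (e + 1) + c" by auto
      have "i < S * S * (e + 2)" using c by simp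
      also have "\<dots> \<le> ?n" using e(1) by (intro mult_le_mono2) simp
      finally have "i < ?n" .
      moreover have "i div (S * S) = e + 1"
      proof -
        have "i = c + (e + 1) * (S * S)" using c(2) by (simp only: mult.commute add.commute)
        then have "i div (S * S) = (e + 1) + c div (S * S)" using S by (simp only:) (rule div_mult_self1, simp)
        then show ?thesis using c(1) by simp
      qed
      moreover have "\<not> i < S * S" using c by simp
      ultimately show "i \<in> {i. i < ?n \<and> ?A i \<noteq> 0}" using e(2) by (simp add: ap_base[OF m])
    qed
    from card_mono[OF _ this] have "card ((\<lambda>c. S * S * (e + 1) + c) ` {..<S * S}) \<le> wt ?n ?A"
      unfolding wt_def by simp
    moreover have "card ((\<lambda>c. S * S * (e + 1) + c) ` {..<S * S}) = S * S"
      by (subst card_image) (auto simp: inj_on_def)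
    ultimately have "S * S \<le> wt ?n ?A" by simp
    then have "real (S * S) \<le> real (wt ?n ?A)" by (simp only: of_nat_le_iff)
    from mult_left_mono[OF this q0] have "?q * (real S * real S) \<le> ?q * real (wt ?n ?A)"
      unfolding of_nat_mult[of S S] .
    then show ?thesis using SD by linarith
  qed
qed

lemma base_upper:
  assumes S: "0 < S" and m: "0 < m" and u: "holds m E cf (\<lambda>a b. u a * u b)"
  shows "wt (S * S * (1 + E)) (ap (m * m) (base S m G cf) (\<lambda>\<gamma>. u (\<gamma> div m) * u (\<gamma> mod m))) =
    wt S (ap m G u) * wt S (ap m G u)"
proof -
  let ?Z = "\<lambda>\<gamma>. u (\<gamma> div m) * u (\<gamma> mod m)" let ?n = "S * S * (1 + E)"
  have "ap (m * m) (base S m G cf) ?Z i = 0" if "i < ?n" "\<not> i < S * S" for i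
  proof -
    have "1 \<le> i div (S * S)" using that S by (simp add: Suc_le_eq div_greater_zero_iff)
    moreover have "i div (S * S) < 1 + E" using that by (intro less_mult_imp_div_less) (simp add: mult.commute)
    ultimately have "i div (S * S) - 1 < E" by linarith
    then have "(\<Sum>a<m. \<Sum>b<m. cf (i div (S * S) - 1) a b * (u a * u b)) = 0" using u unfolding holds_def by simp
    moreover have "(\<Sum>a<m. \<Sum>b<m. cf (i div (S * S) - 1) a b * ?Z (a * m + b)) = (\<Sum>a<m. \<Sum>b<m. cf (i div (S * S) - 1) a b * (u a * u b))"
      by (intro sum.cong refl) auto
    ultimately show ?thesis using that(2) by (simp add: ap_base[OF m])
  qed
  then have "{i. i < ?n \<and> ap (m * m) (base S m G cf) ?Z i \<noteq> 0} = {i. i < S * S \<and> ap (m * m) (tens S m G G) ?Z i \<noteq> 0}"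
    by (auto simp: ap_base[OF m])
  then have "wt ?n (ap (m * m) (base S m G cf) ?Z) = wt (S * S) (ap (m * m) (tens S m G G) ?Z)"
    unfolding wt_def by simp
  then show ?thesis by (simp add: wt_tens_pure[OF m S])
qed

section \<open>Tensor powers and the amplified gap\<close>

primrec tpow :: "nat \<Rightarrow> nat \<Rightarrow> nat \<Rightarrow> (nat \<Rightarrow> nat \<Rightarrow> 'a::field) \<Rightarrow> nat \<Rightarrow> nat \<Rightarrow> 'a" where
  "tpow 0 n d A = (\<lambda>_ _. 1)"
| "tpow (Suc k) n d A = tens n d (tpow k n d A) A"

lemma tpow_lower:
  assumes n: "0 < n" and A: "\<And>z. nz d z \<Longrightarrow> c \<le> real (wt n (ap d A z))" and c: "0 \<le> c"
  shows "nz (d ^ k) Z \<Longrightarrow> c ^ k \<le> real (wt (n ^ k) (ap (d ^ k) (tpow k n d A) Z))"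
proof (induction k arbitrary: Z)
  case 0
  then have "Z 0 \<noteq> 0" by (auto simp: nz_def)
  then have "{i. i < (1::nat) \<and> ap 1 (\<lambda>_ _. 1) Z i \<noteq> 0} = {0}" by (auto simp: ap_def)
  then show ?case by (simp add: wt_def)
next
  case (Suc k)
  have "nz (d ^ k * d) Z" using Suc.prems by (simp add: mult.commute)
  from wt_tens_lower[OF n Suc.IH A c this] show ?case by (simp add: mult.commute)
qed

lemma tpow_upper:
  assumes n: "0 < n" and z: "nz d z"
  shows "\<exists>Z. nz (d ^ k) Z \<and> wt (n ^ k) (ap (d ^ k) (tpow k n d A) Z) = wt n (ap d A z) ^ k"
proof (induction k)
  case 0
  have "{i. i < (1::nat) \<and> ap 1 (\<lambda>_ _. 1) (\<lambda>_. 1 :: 'a) i \<noteq> 0} = {0}" by (auto simp: ap_def)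
  then show ?case by (intro exI[of _ "\<lambda>_. 1"]) (simp add: wt_def nz_def)
next
  case (Suc k)
  then obtain Z where Z: "nz (d ^ k) Z" "wt (n ^ k) (ap (d ^ k) (tpow k n d A) Z) = wt n (ap d A z) ^ k" by blast
  have d: "0 < d" using z unfolding nz_def by (cases d) auto
  let ?Z = "\<lambda>\<gamma>. Z (\<gamma> div d) * z (\<gamma> mod d)"
  have "nz (d ^ k * d) ?Z" by (rule nz_pure[OF Z(1) z])
  moreover have "wt (n ^ k * n) (ap (d ^ k * d) (tens n d (tpow k n d A) A) ?Z) = wt n (ap d A z) ^ k * wt n (ap d A z)"
    unfolding wt_tens_pure[OF d n] Z(2) ..
  ultimately show ?case by (intro exI[of _ ?Z]) (simp add: mult.commute)
qed

text \<open>\<open>t\<close> makes the loss \<open>x = (31 / 32) ^ t\<close> smaller than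
  \<open>1 / (4 * (q + 1))\<close>. Then \<open>(1 - x)\<^sup>2\<close> is at least
  \<open>1 - 2 * x\<close>, and \<open>(1 - 1 / (2 * (q + 1))) * (1 + 1 / q)\<close> equals
  \<open>1 + 1 / (2 * q)\<close>: half of the gain survives. Enough tensor factors lift it above
  \<open>r\<close>.\<close>

lemma gap_constants:
  fixes q r :: real
  assumes "2 \<le> q"
  obtains t \<kappa> where "0 < t" "1 + 1 / (2 * q) \<le> (1 - (31 / 32) ^ t)\<^sup>2 * (1 + 1 / q)" "r < (1 + 1 / (2 * q)) ^ \<kappa>"
proof -
  obtain t where t: "(31 / 32 :: real) ^ t < 1 / (4 * (q + 1))"
    using real_arch_pow_inv[of "1 / (4 * (q + 1))" "31 / 32"] assms by auto
  obtain \<kappa> where k: "r < (1 + 1 / (2 * q)) ^ \<kappa>"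
    using real_arch_pow[of "1 + 1 / (2 * q)" r] assms by auto
  let ?x = "(31 / 32 :: real) ^ t"
  have "1 + 1 / (2 * q) = (1 - 2 * (1 / (4 * (q + 1)))) * (1 + 1 / q)"
  proof -
    have "1 + 1 / q = (q + 1) / q" using assms by (simp add: field_simps)
    moreover have p: "2 * (1 / (4 * p)) * (p / q) = 1 / (2 * q)" if "p \<noteq> 0" for p using that by simp
    have "2 * (1 / (4 * (q + 1))) * ((q + 1) / q) = 1 / (2 * q)" by (rule p) (use assms in simp)
    ultimately have e: "(1 - 2 * (1 / (4 * (q + 1)))) * (1 + 1 / q) = (1 + 1 / q) - 1 / (2 * q)"
      by (simp only: left_diff_distrib mult_1)
    show ?thesis unfolding e using assms by (simp add: field_simps)
  qed
  also have "\<dots> \<le> (1 - 2 * ?x) * (1 + 1 / q)" using t assms by (intro mult_right_mono) auto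
  also have "\<dots> \<le> (1 - ?x)\<^sup>2 * (1 + 1 / q)"
    using assms by (intro mult_right_mono) (auto simp: power2_eq_square algebra_simps)
  finally have g: "1 + 1 / (2 * q) \<le> (1 - ?x)\<^sup>2 * (1 + 1 / q)" .
  have "0 < t"
  proof (rule ccontr)
    assume "\<not> 0 < t"
    then have "1 + 1 / (2 * q) \<le> 0" using g by simp
    moreover have "0 < 1 / (2 * q)" using assms by simp
    ultimately show False by linarith
  qed
  then show thesis using that g k by blast
qed

lemma card_field_ge_2: "2 \<le> CARD('a::{finite,field})"
proof -
  have "card {0, 1 :: 'a} \<le> CARD('a)" by (rule card_mono) auto
  then show ?thesis by simp
qed

context
  fixes cf :: "nat \<Rightarrow> nat \<Rightarrow> nat \<Rightarrow> 'a::{finite,field}" and m E L N t \<kappa> q S W n :: nat and r :: real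
    and A :: "nat \<Rightarrow> nat \<Rightarrow> 'a"
  assumes t: "0 < t" and g: "1 + 1 / (2 * real CARD('a)) \<le> (1 - (31 / 32) ^ t)\<^sup>2 * (1 + 1 / real CARD('a))"
    and r: "r < (1 + 1 / (2 * real CARD('a))) ^ \<kappa>"
    and m: "0 < m" "m \<le> 2 ^ L" and N: "N = 2 ^ (2 * L + 3)"
    and q: "q = CARD('a)" and S: "S = q ^ (t * (L + 4)) * (N * N) ^ t" and W: "W = S * (q - 1) div q"
    and A: "A = base S m (gen N (L + 4) t) cf" and n: "n = S * S * (1 + E)"
begin

lemma gap_aux: "2 \<le> q" "q \<le> S" "0 < S" "0 < W" "0 < n"
proof -
  show q2: "2 \<le> q" unfolding q by (rule card_field_ge_2)
  have N0: "0 < N" unfolding N by simp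
  have "q ^ 1 \<le> q ^ (t * (L + 4))" using q2 t by (intro power_increasing) auto
  also have "\<dots> * 1 \<le> S" unfolding S using N0 by (intro mult_le_mono) auto
  finally show qS: "q \<le> S" by simp
  then show S0: "0 < S" using q2 by simp
  have "q * 1 \<le> S * (q - 1)" using qS q2 by (intro mult_le_mono) auto
  then show "0 < W" unfolding W using q2 by (simp add: div_greater_zero_iff)
  show "0 < n" unfolding n using S0 by simp
qed

lemma gap_upper:
  assumes u: "nz m u" and h: "holds m E cf (\<lambda>a b. u a * u b)"
  shows "\<exists>Z. nz ((m * m) ^ \<kappa>) Z \<and> wt (n ^ \<kappa>) (ap ((m * m) ^ \<kappa>) (tpow \<kappa> n (m * m) A) Z) \<le> (W * W) ^ \<kappa>"
proof -
  let ?w = "wt S (ap m (gen N (L + 4) t) u)"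
  have "q * ?w \<le> S * (q - 1)"
    unfolding q S by (rule wt_gen_bounds(1)[OF u m(2) N])
  then have "?w \<le> W" unfolding W using gap_aux(1) by (simp add: less_eq_div_iff_mult_less_eq mult.commute)
  then have ww: "?w * ?w \<le> W * W" by (intro mult_le_mono)
  let ?z = "\<lambda>\<gamma>. u (\<gamma> div m) * u (\<gamma> mod m)"
  have wz: "wt n (ap (m * m) A ?z) = ?w * ?w"
    unfolding n A by (rule base_upper[OF gap_aux(3) m(1) h])
  have "nz (m * m) ?z" by (rule nz_pure[OF u u])
  from tpow_upper[OF gap_aux(5) this, of \<kappa> A, unfolded wz]
  obtain Z where Z: "nz ((m * m) ^ \<kappa>) Z" "wt (n ^ \<kappa>) (ap ((m * m) ^ \<kappa>) (tpow \<kappa> n (m * m) A) Z) = (?w * ?w) ^ \<kappa>"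
    by (elim exE conjE)
  have "(?w * ?w) ^ \<kappa> \<le> (W * W) ^ \<kappa>" using ww by (rule power_mono) simp
  then show ?thesis using Z by (intro exI[of _ Z]) simp
qed

text \<open>Both bounds are compared with the ideal weight \<open>?V\<close>: a satisfying solution
  costs at most \<open>W * W\<close>, hence at most \<open>?V * ?V\<close>, while any word of an
  unsatisfiable instance costs at least \<open>c\<close>, where \<open>c\<close> is
  \<open>(1 + 1 / q)\<close> times the square of the slightly smaller \<open>D\<close>. The ratio is
  at least \<open>1 + 1 / (2 * q)\<close> per tensor factor.\<close>

lemma gap_lower:
  assumes unsat: "\<And>u v. holds m E cf (\<lambda>a b. u a * v b) \<Longrightarrow> \<forall>a<m. \<forall>b<m. u a * v b = 0"
    and Z: "nz ((m * m) ^ \<kappa>) Z"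
  shows "r * real ((W * W) ^ \<kappa>) < real (wt (n ^ \<kappa>) (ap ((m * m) ^ \<kappa>) (tpow \<kappa> n (m * m) A) Z))"
proof -
  let ?q = "real q" let ?V = "real S * (?q - 1) / ?q"
  define D where "D = (1 - (31 / 32) ^ t) * ?V"
  define c where "c = (?q + 1) * (D * D) / ?q"
  have q2: "2 \<le> ?q" using gap_aux(1) by simp
  have V0: "0 \<le> ?V" using q2 by simp
  have x: "0 \<le> 1 - (31 / 32 :: real) ^ t" "1 - (31 / 32 :: real) ^ t \<le> 1" by (auto simp: power_le_one)
  have D0: "0 \<le> D" unfolding D_def using x(1) V0 by (rule mult_nonneg_nonneg)
  have DV: "D \<le> ?V" unfolding D_def using mult_right_mono[OF x(2) V0] by simp
  have D: "D \<le> real (wt S (ap m (gen N (L + 4) t :: nat \<Rightarrow> nat \<Rightarrow> 'a) z))" if z: "nz m z" for z :: "nat \<Rightarrow> 'a"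
  proof -
    have "(1 - (31 / 32) ^ t) * (real S * real (q - 1)) \<le> ?q * real (wt S (ap m (gen N (L + 4) t) z))"
      unfolding q S by (rule wt_gen_bounds(2)[OF z m(2) N])
    moreover have "real (q - 1) = ?q - 1" using gap_aux(1) by (simp add: of_nat_diff)
    ultimately show ?thesis unfolding D_def using q2 by (simp add: field_simps)
  qed
  \<comment> \<open>As \<open>D\<close> is at most \<open>S * (q - 1) / q\<close>, this comes down
    to \<open>(q + 1) * (q - 1)\<^sup>2 \<le> q ^ 3\<close>.\<close>
  have SD: "(real CARD('a) + 1) * (D * D) \<le> real CARD('a) * (real S * real S)"
  proof -
    have "D * D \<le> ?V * ?V" using DV D0 by (intro mult_mono) auto
    then have "(?q + 1) * (D * D) \<le> (?q + 1) * (?V * ?V)" using q2 by (intro mult_left_mono) auto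
    also have "\<dots> = (real S * real S) * ((?q + 1) * ((?q - 1) * (?q - 1)) / (?q * ?q))" by simp
    also have "\<dots> \<le> (real S * real S) * ?q"
    proof (rule mult_left_mono)
      have "(?q + 1) * ((?q - 1) * (?q - 1)) = ?q * (?q * ?q) - (?q * (?q - 1) + (2 * ?q - 1))" by (simp add: algebra_simps)
      also have "\<dots> \<le> ?q * (?q * ?q)"
      proof -
        have "0 \<le> ?q * (?q - 1)" using q2 by simp
        then show ?thesis using q2 by linarith
      qed
      finally show "(?q + 1) * ((?q - 1) * (?q - 1)) / (?q * ?q) \<le> ?q" using q2 by (simp add: divide_le_eq)
    qed simp
    finally show ?thesis by (simp add: q mult.commute)
  qed
  have c: "c \<le> real (wt n (ap (m * m) A z))" if "nz (m * m) z" for z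
  proof -
    have "(real CARD('a) + 1) * (D * D) \<le> real CARD('a) * real (wt n (ap (m * m) A z))"
      unfolding n A by (rule base_lower[OF gap_aux(3) D D0 SD unsat that])
    then show ?thesis unfolding c_def q[symmetric] using q2 by (simp add: divide_le_eq mult.commute)
  qed
  have c0: "0 \<le> c" unfolding c_def using q2 D0 by simp
  have VW: "real W \<le> ?V"
  proof -
    have "W * q \<le> S * (q - 1)" unfolding W by simp
    then have "real (W * q) \<le> real (S * (q - 1))" by (simp only: of_nat_le_iff)
    then show ?thesis using gap_aux(1) q2 by (simp add: of_nat_diff pos_le_divide_eq)
  qed
  let ?g = "1 + 1 / (2 * ?q)"
  have g0: "0 \<le> ?g" by simp
  have "?g * (real W * real W) \<le> ?g * (?V * ?V)" using VW g0 by (intro mult_left_mono mult_mono) auto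
  also have "\<dots> \<le> ((1 - (31 / 32) ^ t)\<^sup>2 * (1 + 1 / ?q)) * (?V * ?V)"
    using g unfolding q by (intro mult_right_mono) auto
  also have "\<dots> = (1 + 1 / ?q) * (D * D)" unfolding D_def power2_eq_square by (simp only: mult_ac)
  also have "\<dots> = c" unfolding c_def using q2 by (simp add: field_simps)
  finally have gc: "?g * real (W * W) \<le> c" by simp
  have "r * real ((W * W) ^ \<kappa>) < ?g ^ \<kappa> * real ((W * W) ^ \<kappa>)"
    using r gap_aux(4) unfolding q by (intro mult_strict_right_mono) auto
  also have "\<dots> = (?g * real (W * W)) ^ \<kappa>" unfolding of_nat_power by (rule power_mult_distrib[symmetric])
  also have "\<dots> \<le> c ^ \<kappa>" using gc g0 by (intro power_mono) auto
  also have "\<dots> \<le> real (wt (n ^ \<kappa>) (ap ((m * m) ^ \<kappa>) (tpow \<kappa> n (m * m) A) Z))"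
    by (rule tpow_lower[OF gap_aux(5) c c0 Z])
  finally show ?thesis .
qed

end

text \<open>If \<open>u 0\<close> were 0, the diagonal would vanish by \<open>idem\<close>, and by
  symmetry the square of \<open>u a * v b\<close> is a product of two diagonal entries. With
  \<open>u 0\<close> nonzero, symmetry makes \<open>v\<close> a multiple of \<open>u\<close>, and
  \<open>idem\<close> leaves only the values 0 and \<open>u 0\<close> for \<open>u a\<close>. The
  scalar \<open>c\<close> is \<open>u 0 * v 0\<close>.\<close>

lemma rank_one_boolean:
  fixes u v :: "nat \<Rightarrow> 'a::field"
  assumes sym: "\<And>a b. a < m \<Longrightarrow> b < m \<Longrightarrow> u a * v b = u b * v a"
    and idem: "\<And>a. a < m \<Longrightarrow> u a * v a = u 0 * v a"
    and m: "0 < m" and nonzero: "\<not> (\<forall>a<m. \<forall>b<m. u a * v b = 0)"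
  obtains \<alpha> c where "\<alpha> 0" "c \<noteq> 0" "\<And>a b. a < m \<Longrightarrow> b < m \<Longrightarrow> u a * v b = c * (of_bool (\<alpha> a) * of_bool (\<alpha> b))"
proof -
  have u0: "u 0 \<noteq> 0"
  proof
    assume "u 0 = 0"
    then have z: "u a * v a = 0" if "a < m" for a using idem[OF that] by simp
    have "u a * v b = 0" if "a < m" "b < m" for a b
    proof -
      have "(u a * v b) * (u a * v b) = (u a * v b) * (u b * v a)" using sym[OF that] by simp
      also have "\<dots> = (u a * v a) * (u b * v b)" by (simp only: mult_ac)
      finally show ?thesis using z[OF that(1)] by simp
    qed
    then show False using nonzero by blast
  qed
  have v: "v a = v 0 / u 0 * u a" if "a < m" for a
    using sym[OF that m] u0 by (simp add: field_simps)
  have v0: "v 0 \<noteq> 0"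
  proof
    assume "v 0 = 0"
    then have "v a = 0" if "a < m" for a using v[OF that] by simp
    then show False using nonzero by simp
  qed
  have ua: "u a = u 0 * of_bool (u a \<noteq> 0)" if "a < m" for a
  proof (cases "u a = 0")
    case False
    then have "v a \<noteq> 0" using v[OF that] u0 v0 by simp
    then show ?thesis using idem[OF that] False by simp
  qed simp
  show thesis
  proof (rule that[of "\<lambda>a. u a \<noteq> 0" "u 0 * v 0"])
    show "u 0 \<noteq> 0" "u 0 * v 0 \<noteq> 0" using u0 v0 by auto
    fix a b assume ab: "a < m" "b < m"
    have "u a * v b = v 0 / u 0 * (u a * u b)" using v[OF ab(2)] by simp
    also have "\<dots> = v 0 / u 0 * ((u 0 * of_bool (u a \<noteq> 0)) * (u 0 * of_bool (u b \<noteq> 0)))"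
      using ua[OF ab(1)] ua[OF ab(2)] by simp
    also have "\<dots> = u 0 * v 0 * (of_bool (u a \<noteq> 0) * of_bool (u b \<noteq> 0))" using u0 by (simp add: field_simps)
    finally show "u a * v b = u 0 * v 0 * (of_bool (u a \<noteq> 0) * of_bool (u b \<noteq> 0))" .
  qed
qed

section \<open>Rank \<open>d - 1\<close> approximation and minimum distance\<close>

text \<open>Pigeonhole: there are more vectors of length \<open>d\<close> over the finite field than
  of length \<open>d - 1\<close>, so two of them have the same image, and their difference is in the
  kernel.\<close>

lemma wide_kernel:
  fixes V :: "nat \<Rightarrow> nat \<Rightarrow> 'a::{finite,field}"
  assumes "1 \<le> d" obtains z where "nz d z" "\<And>k. k < d - 1 \<Longrightarrow> ap d V z k = 0"
proof -
  let ?P = "PiE {..<d} (\<lambda>_. UNIV :: 'a set)" let ?Q = "PiE {..<d - 1} (\<lambda>_. UNIV :: 'a set)"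
  let ?f = "\<lambda>x. restrict (ap d V x) {..<d - 1}"
  have "card ?Q < card ?P"
    using card_field_ge_2[where 'a = 'a] assms by (simp add: card_PiE)
  moreover have "?f ` ?P \<subseteq> ?Q" by (intro image_subsetI) (simp add: restrict_PiE)
  moreover have "finite ?Q" by (intro finite_PiE) auto
  ultimately have "\<not> inj_on ?f ?P" using card_inj_on_le[of ?f ?P ?Q] by linarith
  then obtain x y where xy: "x \<in> ?P" "y \<in> ?P" "x \<noteq> y" "?f x = ?f y"
    unfolding inj_on_def by (simp only: ball_simps not_all not_imp Ball_def) (elim exE conjE, rule that)
  show thesis
  proof (rule that[of "\<lambda>j. x j - y j"])
    have "\<exists>j\<in>{..<d}. x j \<noteq> y j"
    proof (rule ccontr)
      assume "\<not> (\<exists>j\<in>{..<d}. x j \<noteq> y j)"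
      then have "x = y" using PiE_ext[OF xy(1,2)] by blast
      then show False using xy(3) by simp
    qed
    then show "nz d (\<lambda>j. x j - y j)" unfolding nz_def by auto
    fix k assume k: "k < d - 1"
    have "ap d V x k = ap d V y k" using fun_cong[OF xy(4), of k] k by simp
    then show "ap d V (\<lambda>j. x j - y j) k = 0" unfolding ap_def by (simp add: algebra_simps sum_subtractf)
  qed
qed

text \<open>Take \<open>z\<close> in the kernel of \<open>V\<close>. Then
  \<open>(U * V - A) z = - A z\<close>, so each nonzero entry of \<open>A z\<close> needs a nonzero
  entry of \<open>U * V - A\<close> in the same row.\<close>

lemma l0_ge_distance:
  fixes f :: "nat \<Rightarrow> nat \<Rightarrow> 'a::{finite,field}"
  assumes d: "1 \<le> d" and U: "U \<in> carrier_mat n (d - 1)" and V: "V \<in> carrier_mat (d - 1) d"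
  obtains z where "nz d z" "wt n (ap d f z) \<le> l0 (U * V - mat n d (\<lambda>(i, j). f i j))"
proof -
  let ?A = "mat n d (\<lambda>(i, j). f i j)"
  obtain z where z: "nz d z" "\<And>k. k < d - 1 \<Longrightarrow> ap d (\<lambda>k j. V $$ (k, j)) z k = 0"
    using wide_kernel[OF d, of "\<lambda>k j. V $$ (k, j)"] by blast
  let ?B = "{(i, j). i < n \<and> j < d \<and> (U * V - ?A) $$ (i, j) \<noteq> 0}"
  have e: "(U * V - ?A) $$ (i, j) = (\<Sum>k<d - 1. U $$ (i, k) * V $$ (k, j)) - f i j" if "i < n" "j < d" for i j
    using U V that by (simp add: scalar_prod_def row_def col_def atLeast0LessThan)
  have "i \<in> fst ` ?B" if i: "i < n" "ap d f z i \<noteq> 0" for i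
  proof -
    have "(\<Sum>j<d. (U * V - ?A) $$ (i, j) * z j) = (\<Sum>j<d. (\<Sum>k<d - 1. U $$ (i, k) * (V $$ (k, j) * z j)) - f i j * z j)"
      using e i(1) by (intro sum.cong refl) (simp add: left_diff_distrib sum_distrib_right mult.assoc)
    also have "\<dots> = (\<Sum>k<d - 1. U $$ (i, k) * ap d (\<lambda>k j. V $$ (k, j)) z k) - ap d f z i"
      unfolding sum_subtractf ap_def sum_distrib_left by (subst sum.swap) simp
    also have "\<dots> = - ap d f z i" using z(2) by simp
    finally have "(\<Sum>j<d. (U * V - ?A) $$ (i, j) * z j) \<noteq> 0" using i(2) by simp
    then obtain j where "j < d" "(U * V - ?A) $$ (i, j) * z j \<noteq> 0" by (meson lessThan_iff sum.neutral)
    then have "(i, j) \<in> ?B" using i(1) by auto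
    then show ?thesis by force
  qed
  then have sub: "{i. i < n \<and> ap d f z i \<noteq> 0} \<subseteq> fst ` ?B" by blast
  have fin: "finite ?B" by (rule finite_subset[of _ "{..<n} \<times> {..<d}"]) auto
  have "wt n (ap d f z) \<le> card (fst ` ?B)" unfolding wt_def by (rule card_mono[OF finite_imageI[OF fin] sub])
  also have "\<dots> \<le> card ?B" by (rule card_image_le[OF fin])
  also have "\<dots> = l0 (U * V - ?A)" using U V by (simp add: l0_def)
  finally show thesis using z(1) that by blast
qed

text \<open>Only column \<open>j0\<close>, where \<open>z\<close> is nonzero, is altered, so that
  the new matrix is annihilated by \<open>z\<close>. \<open>U\<close> consists of the other columns
  (\<open>sk\<close> skips \<open>j0\<close>), and \<open>V\<close> expresses column
  \<open>j0\<close> by them. The error in row \<open>i\<close> is the \<open>i\<close>-th entry of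
  \<open>A z\<close> up to a nonzero factor.\<close>

lemma l0_opt_le_distance:
  fixes f :: "nat \<Rightarrow> nat \<Rightarrow> 'a::{finite,field}"
  assumes z: "nz d z"
  shows "l0_opt (d - 1) (mat n d (\<lambda>(i, j). f i j)) \<le> wt n (ap d f z)"
proof -
  let ?A = "mat n d (\<lambda>(i, j). f i j)"
  obtain j0 where j0: "j0 < d" "z j0 \<noteq> 0" using z unfolding nz_def by blast
  define sk where "sk k = (if k < j0 then k else k + 1)" for k
  define U where "U = mat n (d - 1) (\<lambda>(i, k). f i (sk k))"
  define V where "V = mat (d - 1) d (\<lambda>(k, j). if j = j0 then - z (sk k) / z j0 else of_bool (sk k = j))"
  have sk: "(\<Sum>k<d - 1. h (sk k)) = (\<Sum>j\<in>{..<d} - {j0}. h j)" for h :: "nat \<Rightarrow> 'a"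
    by (rule sum.reindex_bij_witness[of _ "\<lambda>j. if j < j0 then j else j - 1" sk])
      (use j0(1) in \<open>auto simp: sk_def\<close>)
  have UV: "U \<in> carrier_mat n (d - 1)" "V \<in> carrier_mat (d - 1) d" unfolding U_def V_def by auto
  have e: "(U * V - ?A) $$ (i, j) = (if j = j0 then - ap d f z i / z j0 else 0)" if ij: "i < n" "j < d" for i j
  proof -
    have 1: "(U * V - ?A) $$ (i, j) = (\<Sum>k<d - 1. f i (sk k) * V $$ (k, j)) - f i j"
      using ij UV by (simp add: scalar_prod_def row_def col_def atLeast0LessThan U_def)
    show ?thesis
    proof (cases "j = j0")
      case True
      have "(\<Sum>k<d - 1. f i (sk k) * V $$ (k, j)) = (\<Sum>k<d - 1. - (f i (sk k) * z (sk k)) / z j0)"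
        using ij True by (intro sum.cong refl) (simp add: V_def)
      also have "\<dots> = (\<Sum>j\<in>{..<d} - {j0}. - (f i j * z j) / z j0)"
        using sk[of "\<lambda>j. - (f i j * z j) / z j0"] .
      also have "\<dots> = - (ap d f z i - f i j0 * z j0) / z j0"
        unfolding ap_def using j0(1)
        by (simp add: sum_diff1 sum_divide_distrib[symmetric] sum_negf) (simp add: minus_divide_left)
      also have "\<dots> = f i j0 - ap d f z i / z j0" using j0(2) by (simp add: field_simps)
      finally show ?thesis using 1 True by simp
    next
      case False
      have "(\<Sum>k<d - 1. f i (sk k) * V $$ (k, j)) = (\<Sum>k<d - 1. f i (sk k) * of_bool (sk k = j))"
        using ij False by (intro sum.cong refl) (simp add: V_def)
      also have "\<dots> = (\<Sum>j'\<in>{..<d} - {j0}. f i j' * of_bool (j' = j))"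
        using sk[of "\<lambda>j'. f i j' * of_bool (j' = j)"] .
      also have "\<dots> = (\<Sum>j'\<in>{..<d} - {j0}. if j' = j then f i j' else 0)"
        by (intro sum.cong refl) auto
      also have "\<dots> = f i j" using ij False by simp
      finally show ?thesis using 1 False by simp
    qed
  qed
  have "{(i, j). i < n \<and> j < d \<and> (U * V - ?A) $$ (i, j) \<noteq> 0} = (\<lambda>i. (i, j0)) ` {i. i < n \<and> ap d f z i \<noteq> 0}"
    using e j0 by (auto simp: image_iff split: if_splits)
  moreover have "card ((\<lambda>i. (i, j0)) ` {i. i < n \<and> ap d f z i \<noteq> 0}) = wt n (ap d f z)"
    unfolding wt_def by (rule card_image) (simp add: inj_on_def)
  ultimately have l: "l0 (U * V - ?A) = wt n (ap d f z)"
    using UV by (simp add: l0_def)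
  have "l0_opt (d - 1) ?A \<le> l0 (U * V - ?A)"
    unfolding l0_opt_def
    by (rule Least_le) (use UV in \<open>intro bexI[of _ U] bexI[of _ V]; simp\<close>)
  then show ?thesis using l by simp
qed

section \<open>Cyclic tapes\<close>

text \<open>A tape is stored relative to its head, which stays at index 0 of a cyclic array of length \<open>W\<close>;
  a step therefore acts uniformly on all cells. The state is the cell 0 of an additional tape, so that the symbols
  at index 0, read as the digits of a number \<open>\<tau>\<close>, determine the transition. Moves are coded by 0, 1, 2.\<close>

definition tau :: "nat \<Rightarrow> nat \<Rightarrow> (nat \<Rightarrow> nat \<Rightarrow> nat) \<Rightarrow> nat" where
  "tau Sg J C = (SOME \<tau>. \<tau> < Sg ^ J \<and> (\<forall>j<J. dig Sg \<tau> j = C j 0))"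

text \<open>The old index of the cell that the move brings to index \<open>p\<close>. As 1 codes a
  head at rest, the displacement is \<open>mv - 1\<close>; adding \<open>W\<close> keeps the
  difference a natural number. Source 0 is the cell that was just written.\<close>

definition src :: "nat \<Rightarrow> (nat \<Rightarrow> nat \<Rightarrow> nat) \<Rightarrow> nat \<Rightarrow> nat \<Rightarrow> nat \<Rightarrow> nat" where
  "src W mv \<tau> j p = (p + mv \<tau> j + W - 1) mod W"

definition cstep :: "nat \<Rightarrow> nat \<Rightarrow> nat \<Rightarrow> (nat \<Rightarrow> nat \<Rightarrow> nat) \<Rightarrow> (nat \<Rightarrow> nat \<Rightarrow> nat) \<Rightarrow> (nat \<Rightarrow> nat \<Rightarrow> nat) \<Rightarrow> nat \<Rightarrow> nat \<Rightarrow> nat" where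
  "cstep Sg J W wr mv C j p = (let \<tau> = tau Sg J C in if src W mv \<tau> j p = 0 then wr \<tau> j else C j (src W mv \<tau> j p))"

lemma tau:
  assumes "\<And>j. j < J \<Longrightarrow> C j 0 < Sg" "0 < Sg"
  shows "tau Sg J C < Sg ^ J" "\<And>j. j < J \<Longrightarrow> dig Sg (tau Sg J C) j = C j 0"
proof -
  have "\<exists>\<tau>. \<tau> < Sg ^ J \<and> (\<forall>j<J. dig Sg \<tau> j = C j 0)"
    using dig_ex[of J "\<lambda>j. C j 0" Sg] assms by blast
  then have "tau Sg J C < Sg ^ J \<and> (\<forall>j<J. dig Sg (tau Sg J C) j = C j 0)"
    unfolding tau_def by (rule someI_ex)
  then show "tau Sg J C < Sg ^ J" "\<And>j. j < J \<Longrightarrow> dig Sg (tau Sg J C) j = C j 0" by auto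
qed

text \<open>The halting state and all illegal combinations act as the identity. So a halted
  computation is frozen, and a tableau of any sufficient height shows its result.\<close>

definition trans_at :: "tm \<Rightarrow> nat \<Rightarrow> nat \<Rightarrow> nat \<times> (nat \<times> move) list" where
  "trans_at V Sg \<tau> = (let k = tm_tapes V; ss = map (dig Sg \<tau>) [0..<k]; q = dig Sg \<tau> k in
     if q < tm_states V \<and> (\<forall>s\<in>set ss. s < tm_symbols V) \<and> q \<noteq> 1 then tm_delta V q ss else (q, stay ss))"

fun move_code :: "move \<Rightarrow> nat" where
  "move_code Move_Left = 0" | "move_code Move_Stay = 1" | "move_code Move_Right = 2"

definition tm_wr :: "tm \<Rightarrow> nat \<Rightarrow> nat \<Rightarrow> nat \<Rightarrow> nat" where
  "tm_wr V Sg \<tau> j = (if j < tm_tapes V then fst (snd (trans_at V Sg \<tau>) ! j) else fst (trans_at V Sg \<tau>))"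

definition tm_mv :: "tm \<Rightarrow> nat \<Rightarrow> nat \<Rightarrow> nat \<Rightarrow> nat" where
  "tm_mv V Sg \<tau> j = (if j < tm_tapes V then move_code (snd (snd (trans_at V Sg \<tau>) ! j)) else 1)"

text \<open>When \<open>2 * T < W\<close>, the window of \<open>W\<close> positions from
  \<open>- T\<close> on contains every head position reachable in \<open>T\<close> steps, and its
  positions have distinct residues modulo \<open>W\<close>. Of the additional tape only cell 0, the
  state, is constrained.\<close>

definition cyclic :: "tm \<Rightarrow> nat \<Rightarrow> nat \<Rightarrow> config \<Rightarrow> (nat \<Rightarrow> nat \<Rightarrow> nat) \<Rightarrow> bool" where
  "cyclic V W T c C \<longleftrightarrow> C (tm_tapes V) 0 = fst c \<and> (\<forall>j<tm_tapes V. \<forall>z. - int T \<le> z \<and> z < int W - int T \<longrightarrow>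
     C j (nat ((z - snd (snd c ! j)) mod int W)) = fst (snd c ! j) z)"

lemma tm_step_trans:
  assumes V: "turing_machine V" and v: "valid_config V (q, ts)"
    and \<tau>: "\<And>j. j < tm_tapes V \<Longrightarrow> dig Sg \<tau> j = head (ts ! j)" "dig Sg \<tau> (tm_tapes V) = q"
  obtains q' acts where "trans_at V Sg \<tau> = (q', acts)" "length acts = tm_tapes V"
    "tm_step V (q, ts) = (q', map2 act_tape ts acts)" "q' < tm_states V"
proof -
  have l: "length ts = tm_tapes V" "q < tm_states V" using v unfolding valid_config_def by auto
  have ss: "map (dig Sg \<tau>) [0..<tm_tapes V] = map head ts"
    by (rule nth_equalityI) (use l \<tau>(1) in auto)
  show thesis
  proof (cases "q = 1")
    case True
    have "map2 act_tape ts (stay (map head ts)) = ts" using map2_stay[of ts] by (simp add: map_head)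
    then show thesis
      using that[of q "stay (map head ts)"] True ss l \<tau>(2) by (auto simp: trans_at_def Let_def tm_step.simps stay_def)
  next
    case False
    obtain q' acts where d: "tm_delta V q (map head ts) = (q', acts)" by fastforce
    note D = turing_machineD[OF V l(2) valid_heads[OF v] d]
    have "trans_at V Sg \<tau> = (q', acts)"
      unfolding trans_at_def Let_def ss \<tau>(2) using False valid_heads(2)[OF v] l(2) d by simp
    then show thesis using that[of q' acts] D False d by (simp add: tm_step.simps map_head)
  qed
qed

lemma mod_eq_0_range:
  fixes z h :: int
  assumes "- T \<le> z" "z < W - T" "- T \<le> h" "h < W - T" "(z - h) mod W = 0"
  shows "z = h"
proof -
  have "W dvd z - h" using assms(5) by presburger
  moreover have "\<bar>z - h\<bar> < \<bar>W\<bar>" using assms by linarith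
  ultimately have "z - h = 0" using dvd_imp_le_int[of "z - h" W] by fastforce
  then show ?thesis by simp
qed

lemma cyclic_step:
  assumes V: "turing_machine V" and v: "valid_config V (q, ts)" and c: "cyclic V W T (q, ts) C"
    and h: "\<And>j. j < tm_tapes V \<Longrightarrow> \<bar>snd (ts ! j)\<bar> \<le> int t" and t: "t < T" and W: "2 * T < W"
    and Sg: "tm_symbols V \<le> Sg" "tm_states V \<le> Sg"
  shows "cyclic V W T (tm_step V (q, ts)) (cstep Sg (tm_tapes V + 1) W (tm_wr V Sg) (tm_mv V Sg) C)"
    and "\<And>j. j < tm_tapes V \<Longrightarrow> \<bar>snd (snd (tm_step V (q, ts)) ! j)\<bar> \<le> int (Suc t)"
proof -
  let ?k = "tm_tapes V"
  define \<tau> where "\<tau> = tau Sg (?k + 1) C"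
  have lt: "length ts = ?k" using v unfolding valid_config_def by auto
  have Ch: "C j 0 = head (ts ! j)" if "j < ?k" for j
  proof -
    have "- int T \<le> snd (ts ! j)" "snd (ts ! j) < int W - int T" using h[OF that] t W by linarith+
    then have "C j (nat ((snd (ts ! j) - snd (ts ! j)) mod int W)) = fst (ts ! j) (snd (ts ! j))"
      using c that unfolding cyclic_def by (metis snd_conv)
    then show ?thesis by (simp add: head_def)
  qed
  have Cq: "C ?k 0 = q" using c unfolding cyclic_def by simp
  have qS: "q < Sg" using v Sg unfolding valid_config_def by auto
  have Csg: "C j 0 < Sg" if "j < ?k + 1" for j
  proof (cases "j < ?k")
    case True
    then have "head (ts ! j) < tm_symbols V" using v lt unfolding valid_config_def head_def by (metis nth_mem snd_conv)
    then show ?thesis using Ch[OF True] Sg by simp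
  qed (use that Cq qS in \<open>simp add: less_Suc_eq\<close>)
  have \<tau>: "dig Sg \<tau> j = C j 0" if "j < ?k + 1" for j
    unfolding \<tau>_def by (rule tau(2)) (use Csg qS that in auto)
  obtain q' acts where tr: "trans_at V Sg \<tau> = (q', acts)" "length acts = ?k"
    "tm_step V (q, ts) = (q', map2 act_tape ts acts)" "q' < tm_states V"
    by (rule tm_step_trans[OF V v, of Sg \<tau>]) (use \<tau> Ch Cq in auto)
  have nth: "snd (tm_step V (q, ts)) ! j = act_tape (ts ! j) (acts ! j)" if "j < ?k" for j
    using tr lt that by simp
  have W0: "0 < W" using W by simp
  show "\<bar>snd (snd (tm_step V (q, ts)) ! j)\<bar> \<le> int (Suc t)" if "j < ?k" for j
  proof -
    have "\<bar>dir m\<bar> \<le> 1" for m by (cases m) auto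
    from this[of "snd (acts ! j)"] show ?thesis using h[OF that] by (simp add: nth[OF that] snd_act_tape)
  qed
  let ?C' = "cstep Sg (?k + 1) W (tm_wr V Sg) (tm_mv V Sg) C"
  have C': "?C' j p = (if src W (tm_mv V Sg) \<tau> j p = 0 then tm_wr V Sg \<tau> j else C j (src W (tm_mv V Sg) \<tau> j p))" for j p
    by (simp add: cstep_def \<tau>_def Let_def)
  show "cyclic V W T (tm_step V (q, ts)) ?C'"
    unfolding cyclic_def
  proof (intro conjI allI impI)
    have "src W (tm_mv V Sg) \<tau> ?k 0 = 0" using W0 by (simp add: src_def tm_mv_def)
    then show "?C' ?k 0 = fst (tm_step V (q, ts))" unfolding C' using tr by (simp add: tm_wr_def)
    fix j z assume j: "j < ?k" and z: "- int T \<le> z \<and> z < int W - int T"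
    let ?h = "snd (ts ! j)" let ?d = "dir (snd (acts ! j))"
    have h': "snd (snd (tm_step V (q, ts)) ! j) = ?h + ?d" using nth[OF j] by (simp add: snd_act_tape)
    have mv: "int (tm_mv V Sg \<tau> j) = ?d + 1"
      unfolding tm_mv_def using j tr(1) by (cases "snd (acts ! j)") auto
    define p where "p = nat ((z - (?h + ?d)) mod int W)"
    have ip: "int p = (z - (?h + ?d)) mod int W" unfolding p_def using W0 by simp
    have "int (src W (tm_mv V Sg) \<tau> j p) = (int p + (?d + 1) + int W - 1) mod int W"
    proof -
      have "int (p + tm_mv V Sg \<tau> j + W - 1) = int p + (?d + 1) + int W - 1" using W0 mv by (simp add: of_nat_diff)
      then show ?thesis unfolding src_def by (simp add: zmod_int)
    qed
    also have "\<dots> = (int p + ?d + int W) mod int W" by (simp add: algebra_simps)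
    also have "\<dots> = (int p + ?d) mod int W" by (rule mod_add_self2)
    also have "\<dots> = (z - (?h + ?d) + ?d) mod int W" unfolding ip by (rule mod_add_left_eq)
    also have "\<dots> = (z - ?h) mod int W" by simp
    finally have s: "int (src W (tm_mv V Sg) \<tau> j p) = (z - ?h) mod int W" .
    have hr: "- int T \<le> ?h" "?h < int W - int T" using h[OF j] t W by linarith+
    have "?C' j p = fst (act_tape (ts ! j) (acts ! j)) z"
    proof (cases "z = ?h")
      case True
      then have "src W (tm_mv V Sg) \<tau> j p = 0" using s by simp
      then show ?thesis unfolding C' using True j tr(1) by (simp add: tm_wr_def fst_act_tape)
    next
      case False
      have "(z - ?h) mod int W \<noteq> 0"
      proof
        assume "(z - ?h) mod int W = 0"
        with mod_eq_0_range[of "int T" z "int W" ?h] z hr False show False by simp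
      qed
      then have "src W (tm_mv V Sg) \<tau> j p \<noteq> 0" using s by (metis of_nat_0)
      moreover have "src W (tm_mv V Sg) \<tau> j p = nat ((z - ?h) mod int W)" using s by linarith
      moreover have "C j (nat ((z - ?h) mod int W)) = fst (ts ! j) z"
        using c j z unfolding cyclic_def by simp
      ultimately show ?thesis unfolding C' using False by (simp add: fst_act_tape)
    qed
    then show "?C' j (nat ((z - snd (snd (tm_step V (q, ts)) ! j)) mod int W)) = fst (snd (tm_step V (q, ts)) ! j) z"
      unfolding p_def nth[OF j] snd_act_tape .
  qed
qed

text \<open>The output \<open>[b]\<close> is one cell with symbol 2 or 1 and blanks elsewhere.
  Acceptance is thus the absence of the symbol 1, a condition that is uniform in the index and
  independent of where the head stopped.\<close>

lemma cyclic_accept: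
  assumes V: "turing_machine V" and out: "tm_outputs V w [b] (real T)"
    and W: "2 * T + length w < W" and Sg: "tm_symbols V \<le> Sg" "tm_states V \<le> Sg"
    and C0: "\<And>p. p < W \<Longrightarrow> C 0 p = tape_of w (int p)" "\<And>j p. 1 \<le> j \<Longrightarrow> j \<le> tm_tapes V \<Longrightarrow> p < W \<Longrightarrow> C j p = 0"
  shows "b \<longleftrightarrow> (\<forall>p<W. (cstep Sg (tm_tapes V + 1) W (tm_wr V Sg) (tm_mv V Sg) ^^ T) C (tm_tapes V - 1) p \<noteq> 1)"
proof -
  let ?k = "tm_tapes V"
  let ?D = "\<lambda>t. (cstep Sg (?k + 1) W (tm_wr V Sg) (tm_mv V Sg) ^^ t) C"
  let ?c = "\<lambda>t. (tm_step V ^^ t) (tm_init V w)"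
  have k1: "1 \<le> ?k" using V unfolding turing_machine_def by auto
  have W0: "0 < W" using W by simp
  have inv: "valid_config V (?c t) \<and> cyclic V W T (?c t) (?D t) \<and> (\<forall>j<?k. \<bar>snd (snd (?c t) ! j)\<bar> \<le> int t)" if "t \<le> T" for t
    using that
  proof (induction t)
    case 0
    have "C j (nat ((z - snd (snd (tm_init V w) ! j)) mod int W)) = fst (snd (tm_init V w) ! j) z"
      if j: "j < ?k" and z: "- int T \<le> z" "z < int W - int T" for j z
    proof -
      let ?p = "nat (z mod int W)"
      have p: "?p < W" using W0 by (simp add: nat_less_iff)
      have "tape_of w (int ?p) = tape_of w z"
      proof (cases "0 \<le> z")
        case True
        then show ?thesis using z by simp
      next
        case False
        then have "z mod int W = z + int W"
        proof -
          have "(z + int W) mod int W = z + int W" using False z W by (intro mod_pos_pos_trivial) auto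
          then show ?thesis by simp
        qed
        then show ?thesis using z W False by (simp add: tape_of_def)
      qed
      then show ?thesis using C0(1)[OF p] C0(2)[of j ?p] p j by (cases "j = 0") (simp_all add: nth_init tape_of_def)
    qed
    moreover have "C ?k 0 = 0" using C0(2)[of ?k 0] k1 W0 by simp
    ultimately show ?case using valid_init[OF V, of w] nth_init[of _ V w]
      unfolding cyclic_def by (auto simp: tm_init_def[of V w])
  next
    case (Suc t)
    obtain q ts where qt: "?c t = (q, ts)" by fastforce
    have i: "valid_config V (q, ts)" "cyclic V W T (q, ts) (?D t)" "\<And>j. j < ?k \<Longrightarrow> \<bar>snd (ts ! j)\<bar> \<le> int t"
      using Suc qt by auto
    have "t < T" "2 * T < W" using Suc.prems W by auto
    from cyclic_step[OF V i(1,2,3) this Sg] valid_step[OF V i(1)] qt show ?case by simp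
  qed
  have "\<exists>t::nat. t \<le> T \<and> (case ?c t of (q, ts) \<Rightarrow> q = 1 \<and> fst (last ts) = tape_of [b])"
    using out unfolding tm_outputs_def by simp
  then obtain t where t0: "t \<le> T \<and> (case ?c t of (q, ts) \<Rightarrow> q = 1 \<and> fst (last ts) = tape_of [b])" by (rule exE)
  obtain q0 ts where qt: "?c t = (q0, ts)" by (rule prod.exhaust)
  have t: "t \<le> T" "q0 = 1" "fst (last ts) = tape_of [b]" using t0 by (auto simp: qt)
  have "?c T = (tm_step V ^^ (T - t)) (?c t)"
  proof -
    have "?c T = (tm_step V ^^ (T - t + t)) (tm_init V w)" using t(1) by simp
    then show ?thesis by (simp only: funpow_add comp_apply)
  qed
  then have cT: "?c T = (1, ts)" using qt t(2) by simp
  have i: "cyclic V W T (1, ts) (?D T)" "\<bar>snd (ts ! (?k - 1))\<bar> \<le> int T" "length ts = ?k"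
    using inv[of T] cT k1 by (auto simp: valid_config_def)
  let ?h = "snd (ts ! (?k - 1))"
  have la: "last ts = ts ! (?k - 1)" using i(3) k1 by (subst last_conv_nth) auto
  have D: "?D T (?k - 1) (nat ((z - ?h) mod int W)) = tape_of [b] z" if "- int T \<le> z" "z < int W - int T" for z
    using i(1) that k1 t(3) la unfolding cyclic_def by simp
  show ?thesis
  proof
    assume b
    show "\<forall>p<W. ?D T (?k - 1) p \<noteq> 1"
    proof (intro allI impI)
      fix p assume p: "p < W"
      \<comment> \<open>The position of the window that index \<open>p\<close> represents:
        \<open>p + ?h\<close>, reduced modulo \<open>W\<close> into the range that starts at
        \<open>- T\<close>.\<close>
      define z where "z = (int p + ?h + int T) mod int W - int T"
      have z: "- int T \<le> z" "z < int W - int T" unfolding z_def using W0 by auto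
      have "(z - ?h) mod int W = ((int p + ?h + int T) mod int W - (int T + ?h)) mod int W" unfolding z_def by (simp add: algebra_simps)
      also have "\<dots> = (int p + ?h + int T - (int T + ?h)) mod int W" by (rule mod_diff_left_eq)
      also have "\<dots> = int p" using p by simp
      finally have "?D T (?k - 1) p = tape_of [b] z" using D[OF z] by simp
      then show "?D T (?k - 1) p \<noteq> 1" using \<open>b\<close> by (simp add: tape_of_def)
    qed
  next
    assume a: "\<forall>p<W. ?D T (?k - 1) p \<noteq> 1"
    have "nat ((0 - ?h) mod int W) < W" using W0 by (simp add: nat_less_iff)
    then have "?D T (?k - 1) (nat ((0 - ?h) mod int W)) \<noteq> 1" using a by blast
    moreover have "?D T (?k - 1) (nat ((0 - ?h) mod int W)) = tape_of [b] 0" by (rule D) (use W in auto)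
    ultimately show b by (simp add: tape_of_def split: if_splits)
  qed
qed

section \<open>The tableau as a system of quadratic equations\<close>

text \<open>Coordinate 0 is the constant. \<open>ix\<close> numbers the variables saying that at
  time \<open>t\<close> index \<open>p\<close> of tape \<open>j\<close> carries \<sigma>;
  \<open>iy\<close>, placed behind them, those saying that the symbols at the heads form the number
  \<tau> at time \<open>t\<close>.\<close>

definition ix :: "nat \<Rightarrow> nat \<Rightarrow> nat \<Rightarrow> nat \<Rightarrow> nat \<Rightarrow> nat \<Rightarrow> nat \<Rightarrow> nat" where
  "ix Sg J W t j p \<sigma> = 1 + (((t * J + j) * W + p) * Sg + \<sigma>)"

definition iy :: "nat \<Rightarrow> nat \<Rightarrow> nat \<Rightarrow> nat \<Rightarrow> nat \<Rightarrow> nat \<Rightarrow> nat" where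
  "iy Sg J W T t \<tau> = 1 + (T + 1) * J * W * Sg + (t * Sg ^ J + \<tau>)"

definition nv :: "nat \<Rightarrow> nat \<Rightarrow> nat \<Rightarrow> nat \<Rightarrow> nat" where
  "nv Sg J W T = 1 + (T + 1) * J * W * Sg + T * Sg ^ J"

text \<open>The equation with parameters \<open>f, \<sigma>, p, j, t, \<tau>, a, b\<close> is a sum of the terms \<open>n \<le> Sg ^ J\<close>, each with a
  coefficient code (0, 1, or 2 for \<open>-1\<close>), a row and a column index of the unknown matrix. Families: 0, 1 force a rank one
  solution to be boolean; 2, 3 select the transition; 4 is the step; 5 - 8 are the input with the cells
  \<open>lo \<le> p < hi\<close> left to the certificate; 9 is acceptance.\<close>

definition fc :: "nat \<Rightarrow> nat \<Rightarrow> nat \<Rightarrow> nat \<Rightarrow> nat \<Rightarrow> nat \<Rightarrow> (nat \<Rightarrow> nat \<Rightarrow> nat) \<Rightarrow> (nat \<Rightarrow> nat \<Rightarrow> nat) \<Rightarrow> (nat \<Rightarrow> nat) \<Rightarrow>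
    nat \<Rightarrow> nat \<Rightarrow> nat \<Rightarrow> nat \<Rightarrow> nat \<Rightarrow> nat \<Rightarrow> nat" where
  "fc Sg J W T lo hi wr mv ini f \<sigma> p j t n =
    (if f \<le> 1 then (if n = 0 then 1 else if n = 1 then 2 else 0)
     else if f = 2 then (if t < T then (if n < Sg ^ J then 1 else 2) else 0)
     else if f = 3 then (if t < T then (if n = 0 then 1 else if n = 1 then 2 else 0) else 0)
     else if f = 4 then (if t < T then (if n < Sg ^ J then (if src W mv n j p = 0 \<and> wr n j \<noteq> \<sigma> then 0 else 2) else 1) else 0)
     else if f = 5 then (if j = 0 \<and> lo \<le> p \<and> p < hi then (if n = 0 \<and> 3 \<le> \<sigma> then 1 else 0)
        else if n = 0 then 1 else if n = 1 \<and> \<sigma> = (if j = 0 then ini p else 0) then 2 else 0)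
     else if f = 6 then (if lo \<le> p \<and> p < hi then (if n < 3 then 1 else if n = 3 then 2 else 0) else 0)
     else if f = 7 then (if lo \<le> p \<and> p < hi \<and> n = 0 then 1 else 0)
     else if f = 8 then (if lo \<le> p \<and> p + 1 < hi then (if n = 0 then 1 else if n = 1 then 2 else 0) else 0)
     else (if n = 0 then 1 else 0))"

text \<open>For \<open>X = \<alpha> \<alpha>\<^sup>T\<close> with \<open>\<alpha> 0 = 1\<close> the
  entry \<open>(0, i)\<close> is \<open>\<alpha> i\<close> and \<open>(0, 0)\<close> is 1. Row 0
  therefore yields the linear terms, and \<open>(0, 0)\<close> the constants.\<close>

definition fa :: "nat \<Rightarrow> nat \<Rightarrow> nat \<Rightarrow> nat \<Rightarrow> (nat \<Rightarrow> nat \<Rightarrow> nat) \<Rightarrow>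
    nat \<Rightarrow> nat \<Rightarrow> nat \<Rightarrow> nat \<Rightarrow> nat \<Rightarrow> nat \<Rightarrow> nat \<Rightarrow> nat \<Rightarrow> nat" where
  "fa Sg J W T mv f p j t \<tau> a b n =
    (if f = 0 then (if n = 0 then a else b)
     else if f = 1 then (if n = 0 then a else 0)
     else if f = 3 then (if n = 0 then 0 else iy Sg J W T t \<tau>)
     else if f = 4 then (if n < Sg ^ J \<and> src W mv n j p \<noteq> 0 then iy Sg J W T t n else 0)
     else if f = 7 then ix Sg J W 0 0 p 1
     else if f = 8 then (if n = 0 then 0 else ix Sg J W 0 0 p 0)
     else 0)"

definition fb :: "nat \<Rightarrow> nat \<Rightarrow> nat \<Rightarrow> nat \<Rightarrow> (nat \<Rightarrow> nat \<Rightarrow> nat) \<Rightarrow>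
    nat \<Rightarrow> nat \<Rightarrow> nat \<Rightarrow> nat \<Rightarrow> nat \<Rightarrow> nat \<Rightarrow> nat \<Rightarrow> nat \<Rightarrow> nat \<Rightarrow> nat" where
  "fb Sg J W T mv f \<sigma> p j t \<tau> a b n =
    (if f = 0 then (if n = 0 then b else a)
     else if f = 1 then a
     else if f = 2 then (if n < Sg ^ J then iy Sg J W T t n else 0)
     else if f = 3 then (if n = 0 then iy Sg J W T t \<tau> else ix Sg J W t j 0 (dig Sg \<tau> j))
     else if f = 4 then (if n < Sg ^ J then (if src W mv n j p = 0 then iy Sg J W T t n else ix Sg J W t j (src W mv n j p) \<sigma>)
        else ix Sg J W (t + 1) j p \<sigma>)
     else if f = 5 then (if n = 0 then ix Sg J W 0 j p \<sigma> else 0)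
     else if f = 6 then (if n < 3 then ix Sg J W 0 0 p n else 0)
     else if f = 7 then ix Sg J W 0 0 p 2
     else if f = 8 then (if n = 0 then ix Sg J W 0 0 p 0 else ix Sg J W 0 0 (p + 1) 0)
     else ix Sg J W T (J - 2) p 1)"

definition sgn_of :: "nat \<Rightarrow> 'a::field" where
  "sgn_of c = (if c = 1 then 1 else if c = 2 then - 1 else 0)"

locale tableau =
  fixes Sg J W T lo hi :: nat and wr mv :: "nat \<Rightarrow> nat \<Rightarrow> nat" and ini :: "nat \<Rightarrow> nat"
  assumes Sg: "3 \<le> Sg" and J: "2 \<le> J" and W: "0 < W" and hi: "hi < W"
    and wr: "\<And>\<tau> j. \<tau> < Sg ^ J \<Longrightarrow> j < J \<Longrightarrow> wr \<tau> j < Sg" and ini: "\<And>p. ini p < Sg"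
begin

abbreviation "K \<equiv> Sg ^ J"
abbreviation "X0 \<equiv> ix Sg J W"
abbreviation "Y0 \<equiv> iy Sg J W T"
abbreviation "M \<equiv> nv Sg J W T"

definition val :: "(nat \<Rightarrow> nat \<Rightarrow> 'a::field) \<Rightarrow> nat \<Rightarrow> nat \<Rightarrow> nat \<Rightarrow> nat \<Rightarrow> nat \<Rightarrow> nat \<Rightarrow> nat \<Rightarrow> nat \<Rightarrow> 'a" where
  "val X f \<sigma> p j t \<tau> a b = (\<Sum>n<K + 1. sgn_of (fc Sg J W T lo hi wr mv ini f \<sigma> p j t n) *
     X (fa Sg J W T mv f p j t \<tau> a b n) (fb Sg J W T mv f \<sigma> p j t \<tau> a b n))"

lemma K9: "9 \<le> K"
proof -
  have "(3::nat) ^ 2 \<le> Sg ^ 2" using Sg by (rule power_mono) simp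
  also have "\<dots> \<le> K" using J Sg by (intro power_increasing) auto
  finally show ?thesis by simp
qed

text \<open>All families except 2 and 4 have at most four terms.\<close>

lemma sum_few:
  assumes "\<And>n. 4 \<le> n \<Longrightarrow> g n = (0::'a::field)" shows "(\<Sum>n<K + 1. g n) = g 0 + g 1 + g 2 + g 3"
proof -
  have "(\<Sum>n<K + 1. g n) = (\<Sum>n<4. g n)"
    by (rule sum.mono_neutral_right) (use K9 assms in auto)
  then show ?thesis by (simp add: numeral_eq_Suc)
qed

lemma val:
  "val X 0 \<sigma> p j t \<tau> a b = X a b - X b a"
  "val X 1 \<sigma> p j t \<tau> a b = X a a - X 0 a"
  "t < T \<Longrightarrow> val X 2 \<sigma> p j t \<tau> a b = (\<Sum>n<K. X 0 (Y0 t n)) - X 0 0"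
  "t < T \<Longrightarrow> val X 3 \<sigma> p j t \<tau> a b = X 0 (Y0 t \<tau>) - X (Y0 t \<tau>) (X0 t j 0 (dig Sg \<tau> j))"
  "t < T \<Longrightarrow> val X 4 \<sigma> p j t \<tau> a b = X 0 (X0 (t + 1) j p \<sigma>) - (\<Sum>n<K. if src W mv n j p = 0
      then of_bool (wr n j = \<sigma>) * X 0 (Y0 t n) else X (Y0 t n) (X0 t j (src W mv n j p) \<sigma>))"
  "j \<noteq> 0 \<or> p < lo \<or> hi \<le> p \<Longrightarrow> val X 5 \<sigma> p j t \<tau> a b = X 0 (X0 0 j p \<sigma>) - of_bool (\<sigma> = (if j = 0 then ini p else 0)) * X 0 0"
  "lo \<le> p \<Longrightarrow> p < hi \<Longrightarrow> 3 \<le> \<sigma> \<Longrightarrow> val X 5 \<sigma> p 0 t \<tau> a b = X 0 (X0 0 0 p \<sigma>)"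
  "lo \<le> p \<Longrightarrow> p < hi \<Longrightarrow> val X 6 \<sigma> p j t \<tau> a b = X 0 (X0 0 0 p 0) + X 0 (X0 0 0 p 1) + X 0 (X0 0 0 p 2) - X 0 0"
  "lo \<le> p \<Longrightarrow> p < hi \<Longrightarrow> val X 7 \<sigma> p j t \<tau> a b = X (X0 0 0 p 1) (X0 0 0 p 2)"
  "lo \<le> p \<Longrightarrow> p + 1 < hi \<Longrightarrow> val X 8 \<sigma> p j t \<tau> a b = X 0 (X0 0 0 p 0) - X (X0 0 0 p 0) (X0 0 0 (p + 1) 0)"
  "val X 9 \<sigma> p j t \<tau> a b = X 0 (X0 T (J - 2) p 1)"
  unfolding val_def
  subgoal by (subst sum_few) (simp_all add: fc_def fa_def fb_def sgn_of_def)
  subgoal by (subst sum_few) (simp_all add: fc_def fa_def fb_def sgn_of_def)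
  subgoal by (simp add: fc_def fa_def fb_def sgn_of_def)
  subgoal by (subst sum_few) (simp_all add: fc_def fa_def fb_def sgn_of_def)
  subgoal
  proof -
    assume t: "t < T"
    let ?g = "\<lambda>n. sgn_of (fc Sg J W T lo hi wr mv ini 4 \<sigma> p j t n) * X (fa Sg J W T mv 4 p j t \<tau> a b n) (fb Sg J W T mv 4 \<sigma> p j t \<tau> a b n)"
    let ?h = "\<lambda>n. if src W mv n j p = 0 then of_bool (wr n j = \<sigma>) * X 0 (Y0 t n) else X (Y0 t n) (X0 t j (src W mv n j p) \<sigma>)"
    have "(\<Sum>n<K. ?g n) = (\<Sum>n<K. - ?h n)"
      by (rule sum.cong[OF refl]) (use t in \<open>simp add: fc_def fa_def fb_def sgn_of_def\<close>)
    moreover have "?g K = X 0 (X0 (t + 1) j p \<sigma>)" using t by (simp add: fc_def fa_def fb_def sgn_of_def)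
    ultimately have "(\<Sum>n<K. ?g n) + ?g K = X 0 (X0 (t + 1) j p \<sigma>) - (\<Sum>n<K. ?h n)"
      by (simp only: sum_negf) simp
    then show ?thesis by simp
  qed
  subgoal by (subst sum_few) (auto simp: fc_def fa_def fb_def sgn_of_def)
  subgoal by (subst sum_few) (auto simp: fc_def fa_def fb_def sgn_of_def)
  subgoal by (subst sum_few) (auto simp: fc_def fa_def fb_def sgn_of_def)
  subgoal by (subst sum_few) (auto simp: fc_def fa_def fb_def sgn_of_def)
  subgoal by (subst sum_few) (auto simp: fc_def fa_def fb_def sgn_of_def)
  subgoal by (subst sum_few) (auto simp: fc_def fa_def fb_def sgn_of_def)
  done

lemma val_trivial:
  "\<not> t < T \<Longrightarrow> val X 2 \<sigma> p j t \<tau> a b = 0" "\<not> t < T \<Longrightarrow> val X 3 \<sigma> p j t \<tau> a b = 0" "\<not> t < T \<Longrightarrow> val X 4 \<sigma> p j t \<tau> a b = 0"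
  "lo \<le> p \<Longrightarrow> p < hi \<Longrightarrow> \<sigma> < 3 \<Longrightarrow> val X 5 \<sigma> p 0 t \<tau> a b = 0"
  "p < lo \<or> hi \<le> p \<Longrightarrow> val X 6 \<sigma> p j t \<tau> a b = 0" "p < lo \<or> hi \<le> p \<Longrightarrow> val X 7 \<sigma> p j t \<tau> a b = 0"
  "p < lo \<or> hi \<le> p + 1 \<Longrightarrow> val X 8 \<sigma> p j t \<tau> a b = 0"
  unfolding val_def by (auto simp: fc_def sgn_of_def intro!: sum.neutral)

text \<open>The last two conditions say that the free cells hold a bit string followed by blanks: no
  symbol above 2 occurs, and a blank is followed only by blanks. So certificates of every length up
  to \<open>hi - lo\<close> are covered.\<close>

definition valid_start :: "(nat \<Rightarrow> nat \<Rightarrow> nat) \<Rightarrow> bool" where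
  "valid_start C \<longleftrightarrow> (\<forall>p<W. p < lo \<or> hi \<le> p \<longrightarrow> C 0 p = ini p) \<and> (\<forall>j p. 1 \<le> j \<and> j < J \<and> p < W \<longrightarrow> C j p = 0) \<and>
     (\<forall>p. lo \<le> p \<and> p < hi \<longrightarrow> C 0 p < 3) \<and> (\<forall>p. lo \<le> p \<and> p + 1 < hi \<and> C 0 p = 0 \<longrightarrow> C 0 (p + 1) = 0)"

lemma valid_start_less:
  assumes "valid_start C" "j < J" "p < W" shows "C j p < Sg"
proof -
  consider "1 \<le> j" | "j = 0" "lo \<le> p" "p < hi" | "j = 0" "p < lo \<or> hi \<le> p" by linarith
  then show ?thesis
  proof cases
    case 1
    then have "C j p = 0" using assms unfolding valid_start_def by simp
    then show ?thesis using Sg by simp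
  next
    case 2
    then have "C j p < 3" using assms unfolding valid_start_def by simp
    then show ?thesis using Sg by simp
  next
    case 3
    then have "C j p = ini p" using assms unfolding valid_start_def by auto
    then show ?thesis using ini by simp
  qed
qed

abbreviation "run_c C t \<equiv> (cstep Sg J W wr mv ^^ t) C"

lemma run_c_Suc:
  "run_c C (Suc t) j p = (if src W mv (tau Sg J (run_c C t)) j p = 0 then wr (tau Sg J (run_c C t)) j
     else run_c C t j (src W mv (tau Sg J (run_c C t)) j p))"
proof -
  have "run_c C (Suc t) j p = cstep Sg J W wr mv (run_c C t) j p" by simp
  then show ?thesis by (simp only: cstep_def[of Sg J W wr mv "run_c C t"] Let_def)
qed

lemma run_c_less: "valid_start C \<Longrightarrow> j < J \<Longrightarrow> p < W \<Longrightarrow> run_c C t j p < Sg"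
proof (induction t arbitrary: j p)
  case (Suc t)
  have "tau Sg J (run_c C t) < K" by (rule tau(1)) (use Suc W Sg in auto)
  from wr[OF this Suc.prems(2)] Suc.IH[OF Suc.prems(1,2), of "src W mv (tau Sg J (run_c C t)) j p"]
  show ?case unfolding run_c_Suc using W by (simp add: src_def)
qed (simp add: valid_start_less)

lemma sum_select: "x < K \<Longrightarrow> (\<Sum>n<K. if n = x then g n else (0::'a::field)) = g x"
  by simp

text \<open>Families 5 to 8 give every cell of time 0 exactly one symbol. By induction on time,
  families 2 and 3 leave only the correct transition number, and family 4 then copies the computed
  successor.\<close>

lemma tableau_sound:
  fixes \<alpha> :: "nat \<Rightarrow> bool"
  defines "X \<equiv> \<lambda>a b. of_bool (\<alpha> a) * of_bool (\<alpha> b) :: 'a::field"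
  assumes a0: "\<alpha> 0"
    and eqs: "\<And>f \<sigma> p j t \<tau>. f < 10 \<Longrightarrow> \<sigma> < Sg \<Longrightarrow> p < W \<Longrightarrow> j < J \<Longrightarrow> t < T + 1 \<Longrightarrow> \<tau> < K \<Longrightarrow> val X f \<sigma> p j t \<tau> 0 0 = 0"
  obtains C where "valid_start C" "\<forall>p<W. run_c C T (J - 2) p \<noteq> 1"
proof -
  have X0: "X 0 a = of_bool (\<alpha> a)" for a using a0 by (simp add: X_def)
  have K0: "0 < K" and Sg0: "0 < Sg" and J0: "0 < J" using K9 Sg J by linarith+
  define C where "C j p = (SOME \<sigma>. \<sigma> < Sg \<and> \<alpha> (X0 0 j p \<sigma>))" for j p
  have plain: "\<alpha> (X0 0 j p \<sigma>) \<longleftrightarrow> \<sigma> = (if j = 0 then ini p else 0)"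
    if "j < J" "p < W" "\<sigma> < Sg" "j \<noteq> 0 \<or> p < lo \<or> hi \<le> p" for j p \<sigma>
    using eqs[of 5 \<sigma> p j 0 0] that K0 val(6)[OF that(4), of X \<sigma> 0 0 0 0] by (simp add: X0 a0 of_bool_eq_iff split: if_splits)
  have cert: "\<not> \<alpha> (X0 0 0 p \<sigma>)" if "lo \<le> p" "p < hi" "3 \<le> \<sigma>" "\<sigma> < Sg" for p \<sigma>
    using eqs[of 5 \<sigma> p 0 0 0] that K0 J0 hi val(7)[OF that(1-3), of X 0 0 0 0] by (simp add: X0)
  have cert1: "\<not> (\<alpha> (X0 0 0 p 1) \<and> \<alpha> (X0 0 0 p 2))"
     "(of_bool (\<alpha> (X0 0 0 p 0)) + of_bool (\<alpha> (X0 0 0 p 1)) + of_bool (\<alpha> (X0 0 0 p 2)) :: 'a) = 1" if "lo \<le> p" "p < hi" for p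
    using eqs[of 7 0 p 0 0 0] eqs[of 6 0 p 0 0 0] that K0 J0 Sg0 hi val(8,9)[OF that, of X 0 0 0 0 0 0] by (simp_all add: X_def a0)
  \<comment> \<open>Family 6 adds truth values in the field, where in characteristic 2 three ones
    also have sum 1. Family 7 excludes that symbols 1 and 2 occur together, so at most two ones
    remain, and \<open>2\<close> differs from \<open>1\<close> in every field.\<close>
  have two: "(2 :: 'a) \<noteq> 1"
  proof
    assume "(2 :: 'a) = 1"
    then have "1 + 1 = 1 + (0 :: 'a)" by simp
    then have "1 = (0 :: 'a)" by (rule add_left_imp_eq)
    then show False by simp
  qed
  have uniq: "\<exists>s<Sg. \<forall>\<sigma><Sg. \<alpha> (X0 0 j p \<sigma>) \<longleftrightarrow> \<sigma> = s" if jp: "j < J" "p < W" for j p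
  proof (cases "j = 0 \<and> lo \<le> p \<and> p < hi")
    case False
    then have "j \<noteq> 0 \<or> p < lo \<or> hi \<le> p" by auto
    then show ?thesis using plain jp Sg0 ini[of p] by (intro exI[of _ "if j = 0 then ini p else 0"]) auto
  next
    case True
    define s where "s = (if \<alpha> (X0 0 0 p 1) then 1 else if \<alpha> (X0 0 0 p 2) then 2 else 0 :: nat)"
    have "\<alpha> (X0 0 0 p \<sigma>) \<longleftrightarrow> \<sigma> = s" if "\<sigma> < Sg" for \<sigma>
    proof (cases "3 \<le> \<sigma>")
      case False
      then consider "\<sigma> = 0" | "\<sigma> = 1" | "\<sigma> = 2" by linarith
      then show ?thesis using cert1[of p] True two by cases (auto simp: s_def split: if_splits)
    qed (use cert[of p \<sigma>] True that in \<open>auto simp: s_def\<close>)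
    moreover have "s < Sg" using Sg by (simp add: s_def)
    ultimately show ?thesis using True by blast
  qed
  have C: "C j p < Sg \<and> (\<forall>\<sigma><Sg. \<alpha> (X0 0 j p \<sigma>) \<longleftrightarrow> \<sigma> = C j p)" if jp: "j < J" "p < W" for j p
  proof -
    obtain s where s: "s < Sg" "\<And>\<sigma>. \<sigma> < Sg \<Longrightarrow> \<alpha> (X0 0 j p \<sigma>) \<longleftrightarrow> \<sigma> = s" using uniq[OF jp] by blast
    then have "C j p = s" unfolding C_def by (intro some_equality) auto
    then show ?thesis using s by auto
  qed
  have start: "valid_start C"
    unfolding valid_start_def
  proof (intro conjI allI impI)
    fix p assume "p < W" "p < lo \<or> hi \<le> p"
    then show "C 0 p = ini p" using plain[of 0 p "ini p"] C[of 0 p] J0 ini[of p] by auto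
  next
    fix j p assume jp: "1 \<le> j \<and> j < J \<and> p < W"
    then show "C j p = 0" using plain[of j p 0] C[of j p] Sg0 by auto
  next
    fix p assume p: "lo \<le> p \<and> p < hi"
    show "C 0 p < 3"
    proof (rule ccontr)
      assume "\<not> C 0 p < 3"
      then show False using cert[of p "C 0 p"] C[of 0 p] p J0 hi by auto
    qed
  next
    fix p assume p: "lo \<le> p \<and> p + 1 < hi \<and> C 0 p = 0"
    have "\<alpha> (X0 0 0 p 0)" using C[of 0 p] p J0 Sg0 hi by auto
    then have "\<alpha> (X0 0 0 (p + 1) 0)"
      using eqs[of 8 0 p 0 0 0] p K0 J0 Sg0 hi val(10)[of p X 0 0 0 0 0 0] by (simp add: X_def a0 of_bool_eq_iff)
    then show "C 0 (p + 1) = 0" using C[of 0 "p + 1"] p J0 Sg0 hi by auto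
  qed
  have inv: "\<forall>j<J. \<forall>p<W. \<forall>\<sigma><Sg. \<alpha> (X0 t j p \<sigma>) \<longleftrightarrow> \<sigma> = run_c C t j p" if "t \<le> T" for t
    using that
  proof (induction t)
    case 0
    then show ?case using C by simp
  next
    case (Suc t)
    have t: "t < T" using Suc.prems by simp
    let ?D = "run_c C t" let ?x = "tau Sg J ?D"
    have IH: "\<alpha> (X0 t j p \<sigma>) \<longleftrightarrow> \<sigma> = ?D j p" if "j < J" "p < W" "\<sigma> < Sg" for j p \<sigma>
      using Suc that by simp
    have Dl: "?D j p < Sg" if "j < J" "p < W" for j p using run_c_less[OF start that] .
    have x: "?x < K" "\<And>j. j < J \<Longrightarrow> dig Sg ?x j = ?D j 0" using tau[of J ?D Sg] Dl W Sg0 by auto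
    \<comment> \<open>By family 3 a true transition variable has the digits of the cells at the
      heads. So at most one term of the sum in family 2 is nonzero, and the sum forces it to be true
      in any characteristic.\<close>
    have yx: "n = ?x" if "n < K" "\<alpha> (Y0 t n)" for n
    proof (rule dig_unique[OF that(1) x(1)])
      fix j assume j: "j < J"
      have "\<alpha> (X0 t j 0 (dig Sg n j))"
        using eqs[of 3 0 0 j t n] val(4)[OF t, of X 0 0 j n 0 0] that j t W Sg0 by (simp add: X_def a0 of_bool_eq_iff)
      then show "dig Sg n j = dig Sg ?x j" using IH[OF j W dig_less[OF Sg0]] x(2)[OF j] by simp
    qed
    have y: "\<alpha> (Y0 t n) \<longleftrightarrow> n = ?x" if "n < K" for n
    proof
      assume "n = ?x"
      have one: "(\<Sum>n<K. of_bool (\<alpha> (Y0 t n)) :: 'a) = 1"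
        using eqs[of 2 0 0 0 t 0] val(3)[OF t, of X 0 0 0 0 0 0] t W Sg0 J0 K0 by (simp add: X0 a0)
      have "(\<Sum>n<K. of_bool (\<alpha> (Y0 t n)) :: 'a) = (\<Sum>n<K. if n = ?x then of_bool (\<alpha> (Y0 t n)) else 0)"
        by (rule sum.cong[OF refl]) (use yx in auto)
      also have "\<dots> = of_bool (\<alpha> (Y0 t ?x))" using x(1) by (rule sum_select)
      finally have "of_bool (\<alpha> (Y0 t ?x)) = (1 :: 'a)" using one by (simp only:)
      then show "\<alpha> (Y0 t n)" using \<open>n = ?x\<close> by (simp split: if_splits)
    qed (use yx that in blast)
    show ?case
    proof (intro allI impI)
      fix j p \<sigma> assume j: "j < J" "p < W" "\<sigma> < Sg"
      let ?s = "\<lambda>n. src W mv n j p"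
      have sW: "?s n < W" for n using W by (simp add: src_def)
      have "of_bool (\<alpha> (X0 (t + 1) j p \<sigma>)) = (\<Sum>n<K. if ?s n = 0 then of_bool (wr n j = \<sigma>) * X 0 (Y0 t n) else X (Y0 t n) (X0 t j (?s n) \<sigma>))"
        using eqs[of 4 \<sigma> p j t 0] val(5)[OF t, of X \<sigma> p j 0 0 0] j t K0 by (simp add: X0)
      also have "\<dots> = (\<Sum>n<K. if n = ?x then (if ?s n = 0 then of_bool (wr n j = \<sigma>) else of_bool (\<sigma> = ?D j (?s n))) else 0)"
      proof (rule sum.cong[OF refl])
        fix n assume "n \<in> {..<K}"
        then show "(if ?s n = 0 then of_bool (wr n j = \<sigma>) * X 0 (Y0 t n) else X (Y0 t n) (X0 t j (?s n) \<sigma>)) =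
          (if n = ?x then (if ?s n = 0 then of_bool (wr n j = \<sigma>) else of_bool (\<sigma> = ?D j (?s n))) else 0)"
          using y[of n] IH[OF j(1) sW j(3), of n] by (auto simp: X0 X_def a0)
      qed
      also have "\<dots> = (if ?s ?x = 0 then of_bool (wr ?x j = \<sigma>) else of_bool (\<sigma> = ?D j (?s ?x)))"
        by (rule sum_select[OF x(1)])
      also have "\<dots> = of_bool (\<sigma> = run_c C (Suc t) j p)" unfolding run_c_Suc by simp
      finally show "\<alpha> (X0 (Suc t) j p \<sigma>) \<longleftrightarrow> \<sigma> = run_c C (Suc t) j p" by (simp only: of_bool_eq_iff Suc_eq_plus1)
    qed
  qed
  have "run_c C T (J - 2) p \<noteq> 1" if p: "p < W" for p
  proof
    assume "run_c C T (J - 2) p = 1"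
    moreover have "J - 2 < J" "1 < Sg" using J Sg by auto
    ultimately have "\<alpha> (X0 T (J - 2) p 1)" using inv[of T] p by simp
    moreover have "val X 9 0 p 0 0 0 0 0 = 0" by (rule eqs) (use p K0 Sg0 J0 in auto)
    ultimately show False using val(11)[of X 0 p 0 0 0 0 0] by (simp add: X0)
  qed
  then show thesis using that start by blast
qed

lemma ix_less: "t < T + 1 \<Longrightarrow> j < J \<Longrightarrow> p < W \<Longrightarrow> \<sigma> < Sg \<Longrightarrow> ((t * J + j) * W + p) * Sg + \<sigma> < (T + 1) * J * W * Sg"
proof -
  have *: "x * B + y < A * B" if "x < A" "y < B" for x y A B :: nat
  proof -
    have "x * B + y < Suc x * B" using that(2) by simp
    also have "\<dots> \<le> A * B" using that(1) by (intro mult_le_mono1) simp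
    finally show ?thesis .
  qed
  assume "t < T + 1" "j < J" "p < W" "\<sigma> < Sg"
  then show ?thesis by (intro *)
qed

lemma iy_less: "t < T \<Longrightarrow> \<tau> < K \<Longrightarrow> t * K + \<tau> < T * K"
proof -
  assume "t < T" "\<tau> < K"
  then have "t * K + \<tau> < Suc t * K" by simp
  also have "\<dots> \<le> T * K" using \<open>t < T\<close> by (intro mult_le_mono1) simp
  finally show ?thesis .
qed

text \<open>The assignment is the computation itself: divisions and remainders invert the numbering
  \<open>ix\<close> and \<open>iy\<close>, and the cut at \<open>M\<close> makes it vanish outside
  the matrix.\<close>

lemma tableau_complete:
  assumes start: "valid_start C" and acc: "\<forall>p<W. run_c C T (J - 2) p \<noteq> 1"
  obtains \<alpha> where "\<alpha> 0" "\<And>i. \<alpha> i \<Longrightarrow> i < M" "\<And>f \<sigma> p j t \<tau> a b. f < 10 \<Longrightarrow> \<sigma> < Sg \<Longrightarrow> p < W \<Longrightarrow> j < J \<Longrightarrow> t < T + 1 \<Longrightarrow> \<tau> < K \<Longrightarrow>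
      val (\<lambda>a b. of_bool (\<alpha> a) * of_bool (\<alpha> b) :: 'a::field) f \<sigma> p j t \<tau> a b = 0"
proof -
  let ?B = "(T + 1) * J * W * Sg"
  define \<alpha> where "\<alpha> i \<longleftrightarrow> i < M \<and> (i = 0 \<or> (if i - 1 < ?B
      then (i - 1) mod Sg = run_c C ((i - 1) div Sg div W div J) ((i - 1) div Sg div W mod J) ((i - 1) div Sg mod W)
      else (i - 1 - ?B) mod K = tau Sg J (run_c C ((i - 1 - ?B) div K))))" for i
  have a0: "\<alpha> 0" by (simp add: \<alpha>_def nv_def)
  have aM: "\<alpha> i \<Longrightarrow> i < M" for i by (simp add: \<alpha>_def)
  have aX: "\<alpha> (X0 t j p \<sigma>) \<longleftrightarrow> \<sigma> = run_c C t j p" if "t < T + 1" "j < J" "p < W" "\<sigma> < Sg" for t j p \<sigma>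
  proof -
    let ?i = "((t * J + j) * W + p) * Sg + \<sigma>"
    have "?i mod Sg = \<sigma>" "?i div Sg = (t * J + j) * W + p" using that by auto
    moreover have "((t * J + j) * W + p) mod W = p" "((t * J + j) * W + p) div W = t * J + j" using that by auto
    moreover have "(t * J + j) mod J = j" "(t * J + j) div J = t" using that by auto
    ultimately show ?thesis using ix_less[OF that] by (simp add: \<alpha>_def ix_def nv_def)
  qed
  have aY: "\<alpha> (Y0 t \<tau>) \<longleftrightarrow> \<tau> = tau Sg J (run_c C t)" if "t < T" "\<tau> < K" for t \<tau>
  proof -
    have "0 < K" using K9 by linarith
    then have "(t * K + \<tau>) mod K = \<tau>" "(t * K + \<tau>) div K = t" using that by (simp_all add: div_mult_self3)
    then show ?thesis using iy_less[OF that] by (simp add: \<alpha>_def iy_def nv_def)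
  qed
  define X :: "nat \<Rightarrow> nat \<Rightarrow> 'a" where "X = (\<lambda>a b. of_bool (\<alpha> a) * of_bool (\<alpha> b))"
  have X0: "X 0 a = of_bool (\<alpha> a)" for a using a0 by (simp add: X_def)
  have Sg0: "0 < Sg" and J0: "0 < J" using Sg J by linarith+
  have Dl: "run_c C t j p < Sg" if "j < J" "p < W" for t j p using run_c_less[OF start that] .
  have x: "tau Sg J (run_c C t) < K" "\<And>j. j < J \<Longrightarrow> dig Sg (tau Sg J (run_c C t)) j = run_c C t j 0" for t
    using tau[of J "run_c C t" Sg] Dl W Sg0 by auto
  have "val X f \<sigma> p j t \<tau> a b = 0"
    if f: "f < 10" and r: "\<sigma> < Sg" "p < W" "j < J" "t < T + 1" "\<tau> < K" for f \<sigma> p j t \<tau> a b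
  proof -
    let ?x = "tau Sg J (run_c C t)"
    consider "f = 0" | "f = 1" | "f = 2" | "f = 3" | "f = 4" | "f = 5" | "f = 6" | "f = 7" | "f = 8" | "f = 9"
      using f by (auto simp: numeral_eq_Suc less_Suc_eq)
    then show ?thesis
    proof cases
      case 1 then show ?thesis by (simp add: val X_def mult.commute)
    next
      case 2 then show ?thesis unfolding 2 val(2) by (auto simp: X_def a0)
    next
      case 3
      show ?thesis
      proof (cases "t < T")
        case True
        have "(\<Sum>n<K. X 0 (Y0 t n)) = (\<Sum>n<K. if n = ?x then 1 else 0)"
          by (rule sum.cong[OF refl]) (use aY[OF True] in \<open>auto simp: X0\<close>)
        also have "\<dots> = 1" using x(1) by (rule sum_select)
        finally show ?thesis unfolding 3 val(3)[OF True] by (simp add: X0 a0)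
      qed (simp add: 3 val_trivial)
    next
      case 4
      show ?thesis
      proof (cases "t < T")
        case True
        have "\<alpha> (X0 t j 0 (run_c C t j 0))" using aX[OF r(4,3) W Dl[OF r(3) W]] by simp
        then have "\<alpha> (Y0 t \<tau>) \<Longrightarrow> \<alpha> (X0 t j 0 (dig Sg \<tau> j))"
          using aY[OF True r(5)] x(2)[OF r(3), of t] by simp
        then show ?thesis unfolding 4 val(4)[OF True] by (auto simp: X_def a0)
      qed (simp add: 4 val_trivial)
    next
      case 5
      show ?thesis
      proof (cases "t < T")
        case True
        let ?s = "\<lambda>n. src W mv n j p"
        have sW: "?s n < W" for n using W by (simp add: src_def)
        have "(\<Sum>n<K. if ?s n = 0 then of_bool (wr n j = \<sigma>) * X 0 (Y0 t n) else X (Y0 t n) (X0 t j (?s n) \<sigma>)) =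
          (\<Sum>n<K. if n = ?x then (if ?s n = 0 then of_bool (wr n j = \<sigma>) else of_bool (\<sigma> = run_c C t j (?s n))) else 0)"
        proof (rule sum.cong[OF refl])
          fix n assume "n \<in> {..<K}"
          then show "(if ?s n = 0 then of_bool (wr n j = \<sigma>) * X 0 (Y0 t n) else X (Y0 t n) (X0 t j (?s n) \<sigma>)) =
            (if n = ?x then (if ?s n = 0 then of_bool (wr n j = \<sigma>) else of_bool (\<sigma> = run_c C t j (?s n))) else 0)"
            using aY[OF True, of n] aX[OF r(4,3) sW r(1), of n] by (auto simp: X0 X_def a0)
        qed
        also have "\<dots> = (if ?s ?x = 0 then of_bool (wr ?x j = \<sigma>) else of_bool (\<sigma> = run_c C t j (?s ?x)))"
          using x(1) by (rule sum_select)
        also have "\<dots> = of_bool (\<sigma> = run_c C (Suc t) j p)" unfolding run_c_Suc by simp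
        also have "\<dots> = X 0 (X0 (t + 1) j p \<sigma>)" using aX[of "t + 1" j p \<sigma>] True r by (simp add: X0)
        finally show ?thesis unfolding 5 val(5)[OF True] by simp
      qed (simp add: 5 val_trivial)
    next
      case 6
      have a: "\<alpha> (X0 0 j p \<sigma>) \<longleftrightarrow> \<sigma> = C j p" using aX[of 0 j p \<sigma>] r by simp
      show ?thesis
      proof (cases "j = 0 \<and> lo \<le> p \<and> p < hi")
        case True
        show ?thesis
        proof (cases "\<sigma> < 3")
          case False
          then have "C 0 p \<noteq> \<sigma>" using start True unfolding valid_start_def by auto
          then have "X 0 (X0 0 0 p \<sigma>) = 0" using a True by (simp add: X0)
          then show ?thesis using val(7)[of p \<sigma> X t \<tau> a b] True False 6 by simp
        qed (use True 6 in \<open>simp add: val_trivial(4)\<close>)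
      next
        case False
        then have n: "j \<noteq> 0 \<or> p < lo \<or> hi \<le> p" by auto
        then have "C j p = (if j = 0 then ini p else 0)" using start r unfolding valid_start_def by auto
        then show ?thesis using val(6)[OF n, of X \<sigma> t \<tau> a b] a 6 by (simp add: X0 a0)
      qed
    next
      case 7
      show ?thesis
      proof (cases "lo \<le> p \<and> p < hi")
        case True
        then have c3: "C 0 p < 3" using start unfolding valid_start_def by auto
        have "\<alpha> (X0 0 0 p s) \<longleftrightarrow> s = C 0 p" if "s < 3" for s using aX[of 0 0 p s] r J0 Sg that by simp
        then have e: "X 0 (X0 0 0 p 0) = of_bool (C 0 p = 0)" "X 0 (X0 0 0 p 1) = of_bool (C 0 p = 1)"
            "X 0 (X0 0 0 p 2) = of_bool (C 0 p = 2)" by (auto simp: X0)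
        have "C 0 p = 0 \<or> C 0 p = 1 \<or> C 0 p = 2" using c3 by linarith
        then have "X 0 (X0 0 0 p 0) + X 0 (X0 0 0 p 1) + X 0 (X0 0 0 p 2) = 1" unfolding e by (elim disjE) simp_all
        then show ?thesis using val(8)[of p X \<sigma> j t \<tau> a b] True 7 by (simp add: X0 a0)
      qed (use 7 in \<open>auto simp: val_trivial(5) not_le not_less\<close>)
    next
      case 8
      show ?thesis
      proof (cases "lo \<le> p \<and> p < hi")
        case True
        have "\<alpha> (X0 0 0 p s) \<longleftrightarrow> s = C 0 p" if "s < 3" for s using aX[of 0 0 p s] r J0 Sg that by simp
        then have "X (X0 0 0 p 1) (X0 0 0 p 2) = 0" by (simp add: X_def)
        then show ?thesis using val(9)[of p X \<sigma> j t \<tau> a b] True 8 by simp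
      qed (use 8 in \<open>auto simp: val_trivial(6) not_le not_less\<close>)
    next
      case 9
      show ?thesis
      proof (cases "lo \<le> p \<and> p + 1 < hi")
        case True
        then have "C 0 p = 0 \<Longrightarrow> C 0 (p + 1) = 0" using start unfolding valid_start_def by auto
        moreover have "\<alpha> (X0 0 0 p 0) \<longleftrightarrow> 0 = C 0 p" "\<alpha> (X0 0 0 (p + 1) 0) \<longleftrightarrow> 0 = C 0 (p + 1)"
          using aX[of 0 0 p 0] aX[of 0 0 "p + 1" 0] r J0 Sg0 True hi by simp_all
        ultimately show ?thesis using val(10)[of p X \<sigma> j t \<tau> a b] True 9 by (auto simp: X_def a0)
      qed (use 9 in \<open>auto simp: val_trivial(7) not_le not_less\<close>)
    next
      case 10
      have "\<alpha> (X0 T (J - 2) p 1) \<longleftrightarrow> 1 = run_c C T (J - 2) p" by (rule aX) (use r J Sg in auto)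
      then have "\<not> \<alpha> (X0 T (J - 2) p 1)" using acc r(2) by metis
      then show ?thesis unfolding 10 val(11) by (simp add: X0)
    qed
  qed
  note v = this
  show thesis by (rule that[of \<alpha>]) (simp_all add: a0 aM v[unfolded X_def])
qed

end

lemma divmod_code:
  fixes x y :: nat
  assumes "x < A" shows "(x + A * y) mod A = x" "(x + A * y) div A = y" "y < B \<Longrightarrow> x + A * y < A * B"
proof -
  show "(x + A * y) mod A = x" "(x + A * y) div A = y" using assms by simp_all
  assume "y < B"
  then have "A * Suc y \<le> A * B" by (intro mult_le_mono2) simp
  then show "x + A * y < A * B" using assms by simp
qed

text \<open>The parameters of an equation are the mixed radix digits of its number.\<close>

definition eqn :: "nat \<Rightarrow> nat \<Rightarrow> nat \<Rightarrow> nat \<Rightarrow> nat \<Rightarrow> nat \<Rightarrow> (nat \<Rightarrow> nat \<Rightarrow> nat) \<Rightarrow> (nat \<Rightarrow> nat \<Rightarrow> nat) \<Rightarrow> (nat \<Rightarrow> nat) \<Rightarrow>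
    nat \<Rightarrow> nat \<Rightarrow> nat \<Rightarrow> 'a::field" where
  "eqn Sg J W T lo hi wr mv ini e a' b' =
    (let f = e mod 10; e = e div 10; \<sigma> = e mod Sg; e = e div Sg; p = e mod W; e = e div W; j = e mod J; e = e div J;
       t = e mod (T + 1); e = e div (T + 1); \<tau> = e mod Sg ^ J; e = e div Sg ^ J;
       a = e mod nv Sg J W T; b = e div nv Sg J W T
     in \<Sum>n<Sg ^ J + 1. if fa Sg J W T mv f p j t \<tau> a b n = a' \<and> fb Sg J W T mv f \<sigma> p j t \<tau> a b n = b'
          then sgn_of (fc Sg J W T lo hi wr mv ini f \<sigma> p j t n) else 0)"

definition neq :: "nat \<Rightarrow> nat \<Rightarrow> nat \<Rightarrow> nat \<Rightarrow> nat" where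
  "neq Sg J W T = 10 * (Sg * (W * (J * ((T + 1) * (Sg ^ J * (nv Sg J W T * nv Sg J W T))))))"

lemma sum_pair_select:
  fixes X :: "nat \<Rightarrow> nat \<Rightarrow> 'a::field"
  shows "(\<Sum>a<m. \<Sum>b<m. (if x = a \<and> y = b then c else 0) * X a b) = c * (if x < m \<and> y < m then X x y else 0)"
proof -
  have "(\<Sum>b<m. (if x = a \<and> y = b then c else 0) * X a b) = (if a = x then (if y < m then c * X x y else 0) else 0)" for a
  proof -
    have "(\<Sum>b<m. (if x = a \<and> y = b then c else 0) * X a b) = (\<Sum>b<m. if b = y then (if a = x then c * X x y else 0) else 0)"
      by (rule sum.cong[OF refl]) auto
    then show ?thesis by simp
  qed
  then have "(\<Sum>a<m. \<Sum>b<m. (if x = a \<and> y = b then c else 0) * X a b) =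
      (\<Sum>a<m. if a = x then (if y < m then c * X x y else 0) else 0)" by (simp only:)
  also have "\<dots> = (if x < m then if y < m then c * X x y else 0 else 0)" by (simp only: sum.delta finite_lessThan lessThan_iff)
  finally show ?thesis by auto
qed

section \<open>The tableau equations as linear forms in the matrix entries\<close>

context tableau
begin

text \<open>A term whose indices lie outside the \<open>M\<close> by \<open>M\<close> matrix
  contributes nothing to the sum over its entries. Extending \<open>X\<close> by zero lets
  \<open>val\<close> see the same.\<close>

definition trunc :: "(nat \<Rightarrow> nat \<Rightarrow> 'a::field) \<Rightarrow> nat \<Rightarrow> nat \<Rightarrow> 'a" where
  "trunc X a b = (if a < M \<and> b < M then X a b else 0)"

abbreviation "eqs \<equiv> eqn Sg J W T lo hi wr mv ini"

abbreviation "num f \<sigma> p j t \<tau> a b \<equiv> f + 10 * (\<sigma> + Sg * (p + W * (j + J * (t + (T + 1) * (\<tau> + K * (a + M * b))))))"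

lemma eqs_val:
  fixes X :: "nat \<Rightarrow> nat \<Rightarrow> 'a::field"
  shows "(\<Sum>a'<M. \<Sum>b'<M. eqs e a' b' * X a' b') = val (trunc X) (e mod 10) (e div 10 mod Sg) (e div 10 div Sg mod W)
     (e div 10 div Sg div W mod J) (e div 10 div Sg div W div J mod (T + 1)) (e div 10 div Sg div W div J div (T + 1) mod K)
     (e div 10 div Sg div W div J div (T + 1) div K mod M) (e div 10 div Sg div W div J div (T + 1) div K div M)"
  (is "?l = val _ ?f ?s ?p ?j ?t ?u ?a ?b")
proof -
  have "?l = (\<Sum>a'<M. \<Sum>b'<M. \<Sum>n<K + 1. (if fa Sg J W T mv ?f ?p ?j ?t ?u ?a ?b n = a' \<and> fb Sg J W T mv ?f ?s ?p ?j ?t ?u ?a ?b n = b'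
          then sgn_of (fc Sg J W T lo hi wr mv ini ?f ?s ?p ?j ?t n) else 0) * X a' b')"
    unfolding eqn_def Let_def sum_distrib_right ..
  also have "\<dots> = (\<Sum>n<K + 1. \<Sum>a'<M. \<Sum>b'<M. (if fa Sg J W T mv ?f ?p ?j ?t ?u ?a ?b n = a' \<and> fb Sg J W T mv ?f ?s ?p ?j ?t ?u ?a ?b n = b'
          then sgn_of (fc Sg J W T lo hi wr mv ini ?f ?s ?p ?j ?t n) else 0) * X a' b')"
    unfolding sum.swap[of _ "{..<K + 1}" "{..<M}"] ..
  also have "\<dots> = val (trunc X) ?f ?s ?p ?j ?t ?u ?a ?b"
    unfolding val_def trunc_def sum_pair_select ..
  finally show ?thesis .
qed

lemma M0: "0 < M" by (simp add: nv_def)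

lemma num:
  assumes "f < 10" "\<sigma> < Sg" "p < W" "j < J" "t < T + 1" "\<tau> < K" "a < M" "b < M"
  shows "num f \<sigma> p j t \<tau> a b < neq Sg J W T"
    and "(\<Sum>a'<M. \<Sum>b'<M. eqs (num f \<sigma> p j t \<tau> a b) a' b' * X a' b') = val (trunc X) f \<sigma> p j t \<tau> a b"
proof -
  show "num f \<sigma> p j t \<tau> a b < neq Sg J W T"
    unfolding neq_def using assms by (intro divmod_code)
  show "(\<Sum>a'<M. \<Sum>b'<M. eqs (num f \<sigma> p j t \<tau> a b) a' b' * X a' b') = val (trunc X) f \<sigma> p j t \<tau> a b"
    unfolding eqs_val using assms by (simp only: divmod_code(1,2))
qed

lemma val_scale:
  "val (\<lambda>a b. c * X a b) f \<sigma> p j t \<tau> a b = c * val X f \<sigma> p j t \<tau> a (b::nat)"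
  unfolding val_def sum_distrib_left by (rule sum.cong[OF refl]) simp

text \<open>Families 0 and 1 are the hypotheses of \<open>rank_one_boolean\<close>, so the solution
  is a nonzero multiple of a boolean one. The equations are homogeneous, hence the factor cancels,
  and \<open>tableau_sound\<close> applies.\<close>

lemma system_sound:
  fixes u v :: "nat \<Rightarrow> 'a::field"
  assumes h: "holds M (neq Sg J W T) eqs (\<lambda>a b. u a * v b)" and nonzero: "\<not> (\<forall>a<M. \<forall>b<M. u a * v b = 0)"
  obtains C where "valid_start C" "\<forall>p<W. run_c C T (J - 2) p \<noteq> 1"
proof -
  let ?X = "\<lambda>a b. u a * v b"
  have v: "val (trunc ?X) f \<sigma> p j t \<tau> a b = 0"
    if "f < 10" "\<sigma> < Sg" "p < W" "j < J" "t < T + 1" "\<tau> < K" "a < M" "b < M" for f \<sigma> p j t \<tau> a b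
    by (rule trans[OF num(2)[OF that, of ?X, symmetric] h[unfolded holds_def, rule_format, OF num(1)[OF that]]])
  have K0: "0 < K" and Sg0: "0 < Sg" and J0: "0 < J" using K9 Sg J by linarith+
  have tr: "trunc ?X a b = u a * v b" if "a < M" "b < M" for a b using that by (simp add: trunc_def)
  have sym: "u a * v b = u b * v a" if "a < M" "b < M" for a b
    using v[of 0 0 0 0 0 0 a b] that W K0 Sg0 J0 by (simp add: val(1) tr)
  have idem: "u a * v a = u 0 * v a" if "a < M" for a
    using v[of 1 0 0 0 0 0 a 0] that W K0 Sg0 J0 M0 by (simp add: val(2)[unfolded One_nat_def] tr)
  obtain \<alpha> c where \<alpha>: "\<alpha> 0" "c \<noteq> 0" "\<And>a b. a < M \<Longrightarrow> b < M \<Longrightarrow> u a * v b = c * (of_bool (\<alpha> a) * of_bool (\<alpha> b))"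
    by (rule rank_one_boolean[of M u v, OF sym idem M0 nonzero]) (assumption | rule that)+
  define \<beta> where "\<beta> a \<longleftrightarrow> \<alpha> a \<and> a < M" for a
  have "trunc ?X = (\<lambda>a b. c * (of_bool (\<beta> a) * of_bool (\<beta> b)))"
    by (intro ext) (simp add: trunc_def \<beta>_def \<alpha>(3))
  then have e: "val (\<lambda>a b. of_bool (\<beta> a) * of_bool (\<beta> b) :: 'a) f \<sigma> p j t \<tau> 0 0 = 0"
    if "f < 10" "\<sigma> < Sg" "p < W" "j < J" "t < T + 1" "\<tau> < K" for f \<sigma> p j t \<tau>
    using v[OF that M0 M0] \<alpha>(2) by (simp add: val_scale)
  have "\<beta> 0" using \<alpha>(1) M0 by (simp add: \<beta>_def)
  then show thesis by (rule tableau_sound[of \<beta>, OF _ e]) (assumption | rule that)+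
qed

lemma system_complete:
  assumes "valid_start C" "\<forall>p<W. run_c C T (J - 2) p \<noteq> 1"
  obtains u :: "nat \<Rightarrow> 'a::field" where "nz M u" "holds M (neq Sg J W T) eqs (\<lambda>a b. u a * u b)"
proof -
  obtain \<alpha> where \<alpha>: "\<alpha> 0" "\<And>i. \<alpha> i \<Longrightarrow> i < M" and v: "\<And>f \<sigma> p j t \<tau> a b. f < 10 \<Longrightarrow> \<sigma> < Sg \<Longrightarrow> p < W \<Longrightarrow> j < J \<Longrightarrow> t < T + 1 \<Longrightarrow> \<tau> < K \<Longrightarrow>
      val (\<lambda>a b. of_bool (\<alpha> a) * of_bool (\<alpha> b) :: 'a::field) f \<sigma> p j t \<tau> a b = 0"
    by (rule tableau_complete[OF assms]) (rule that)
  let ?u = "\<lambda>a. of_bool (\<alpha> a) :: 'a"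
  have "trunc (\<lambda>a b. ?u a * ?u b) = (\<lambda>a b. ?u a * ?u b)" using \<alpha>(2) by (intro ext) (auto simp: trunc_def)
  then have "holds M (neq Sg J W T) eqs (\<lambda>a b. ?u a * ?u b)"
    unfolding holds_def eqs_val using K9 Sg J W by (auto intro!: v)
  moreover have "nz M ?u" unfolding nz_def using M0 \<alpha>(1) by (intro exI[of _ 0]) simp
  ultimately show thesis by (rule that[rotated])
qed

end

section \<open>From NP certificates to solutions of the system\<close>

lemma tape_of_append: "p < length w \<Longrightarrow> tape_of (w @ u) (int p) = tape_of w (int p)"
  by (simp add: tape_of_def nth_append)

lemma tape_of_append_ge:
  assumes "length w \<le> p" shows "tape_of (w @ u) (int p) = tape_of u (int (p - length w))"
proof -
  have "p < length (w @ u) \<longleftrightarrow> p - length w < length u" using assms by auto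
  then show ?thesis unfolding tape_of_int using assms by (simp add: nth_append)
qed

lemma tape_of_ge: "length w \<le> p \<Longrightarrow> tape_of w (int p) = 0"
  by (simp add: tape_of_def)

text \<open>The certificate ends at the first blank of the free region, or fills the region if there
  is none; \<open>k\<close> is its length.\<close>

lemma (in tableau) valid_start_iff:
  assumes lo: "lo = length w" and ini': "\<And>p. ini p = tape_of w (int p)" and lh: "lo \<le> hi"
  shows "valid_start C \<longleftrightarrow> (\<exists>u. length u \<le> hi - lo \<and> (\<forall>p<W. C 0 p = tape_of (w @ u) (int p))) \<and>
     (\<forall>j p. 1 \<le> j \<and> j < J \<and> p < W \<longrightarrow> C j p = 0)"
proof
  assume v: "valid_start C"
  let ?P = "\<lambda>k. lo + k = hi \<or> C 0 (lo + k) = 0"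
  define k where "k = (LEAST k. ?P k)"
  have ex: "?P (hi - lo)" using lh by simp
  have k: "?P k" "k \<le> hi - lo" and below: "i < k \<Longrightarrow> C 0 (lo + i) \<noteq> 0" for i
    unfolding k_def using LeastI[of ?P, OF ex] Least_le[of ?P, OF ex] not_less_Least[of i ?P] by auto
  have zero: "C 0 (lo + k + i) = 0" if "lo + k + i < hi" for i
    using that
  proof (induction i)
    case (Suc i)
    then show ?case using v unfolding valid_start_def by auto
  qed (use k in auto)
  define u where "u = map (\<lambda>i. C 0 (lo + i) = 2) [0..<k]"
  have "C 0 p = tape_of (w @ u) (int p)" if p: "p < W" for p
  proof -
    consider "p < lo" | "hi \<le> p" | "lo \<le> p" "p < lo + k" | "lo + k \<le> p" "p < hi" by linarith
    then show ?thesis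
    proof cases
      case 1
      then show ?thesis using v p ini' lo tape_of_append[of p w u] unfolding valid_start_def by simp
    next
      case 2
      then have "C 0 p = 0" using v p ini' lo lh tape_of_ge[of w p] unfolding valid_start_def by simp
      moreover have "length (w @ u) \<le> p" using 2 k(2) lo lh by (simp add: u_def)
      ultimately show ?thesis using tape_of_ge by simp
    next
      case 3
      then have "p < hi" using k(2) by simp
      then have "C 0 p < 3" using v 3 unfolding valid_start_def by auto
      moreover have "C 0 p \<noteq> 0" using below[of "p - lo"] 3 by simp
      ultimately have "C 0 p = 1 \<or> C 0 p = 2" by linarith
      moreover have "tape_of u (int (p - lo)) = (if C 0 p = 2 then 2 else 1)" using 3 unfolding tape_of_int by (simp add: u_def)
      ultimately show ?thesis using tape_of_append_ge[of w p u] 3(1) lo by auto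
    next
      case 4
      then show ?thesis using zero[of "p - (lo + k)"] lo tape_of_ge[of "w @ u" p] by (simp add: u_def)
    qed
  qed
  moreover have "length u \<le> hi - lo" using k(2) by (simp add: u_def)
  moreover have "\<forall>j p. 1 \<le> j \<and> j < J \<and> p < W \<longrightarrow> C j p = 0" using v unfolding valid_start_def by blast
  ultimately show "(\<exists>u. length u \<le> hi - lo \<and> (\<forall>p<W. C 0 p = tape_of (w @ u) (int p))) \<and>
     (\<forall>j p. 1 \<le> j \<and> j < J \<and> p < W \<longrightarrow> C j p = 0)" by blast
next
  assume a: "(\<exists>u. length u \<le> hi - lo \<and> (\<forall>p<W. C 0 p = tape_of (w @ u) (int p))) \<and>
     (\<forall>j p. 1 \<le> j \<and> j < J \<and> p < W \<longrightarrow> C j p = 0)"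
  then obtain u where u: "length u \<le> hi - lo" "\<And>p. p < W \<Longrightarrow> C 0 p = tape_of (w @ u) (int p)" by blast
  show "valid_start C"
    unfolding valid_start_def
  proof (intro conjI allI impI)
    fix p assume p: "p < W" "p < lo \<or> hi \<le> p"
    then show "C 0 p = ini p"
      using u(1) lh unfolding u(2)[OF p(1)] ini' lo by (auto simp: tape_of_append tape_of_ge)
  next
    fix p assume p: "lo \<le> p \<and> p < hi"
    then show "C 0 p < 3" using hi by (subst u(2)) (auto simp: tape_of_def)
  next
    fix p assume p: "lo \<le> p \<and> p + 1 < hi \<and> C 0 p = 0"
    then have "tape_of (w @ u) (int p) = 0" using u(2)[of p] hi by simp
    then have "tape_of (w @ u) (int (p + 1)) = 0" unfolding tape_of_int by (auto split: if_splits)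
    then show "C 0 (p + 1) = 0" using u(2)[of "p + 1"] hi p by simp
  qed (use a in blast)
qed

lemma tm_wr_less:
  assumes V: "turing_machine V" and Sg: "tm_symbols V \<le> Sg" "tm_states V \<le> Sg" "0 < Sg" and j: "j < tm_tapes V + 1"
  shows "tm_wr V Sg \<tau> j < Sg"
proof -
  let ?ss = "map (dig Sg \<tau>) [0..<tm_tapes V]" let ?q = "dig Sg \<tau> (tm_tapes V)"
  have d: "dig Sg \<tau> i < Sg" for i using Sg by (simp add: dig_less)
  obtain q' acts where tr: "trans_at V Sg \<tau> = (q', acts)" by fastforce
  have "q' < Sg \<and> length acts = tm_tapes V \<and> (\<forall>a\<in>set acts. fst a < Sg)"
  proof (cases "?q < tm_states V \<and> (\<forall>s\<in>set ?ss. s < tm_symbols V) \<and> ?q \<noteq> 1")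
    case True
    then have "tm_delta V ?q ?ss = (q', acts)" using tr unfolding trans_at_def Let_def by simp
    from turing_machineD[OF V _ _ _ this] True show ?thesis using Sg by auto
  next
    case False
    then have "q' = ?q" "acts = stay ?ss" using tr unfolding trans_at_def Let_def if_not_P[OF False] by auto
    then show ?thesis using d by (auto simp: stay_def)
  qed
  then show ?thesis unfolding tm_wr_def tr using j by auto
qed

text \<open>\<open>T\<close> bounds the time on the longest admissible pair, so one tableau serves
  all certificates, and \<open>W\<close> exceeds \<open>2 * T\<close> plus every input length as
  \<open>cyclic_accept\<close> demands. A certificate gives a symmetric solution, whereas without
  one all rank one solutions have to be excluded.\<close>

lemma cook_levin:
  fixes x :: "bool list"
  assumes V: "turing_machine V" and out: "\<And>w. tm_outputs V w [w \<in> R] (real ((length w + 2) ^ b))"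
    and lo': "lo = 2 * length x + 1" and hi': "hi = lo + cl" and T': "T = (hi + 2) ^ b" and W': "W = 2 * T + hi + 2"
    and Sg': "Sg = max (tm_symbols V) (tm_states V)" and J': "J = tm_tapes V + 1" and m: "m = nv Sg J W T"
    and cf: "cf = eqn Sg J W T lo hi (tm_wr V Sg) (tm_mv V Sg) (\<lambda>p. tape_of (enc_pair x []) (int p))"
  shows "\<exists>u. length u \<le> cl \<and> enc_pair x u \<in> R \<Longrightarrow> \<exists>u. nz m u \<and> holds m (neq Sg J W T) cf (\<lambda>a b. u a * u b :: 'a::field)"
    and "\<not> (\<exists>u. length u \<le> cl \<and> enc_pair x u \<in> R) \<Longrightarrow> holds m (neq Sg J W T) cf (\<lambda>a b. u' a * v' b) \<Longrightarrow> \<forall>a<m. \<forall>b<m. u' a * v' b = (0::'a)"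
proof -
  let ?w = "enc_pair x []"
  have V': "1 \<le> tm_tapes V" "2 \<le> tm_states V" "3 \<le> tm_symbols V" using V unfolding turing_machine_def by auto
  interpret tableau Sg J W T lo hi "tm_wr V Sg" "tm_mv V Sg" "\<lambda>p. tape_of ?w (int p)"
  proof
    show "3 \<le> Sg" "2 \<le> J" "0 < W" "hi < W" using V' by (auto simp: Sg' J' W')
    show "tape_of ?w (int p) < Sg" for p using V' by (auto simp: Sg' tape_of_def)
    show "tm_wr V Sg \<tau> j < Sg" if "\<tau> < Sg ^ J" "j < J" for \<tau> j
      by (rule tm_wr_less) (use V V' that in \<open>auto simp: Sg' J'\<close>)
  qed
  have lw: "lo = length ?w" by (simp add: lo' enc_pair_def enc_nat_def)
  have lh: "lo \<le> hi" by (simp add: hi')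
  have pu: "?w @ u = enc_pair x u" for u by (simp add: enc_pair_def)
  note vs = valid_start_iff[OF lw refl lh, unfolded pu]
  have acc: "(enc_pair x u \<in> R) = (\<forall>p<W. run_c C T (J - 2) p \<noteq> 1)"
    if u: "length u \<le> cl" and C: "\<And>p. p < W \<Longrightarrow> C 0 p = tape_of (enc_pair x u) (int p)"
      "\<forall>j p. 1 \<le> j \<and> j < J \<and> p < W \<longrightarrow> C j p = 0" for u C
  proof -
    have l: "length (enc_pair x u) \<le> hi" using u by (simp add: enc_pair_def enc_nat_def hi' lo')
    then have "(length (enc_pair x u) + 2) ^ b \<le> T" unfolding T' by (intro power_mono) auto
    then have "tm_outputs V (enc_pair x u) [enc_pair x u \<in> R] (real T)"
      using out[of "enc_pair x u"] unfolding tm_outputs_def by (meson of_nat_mono order_trans)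
    from cyclic_accept[OF V this, of W Sg C] show ?thesis using l C by (simp add: W' Sg' J')
  qed
  {
    assume "\<exists>u. length u \<le> cl \<and> enc_pair x u \<in> R"
    then obtain u where u: "length u \<le> cl" "enc_pair x u \<in> R" by blast
    define C where "C j p = (if j = 0 then tape_of (enc_pair x u) (int p) else 0)" for j p :: nat
    have "valid_start C" unfolding vs using u(1) by (auto simp: C_def hi')
    moreover have "\<forall>p<W. run_c C T (J - 2) p \<noteq> 1" using acc[OF u(1), of C] u(2) by (simp add: C_def)
    ultimately obtain u :: "nat \<Rightarrow> 'a" where "nz M u" "holds M (neq Sg J W T) eqs (\<lambda>a b. u a * u b)"
      by (rule system_complete)
    then show "\<exists>u. nz m u \<and> holds m (neq Sg J W T) cf (\<lambda>a b. u a * u b :: 'a::field)" unfolding m cf by blast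
  }
  {
    assume no: "\<not> (\<exists>u. length u \<le> cl \<and> enc_pair x u \<in> R)" and h: "holds m (neq Sg J W T) cf (\<lambda>a b. u' a * v' b)"
    show "\<forall>a<m. \<forall>b<m. u' a * v' b = 0"
    proof (rule ccontr)
      assume n: "\<not> (\<forall>a<m. \<forall>b<m. u' a * v' b = 0)"
      obtain C where C: "valid_start C" "\<forall>p<W. run_c C T (J - 2) p \<noteq> 1"
        by (rule system_sound[OF h[unfolded m cf] n[unfolded m]]) (rule that)
      then obtain u where "length u \<le> hi - lo" "\<forall>p<W. C 0 p = tape_of (enc_pair x u) (int p)"
        "\<forall>j p. 1 \<le> j \<and> j < J \<and> p < W \<longrightarrow> C j p = 0" unfolding vs by blast
      then show False using acc[of u C] C(2) no by (auto simp: hi')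
    qed
  }
qed

section \<open>Computing with field elements\<close>

abbreviation code :: "'a::finite \<Rightarrow> nat" where "code \<equiv> to_nat_on UNIV"

lemma code_less: "code (x :: 'a::finite) < CARD('a)"
  using to_nat_on_finite[of "UNIV :: 'a set"] by (auto simp: bij_betw_def)

lemma felt_code [simp]: "felt (code x) = (x :: 'a::finite)"
  unfolding felt_def by (rule from_nat_into_to_nat_on) (auto simp: countable_finite)

definition pe :: "(strs \<Rightarrow> env \<Rightarrow> 'a::{finite,field}) \<Rightarrow> bool" where
  "pe h \<longleftrightarrow> pf (\<lambda>s e. code (h s e))"

lemma pe_cong: "pe f \<Longrightarrow> (\<And>s e. f s e = g s e) \<Longrightarrow> pe g"
  by (metis ext)

text \<open>A pair of field elements is a number below the square of the field size, so every
  operation on the fixed field is a finite table.\<close>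

lemma pf_of_pe2:
  fixes h1 h2 :: "strs \<Rightarrow> env \<Rightarrow> 'a::{finite,field}"
  assumes "pe h1" "pe h2" shows "pf (\<lambda>s e. g (h1 s e) (h2 s e) :: nat)"
proof -
  let ?q = "CARD('a)"
  have pair: "code x + ?q * code y < ?q * ?q" for x y :: 'a
    by (rule divmod_code) (rule code_less)+
  have "pf (\<lambda>s e. (\<lambda>n. g (felt (n mod ?q)) (felt (n div ?q))) (code (h1 s e) + ?q * code (h2 s e)))"
    by (rule pf_table[OF _ pair]) (use assms in \<open>auto simp: pe_def intro!: pf_add pf_mult pf_const\<close>)
  then show ?thesis
    by (rule pf_cong) (simp only: divmod_code[OF code_less] felt_code)
qed

lemma pe_const [pfi]: "pe (\<lambda>s e. x)" unfolding pe_def by (rule pf_const)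

lemma pe_mult [pfi]: "pe f \<Longrightarrow> pe g \<Longrightarrow> pe (\<lambda>s e. f s e * g s e)"
  unfolding pe_def by (rule pf_of_pe2) (simp_all add: pe_def)

lemma pe_add [pfi]: "pe f \<Longrightarrow> pe g \<Longrightarrow> pe (\<lambda>s e. f s e + g s e)"
  unfolding pe_def by (rule pf_of_pe2) (simp_all add: pe_def)

lemma pfp_field_eq [pfi]: "pe f \<Longrightarrow> pe g \<Longrightarrow> pfp (\<lambda>s e. f s e = g s e)"
  by (rule pf_of_pe2)

lemma pe_If [pfi]: "pfp P \<Longrightarrow> pe f \<Longrightarrow> pe g \<Longrightarrow> pe (\<lambda>s e. if P s e then f s e else g s e)"
  unfolding pe_def if_distrib[of code] by (rule pf_If)

lemma pe_of_bool [pfi]: "pfp P \<Longrightarrow> pe (\<lambda>s e. of_bool (P s e))"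
  by (rule pe_cong[OF pe_If[OF _ pe_const[of 1] pe_const[of 0]]]) auto

lemma pe_table: "pf f \<Longrightarrow> (\<And>s e. f s e < q) \<Longrightarrow> pe (\<lambda>s e. g (f s e))"
  unfolding pe_def by (rule pf_table)

lemma pe_felt [pfi]:
  assumes "pf f" shows "pe (\<lambda>s e. felt (f s e mod CARD('a)) :: 'a::{finite,field})"
  by (rule pe_table[where q = "CARD('a)"]) (use assms in \<open>auto intro!: pf_mod pf_const\<close>)

lemma pe_sum [pfi]:
  fixes F :: "strs \<Rightarrow> env \<Rightarrow> nat \<Rightarrow> 'a::{finite,field}"
  assumes "pe (\<lambda>s e. F s (\<lambda>n. e (Suc n)) (e 0))" "pf N"
  shows "pe (\<lambda>s e. \<Sum>i<N s e. F s e i)"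
proof -
  have w: "pe (\<lambda>s e. F s (\<lambda>n. e (Suc (Suc n))) (e 0))"
    using pf_rename[OF assms(1)[unfolded pe_def], of "case_nat 0 (\<lambda>n. Suc (Suc n))"] by (simp add: pe_def)
  \<comment> \<open>The remainder turns an arbitrary value of variable 1 into a legal code, so the
    step is defined on all environments.\<close>
  have H: "pf (\<lambda>s e. code (felt (e 1 mod CARD('a)) + F s (\<lambda>n. e (Suc (Suc n))) (e 0)))"
    using pe_add[OF pe_felt[OF pf_var[of 1]] w] by (simp add: pe_def)
  show ?thesis
    unfolding pe_def
    by (rule pf_iter[where H = "\<lambda>s e i a. code (felt (a mod CARD('a)) + F s e i)" and A = "\<lambda>s e. code (0::'a)"
          and B = "\<lambda>s e. CARD('a)", OF H pf_const assms(2) pbd_const])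
      (simp_all add: code_less less_imp_le add.commute)
qed

lemma pe_sum_const: "(\<And>n. n < c \<Longrightarrow> pe (\<lambda>s e. F s e n)) \<Longrightarrow> pe (\<lambda>s e. \<Sum>n<c. F s e n)" for c :: nat
  by (induction c) (auto intro!: pe_const pe_add)

text \<open>Bounds are required for all arguments, although an exponent may be small only for the
  relevant ones. Capping it by its true maximum makes the power polynomial everywhere.\<close>

lemma pf_power_min:
  assumes "pf a" "pf f" "pf g" "pbd (\<lambda>s e. a s e ^ g s e)" shows "pf (\<lambda>s e. a s e ^ min (f s e) (g s e))"
proof (rule pf_power)
  show "pf (\<lambda>s e. min (f s e) (g s e))" unfolding min_def using assms by (intro pfi)
  have bd: "x ^ min i n \<le> x ^ n + 1" for x i n :: nat
    using power_increasing[of "min i n" n x] by (cases "x = 0") (auto simp: power_0_left)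
  show "pbd (\<lambda>s e. a s e ^ min (f s e) (g s e))"
    by (rule pbd_mono[OF pbd_add[OF assms(4) pbd_const[of 1]] bd])
qed fact

lemma pf_fst [pfi]: "pf (\<lambda>s e. length (fst s))" and pf_snd [pfi]: "pf (\<lambda>s e. length (snd s))"
  using pf_len[of False] pf_len[of True] by (simp_all add: str_def)

lemma pfp_sym [pfi]:
  assumes "pf f" shows "pfp (\<lambda>s e. tape_of (fst s) (int (f s e)) = c)" "pfp (\<lambda>s e. tape_of (snd s) (int (f s e)) = c)"
  using pf_symeq[OF assms, of False] pf_symeq[OF assms, of True] by (simp_all add: str_def)

text \<open>A parameter depends on the input only, so it can be used under any binder.\<close>

definition pp :: "(bool list \<Rightarrow> nat) \<Rightarrow> bool" where "pp n \<longleftrightarrow> pf (\<lambda>s e. n (fst s))"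

lemma pp [pfi]: "pp n \<Longrightarrow> pf (\<lambda>s e. n (fst s))" by (simp add: pp_def)

lemma pp_poly: "pp n \<Longrightarrow> \<exists>a. \<forall>x. n x \<le> (length x + 2) ^ a"
proof -
  assume "pp n"
  then have "pbd (\<lambda>s e. n (fst s))" unfolding pp_def by (rule pf_pbd)
  then obtain a k where "\<And>s e. n (fst s) \<le> (sz k s e + 2) ^ a" unfolding pbd_def by blast
  from this[of "(_, [])" "\<lambda>_. 0"] show ?thesis unfolding sz_def by auto
qed

text \<open>The indices may be arbitrary computed values, including bound variables, so an entry can
  occur under any binder.\<close>

definition pm :: "(bool list \<Rightarrow> nat \<Rightarrow> nat \<Rightarrow> 'a::{finite,field}) \<Rightarrow> bool" where
  "pm A \<longleftrightarrow> (\<forall>f g. pf f \<longrightarrow> pf g \<longrightarrow> pe (\<lambda>s e. A (fst s) (f s e) (g s e)))"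

lemma pmI: "(\<And>f g. pf f \<Longrightarrow> pf g \<Longrightarrow> pe (\<lambda>s e. A (fst s) (f s e) (g s e))) \<Longrightarrow> pm A"
  by (simp add: pm_def)

lemma pmD: "pm A \<Longrightarrow> pf f \<Longrightarrow> pf g \<Longrightarrow> pe (\<lambda>s e. A (fst s) (f s e) (g s e))"
  by (simp add: pm_def)

lemma pm_tens:
  assumes "pm A" "pm B" "pp n" "pp d" shows "pm (\<lambda>x. tens (n x) (d x) (A x) (B x))"
  unfolding tens_def by (rule pmI) (intro pe_mult pmD[OF assms(1)] pmD[OF assms(2)] pf_div pf_mod pp assms(3,4))

lemma pm_tpow:
  assumes A: "pm A" "pp n" "pp d" shows "pm (\<lambda>x. tpow k (n x) (d x) (A x))"
proof (induction k)
  case 0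
  show ?case by (rule pmI) (simp add: pe_const)
next
  case (Suc k)
  show ?case unfolding tpow.simps by (rule pm_tens[OF Suc A])
qed

lemma pm_gen:
  assumes N: "pp N" and l: "pp l" and q: "pbd (\<lambda>s e. CARD('a) ^ (t * l (fst s)))" and l2: "pbd (\<lambda>s e. 2 ^ l (fst s))"
  shows "pm (\<lambda>x. gen (N x) (l x) t :: nat \<Rightarrow> nat \<Rightarrow> 'a::{finite,field})"
proof (rule pmI)
  fix f g assume fg: "pf f" "pf g"
  let ?q = "CARD('a)"
  \<comment> \<open>The summand of \<open>gen\<close> with all exponents capped; for
    \<open>j < t * l x\<close> the caps have no effect.\<close>
  define h :: "bool list \<Rightarrow> nat \<Rightarrow> nat \<Rightarrow> nat \<Rightarrow> 'a" where "h x \<rho> i j = felt (\<rho> mod ?q ^ (t * l x) div ?q ^ min j (t * l x) mod ?q) *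
     of_bool (hash (N x) (\<rho> div ?q ^ (t * l x) div (N x * N x) ^ min (j div l x) t mod (N x * N x)) i < N x div 2 ^ min (j mod l x) (l x))"
    for x \<rho> i j
  have *: "gen (N x) (l x) t \<rho> i = (\<Sum>j<t * l x. h x \<rho> i j)" for x \<rho> i
    unfolding gen_def
  proof (rule sum.cong[OF refl])
    fix j assume j: "j \<in> {..<t * l x}"
    then have "j div l x < t" "j mod l x \<le> l x" by (cases "l x"; simp add: less_mult_imp_div_less less_imp_le)+
    then have "min j (t * l x) = j" "min (j div l x) t = j div l x" "min (j mod l x) (l x) = j mod l x" using j by auto
    then show "felt (dig ?q (\<rho> mod ?q ^ (t * l x)) j) * block (N x) (dig (N x * N x) (\<rho> div ?q ^ (t * l x)) (j div l x)) (j mod l x) i =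
        h x \<rho> i j" unfolding h_def dig_def block_def by (simp only:)
  qed
  have fg': "pf (\<lambda>s e. f s (\<lambda>n. e (Suc n)))" "pf (\<lambda>s e. g s (\<lambda>n. e (Suc n)))" using fg by (simp_all add: pf_weaken)
  have pw: "pf (\<lambda>s e. ?q ^ (t * l (fst s)))" by (intro pf_power pf_const pf_mult pp l q)
  have b: "pbd (\<lambda>s e. (N (fst s) * N (fst s)) ^ t)" by (intro pbd_power pbd_mult pf_pbd pp N)
  have "pe (\<lambda>s e. h (fst s) (f s (\<lambda>n. e (Suc n))) (g s (\<lambda>n. e (Suc n))) (e 0))"
    unfolding h_def hash_def
    by (intro pe_mult pe_felt pe_of_bool pfp_less pf_mod pf_div pf_add pf_mult pf_power_min pw pf_const pp N l fg' q l2 b pf_var)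
  then have "pe (\<lambda>s e. \<Sum>j<t * l (fst s). h (fst s) (f s e) (g s e) j)"
    by (rule pe_sum) (intro pf_mult pf_const pp l)
  then show "pe (\<lambda>s e. gen (N (fst s)) (l (fst s)) t (f s e) (g s e) :: 'a)" unfolding * .
qed

lemma pm_base:
  assumes "pp S" "pp m" "pm G" and cf: "\<And>f g h. pf f \<Longrightarrow> pf g \<Longrightarrow> pf h \<Longrightarrow> pe (\<lambda>s e. cf (fst s) (f s e) (g s e) (h s e))"
  shows "pm (\<lambda>x. base (S x) (m x) (G x) (cf x))"
  unfolding base_def
  by (rule pmI) (intro pe_If pfp_less pmD[OF pm_tens[OF assms(3,3,1,2)]] cf pf_mult pf_diff pf_div pf_mod pf_const pp assms(1,2))

lemma pf_src:
  assumes "pp W" "pf (\<lambda>s e. mv (f s e) (g s e))" "pf p"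
  shows "pf (\<lambda>s e. src (W (fst s)) mv (f s e) (g s e) (p s e))"
  unfolding src_def by (intro pf_mod pf_diff pf_add pf_const pp assms)

text \<open>\<open>Sg\<close> and \<open>J\<close> depend only on the machine. The sum over
  \<open>n\<close> therefore has constant length and is unrolled, and for each \<open>n\<close> the
  functions \<open>wr n\<close> and \<open>mv n\<close> are finite tables in
  \<open>j mod J\<close>.\<close>

lemma pe_eqn:
  fixes wr mv :: "nat \<Rightarrow> nat \<Rightarrow> nat"
  assumes W: "pp W" and T: "pp T" and lo: "pp lo" and hi: "pp hi" and J: "0 < J" and Sg: "0 < Sg"
    and ini: "\<And>f. pf f \<Longrightarrow> pf (\<lambda>s e. ini (fst s) (f s e))"
    and fgh: "pf f" "pf g" "pf h"
  shows "pe (\<lambda>s e. eqn Sg J (W (fst s)) (T (fst s)) (lo (fst s)) (hi (fst s)) wr mv (ini (fst s)) (f s e) (g s e) (h s e) :: 'a::{finite,field})"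
proof -
  have tab0: "pf (\<lambda>s e. w (j s e mod J) :: nat)" if "pf j" for w and j :: "strs \<Rightarrow> env \<Rightarrow> nat"
    by (rule pf_table[where q = J]) (use that J in \<open>auto intro!: pf_mod pf_const\<close>)
  have tab: "pf (\<lambda>s e. wr n (j s e mod J))" "pf (\<lambda>s e. mv n (j s e mod J))" "pf (\<lambda>s e. Sg ^ (j s e mod J))" if "pf j" for j n
    by (rule tab0[OF that])+
  have ix: "pf (\<lambda>s e. ix Sg J (W (fst s)) (a s e) (b s e) (c s e) (d s e))" if "pf a" "pf b" "pf c" "pf d" for a b c d
    unfolding ix_def by (intro pf_add pf_mult pf_const pp[OF W] that)
  have iy: "pf (\<lambda>s e. iy Sg J (W (fst s)) (T (fst s)) (a s e) (b s e))" if "pf a" "pf b" for a b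
    unfolding iy_def by (intro pf_add pf_mult pf_const pp[OF W] pp[OF T] that)
  have M: "pf (\<lambda>s e. nv Sg J (W (fst s)) (T (fst s)))"
    unfolding nv_def by (intro pf_add pf_mult pf_const pp[OF W] pp[OF T])
  have dg: "pf (\<lambda>s e. dig Sg (a s e) (j s e mod J))" if "pf a" "pf j" for a j
    unfolding dig_def by (intro pf_mod pf_div pf_const tab that)
  note basic = pf_add pf_diff pf_mult pf_div pf_mod pf_const pf_If pfp_le pfp_less pfp_eq pfp_conj pfp_not
    pp[OF W] pp[OF T] pp[OF lo] pp[OF hi] ix iy M dg fgh tab pf_src[OF W]
  have c: "pf (\<lambda>s e. fc Sg J (W (fst s)) (T (fst s)) (lo (fst s)) (hi (fst s)) wr mv (ini (fst s)) (a s e) (b s e) (p s e) (j s e mod J) (t s e) n)"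
    if "pf a" "pf b" "pf p" "pf j" "pf t" for a b p j t n
    unfolding fc_def by (intro basic ini that)
  have if_less: "x < k \<Longrightarrow> y < k \<Longrightarrow> (if P then x else y) < k" for x y k :: nat and P by simp
  have c3: "fc Sg J W' T' lo' hi' wr mv ini' a b p j t n < 3" for W' T' lo' hi' ini' a b p j t n
    unfolding fc_def by (intro if_less) simp_all
  have A: "pf (\<lambda>s e. fa Sg J (W (fst s)) (T (fst s)) mv (a s e) (p s e) (j s e mod J) (t s e) (u s e) (x s e) (y s e) n)"
    if "pf a" "pf p" "pf j" "pf t" "pf u" "pf x" "pf y" for a p j t u x y n
    unfolding fa_def by (intro basic that)
  have B: "pf (\<lambda>s e. fb Sg J (W (fst s)) (T (fst s)) mv (a s e) (b s e) (p s e) (j s e mod J) (t s e) (u s e) (x s e) (y s e) n)"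
    if "pf a" "pf b" "pf p" "pf j" "pf t" "pf u" "pf x" "pf y" for a b p j t u x y n
    unfolding fb_def by (intro basic that)
  have s: "pe (\<lambda>s e. sgn_of (fc Sg J (W (fst s)) (T (fst s)) (lo (fst s)) (hi (fst s)) wr mv (ini (fst s)) (a s e) (b s e) (p s e) (j s e mod J) (t s e) n) :: 'a)"
    if "pf a" "pf b" "pf p" "pf j" "pf t" for a b p j t n
    by (rule pe_table[OF c[OF that] c3])
  show ?thesis
    unfolding eqn_def Let_def
    by (rule pe_sum_const) (intro pe_If pfp_conj pfp_eq A B s fgh pf_div pf_mod pf_add pf_const pp[OF W] pp[OF T] M pe_const)
qed

section \<open>Reading a matrix\<close>

text \<open>The \<open>j\<close>-th number of a sequence of unary codes: the count of bits
  \<open>True\<close> that come after exactly \<open>j\<close> bits \<open>False\<close>. Symbols 2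
  and 1 represent these bits.\<close>

definition nums :: "bool list \<Rightarrow> nat \<Rightarrow> nat" where
  "nums y j = (\<Sum>p<length y. of_bool (tape_of y (int p) = 2 \<and> (\<Sum>p'<p. of_bool (tape_of y (int p') = 1)) = j))"

lemma sum_lessThan_add: "(\<Sum>p<a + b. f p) = (\<Sum>p<a. f p) + (\<Sum>p<b. f (a + p))"
  for f :: "nat \<Rightarrow> nat"
  by (induction b) simp_all

lemma nums_enc_nat: "nums (enc_nat n @ y) j = (if j = 0 then n else nums y (j - 1))"
proof -
  let ?y = "enc_nat n @ y"
  let ?z = "\<lambda>w p. \<Sum>p'<p. of_bool (tape_of w (int p') = 1) :: nat"
  have l: "length (enc_nat n) = n + 1" by (simp add: enc_nat_def)
  have low: "tape_of ?y (int p) = 2" if "p < n" for p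
    using that by (subst tape_of_append) (simp_all add: l, simp add: tape_of_int enc_nat_def nth_append)
  have mid: "tape_of ?y (int n) = 1"
    by (subst tape_of_append) (simp_all add: l, simp add: tape_of_int enc_nat_def nth_append)
  have high: "tape_of ?y (int (n + 1 + p)) = tape_of y (int p)" for p
    using tape_of_append_ge[of "enc_nat n" "n + 1 + p" y] by (simp add: l)
  have zl: "?z ?y p = 0" if "p \<le> n" for p using low that by (intro sum.neutral) simp
  have zh: "?z ?y (n + 1 + p) = 1 + ?z y p" for p
    unfolding sum_lessThan_add high using zl[of n] mid by simp
  define g where "g p = (of_bool (tape_of ?y (int p) = 2 \<and> ?z ?y p = j) :: nat)" for p
  have "nums ?y j = (\<Sum>p<n + 1 + length y. g p)" unfolding nums_def g_def by (simp only: length_append l)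
  also have "\<dots> = (\<Sum>p<n + 1. g p) + (\<Sum>p<length y. g (n + 1 + p))" by (rule sum_lessThan_add)
  also have "(\<Sum>p<n + 1. g p) = (\<Sum>p<n. g p) + g n" by (simp only: Suc_eq_plus1[symmetric] sum.lessThan_Suc)
  also have "g n = 0" unfolding g_def mid by (simp only: of_bool_eq_0_iff) simp
  also have "(\<Sum>p<n. g p) = (\<Sum>p<n. of_bool (j = 0))"
    by (rule sum.cong[OF refl]) (use low zl in \<open>auto simp: g_def simp del: sum_of_bool_eq\<close>)
  also have "(\<Sum>p<length y. g (n + 1 + p)) = (if j = 0 then 0 else nums y (j - 1))"
    unfolding g_def high zh nums_def by (cases j) simp_all
  finally show ?thesis by simp
qed

lemma nums_concat: "j < length ns \<Longrightarrow> nums (concat (map enc_nat ns)) j = ns ! j"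
proof (induction ns arbitrary: j)
  case (Cons n ns)
  then show ?case by (cases j) (simp_all add: nums_enc_nat)
qed simp

definition mat_codes :: "'a::finite mat \<Rightarrow> nat list" where
  "mat_codes A = concat (map (\<lambda>i. map (\<lambda>j. code (A $$ (i, j))) [0..<dim_col A]) [0..<dim_row A])"

lemma length_concat_uniform: "length (concat (map (\<lambda>i. map (f i) [0..<c]) [0..<r])) = r * c"
  by (induction r) simp_all

lemma nth_concat_uniform:
  assumes "i < r" "j < c" shows "concat (map (\<lambda>i. map (f i) [0..<c]) [0..<r]) ! (i * c + j) = f i j"
  using assms(1)
proof (induction r)
  case (Suc r)
  show ?case
  proof (cases "i = r")
    case True
    then show ?thesis using assms(2) by (simp add: nth_append length_concat_uniform)
  next
    case False
    then have "i < r" using Suc.prems by simp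
    then have "i * c + j < Suc i * c" "Suc i * c \<le> r * c" using assms(2) by (simp, intro mult_le_mono1) simp
    then have "i * c + j < r * c" by simp
    then show ?thesis using Suc.IH[OF \<open>i < r\<close>] by (simp add: nth_append length_concat_uniform)
  qed
qed simp

lemma concat_concat: "concat (concat xs) = concat (map concat xs)"
  by (induction xs) simp_all

lemma enc_mat_codes: "enc_mat A = concat (map enc_nat (dim_row A # dim_col A # mat_codes A))"
  by (simp add: enc_mat_def mat_codes_def map_concat concat_concat comp_def)

text \<open>Each matrix starts with its two dimensions, hence the offsets 2; the second matrix
  follows the \<open>2 + n * k\<close> numbers of the first.\<close>

lemma nums_mats:
  fixes U V :: "'a::finite mat"
  assumes U: "U \<in> carrier_mat n k" and V: "V \<in> carrier_mat k d"
  shows "i < n \<Longrightarrow> l < k \<Longrightarrow> nums (enc_mat U @ enc_mat V) (2 + (i * k + l)) = code (U $$ (i, l))"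
    and "l < k \<Longrightarrow> j < d \<Longrightarrow> nums (enc_mat U @ enc_mat V) (2 + n * k + (2 + (l * d + j))) = code (V $$ (l, j))"
proof -
  have lU: "length (mat_codes U) = n * k" and lV: "length (mat_codes V) = k * d"
    using U V by (auto simp: mat_codes_def length_concat_uniform)
  have less: "x * B + y < A * B" if "x < A" "y < B" for x y A B :: nat
    using divmod_code(3)[OF that(2,1)] by (simp add: ac_simps)
  let ?u = "dim_row U # dim_col U # mat_codes U" let ?v = "dim_row V # dim_col V # mat_codes V"
  have e: "enc_mat U @ enc_mat V = concat (map enc_nat (?u @ ?v))" unfolding enc_mat_codes by simp
  { assume "i < n" "l < k"
    then have "i * k + l < n * k" "mat_codes U ! (i * k + l) = code (U $$ (i, l))"
      using U by (auto simp: mat_codes_def nth_concat_uniform less)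
    then show "nums (enc_mat U @ enc_mat V) (2 + (i * k + l)) = code (U $$ (i, l))"
      unfolding e by (subst nums_concat) (simp_all add: lU nth_append) }
  { assume "l < k" "j < d"
    then have i: "l * d + j < k * d" "mat_codes V ! (l * d + j) = code (V $$ (l, j))"
      using V by (auto simp: mat_codes_def nth_concat_uniform less)
    have "(?u @ ?v) ! (length ?u + (2 + (l * d + j))) = ?v ! (2 + (l * d + j))" by (rule nth_append_length_plus)
    moreover have "length ?u = 2 + n * k" by (simp add: lU)
    ultimately show "nums (enc_mat U @ enc_mat V) (2 + n * k + (2 + (l * d + j))) = code (V $$ (l, j))"
      unfolding e using i by (subst nums_concat) (simp_all add: lU lV) }
qed

lemma length_enc_mat:
  fixes U :: "'a::finite mat"
  assumes "U \<in> carrier_mat n k" shows "length (enc_mat U) \<le> n + k + 2 + n * k * CARD('a)"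
proof -
  have *: "length (concat (map enc_nat ns)) \<le> length ns * B" if "\<And>x. x \<in> set ns \<Longrightarrow> x < B" for ns B
    using that by (induction ns) (fastforce simp: enc_nat_def)+
  have "length (concat (map enc_nat (mat_codes U))) \<le> length (mat_codes U) * CARD('a)"
    by (rule *) (auto simp: mat_codes_def code_less)
  moreover have "length (mat_codes U) = n * k" using assms by (auto simp: mat_codes_def length_concat_uniform)
  ultimately show ?thesis using assms unfolding enc_mat_codes by (simp add: enc_nat_def)
qed

lemma l0_sum: "l0 B = (\<Sum>i<dim_row B. \<Sum>j<dim_col B. of_bool (B $$ (i, j) \<noteq> 0))"
proof -
  have "{(i, j). i < dim_row B \<and> j < dim_col B \<and> B $$ (i, j) \<noteq> 0} =
      (SIGMA i:{..<dim_row B}. {j. j < dim_col B \<and> B $$ (i, j) \<noteq> 0})" by auto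
  moreover have "card {j. j < dim_col B \<and> B $$ (i, j) \<noteq> 0} = (\<Sum>j<dim_col B. of_bool (B $$ (i, j) \<noteq> 0))" for i
    by (subst sum_of_bool_eq) (auto intro!: arg_cong[of _ _ card])
  ultimately show ?thesis unfolding l0_def by (simp only: card_SigmaI finite_lessThan finite_Collect_conjI finite_Collect_less_nat simp_thms) simp
qed

lemma l0_diff:
  fixes f :: "nat \<Rightarrow> nat \<Rightarrow> 'a::field"
  assumes U: "U \<in> carrier_mat n k" and V: "V \<in> carrier_mat k d"
  shows "l0 (U * V - mat n d (\<lambda>(i, j). f i j)) = (\<Sum>i<n. \<Sum>j<d. of_bool ((\<Sum>l<k. U $$ (i, l) * V $$ (l, j)) \<noteq> f i j))"
proof -
  have "(U * V - mat n d (\<lambda>(i, j). f i j)) $$ (i, j) \<noteq> 0 \<longleftrightarrow> (\<Sum>l<k. U $$ (i, l) * V $$ (l, j)) \<noteq> f i j"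
    if "i < n" "j < d" for i j
    using that U V by (auto simp: scalar_prod_def atLeast0LessThan)
  then show ?thesis unfolding l0_sum using U V by simp
qed

lemma pf_nums [pfi]:
  assumes "pf f" shows "pf (\<lambda>s e. nums (fst s) (f s e))" "pf (\<lambda>s e. nums (snd s) (f s e))"
  unfolding nums_def
  by (intro pf_sum pfp_conj pfp_eq pfp_sym pf_weaken[OF assms] pf_fst pf_snd pf_var pf_const)+

lemma ps_enc_mat:
  assumes A: "pm A" and n: "pp n" and d: "pp d"
  shows "ps (\<lambda>s e. enc_mat (mat (n (fst s)) (d (fst s)) (\<lambda>(i, j). A (fst s) i j :: 'a::{finite,field})))"
proof -
  have *: "enc_mat (mat n' d' (\<lambda>(i, j). f i j)) = enc_nat n' @ enc_nat d' @
     concat (map (\<lambda>i. concat (map (\<lambda>j. enc_nat (code (f i j))) [0..<d'])) [0..<n'])" for n' d' and f :: "nat \<Rightarrow> nat \<Rightarrow> 'a"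
    unfolding enc_mat_def by (auto intro!: arg_cong[of _ _ concat] map_cong)
  have "pf (\<lambda>s e. code (A (fst s) (e 1) (e 0)))"
    using pmD[OF A pf_var pf_var, of 1 0] by (simp add: pe_def)
  then show ?thesis unfolding *
    by (intro ps_append ps_enc_nat ps_concat pp[OF n] pp[OF d]) simp
qed

text \<open>The final test: decode the returned factors and count the entries in which their product
  differs from the instance. The remainders modulo the field size only make decoding total.\<close>

lemma pf_check:
  fixes A :: "bool list \<Rightarrow> nat \<Rightarrow> nat \<Rightarrow> 'a::{finite,field}"
  assumes A: "pm A" and n: "pp n" and d: "pp d" and B: "pp B"
  obtains D where "pf D" "\<And>x (U :: 'a mat) V e. U \<in> carrier_mat (n x) (d x - 1) \<Longrightarrow> V \<in> carrier_mat (d x - 1) (d x) \<Longrightarrow>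
     D (x, enc_mat U @ enc_mat V) e \<noteq> 0 \<longleftrightarrow> l0 (U * V - mat (n x) (d x) (\<lambda>(i, j). A x i j)) \<le> B x"
proof -
  let ?q = "CARD('a)"
  define D where "D s e = (of_bool ((\<Sum>i<n (fst s). \<Sum>j<d (fst s). of_bool (\<not> (\<Sum>l<d (fst s) - 1.
      felt (nums (snd s) (2 + (i * (d (fst s) - 1) + l)) mod ?q) *
      felt (nums (snd s) (2 + n (fst s) * (d (fst s) - 1) + (2 + (l * d (fst s) + j))) mod ?q)) = A (fst s) i j)) \<le> B (fst s)) :: nat)"
    for s :: strs and e :: env
  have "pf D"
    unfolding D_def
    by (intro pfp_le pf_sum pfp_not pfp_field_eq pe_sum pe_mult pe_felt pf_nums pmD[OF A] pf_add pf_mult pf_diff pf_const pf_var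
        pp[OF n] pp[OF d] pp[OF B])
  moreover have "D (x, enc_mat U @ enc_mat V) e \<noteq> 0 \<longleftrightarrow> l0 (U * V - mat (n x) (d x) (\<lambda>(i, j). A x i j)) \<le> B x"
    if U: "U \<in> carrier_mat (n x) (d x - 1)" and V: "V \<in> carrier_mat (d x - 1) (d x)" for x e and U V :: "'a mat"
  proof -
    have "(\<Sum>l<d x - 1. felt (nums (enc_mat U @ enc_mat V) (2 + (i * (d x - 1) + l)) mod ?q) *
        felt (nums (enc_mat U @ enc_mat V) (2 + n x * (d x - 1) + (2 + (l * d x + j))) mod ?q)) =
        (\<Sum>l<d x - 1. U $$ (i, l) * V $$ (l, j))" if "i < n x" "j < d x" for i j
      by (rule sum.cong[OF refl]) (use that nums_mats[OF U V] in \<open>simp add: code_less del: One_nat_def add_2_eq_Suc add_2_eq_Suc'\<close>)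
    then have "(\<Sum>i<n x. \<Sum>j<d x. of_bool (\<not> (\<Sum>l<d x - 1. felt (nums (enc_mat U @ enc_mat V) (2 + (i * (d x - 1) + l)) mod ?q) *
        felt (nums (enc_mat U @ enc_mat V) (2 + n x * (d x - 1) + (2 + (l * d x + j))) mod ?q)) = A x i j)) =
        l0 (U * V - mat (n x) (d x) (\<lambda>(i, j). A x i j))"
      unfolding l0_diff[OF U V] by (intro sum.cong refl) simp
    then show ?thesis unfolding D_def fst_conv snd_conv by simp
  qed
  ultimately show thesis by (rule that)
qed

section \<open>The reduction\<close>

text \<open>The least exponent whose power of two reaches \<open>m\<close>, written as a bounded sum
  of tests so that it is computable with unary counters. The range \<open>l < m\<close> loses
  nothing, since \<open>l < 2 ^ l\<close>.\<close>

definition log_ceil :: "nat \<Rightarrow> nat" where "log_ceil m = (\<Sum>l<m. of_bool (2 ^ l < m))"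

lemma log_ceil:
  assumes "0 < m" shows "m \<le> 2 ^ log_ceil m" "2 ^ log_ceil m \<le> 2 * m"
proof -
  define L where "L = (LEAST L. m \<le> 2 ^ L)"
  have L: "m \<le> 2 ^ L" unfolding L_def by (rule LeastI[of _ m]) (simp add: less_imp_le)
  have below: "2 ^ l < m" if "l < L" for l using not_less_Least[of l "\<lambda>L. m \<le> 2 ^ L"] that unfolding L_def by simp
  have "l < m \<and> 2 ^ l < m \<longleftrightarrow> l < L" for l
  proof
    assume "l < m \<and> 2 ^ l < m"
    then have "2 ^ l < (2::nat) ^ L" using L by linarith
    then show "l < L" by simp
  next
    assume "l < L"
    then have "2 ^ l < m" by (rule below)
    moreover have "l < 2 ^ l" by (rule less_exp)
    ultimately show "l < m \<and> 2 ^ l < m" by linarith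
  qed
  then have "card {l. l < m \<and> 2 ^ l < m} = L" by simp
  moreover have "log_ceil m = card {l. l < m \<and> 2 ^ l < m}"
    unfolding log_ceil_def by (subst sum_of_bool_eq) (auto intro!: arg_cong[of _ _ card])
  ultimately have e: "log_ceil m = L" by simp
  show "m \<le> 2 ^ log_ceil m" unfolding e by (rule L)
  show "2 ^ log_ceil m \<le> 2 * m"
  proof (cases L)
    case 0
    then show ?thesis unfolding e using assms by simp
  next
    case (Suc l)
    then show ?thesis unfolding e using below[of l] by simp
  qed
qed

lemma pp_log_ceil:
  assumes "pp m" shows "pp (\<lambda>x. log_ceil (m x))"
proof -
  have "pfp (\<lambda>s e. 2 ^ e 0 < m (fst s))" by (rule pfp_cappow[OF pf_var pp[OF assms]])
  then have "pf (\<lambda>s e. \<Sum>l<m (fst s). of_bool (2 ^ l < m (fst s)))"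
    by (rule pf_sum[of "\<lambda>s e l. of_bool (2 ^ l < m (fst s))"]) (rule pp[OF assms])
  then show ?thesis unfolding log_ceil_def pp_def .
qed

text \<open>\<open>t\<close> and \<kappa> are chosen before the input, and \<open>2 ^ L\<close> is
  at most twice the number of variables. So the code length \<open>S\<close>, exponential in
  \<open>L\<close>, is polynomial in the input, and so are all sizes built from it.\<close>

lemma distance_gap:
  fixes r :: nat and x0 :: "'a::{finite,field}"
  assumes V: "turing_machine V" and out: "\<And>w. tm_outputs V w [w \<in> R] (real ((length w + 2) ^ b))"
  obtains n d B :: "bool list \<Rightarrow> nat" and A :: "bool list \<Rightarrow> nat \<Rightarrow> nat \<Rightarrow> 'a"
  where "pp n" "pp d" "pp B" "pm A" "\<And>x. 1 \<le> d x \<and> d x \<le> n x"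
    "\<And>x. \<exists>u. length u \<le> c * length x ^ c + c \<and> enc_pair x u \<in> R \<Longrightarrow> \<exists>z. nz (d x) z \<and> wt (n x) (ap (d x) (A x) z) \<le> B x"
    "\<And>x z. \<not> (\<exists>u. length u \<le> c * length x ^ c + c \<and> enc_pair x u \<in> R) \<Longrightarrow> nz (d x) z \<Longrightarrow> r * B x < wt (n x) (ap (d x) (A x) z)"
proof -
  let ?q = "CARD('a)"
  obtain t \<kappa> where g: "0 < t" "1 + 1 / (2 * real ?q) \<le> (1 - (31 / 32) ^ t)\<^sup>2 * (1 + 1 / real ?q)" "real r < (1 + 1 / (2 * real ?q)) ^ \<kappa>"
    by (rule gap_constants[of "real ?q" "real r"]) (use card_field_ge_2[where 'a = 'a] in auto)
  define Sg where "Sg = max (tm_symbols V) (tm_states V)"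
  define J where "J = tm_tapes V + 1"
  define lo where "lo x = 2 * length x + 1" for x :: "bool list"
  define hi where "hi x = lo x + (c * length x ^ c + c)" for x
  define T where "T x = (hi x + 2) ^ b" for x
  define W where "W x = 2 * T x + hi x + 2" for x
  define m where "m x = nv Sg J (W x) (T x)" for x
  define E where "E x = neq Sg J (W x) (T x)" for x
  define ini where "ini x p = tape_of (enc_pair x []) (int p)" for x :: "bool list" and p :: nat
  define cf :: "bool list \<Rightarrow> nat \<Rightarrow> nat \<Rightarrow> nat \<Rightarrow> 'a" where
    "cf x = eqn Sg J (W x) (T x) (lo x) (hi x) (tm_wr V Sg) (tm_mv V Sg) (ini x)" for x
  define L where "L x = log_ceil (m x)" for x
  define N where "N x = (2::nat) ^ (2 * L x + 3)" for x
  define S where "S x = ?q ^ (t * (L x + 4)) * (N x * N x) ^ t" for x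
  define w where "w x = S x * (?q - 1) div ?q" for x
  define A where "A x = base (S x) (m x) (gen (N x) (L x + 4) t) (cf x)" for x
  define n where "n x = S x * S x * (1 + E x)" for x
  have m0: "0 < m x" for x by (simp add: m_def nv_def)
  have mL: "m x \<le> 2 ^ L x" "2 ^ L x \<le> 2 * m x" for x using log_ceil[OF m0] by (simp_all add: L_def)
  note gu = gap_upper[OF g m0 mL(1) N_def refl S_def w_def A_def n_def]
  note gl = gap_lower[OF g m0 mL(1) N_def refl S_def w_def A_def n_def]
  note aux = gap_aux[OF g m0 mL(1) N_def refl S_def w_def A_def n_def]
  note cl = cook_levin[OF V out lo_def hi_def T_def W_def Sg_def J_def m_def cf_def[unfolded ini_def]]
  have V': "1 \<le> tm_tapes V" "2 \<le> tm_states V" "3 \<le> tm_symbols V" using V unfolding turing_machine_def by auto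
  then have SJ: "0 < Sg" "0 < J" by (auto simp: Sg_def J_def)
  have lo: "pp lo" unfolding lo_def pp_def by (intro pfi)
  have hi: "pp hi" unfolding hi_def pp_def by (intro pf_add pf_mult pf_const pf_power_const pf_fst pp[OF lo])
  have T: "pp T" unfolding T_def pp_def by (intro pf_power_const pf_add pf_const pp[OF hi])
  have W: "pp W" unfolding W_def pp_def by (intro pf_mult pf_add pf_const pp[OF hi] pp[OF T])
  have m: "pp m" unfolding m_def pp_def nv_def by (intro pf_mult pf_add pf_const pp[OF W] pp[OF T])
  have E: "pp E" unfolding E_def pp_def neq_def nv_def by (intro pf_mult pf_add pf_const pp[OF W] pp[OF T])
  have L: "pp L" unfolding L_def by (rule pp_log_ceil[OF m])
  have L2: "pbd (\<lambda>s e. 2 ^ L (fst s))"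
    by (rule pbd_mono[OF pbd_mult[OF pbd_const[of 2] pf_pbd[OF pp[OF m]]]]) (rule mL(2))
  have L4: "pbd (\<lambda>s e. 2 ^ (L (fst s) + 4))"
    unfolding power_add by (intro pbd_mult L2 pbd_const)
  have qp: "pbd (\<lambda>s e. ?q ^ (t * (L (fst s) + 4)))"
  proof (rule pbd_mono[OF pbd_power[OF L4]])
    fix s :: strs and e :: env
    let ?l = "L (fst s) + 4"
    \<comment> \<open>Since \<open>?q \<le> 2 ^ ?q\<close>, a power of the field size with exponent
      linear in \<open>L\<close> is a constant power of \<open>2 ^ ?l\<close>.\<close>
    have "?q ^ (t * ?l) \<le> (2 ^ ?q) ^ (t * ?l)" by (intro power_mono) (simp_all add: less_imp_le)
    also have "\<dots> = (2 ^ ?l) ^ (?q * t)" by (simp only: power_mult[symmetric] ac_simps)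
    finally show "?q ^ (t * ?l) \<le> (2 ^ ?l) ^ (?q * t)" .
  qed
  have "pbd (\<lambda>s e. 2 ^ (2 * L (fst s) + 3))"
  proof (rule pbd_mono[OF pbd_mult[OF pbd_power[OF L2, of 2] pbd_const[of 8]]])
    fix s :: strs and e :: env
    show "2 ^ (2 * L (fst s) + 3) \<le> (2 ^ L (fst s))\<^sup>2 * (8::nat)"
      by (simp add: power_add power_mult[symmetric] mult.commute)
  qed
  then have N: "pp N" unfolding N_def pp_def by (intro pf_power pf_add pf_mult pf_const pp[OF L])
  have S: "pp S" unfolding S_def pp_def
    by (intro pf_mult pf_power_const pf_power[OF pf_const _ qp] pf_add pf_const pp[OF L] pp[OF N])
  have w: "pp w" unfolding w_def pp_def by (intro pf_div pf_mult pf_const pp[OF S])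
  have n: "pp n" unfolding n_def pp_def by (intro pf_mult pf_add pf_const pp[OF S] pp[OF E])
  have ini: "pf (\<lambda>s e. ini (fst s) (f s e))" if f: "pf f" for f
  proof -
    have *: "ini x p = (if p < length x then 2 else if p = length x then 1
        else of_bool (tape_of x (int (p - length x - 1)) = 1) + 2 * of_bool (tape_of x (int (p - length x - 1)) = 2))" for x p
    proof -
      have l: "length (enc_nat (length x)) = length x + 1" by (simp add: enc_nat_def)
      consider "p < length x" | "p = length x" | "length x + 1 \<le> p" by linarith
      then show ?thesis
      proof cases
        case 3
        then have "ini x p = tape_of x (int (p - length x - 1))"
          unfolding ini_def enc_pair_def using tape_of_append_ge[of "enc_nat (length x)" p x] by (simp add: l)
        moreover have "tape_of x (int (p - length x - 1)) \<in> {0, 1, 2}" by (simp add: tape_of_def)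
        then have "tape_of x (int (p - length x - 1)) = of_bool (tape_of x (int (p - length x - 1)) = 1) +
            2 * of_bool (tape_of x (int (p - length x - 1)) = 2)" by (elim insertE) simp_all
        moreover have "\<not> p < length x" "p \<noteq> length x" using 3 by auto
        ultimately show ?thesis by (simp only: if_False)
      qed (simp_all add: ini_def enc_pair_def tape_of_int, simp_all add: enc_nat_def nth_append)
    qed
    show ?thesis unfolding * by (intro pfi f)
  qed
  have cf: "pe (\<lambda>s e. cf (fst s) (f s e) (f2 s e) (f3 s e))" if "pf f" "pf f2" "pf f3" for f f2 f3
    unfolding cf_def by (rule pe_eqn[OF W T lo hi SJ(2,1) ini that])
  have gen: "pm (\<lambda>x. gen (N x) (L x + 4) t :: nat \<Rightarrow> nat \<Rightarrow> 'a)"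
    by (rule pm_gen[OF N _ qp L4]) (unfold pp_def, intro pf_add pf_const pp[OF L])
  have A: "pm A" unfolding A_def by (rule pm_base[OF S m gen cf])
  have mm: "pp (\<lambda>x. m x * m x)" unfolding pp_def by (intro pf_mult pp[OF m])
  show thesis
  proof (rule that)
    show "pp (\<lambda>x. n x ^ \<kappa>)" "pp (\<lambda>x. (m x * m x) ^ \<kappa>)" "pp (\<lambda>x. (w x * w x) ^ \<kappa>)"
      unfolding pp_def by (intro pf_power_const pf_mult pp[OF n] pp[OF m] pp[OF w])+
    show "pm (\<lambda>x. tpow \<kappa> (n x) (m x * m x) (A x))" by (rule pm_tpow[OF A n mm])
    show "1 \<le> (m x * m x) ^ \<kappa> \<and> (m x * m x) ^ \<kappa> \<le> n x ^ \<kappa>" for x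
    proof
      show "1 \<le> (m x * m x) ^ \<kappa>" using m0[of x] by (simp add: Suc_le_eq)
      \<comment> \<open>The two matrix indices among the equation parameters alone give
        \<open>m * m\<close> equations, so the matrix has at least as many rows as columns.\<close>
      have "E x = 10 * Sg * W x * J * (T x + 1) * Sg ^ J * (m x * m x)"
        unfolding E_def neq_def m_def[symmetric] by (simp only: mult.assoc)
      moreover have "1 \<le> 10 * Sg * W x * J * (T x + 1) * Sg ^ J" using SJ by (simp add: Suc_le_eq W_def)
      ultimately have "1 * (m x * m x) \<le> E x" by (metis mult_le_mono1)
      moreover have "1 * E x \<le> n x" unfolding n_def using aux(3)[of x]
        by (intro mult_le_mono) (auto simp: Suc_le_eq)
      ultimately show "(m x * m x) ^ \<kappa> \<le> n x ^ \<kappa>" by (intro power_mono) auto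
    qed
    show "\<exists>z. nz ((m x * m x) ^ \<kappa>) z \<and> wt (n x ^ \<kappa>) (ap ((m x * m x) ^ \<kappa>) (tpow \<kappa> (n x) (m x * m x) (A x)) z) \<le> (w x * w x) ^ \<kappa>"
      if yes: "\<exists>u. length u \<le> c * length x ^ c + c \<and> enc_pair x u \<in> R" for x
    proof -
      obtain u where u: "nz (m x) u" "holds (m x) (E x) (cf x) (\<lambda>a b. u a * u b)"
        using cl(1)[OF yes] unfolding E_def by blast
      show ?thesis by (rule gu[OF u])
    qed
    show "r * (w x * w x) ^ \<kappa> < wt (n x ^ \<kappa>) (ap ((m x * m x) ^ \<kappa>) (tpow \<kappa> (n x) (m x * m x) (A x)) z)"
      if no: "\<not> (\<exists>u. length u \<le> c * length x ^ c + c \<and> enc_pair x u \<in> R)" and z: "nz ((m x * m x) ^ \<kappa>) z" for x z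
    proof -
      have "real r * real ((w x * w x) ^ \<kappa>) < real (wt (n x ^ \<kappa>) (ap ((m x * m x) ^ \<kappa>) (tpow \<kappa> (n x) (m x * m x) (A x)) z))"
      proof (rule gl[OF _ z])
        show "\<forall>a<m x. \<forall>b<m x. u a * v b = 0" if h: "holds (m x) (E x) (cf x) (\<lambda>a b. u a * v b)" for u v
          by (rule cl(2)[OF no h[unfolded E_def]])
      qed
      then show ?thesis by (simp only: of_nat_mult[symmetric] of_nat_less_iff)
    qed
  qed
qed

section \<open>From the gap to a decision procedure\<close>

lemma tm_outputs_mono: "tm_outputs M x y t \<Longrightarrow> t \<le> t' \<Longrightarrow> tm_outputs M x y t'"
  unfolding tm_outputs_def by (elim exE conjE, intro exI conjI) (assumption | rule order_trans)+

text \<open>A constant \<open>K\<close> covers the finitely many exceptional values and the factor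
  of the O-bound, and \<open>K \<le> 2 ^ K \<le> (n + 2) ^ K\<close> moves it into the
  exponent.\<close>

lemma poly_bounded_nat:
  assumes "poly_bounded T" obtains b where "\<And>n. T n \<le> real ((n + 2) ^ b)"
proof -
  obtain c where "T \<in> O(\<lambda>n. real n ^ c)" using assms unfolding poly_bounded_def by blast
  then obtain C where C: "0 < C" "eventually (\<lambda>n. norm (T n) \<le> C * norm (real n ^ c)) sequentially"
    by (rule landau_o.bigE)
  then obtain n0 where n0: "\<And>n. n0 \<le> n \<Longrightarrow> norm (T n) \<le> C * norm (real n ^ c)"
    unfolding eventually_sequentially by blast
  define K where "K = nat \<lceil>C + (\<Sum>n<n0. \<bar>T n\<bar>)\<rceil>"
  have K: "C \<le> real K" "n < n0 \<Longrightarrow> T n \<le> real K" for n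
  proof -
    have s: "0 \<le> (\<Sum>n<n0. \<bar>T n\<bar>)" by (intro sum_nonneg) auto
    have k: "C + (\<Sum>n<n0. \<bar>T n\<bar>) \<le> real K" unfolding K_def by linarith
    show "C \<le> real K" using s k by linarith
    assume "n < n0"
    then have "\<bar>T n\<bar> \<le> (\<Sum>n<n0. \<bar>T n\<bar>)" by (intro member_le_sum) auto
    then show "T n \<le> real K" using k C(1) by linarith
  qed
  have "T n \<le> real ((n + 2) ^ (K + c))" for n
  proof -
    have "T n \<le> real K * real ((n + 2) ^ c)"
    proof (cases "n < n0")
      case True
      have "real K * 1 \<le> real K * real ((n + 2) ^ c)" by (intro mult_left_mono) simp_all
      then show ?thesis using K(2)[OF True] by simp
    next
      case False
      then have "T n \<le> C * real n ^ c" using n0[of n] by simp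
      also have "\<dots> \<le> real K * real (n + 2) ^ c" using K(1) C(1) by (intro mult_mono power_mono) auto
      finally show ?thesis by simp
    qed
    also have "\<dots> \<le> real ((n + 2) ^ K) * real ((n + 2) ^ c)"
    proof (intro mult_right_mono of_nat_mono)
      have "K \<le> 2 ^ K" by (simp add: less_imp_le)
      also have "\<dots> \<le> (n + 2) ^ K" by (intro power_mono) auto
      finally show "K \<le> (n + 2) ^ K" .
    qed simp
    finally show ?thesis by (simp only: power_add of_nat_mult)
  qed
  then show thesis by (rule that)
qed

lemma oracle_machine_poly:
  assumes "turing_machine M" "ps F" "pf D" and y: "\<And>x. tm_outputs M (F (x, []) (\<lambda>_. 0)) (y x) (t x)"
    and len: "\<And>x. length (y x) \<le> (length x + 2) ^ a" and D: "\<And>x. D (x, y x) (\<lambda>_. 0) \<noteq> 0 \<longleftrightarrow> x \<in> L"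
  obtains M' c where "turing_machine M'" "\<And>x. tm_outputs M' x [x \<in> L] (real ((length x + 2) ^ c) + 10 * t x)"
proof -
  obtain M' c where M': "turing_machine M'" "\<And>x y t. tm_outputs M (F (x, []) (\<lambda>_. 0)) y t \<Longrightarrow>
       tm_outputs M' x [D (x, y) (\<lambda>_. 0) \<noteq> 0] (real ((length x + length y + 2) ^ c) + 10 * t)"
    by (rule oracle_machine[OF assms(1-3)]) (rule that)
  have "tm_outputs M' x [x \<in> L] (real ((length x + 2) ^ (Suc (Suc a) * c)) + 10 * t x)" for x
  proof (rule tm_outputs_mono[OF M'(2)[OF y[of x], unfolded D]])
    let ?k = "length x + 2"
    have "length x + length (y x) + 2 \<le> ?k ^ Suc a + ?k ^ Suc a"
      using len[of x] power_increasing[of 1 "Suc a" ?k] power_increasing[of a "Suc a" ?k] by simp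
    also have "\<dots> \<le> ?k * ?k ^ Suc a" using mult_le_mono1[of 2 ?k "?k ^ Suc a"] by simp
    finally have "(length x + length (y x) + 2) ^ c \<le> (?k ^ Suc (Suc a)) ^ c" by (intro power_mono) simp_all
    then show "real ((length x + length (y x) + 2) ^ c) + 10 * t x \<le> real (?k ^ (Suc (Suc a) * c)) + 10 * t x"
      unfolding power_mult by (simp only: add_le_cancel_right of_nat_le_iff)
  qed
  with M'(1) show thesis by (rule that)
qed

text \<open>The instance, and with it the exponent \<open>a\<close>, is fixed before the algorithm;
  this order of quantifiers lets one \<delta> work against all algorithms. For members of
  \<open>L\<close> the optimum is at most \<open>B x\<close>, so the returned matrices meet the
  threshold \<open>R' * B x\<close>; for other inputs no matrices meet it.\<close>

theorem approx_algorithm_decides_NP: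
  fixes r :: real
  assumes L: "L \<in> class_NP"
  obtains a :: nat and rows :: "bool list \<Rightarrow> nat" where "\<And>x. 1 \<le> rows x \<and> rows x \<le> (length x + 2) ^ a"
    "\<And>M T. approx_algorithm TYPE('a::{finite,field}) r M T \<Longrightarrow>
       \<exists>M' c. turing_machine M' \<and> (\<forall>x. tm_outputs M' x [x \<in> L] (real ((length x + 2) ^ c) + 10 * T (rows x)))"
proof -
  obtain R c where R: "R \<in> class_P" "\<And>x. x \<in> L \<longleftrightarrow> (\<exists>u. length u \<le> c * length x ^ c + c \<and> enc_pair x u \<in> R)"
    using L unfolding class_NP_def by blast
  obtain V TV where V: "turing_machine V" "poly_bounded TV" "\<And>w. tm_outputs V w [w \<in> R] (TV (length w))"
    using R(1) unfolding class_P_def by blast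
  obtain b where b: "\<And>n. TV n \<le> real ((n + 2) ^ b)" by (rule poly_bounded_nat[OF V(2)]) (rule that)
  have out: "tm_outputs V w [w \<in> R] (real ((length w + 2) ^ b))" for w
    by (rule tm_outputs_mono[OF V(3) b])
  \<comment> \<open>Rounding up makes the threshold a natural number that the machine can
    compute.\<close>
  define R' where "R' = nat \<lceil>r\<rceil>"
  have R': "r \<le> real R'" unfolding R'_def by linarith
  obtain n d B :: "bool list \<Rightarrow> nat" and A :: "bool list \<Rightarrow> nat \<Rightarrow> nat \<Rightarrow> 'a" where pn: "pp n" and pd: "pp d" and pB: "pp B" and pA: "pm A"
    and dn: "\<And>x. 1 \<le> d x \<and> d x \<le> n x"
    and yes: "\<And>x. \<exists>u. length u \<le> c * length x ^ c + c \<and> enc_pair x u \<in> R \<Longrightarrow> \<exists>z. nz (d x) z \<and> wt (n x) (ap (d x) (A x) z) \<le> B x"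
    and no: "\<And>x z. \<not> (\<exists>u. length u \<le> c * length x ^ c + c \<and> enc_pair x u \<in> R) \<Longrightarrow> nz (d x) z \<Longrightarrow> R' * B x < wt (n x) (ap (d x) (A x) z)"
    by (rule distance_gap[OF V(1) out, of c R']) (rule that)
  obtain a where a: "\<And>x. n x \<le> (length x + 2) ^ a" using pp_poly[OF pn] by blast
  define mt where "mt x = mat (n x) (d x) (\<lambda>(i, j). A x i j)" for x
  have RB: "pp (\<lambda>x. R' * B x)" unfolding pp_def by (intro pf_mult pf_const pp[OF pB])
  obtain D where D0: "pf D" "\<And>x (U :: 'a mat) V e. U \<in> carrier_mat (n x) (d x - 1) \<Longrightarrow> V \<in> carrier_mat (d x - 1) (d x) \<Longrightarrow>
     D (x, enc_mat U @ enc_mat V) e \<noteq> 0 \<longleftrightarrow> l0 (U * V - mat (n x) (d x) (\<lambda>(i, j). A x i j)) \<le> R' * B x"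
    by (rule pf_check[OF pA pn pd RB]) (rule that)
  note D = D0(2)[folded mt_def]
  let ?l = "\<lambda>x. 2 * (n x + d x + 2 + n x * d x * CARD('a))"
  have "pp ?l" unfolding pp_def by (intro pf_mult pf_add pf_const pp[OF pn] pp[OF pd])
  then obtain a' where a': "\<And>x. ?l x \<le> (length x + 2) ^ a'" using pp_poly by blast
  show thesis
  proof (rule that[of n a])
    show "1 \<le> n x \<and> n x \<le> (length x + 2) ^ a" for x using dn[of x] a by auto
    fix M T assume M: "approx_algorithm TYPE('a) r M T"
    have "\<exists>U V. l0_approx r (d x - 1) (mt x) U V \<and> tm_outputs M (enc_mat (mt x)) (enc_mat U @ enc_mat V) (T (n x))" for x
      using M dn[of x] unfolding approx_algorithm_def mt_def by (meson mat_carrier)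
    then obtain U V where UV: "\<And>x. l0_approx r (d x - 1) (mt x) (U x) (V x)"
      "\<And>x. tm_outputs M (enc_mat (mt x)) (enc_mat (U x) @ enc_mat (V x)) (T (n x))" by metis
    have car: "U x \<in> carrier_mat (n x) (d x - 1)" "V x \<in> carrier_mat (d x - 1) (d x)"
      and apx: "real (l0 (U x * V x - mt x)) \<le> r * real (l0_opt (d x - 1) (mt x))" for x
      using UV(1)[of x] unfolding l0_approx_def mt_def by auto
    have h1: "turing_machine M" using M unfolding approx_algorithm_def by blast
    have h2: "ps (\<lambda>s e. enc_mat (mt (fst s)))" unfolding mt_def by (rule ps_enc_mat[OF pA pn pd])
    have h4: "tm_outputs M (enc_mat (mt (fst (x, [])))) (enc_mat (U x) @ enc_mat (V x)) (T (n x))" for x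
      using UV(2) by simp
    have h5: "length (enc_mat (U x) @ enc_mat (V x)) \<le> (length x + 2) ^ a'" for x
    proof -
      have "length (enc_mat (U x)) \<le> n x + d x + 2 + n x * d x * CARD('a)"
        by (rule order_trans[OF length_enc_mat[OF car(1)]]) (intro add_mono mult_le_mono, auto)
      moreover have "length (enc_mat (V x)) \<le> n x + d x + 2 + n x * d x * CARD('a)"
      proof (rule order_trans[OF length_enc_mat[OF car(2)]])
        have "d x - 1 \<le> n x" using dn[of x] by linarith
        then show "d x - 1 + d x + 2 + (d x - 1) * d x * CARD('a) \<le> n x + d x + 2 + n x * d x * CARD('a)"
          by (intro add_mono mult_le_mono) simp_all
      qed
      ultimately have "length (enc_mat (U x) @ enc_mat (V x)) \<le> ?l x" by simp
      then show ?thesis using a'[of x] by linarith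
    qed
    have h6: "D (x, enc_mat (U x) @ enc_mat (V x)) (\<lambda>_. 0) \<noteq> 0 \<longleftrightarrow> x \<in> L" for x
      unfolding D[OF car]
    proof
      assume "x \<in> L"
      then obtain z where z: "nz (d x) z" "wt (n x) (ap (d x) (A x) z) \<le> B x" using yes R(2) by blast
      have le: "real (l0_opt (d x - 1) (mt x)) \<le> real (B x)"
        using l0_opt_le_distance[OF z(1), of "n x" "A x"] z(2) unfolding mt_def by simp
      have "r * real (l0_opt (d x - 1) (mt x)) \<le> real R' * real (l0_opt (d x - 1) (mt x))"
        using R' by (intro mult_right_mono) simp_all
      moreover have "real R' * real (l0_opt (d x - 1) (mt x)) \<le> real R' * real (B x)"
        using le by (intro mult_left_mono) simp_all
      ultimately have "real (l0 (U x * V x - mt x)) \<le> real R' * real (B x)" using apx[of x] by linarith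
      then show "l0 (U x * V x - mt x) \<le> R' * B x" by (simp only: of_nat_mult[symmetric] of_nat_le_iff)
    next
      assume le: "l0 (U x * V x - mt x) \<le> R' * B x"
      obtain z where z: "nz (d x) z" "wt (n x) (ap (d x) (A x) z) \<le> l0 (U x * V x - mat (n x) (d x) (\<lambda>(i, j). A x i j))"
        by (rule l0_ge_distance[OF conjunct1[OF dn] car]) (rule that)
      show "x \<in> L"
      proof (rule ccontr)
        assume "x \<notin> L"
        then have "R' * B x < wt (n x) (ap (d x) (A x) z)" using no[OF _ z(1)] R(2) by blast
        then show False using z(2) le unfolding mt_def by linarith
      qed
    qed
    show "\<exists>M' c. turing_machine M' \<and> (\<forall>x. tm_outputs M' x [x \<in> L] (real ((length x + 2) ^ c) + 10 * T (n x)))"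
      by (rule oracle_machine_poly[OF h1 h2 D0(1) h4 h5 h6]) blast
  qed
qed

section \<open>Languages\<close>

lemma poly_boundedI: "poly_bounded (\<lambda>n. real ((n + 2) ^ b) * C)"
proof -
  have "(\<lambda>n. real ((n + 2) ^ b) * C) \<in> O(\<lambda>n. real n ^ b)"
  proof (rule bigoI[of _ "3 ^ b * \<bar>C\<bar>"])
    show "eventually (\<lambda>n. norm (real ((n + 2) ^ b) * C) \<le> 3 ^ b * \<bar>C\<bar> * norm (real n ^ b)) sequentially"
      using eventually_ge_at_top[of 1]
    proof eventually_elim
      case (elim n)
      then have "real (n + 2) ^ b \<le> (3 * real n) ^ b" by (intro power_mono) auto
      then have "real (n + 2) ^ b * \<bar>C\<bar> \<le> (3 * real n) ^ b * \<bar>C\<bar>" by (intro mult_right_mono) auto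
      then show ?case by (simp add: abs_mult power_mult_distrib mult.commute mult.left_commute)
    qed
  qed
  then show ?thesis unfolding poly_bounded_def by blast
qed

lemma class_PI:
  assumes M: "turing_machine M" "\<And>x. tm_outputs M x [x \<in> L] (real ((length x + 2) ^ c) + 10 * real ((length x + 2) ^ b))"
  shows "L \<in> class_P"
proof -
  have "tm_outputs M x [x \<in> L] (real ((length x + 2) ^ (c + b)) * 11)" for x
  proof (rule tm_outputs_mono[OF M(2)])
    have "(length x + 2) ^ c \<le> (length x + 2) ^ (c + b)" "(length x + 2) ^ b \<le> (length x + 2) ^ (c + b)"
      by (intro power_increasing; simp)+
    then have "real ((length x + 2) ^ c) \<le> real ((length x + 2) ^ (c + b))" "real ((length x + 2) ^ b) \<le> real ((length x + 2) ^ (c + b))"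
      by (simp_all only: of_nat_le_iff)
    then show "real ((length x + 2) ^ c) + 10 * real ((length x + 2) ^ b) \<le> real ((length x + 2) ^ (c + b)) * 11" by linarith
  qed
  then show ?thesis unfolding class_P_def using M(1) poly_boundedI[of "c + b" 11] by blast
qed

section \<open>Deciding computable predicates, and the inclusion of P in NP\<close>

definition idle :: tm where
  "idle = \<lparr>tm_tapes = 1, tm_states = 2, tm_symbols = 3, tm_delta = \<lambda>q ss. (1, stay ss)\<rparr>"

lemma idle: "turing_machine idle" "tm_outputs idle [] [] 1"
proof -
  show "turing_machine idle" unfolding turing_machine_def idle_def stay_def by auto
  have "tm_step idle (tm_init idle []) = (1, map2 act_tape [(tape_of [], 0)] (stay (map (\<lambda>(c, p). c p) [(tape_of [], 0)])))"
    by (simp add: tm_init_def idle_def tm_step.simps)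
  then have "(tm_step idle ^^ 1) (tm_init idle []) = (1, [(tape_of [], 0)])" unfolding map2_stay by simp
  then show "tm_outputs idle [] [] 1" unfolding tm_outputs_def by (intro exI[of _ 1]) simp
qed

text \<open>The oracle construction with a trivial oracle turns a program into a decision
  machine.\<close>

lemma class_P_pf:
  assumes "pf D" shows "{w. D (w, []) (\<lambda>_. 0) \<noteq> 0} \<in> class_P" (is "?L \<in> _")
proof -
  obtain M c where M: "turing_machine M" "\<And>x. tm_outputs M x [x \<in> ?L] (real ((length x + 2) ^ c) + 10 * 1)"
    by (rule oracle_machine_poly[OF idle(1) ps_nil assms, of "\<lambda>x. []" "\<lambda>x. 1" 0 ?L]) (use idle(2) in auto)
  then show ?thesis by (intro class_PI[where b = 0]) simp_all
qed

lemma nums_0_cases: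
  obtains "w = replicate (nums w 0) True" | w' where "w = enc_nat (nums w 0) @ w'"
proof -
  have "w = replicate k True \<or> (\<exists>w'. w = enc_nat k @ w')" if "k = length (takeWhile id w)" for k
    using that
  proof (induction w arbitrary: k)
    case (Cons a w)
    then show ?case by (cases a) (auto simp: enc_nat_def)
  qed simp
  then consider k where "w = replicate k True" | k w' where "w = enc_nat k @ w'" by blast
  then show thesis
  proof cases
    case (1 k)
    have "nums w 0 = (\<Sum>p<k. 1)"
      unfolding nums_def 1 length_replicate by (rule sum.cong[OF refl]) (auto simp: tape_of_int intro!: sum.neutral)
    then show thesis using that(1) 1 by simp
  next
    case 2
    then show thesis using that(2) by (simp add: nums_enc_nat)
  qed
qed

lemma nums_0_enc_pair: "nums (enc_pair x u) 0 = length x"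
  by (simp add: enc_pair_def nums_enc_nat)

text \<open>\<open>nums w 0\<close> is the number of leading bits \<open>True\<close>. A word codes
  a pair as soon as the separating \<open>False\<close> and a first component of the announced
  length fit into it.\<close>

lemma enc_pair_iff: "2 * nums w 0 + 1 \<le> length w \<longleftrightarrow> (\<exists>x u. w = enc_pair x u)"
proof
  assume l: "2 * nums w 0 + 1 \<le> length w"
  show "\<exists>x u. w = enc_pair x u"
  proof (rule nums_0_cases[of w])
    assume "w = replicate (nums w 0) True"
    then have "length w = nums w 0" by (metis length_replicate)
    then show ?thesis using l by simp
  next
    fix w' assume w: "w = enc_nat (nums w 0) @ w'"
    then have "length w = nums w 0 + 1 + length w'" by (metis enc_nat_def length_append length_append_singleton length_replicate Suc_eq_plus1)
    then have "length (take (nums w 0) w') = nums w 0" using l by simp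
    then have "w = enc_pair (take (nums w 0) w') (drop (nums w 0) w')" unfolding enc_pair_def using w by simp
    then show ?thesis by blast
  qed
next
  assume "\<exists>x u. w = enc_pair x u"
  then obtain x u where "w = enc_pair x u" by blast
  then show "2 * nums w 0 + 1 \<le> length w" using nums_0_enc_pair by (simp add: enc_pair_def enc_nat_def)
qed

lemma tape_of_enc_pair:
  shows "i < length x \<Longrightarrow> tape_of (enc_pair x u) (int (length x + 1 + i)) = tape_of x (int i)"
    and "tape_of (enc_pair x u) (int (2 * length x + 1 + i)) = tape_of u (int i)"
proof -
  have l: "length (enc_nat (length x)) = length x + 1" by (simp add: enc_nat_def)
  have e: "tape_of (enc_pair x u) (int (length x + 1 + k)) = tape_of (x @ u) (int k)" for k
    unfolding enc_pair_def using tape_of_append_ge[of "enc_nat (length x)" "length x + 1 + k" "x @ u"] by (simp add: l)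
  show "i < length x \<Longrightarrow> tape_of (enc_pair x u) (int (length x + 1 + i)) = tape_of x (int i)"
    unfolding e by (rule tape_of_append)
  have "2 * length x + 1 + i = length x + 1 + (length x + i)" by simp
  then show "tape_of (enc_pair x u) (int (2 * length x + 1 + i)) = tape_of u (int i)"
    using e[of "length x + i"] tape_of_append_ge[of x "length x + i" u] by simp
qed

text \<open>\<open>class_P \<noteq> class_NP\<close> is refuted by equality, so this inclusion is
  needed too. The verifier ignores the certificate, but as it reads one string it has to recognise
  pair codes and extract the first component before it calls the machine for
  \<open>L\<close>.\<close>

lemma class_P_subset_NP: "class_P \<subseteq> class_NP"
proof
  fix L assume "L \<in> class_P"
  then obtain M T where M: "turing_machine M" "poly_bounded T" "\<And>w. tm_outputs M w [w \<in> L] (T (length w))"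
    unfolding class_P_def by blast
  obtain b where b: "\<And>n. T n \<le> real ((n + 2) ^ b)" by (rule poly_bounded_nat[OF M(2)]) (rule that)
  define R where "R = {w. \<exists>x u. w = enc_pair x u \<and> x \<in> L}"
  define F :: "strs \<Rightarrow> env \<Rightarrow> bool list" where
    "F s e = concat (map (\<lambda>i. [tape_of (fst s) (int (nums (fst s) 0 + 1 + i)) = 2]) [0..<nums (fst s) 0])" for s e
  define D :: "strs \<Rightarrow> env \<Rightarrow> nat" where
    "D s e = of_bool (2 * nums (fst s) 0 + 1 \<le> length (fst s) \<and> tape_of (snd s) (int 0) = 2)" for s e
  have F: "ps F" unfolding F_def
    by (rule ps_concat) (intro ps_bit pfp_sym pf_add pf_nums pf_const pf_var)+
  have D: "pf D" unfolding D_def by (intro pfp_conj pfp_le pf_add pf_mult pf_nums pf_const pfp_sym pf_fst)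
  have Fx: "F (enc_pair x u, v) e = x" for x u v e
  proof -
    have "concat (map (\<lambda>i. [f i]) xs) = map f xs" for f :: "nat \<Rightarrow> bool" and xs by (induction xs) simp_all
    then have "F (enc_pair x u, v) e = map (\<lambda>i. tape_of (enc_pair x u) (int (length x + 1 + i)) = 2) [0..<length x]"
      unfolding F_def by (simp add: nums_0_enc_pair)
    also have "\<dots> = map (\<lambda>i. x ! i) [0..<length x]"
      by (rule map_cong[OF refl]) (subst tape_of_enc_pair(1), auto simp: tape_of_int)
    finally show ?thesis by (simp add: map_nth)
  qed
  have Fl: "length (F (w, v) e) \<le> length w" for w v e
  proof -
    have "length (F (w, v) e) = nums w 0" unfolding F_def by (simp add: length_concat comp_def sum_list_triv)
    also have "\<dots> \<le> (\<Sum>p<length w. 1)" unfolding nums_def by (rule sum_mono) simp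
    finally show ?thesis by simp
  qed
  have DR: "D (w, [F (w, []) (\<lambda>_. 0) \<in> L]) (\<lambda>_. 0) \<noteq> 0 \<longleftrightarrow> w \<in> R" for w
  proof -
    have "w \<in> R \<longleftrightarrow> (\<exists>x u. w = enc_pair x u) \<and> F (w, []) (\<lambda>_. 0) \<in> L" unfolding R_def using Fx by fastforce
    then show ?thesis unfolding D_def fst_conv enc_pair_iff by (simp add: tape_of_def)
  qed
  have t: "tm_outputs M (F (w, []) (\<lambda>_. 0)) [F (w, []) (\<lambda>_. 0) \<in> L] (real ((length w + 2) ^ b))" for w
  proof (rule tm_outputs_mono[OF M(3)])
    have "(length (F (w, []) (\<lambda>_. 0)) + 2) ^ b \<le> (length w + 2) ^ b" using Fl[of w] by (intro power_mono) simp_all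
    then show "T (length (F (w, []) (\<lambda>_. 0))) \<le> real ((length w + 2) ^ b)"
      using b[of "length (F (w, []) (\<lambda>_. 0))"] by (meson of_nat_le_iff order_trans)
  qed
  obtain M' c where "turing_machine M'" "\<And>x. tm_outputs M' x [x \<in> R] (real ((length x + 2) ^ c) + 10 * real ((length x + 2) ^ b))"
    by (rule oracle_machine_poly[OF M(1) F D t _ DR, of 0]) (simp, rule that)
  then have R: "R \<in> class_P" by (rule class_PI)
  have xR: "enc_pair x u \<in> R \<longleftrightarrow> x \<in> L" for x u
  proof -
    have "x = y" if "enc_pair x u = enc_pair y v" for y v using Fx[of x u "[]"] Fx[of y v "[]"] that by metis
    then show ?thesis unfolding R_def by blast
  qed
  have "x \<in> L \<longleftrightarrow> (\<exists>u. length u \<le> 0 * length x ^ 0 + 0 \<and> enc_pair x u \<in> R)" for x using xR by auto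
  with R show "L \<in> class_NP" unfolding class_NP_def by blast
qed

text \<open>A finite automaton with a counter: the state \<open>q + 11 * v\<close> consists of the control state \<open>q\<close> and the
  variable \<open>v\<close> read so far. States: 0 header; 1 between clauses; 2, 3 in a clause not yet / already satisfied;
  4, 5 before a sign; 6, 7, 8 in a variable (6, 7 after a negative, positive sign); 9 accept; 10 reject.\<close>

definition scan :: "(nat \<Rightarrow> bool) \<Rightarrow> nat \<Rightarrow> bool \<Rightarrow> nat" where
  "scan \<alpha> a b = (let q = a mod 11; v = a div 11 in
     if q = 0 then (if b then 0 else 1)
     else if q = 1 then (if b then 2 else 9)
     else if q = 2 then (if b then 4 else 10)
     else if q = 3 then (if b then 5 else 1)
     else if q = 4 then (if b then 7 else 6)
     else if q = 5 then 8
     else if q = 6 then (if b then a + 11 else if \<alpha> v then 2 else 3)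
     else if q = 7 then (if b then a + 11 else if \<alpha> v then 3 else 2)
     else if q = 8 then (if b then 8 else 3)
     else q)"

abbreviation "scans \<alpha> \<equiv> foldl (scan \<alpha>)"

lemma scan_header: "scans \<alpha> 0 (enc_nat n) = 1"
proof -
  have "scans \<alpha> 0 (replicate n True) = 0" by (induction n) (simp_all add: scan_def)
  then show ?thesis by (simp add: enc_nat_def scan_def)
qed

lemma scan_var:
  "scans \<alpha> 6 (enc_nat v) = (if \<alpha> v then 2 else 3)" "scans \<alpha> 7 (enc_nat v) = (if \<alpha> v then 3 else 2)" "scans \<alpha> 8 (enc_nat v) = 3"
proof -
  have m: "(6 + 11 * w) mod 11 = 6" "(6 + 11 * w) div 11 = w" "(7 + 11 * w) mod 11 = 7" "(7 + 11 * w) div 11 = w" for w :: nat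
    by presburger+
  have "scans \<alpha> (6 + 11 * w) (replicate v True) = 6 + 11 * (w + v)" for w
  proof (induction v arbitrary: w)
    case (Suc v)
    have "scan \<alpha> (6 + 11 * w) True = 6 + 11 * (w + 1)" unfolding scan_def Let_def m by simp
    then show ?case using Suc.IH[of "w + 1"] by simp
  qed simp
  from this[of 0] have a: "scans \<alpha> 6 (replicate v True) = 6 + 11 * v" by simp
  have "scans \<alpha> (7 + 11 * w) (replicate v True) = 7 + 11 * (w + v)" for w
  proof (induction v arbitrary: w)
    case (Suc v)
    have "scan \<alpha> (7 + 11 * w) True = 7 + 11 * (w + 1)" unfolding scan_def Let_def m by simp
    then show ?case using Suc.IH[of "w + 1"] by simp
  qed simp
  from this[of 0] have b: "scans \<alpha> 7 (replicate v True) = 7 + 11 * v" by simp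
  have c: "scans \<alpha> 8 (replicate v True) = 8" by (induction v) (simp_all add: scan_def)
  show "scans \<alpha> 6 (enc_nat v) = (if \<alpha> v then 2 else 3)" unfolding enc_nat_def foldl_append a by (simp add: scan_def m Let_def)
  show "scans \<alpha> 7 (enc_nat v) = (if \<alpha> v then 3 else 2)" unfolding enc_nat_def foldl_append b by (simp add: scan_def m Let_def)
  show "scans \<alpha> 8 (enc_nat v) = 3" unfolding enc_nat_def foldl_append c by (simp add: scan_def)
qed

lemma scan_literal:
  "scans \<alpha> 2 (True # enc_literal l) = (if \<alpha> (snd l) = fst l then 3 else 2)" "scans \<alpha> 3 (True # enc_literal l) = 3"
proof -
  have s: "scan \<alpha> 2 True = 4" "scan \<alpha> 3 True = 5" "scan \<alpha> 4 b = (if b then 7 else 6)" "scan \<alpha> 5 b = 8" for b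
    by (simp_all add: scan_def)
  show "scans \<alpha> 2 (True # enc_literal l) = (if \<alpha> (snd l) = fst l then 3 else 2)" "scans \<alpha> 3 (True # enc_literal l) = 3"
    unfolding enc_literal_def foldl.simps s by (cases "fst l"; simp add: scan_var)+
qed

lemma enc_list_simps: "enc_list e [] = [False]" "enc_list e (x # xs) = (True # e x) @ enc_list e xs"
  by (simp_all add: enc_list_def)

lemma scan_clause:
  "scans \<alpha> 2 (enc_list enc_literal C) = (if \<exists>(b, v)\<in>set C. \<alpha> v = b then 1 else 10)" "scans \<alpha> 3 (enc_list enc_literal C) = 1"
proof -
  show 3: "scans \<alpha> 3 (enc_list enc_literal C) = 1" for C
  proof (induction C)
    case (Cons l C)
    then show ?case unfolding enc_list_simps foldl_append scan_literal .
  qed (simp add: enc_list_simps scan_def)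
  show "scans \<alpha> 2 (enc_list enc_literal C) = (if \<exists>(b, v)\<in>set C. \<alpha> v = b then 1 else 10)"
  proof (induction C)
    case (Cons l C)
    then show ?case unfolding enc_list_simps foldl_append scan_literal by (auto simp: 3 split: prod.splits)
  qed (simp add: enc_list_simps scan_def)
qed

lemma scan_cnf: "scans \<alpha> 0 (enc_cnf n \<phi>) = 9 \<longleftrightarrow> (\<forall>C\<in>set \<phi>. \<exists>(b, v)\<in>set C. \<alpha> v = b)"
proof -
  have 10: "scans \<alpha> 10 w = 10" for w by (induction w) (simp_all add: scan_def)
  have 1: "scan \<alpha> 1 True = 2" by (simp add: scan_def)
  have "scans \<alpha> 1 (enc_list (enc_list enc_literal) \<phi>) = (if \<forall>C\<in>set \<phi>. \<exists>(b, v)\<in>set C. \<alpha> v = b then 9 else 10)"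
  proof (induction \<phi>)
    case (Cons C \<phi>)
    then show ?case unfolding enc_list_simps foldl_append foldl.simps 1 scan_clause
      by (cases "\<exists>(b, v)\<in>set C. \<alpha> v = b") (simp_all add: 10)
  qed (simp add: enc_list_simps scan_def)
  then show ?thesis unfolding enc_cnf_def foldl_append scan_header by simp
qed

text \<open>Each bit increases the state by at most 11, which bounds all intermediate states
  linearly.\<close>

lemma pf_scan:
  assumes n: "pf n" and X: "pfp (\<lambda>s e. X s (e 0))" and \<alpha>: "pfp (\<lambda>s e. \<alpha> s (e 0))"
  shows "pf (\<lambda>s e. scans (\<alpha> s) 0 (map (X s) [0..<n s e]))"
proof -
  have bd: "scan \<alpha>' a b \<le> a + 11" for \<alpha>' a b
  proof -
    have "a mod 11 < 11" by simp
    then show ?thesis unfolding scan_def Let_def by (auto simp del: mod_less_divisor)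
  qed
  have X': "pfp (\<lambda>s e. X s (f s e))" if "pf f" for f
    by (rule pf_cong[OF pf_let[OF X that]]) simp
  have \<alpha>': "pfp (\<lambda>s e. \<alpha> s (f s e))" if "pf f" for f
    by (rule pf_cong[OF pf_let[OF \<alpha> that]]) simp
  have H: "pf (\<lambda>s e. scan (\<alpha> s) (e 1) (X s (e 0)))"
    unfolding scan_def Let_def by (intro pf_If pfp_eq pf_mod pf_div pf_add pf_var pf_const X' \<alpha>')
  have le: "scans (\<alpha> s) 0 (map (X s) [0..<i]) \<le> 11 * i" for s i
  proof (induction i)
    case (Suc i)
    have "scans (\<alpha> s) 0 (map (X s) [0..<Suc i]) = scan (\<alpha> s) (scans (\<alpha> s) 0 (map (X s) [0..<i])) (X s i)" by simp
    also have "\<dots> \<le> scans (\<alpha> s) 0 (map (X s) [0..<i]) + 11" by (rule bd)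
    finally show ?case by (rule order_trans) (use Suc.IH in simp)
  qed simp
  show ?thesis
  proof (rule pf_iter[where H = "\<lambda>s e i a. scan (\<alpha> s) a (X s i)" and A = "\<lambda>s e. 0" and B = "\<lambda>s e. 11 * n s e"
        and R = "\<lambda>s e i. scans (\<alpha> s) 0 (map (X s) [0..<i])"])
    show "pbd (\<lambda>s e. 11 * n s e)" by (intro pbd_mult pbd_const pf_pbd[OF n])
    show "scans (\<alpha> s) 0 (map (X s) [0..<i]) \<le> 11 * n s e" if "i \<le> n s e" for s e i
      using le[of s i] that by linarith
  qed (use H n in \<open>simp_all add: pf_const\<close>)
qed

lemma length_enc_list: "x \<in> set xs \<Longrightarrow> length (e x) < length (enc_list e xs)"
  by (induction xs) (auto simp: enc_list_simps)

text \<open>The certificate lists the truth values. Variables are written in unary, so each is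
  smaller than the length of the formula code, and a certificate of that length suffices. Words that
  code no formula are treated arbitrarily.\<close>

lemma sat_in_NP: obtains L where "L \<in> class_NP" "\<And>n \<phi>. enc_cnf n \<phi> \<in> L \<longleftrightarrow> satisfiable \<phi>"
proof -
  define D :: "strs \<Rightarrow> env \<Rightarrow> nat" where "D s e = of_bool (scans (\<lambda>v. tape_of (fst s) (int (2 * nums (fst s) 0 + 1 + v)) = 2) 0
     (map (\<lambda>i. tape_of (fst s) (int (nums (fst s) 0 + 1 + i)) = 2) [0..<nums (fst s) 0]) = 9)" for s e
  define R where "R = {w. D (w, []) (\<lambda>_. 0) \<noteq> 0}"
  have n: "pf (\<lambda>s e. nums (fst s) 0)" by (intro pf_nums pf_const)
  have X: "pfp (\<lambda>s e. tape_of (fst s) (int (nums (fst s) 0 + 1 + e 0)) = 2)"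
    and \<alpha>: "pfp (\<lambda>s e. tape_of (fst s) (int (2 * nums (fst s) 0 + 1 + e 0)) = 2)"
    by (intro pfp_sym pf_add pf_mult n pf_const pf_var)+
  have "pf D" unfolding D_def
    by (rule pfp_eq[OF pf_scan[where X = "\<lambda>s i. tape_of (fst s) (int (nums (fst s) 0 + 1 + i)) = 2"
        and \<alpha> = "\<lambda>s v. tape_of (fst s) (int (2 * nums (fst s) 0 + 1 + v)) = 2", OF n X \<alpha>] pf_const])
  then have R: "R \<in> class_P" unfolding R_def by (rule class_P_pf)
  have xR: "enc_pair x u \<in> R \<longleftrightarrow> scans (\<lambda>v. tape_of u (int v) = 2) 0 x = 9" for x u
  proof -
    have "map (\<lambda>i. tape_of (enc_pair x u) (int (length x + 1 + i)) = 2) [0..<length x] = map (\<lambda>i. x ! i) [0..<length x]"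
      by (rule map_cong[OF refl]) (subst tape_of_enc_pair(1), auto simp: tape_of_int)
    then have "map (\<lambda>i. tape_of (enc_pair x u) (int (length x + 1 + i)) = 2) [0..<length x] = x" by (simp only: map_nth)
    then show ?thesis unfolding R_def D_def mem_Collect_eq fst_conv nums_0_enc_pair tape_of_enc_pair(2)
      by (simp only: of_bool_eq_0_iff not_not)
  qed
  define L where "L = {x. \<exists>u. length u \<le> 1 * length x ^ 1 + 1 \<and> enc_pair x u \<in> R}"
  show thesis
  proof (rule that)
    show "L \<in> class_NP" unfolding class_NP_def L_def using R by blast
    show "enc_cnf n \<phi> \<in> L \<longleftrightarrow> satisfiable \<phi>" for n \<phi>
    proof
      assume "enc_cnf n \<phi> \<in> L"
      then obtain u where "enc_pair (enc_cnf n \<phi>) u \<in> R" unfolding L_def by blast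
      then show "satisfiable \<phi>" unfolding xR scan_cnf satisfiable_def
        by (rule exI[of _ "\<lambda>v. tape_of u (int v) = 2"])
    next
      assume "satisfiable \<phi>"
      then obtain \<alpha> where \<alpha>: "\<forall>C\<in>set \<phi>. \<exists>(b, v)\<in>set C. \<alpha> v = b" unfolding satisfiable_def by blast
      let ?x = "enc_cnf n \<phi>" let ?u = "map \<alpha> [0..<length ?x]"
      have "\<exists>(b, v)\<in>set C. (tape_of ?u (int v) = 2) = b" if C: "C \<in> set \<phi>" for C
      proof -
        obtain b v where l: "(b, v) \<in> set C" "\<alpha> v = b" using \<alpha> C by blast
        have "v < length (enc_literal (b, v))" by (simp add: enc_literal_def enc_nat_def)
        also have "\<dots> < length (enc_list enc_literal C)" using l(1) by (rule length_enc_list)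
        also have "\<dots> < length (enc_list (enc_list enc_literal) \<phi>)" using C by (rule length_enc_list)
        also have "\<dots> \<le> length ?x" by (simp add: enc_cnf_def)
        finally have "(tape_of ?u (int v) = 2) = b" using l(2) by (simp add: tape_of_int)
        then show ?thesis using l(1) by blast
      qed
      then have "scans (\<lambda>v. tape_of ?u (int v) = 2) 0 ?x = 9" unfolding scan_cnf by blast
      then have "length ?u \<le> 1 * length ?x ^ 1 + 1 \<and> enc_pair ?x ?u \<in> R" unfolding xR by simp
      then show "?x \<in> L" unfolding L_def by blast
    qed
  qed
qed

text \<open>Clauses are distinct lists of at most three literals over \<open>n\<close> variables, so
  there are at most cubically many up to a constant, each with a code of linear length.\<close>

lemma length_enc_cnf:
  assumes "three_cnf n \<phi>" shows "length (enc_cnf n \<phi>) \<le> (n + 2) ^ 12"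
proof -
  let ?A = "UNIV \<times> {..<n} :: literal set"
  define k where "k = n + 2"
  have C: "length C \<le> 3" "\<forall>l\<in>set C. snd l < n" if "C \<in> set \<phi>" for C
    using assms that unfolding three_cnf_def by fastforce+
  have lC: "length (enc_list enc_literal C) \<le> length C * (n + 3) + 1" if "\<forall>l\<in>set C. snd l < n" for C
    using that by (induction C) (auto simp: enc_list_simps enc_literal_def enc_nat_def)
  have lC': "length (enc_list enc_literal C) \<le> 3 * (n + 3) + 1" if "C \<in> set \<phi>" for C
    using lC[OF C(2)[OF that]] mult_le_mono1[OF C(1)[OF that], of "n + 3"] by linarith
  have l\<phi>: "length (enc_list (enc_list enc_literal) \<psi>) \<le> length \<psi> * (3 * (n + 3) + 2) + 1" if "set \<psi> \<subseteq> set \<phi>" for \<psi>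
    using that
  proof (induction \<psi>)
    case (Cons C \<psi>)
    then show ?case using lC'[of C] by (simp add: enc_list_simps)
  qed (simp add: enc_list_simps)
  have "length \<phi> = card (set \<phi>)" using assms unfolding three_cnf_def by (simp add: distinct_card)
  also have "\<dots> \<le> card {xs. set xs \<subseteq> ?A \<and> length xs \<le> 3}"
  proof (rule card_mono)
    show "set \<phi> \<subseteq> {xs. set xs \<subseteq> ?A \<and> length xs \<le> 3}"
    proof
      fix C assume "C \<in> set \<phi>"
      from C[OF this] show "C \<in> {xs. set xs \<subseteq> ?A \<and> length xs \<le> 3}" by fastforce
    qed
  qed (simp add: finite_lists_length_le)
  also have "\<dots> = (\<Sum>i\<le>3. card ?A ^ i)" by (rule card_lists_length_le) simp
  also have "card ?A = 2 * n" by (simp add: card_cartesian_product)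
  also have "(\<Sum>i\<le>3. (2 * n) ^ i) \<le> (\<Sum>i\<le>(3::nat). (2 * k) ^ 3)"
  proof (rule sum_mono)
    fix i :: nat assume "i \<in> {..3}"
    have "(2 * n) ^ i \<le> (2 * k) ^ i" by (rule power_mono) (simp_all add: k_def)
    also have "\<dots> \<le> (2 * k) ^ 3" using \<open>i \<in> {..3}\<close> by (intro power_increasing) (auto simp: k_def)
    finally show "(2 * n) ^ i \<le> (2 * k) ^ 3" .
  qed
  also have "(\<Sum>i\<le>(3::nat). (2 * k) ^ 3) = 32 * k ^ 3" by (simp add: power_mult_distrib)
  finally have c: "length \<phi> \<le> 32 * k ^ 3" .
  have "length (enc_cnf n \<phi>) \<le> n + 1 + (length \<phi> * (3 * (n + 3) + 2) + 1)"
    using l\<phi>[OF order_refl] by (simp add: enc_cnf_def enc_nat_def)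
  moreover have "length \<phi> * (3 * (n + 3) + 2) \<le> 32 * k ^ 3 * (7 * k)"
    by (rule mult_le_mono[OF c]) (simp add: k_def)
  moreover have "32 * k ^ 3 * (7 * k) = 224 * k ^ 4" by (simp add: power3_eq_cube power4_eq_xxxx)
  moreover have "k \<le> k ^ 4" using power_increasing[of 1 4 k] by (simp add: k_def)
  \<comment> \<open>The clauses cost \<open>224 * k ^ 4\<close>, and the remainder
    \<open>n + 2 = k\<close> is at most \<open>k ^ 4\<close>. Since \<open>k\<close> is at least 2,
    the factor \<open>2 ^ 8\<close> is then absorbed by \<open>k ^ 8\<close>.\<close>
  ultimately have "length (enc_cnf n \<phi>) \<le> 2 ^ 8 * k ^ 4" using k_def by simp
  also have "\<dots> \<le> k ^ 8 * k ^ 4" by (intro mult_le_mono1 power_mono) (simp_all add: k_def)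
  also have "\<dots> = k ^ 12" by (simp only: power_add[symmetric]) simp
  finally show ?thesis unfolding k_def .
qed

section \<open>The consequences for P, NP and the Exponential Time Hypothesis\<close>

lemma bigo_bound:
  fixes T :: "nat \<Rightarrow> real"
  assumes "T \<in> O(g)" and g: "\<And>n. 1 \<le> g n" obtains C where "1 \<le> C" "\<And>n. T n \<le> C * g n"
proof -
  obtain C0 where C0: "0 < C0" "eventually (\<lambda>n. norm (T n) \<le> C0 * norm (g n)) sequentially"
    using assms(1) by (rule landau_o.bigE)
  then obtain n0 where n0: "\<And>n. n0 \<le> n \<Longrightarrow> norm (T n) \<le> C0 * norm (g n)"
    unfolding eventually_sequentially by blast
  define C where "C = 1 + C0 + (\<Sum>n<n0. \<bar>T n\<bar>)"
  have s: "0 \<le> (\<Sum>n<n0. \<bar>T n\<bar>)" by (intro sum_nonneg) auto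
  have "T n \<le> C * g n" for n
  proof (cases "n < n0")
    case True
    then have "\<bar>T n\<bar> \<le> (\<Sum>n<n0. \<bar>T n\<bar>)" by (intro member_le_sum) auto
    then have "T n \<le> (\<Sum>n<n0. \<bar>T n\<bar>)" by (rule order_trans[OF abs_ge_self])
    then have "T n \<le> C * 1" unfolding C_def using C0(1) by simp
    also have "\<dots> \<le> C * g n" by (rule mult_left_mono[OF g]) (use s C0(1) in \<open>simp add: C_def\<close>)
    finally show ?thesis .
  next
    case False
    then have "T n \<le> C0 * g n" using n0[of n] g[of n] by simp
    also have "\<dots> \<le> C * g n" using s g[of n] by (intro mult_right_mono) (auto simp: C_def)
    finally show ?thesis .
  qed
  moreover have "1 \<le> C" unfolding C_def using s C0(1) by linarith
  ultimately show thesis using that by blast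
qed

lemma NP_subset_P_if_approx:
  assumes T: "poly_bounded T" and M: "approx_algorithm TYPE('a::{finite,field}) r M T"
  shows "class_NP \<subseteq> class_P"
proof
  fix L assume L: "L \<in> class_NP"
  obtain a and rows :: "bool list \<Rightarrow> nat" where rows: "\<And>x. 1 \<le> rows x \<and> rows x \<le> (length x + 2) ^ a"
    and red: "\<And>M T. approx_algorithm TYPE('a) r M T \<Longrightarrow>
       \<exists>M' c. turing_machine M' \<and> (\<forall>x. tm_outputs M' x [x \<in> L] (real ((length x + 2) ^ c) + 10 * T (rows x)))"
    by (rule approx_algorithm_decides_NP[OF L, where 'a = 'a and r = r]) (rule that)
  obtain b where b: "\<And>n. T n \<le> real ((n + 2) ^ b)" by (rule poly_bounded_nat[OF T]) (rule that)
  obtain M' c where M': "turing_machine M'" "\<And>x. tm_outputs M' x [x \<in> L] (real ((length x + 2) ^ c) + 10 * T (rows x))"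
    using red[OF M] by blast
  show "L \<in> class_P"
  proof (rule class_PI[OF M'(1)])
    fix x :: "bool list"
    let ?k = "length x + 2"
    have "rows x + 2 \<le> ?k ^ a + 2" using rows[of x] by simp
    also have "\<dots> \<le> ?k ^ a * (2 * 2)" using one_le_power[of ?k a] by linarith
    also have "\<dots> \<le> ?k ^ a * (?k * ?k)" by (intro mult_le_mono) simp_all
    also have "\<dots> = ?k ^ (a + 2)" by (simp only: power_add power2_eq_square)
    finally have "(rows x + 2) ^ b \<le> (?k ^ (a + 2)) ^ b" by (intro power_mono) simp_all
    then have "real ((rows x + 2) ^ b) \<le> real (?k ^ ((a + 2) * b))" unfolding power_mult by (simp only: of_nat_le_iff)
    then show "tm_outputs M' x [x \<in> L] (real (?k ^ c) + 10 * real (?k ^ ((a + 2) * b)))"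
      by (intro tm_outputs_mono[OF M'(2)]) (use b[of "rows x"] in linarith)
  qed
qed

lemma ETH_excludes_approx:
  assumes ETH
  shows "\<exists>\<delta>>0. \<not> (\<exists>M T. T \<in> O(\<lambda>n. 2 powr (real n powr \<delta>)) \<and> approx_algorithm TYPE('a::{finite,field}) r M T)"
proof -
  obtain L where L: "L \<in> class_NP" "\<And>n \<phi>. enc_cnf n \<phi> \<in> L \<longleftrightarrow> satisfiable \<phi>" by (rule sat_in_NP) (rule that)
  obtain a and rows :: "bool list \<Rightarrow> nat" where rows: "\<And>x. 1 \<le> rows x \<and> rows x \<le> (length x + 2) ^ a"
    and red: "\<And>M T. approx_algorithm TYPE('a) r M T \<Longrightarrow>
       \<exists>M' c. turing_machine M' \<and> (\<forall>x. tm_outputs M' x [x \<in> L] (real ((length x + 2) ^ c) + 10 * T (rows x)))"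
    by (rule approx_algorithm_decides_NP[OF L(1), where 'a = 'a and r = r]) (rule that)
  \<comment> \<open>As \<open>length x + 2\<close> will be at most \<open>(n + 2) ^ 14\<close>,
    there are at most \<open>(n + 2) ^ (14 * a)\<close> rows, and this choice brings the exponent of
    \<open>n + 2\<close> down to at most \<open>1 / 2\<close>. The summand 1 keeps the denominator
    positive.\<close>
  define \<delta> where "\<delta> = 1 / (2 * real (14 * a + 1))"
  have \<delta>: "0 < \<delta>" "real (14 * a) * \<delta> \<le> 1 / 2" by (simp_all add: \<delta>_def field_simps)
  have False if T: "T \<in> O(\<lambda>n. 2 powr (real n powr \<delta>))" and M: "approx_algorithm TYPE('a) r M T" for M T
  proof -
    obtain M' c where M': "turing_machine M'" "\<And>x. tm_outputs M' x [x \<in> L] (real ((length x + 2) ^ c) + 10 * T (rows x))"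
      using red[OF M] by blast
    obtain C where C: "1 \<le> C" "\<And>n. T n \<le> C * 2 powr (real n powr \<delta>)"
      by (rule bigo_bound[OF T]) (auto intro: ge_one_powr_ge_zero)
    \<comment> \<open>The binary logarithm of a bound for the total time: constants, the polynomial
      overhead of the reduction, and the call of the algorithm. The last term is about the square
      root of \<open>n\<close>, hence \<open>f\<close> is sublinear.\<close>
    define f where "f n = log 2 (11 * C) + real (14 * c) * log 2 (real n + 2) + (real n + 2) powr (1 / 2)" for n
    have f: "f \<in> o(\<lambda>n. real n)" unfolding f_def by real_asymp
    have "tm_outputs M' (enc_cnf n \<phi>) [satisfiable \<phi>] (2 powr f n)" if \<phi>: "three_cnf n \<phi>" for n \<phi>
    proof -
      let ?x = "enc_cnf n \<phi>" let ?k = "n + 2" let ?s = "2 powr ((real n + 2) powr (1 / 2))"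
      have "length ?x + 2 \<le> ?k ^ 12 + 2" using length_enc_cnf[OF \<phi>] by simp
      also have "\<dots> \<le> ?k ^ 12 * (2 * 2)" using one_le_power[of ?k 12] by linarith
      also have "\<dots> \<le> ?k ^ 12 * (?k * ?k)" by (intro mult_le_mono) simp_all
      also have "\<dots> = ?k ^ 14" by (simp only: power_add[symmetric] power2_eq_square[symmetric]) simp
      finally have lx: "length ?x + 2 \<le> ?k ^ 14" .
      have "(length ?x + 2) ^ c \<le> (?k ^ 14) ^ c" by (rule power_mono[OF lx]) simp
      then have 1: "real ((length ?x + 2) ^ c) \<le> real ?k ^ (14 * c)" unfolding power_mult of_nat_power[symmetric] by (simp only: of_nat_le_iff)
      have "rows ?x \<le> (?k ^ 14) ^ a" using rows[of ?x] power_mono[OF lx, of a] by linarith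
      then have "real (rows ?x) \<le> real ?k ^ (14 * a)" unfolding power_mult of_nat_power[symmetric] by (simp only: of_nat_le_iff)
      then have "real (rows ?x) powr \<delta> \<le> (real ?k ^ (14 * a)) powr \<delta>" using \<delta>(1) by (intro powr_mono2) simp_all
      also have "\<dots> = real ?k powr (real (14 * a) * \<delta>)" by (simp only: powr_powr powr_realpow[symmetric])
      also have "\<dots> \<le> real ?k powr (1 / 2)" using \<delta>(2) by (intro powr_mono) simp_all
      finally have "real (rows ?x) powr \<delta> \<le> (real n + 2) powr (1 / 2)" by (simp add: add.commute)
      then have "2 powr (real (rows ?x) powr \<delta>) \<le> ?s" by (intro powr_mono) simp_all
      then have "C * 2 powr (real (rows ?x) powr \<delta>) \<le> C * ?s" using C(1) by (intro mult_left_mono) simp_all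
      then have 2: "T (rows ?x) \<le> C * ?s" using C(2)[of "rows ?x"] by linarith
      let ?p = "real ?k ^ (14 * c)"
      have p1: "1 \<le> ?p" by (rule one_le_power) simp
      have s1: "1 \<le> ?s" by (rule ge_one_powr_ge_zero) simp_all
      have "?p * 1 \<le> ?p * (C * ?s)"
        by (rule mult_left_mono) (use mult_mono[OF C(1) s1] p1 C(1) in auto)
      moreover have "1 * (C * ?s) \<le> ?p * (C * ?s)" by (rule mult_right_mono[OF p1]) (use C(1) in simp)
      ultimately have "real ((length ?x + 2) ^ c) + 10 * T (rows ?x) \<le> 11 * (?p * (C * ?s))" using 1 2 by linarith
      also have "\<dots> = 2 powr f n"
      proof -
        have "2 powr (real (14 * c) * log 2 (real n + 2)) = ?p"
          by (simp add: powr_powr[symmetric] mult.commute[of _ "log 2 _"] powr_realpow[symmetric] add.commute del: of_nat_mult)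
        then show ?thesis unfolding f_def powr_add using C(1) by simp
      qed
      finally show ?thesis using tm_outputs_mono[OF M'(2)[of ?x]] L(2) by simp
    qed
    then show False using \<open>ETH\<close> M'(1) f unfolding ETH_def by blast
  qed
  then show ?thesis using \<delta>(1) by blast
qed

theorem theorem5p3:
  fixes r :: real
  assumes "r > 1"
  shows "(class_P \<noteq> class_NP \<longrightarrow>
            \<not> (\<exists>M T. poly_bounded T \<and> approx_algorithm TYPE('a::{finite,field}) r M T)) \<and>
         (ETH \<longrightarrow>
            (\<exists>\<delta>>0. \<not> (\<exists>M T. T \<in> O(\<lambda>n. 2 powr (real n powr \<delta>)) \<and>
                               approx_algorithm TYPE('a) r M T)))"
  using NP_subset_P_if_approx[where 'a = 'a and r = r] class_P_subset_NP ETH_excludes_approx[where 'a = 'a and r = r]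
  by blast

end
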